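(* Let $T>0$, $r\in[2,\infty]$, $\bar u\in L^1\cap L^r$, and let $b=(b_t)_{t\in(0,T)}$ be a Borel family of derivations with $|b|\in L^1_t(L^2_x+L^\infty_x)$, $\operatorname{div}b_t\in L^1_t(L^2_x+L^\infty_x)$ and $(\operatorname{div}b_t)^-\in L^1_t(L^\infty_x)$. Then there exists a solution $u\in L^\infty((0,T);L^1\cap L^r)$ of $\partial_tu_t+\operatorname{div}(u_tb_t)=0$ with $u_0=\bar u$ in the weak sense, which is weakly continuous on $[0,T)$ in duality with $\mathscr A$. If $\bar u\ge0$, $u$ can be chosen with $u_t\ge0$ for all $t$. Finally, if condition (M) holds, then $\int u_t\,dm=\int\bar u\,dm$ for all $t\in[0,T)$.
   Context: Standing setting. $(X,\tau)$ is a Polish space and $m$ a $\sigma$-finite nonnegative Borel measure on $X$ with $\operatorname{supp} m=X$. $L^p:=L^p(X,m)$ with norm $\|\cdot\|_p$; $L^0$ denotes the space of $m$-a.e. classes of Borel functions $X\to[-\infty,\infty]$ finite $m$-a.e.; $L^p+L^q$, $L^p\cap L^q$ carry the usual sum/intersection norms; $p'$ is the conjugate exponent. $\mathcal E$ is a symmetric, densely defined, strongly local Dirichlet form on $L^2$ with domain $\mathbb V$ (Hilbert, $\|f\|_{\mathbb V}^2=\|f\|_2^2+\mathcal E(f)$) admitting a carré du champ $\Gamma:\mathbb V\times\mathbb V\to L^1$, symmetric bilinear, $\Gamma(f):=\Gamma(f,f)\ge0$, $\mathcal E(f)=\int\Gamma(f)\,dm$, with chain and Leibniz rules. $\Delta$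 is the associated generator ($\int g\Delta f\,dm=-\int\Gamma(f,g)\,dm$ for $g\in\mathbb V$) and $P_t=e^{t\Delta}$ the associated Markov semigroup. $\mathbb V_p:=\{u\in\mathbb V\cap L^p:\sqrt{\Gamma(u)}\in L^p\}$. Algebra: $\mathscr A\subset\mathbb V$ is an algebra with $\mathscr A\subset\bigcap_{p\in[1,\infty]}L^p$, dense in $\mathbb V$, contained and dense in $\mathbb V_p$ for $p\in[1,2]$, $\mathscr A\subset\mathbb V_\infty$, and $\Phi(f_1,\dots,f_n)\in\mathscr A$ for $f_i\in\mathscr A$, $\Phi\in C^1(\mathbb R^n)$, $\Phi(0)=0$. Derivations: a derivation is a linear map $b:\mathscr A\to L^0$, $f\mapsto df(b)$, with $d(fg)(b)=f\,dg(b)+g\,df(b)$ and $|df(b)|\le h\sqrt{\Gamma(f)}$ $m$-a.e. for all $f,g\in\mathscr A$, for some $h\in L^0$; $|b|$ is the smallest such $h$. For $b$ with $|b|\in L^p+L^q$, $\operatorname{div}b=g$ means $\int df(b)\,dm=-\int fg\,dm$ for all $f\in\mathscr A$; $(\operatorname{div}b)^-$ is the smallest nonnegative $g$ with $\int df(b)\,dm\le\int fg\,dm$ for all nonnegative $f\in\mathscr A$. A Borel family of derivations $(b_t)_{t\in(0,T)}$ is a map $t\mapsto b_t$ into derivations such that $|b_t|\le g(t,\cdot)$ $m$-a.e. for a.e. $t$ for some Borel $g$; $|b|$ is the smallest such $g$, and $|b|\in L^r_t(L^p_x+L^q_x)$ means $|b|\in L^r((0,T);L^p+L^q)$; analogously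 for $\operatorname{div}b_t$, $(\operatorname{div}b_t)^-$. Weak solutions: for $\bar u\in L^p\cap L^q$ and $b$ in $L^1_t(L^{p'}_x+L^{q'}_x)$, $u\in L^\infty((0,T);L^p\cap L^q)$ is a weak solution of $\partial_tu_t+\operatorname{div}(u_tb_t)=0$ with $u_0=\bar u$ if $\int_0^T\int[-\psi'(t)\varphi-\psi(t)d\varphi(b_t)]u_t\,dm\,dt=\psi(0)\int\varphi\bar u\,dm$ for all $\varphi\in\mathscr A$ and $\psi\in C^1([0,T])$ with $\psi(T)=0$. Weak continuity in duality with $\mathscr A$: $t\mapsto\int fu_t\,dm$ is continuous for every $f\in\mathscr A$. Condition (M): there exist $f_n\in\mathscr A$ with $0\le f_n\le1$, $f_n\uparrow1$ $m$-a.e., and $\sqrt{\Gamma(f_n)}\to0$ weakly-$*$ in $L^\infty$. *)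

theory Defs
  imports "HOL-Analysis.Analysis"
begin

section \<open>Lebesgue spaces (functions modulo a.e. equality are represented by functions)\<close>

definition Lp :: "'a measure \<Rightarrow> ennreal \<Rightarrow> ('a \<Rightarrow> real) set" where
  "Lp M p = {f \<in> borel_measurable M.
     if p = \<infinity> then (\<exists>C. AE x in M. \<bar>f x\<bar> \<le> C)
     else (\<integral>\<^sup>+x. ennreal (\<bar>f x\<bar> powr enn2real p) \<partial>M) < \<infinity>}"

definition Lp_norm :: "'a measure \<Rightarrow> ennreal \<Rightarrow> ('a \<Rightarrow> real) \<Rightarrow> real" where
  "Lp_norm M p f =
     (if p = \<infinity> then Inf {C. 0 \<le> C \<and> (AE x in M. \<bar>f x\<bar> \<le> C)}
      else (\<integral>x. \<bar>f x\<bar> powr enn2real p \<partial>M) powr (1 / enn2real p))"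

definition Lp_sum :: "'a measure \<Rightarrow> ennreal \<Rightarrow> ennreal \<Rightarrow> ('a \<Rightarrow> real) set" where
  "Lp_sum M p q = {f \<in> borel_measurable M. \<exists>g h. g \<in> Lp M p \<and> h \<in> Lp M q \<and>
      (AE x in M. f x = g x + h x)}"

definition Lp_sum_norm :: "'a measure \<Rightarrow> ennreal \<Rightarrow> ennreal \<Rightarrow> ('a \<Rightarrow> real) \<Rightarrow> real" where
  "Lp_sum_norm M p q f = Inf {Lp_norm M p g + Lp_norm M q h | g h.
      g \<in> Lp M p \<and> h \<in> Lp M q \<and> (AE x in M. f x = g x + h x)}"

definition Lp_int_norm :: "'a measure \<Rightarrow> ennreal \<Rightarrow> ennreal \<Rightarrow> ('a \<Rightarrow> real) \<Rightarrow> real" where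
  "Lp_int_norm M p q f = Lp_norm M p f + Lp_norm M q f"

abbreviation time_space :: "real \<Rightarrow> real measure" where
  "time_space T \<equiv> restrict_space lborel {0<..<T}"

definition jointly_borel :: "'a measure \<Rightarrow> real \<Rightarrow> (real \<Rightarrow> 'a \<Rightarrow> real) \<Rightarrow> bool" where
  "jointly_borel M T g \<longleftrightarrow> (\<lambda>(t, x). g t x) \<in> borel_measurable (time_space T \<Otimes>\<^sub>M M)"

definition time_L1 :: "real \<Rightarrow> 'a measure \<Rightarrow> ('a \<Rightarrow> real) set \<Rightarrow> (('a \<Rightarrow> real) \<Rightarrow> real)
    \<Rightarrow> (real \<Rightarrow> 'a \<Rightarrow> real) \<Rightarrow> bool" where
  "time_L1 T M S N g \<longleftrightarrow> jointly_borel M T g \<and>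
     (AE t in lborel. t \<in> {0<..<T} \<longrightarrow> g t \<in> S) \<and>
     (\<integral>\<^sup>+t\<in>{0<..<T}. ennreal (N (g t)) \<partial>lborel) < \<infinity>"

definition V_norm :: "'a measure \<Rightarrow> (('a \<Rightarrow> real) \<Rightarrow> ('a \<Rightarrow> real) \<Rightarrow> 'a \<Rightarrow> real)
    \<Rightarrow> ('a \<Rightarrow> real) \<Rightarrow> real" where
  "V_norm M \<Gamma> f = sqrt ((Lp_norm M 2 f)\<^sup>2 + (\<integral>x. \<Gamma> f f x \<partial>M))"

definition Vp :: "'a measure \<Rightarrow> ('a \<Rightarrow> real) set \<Rightarrow> (('a \<Rightarrow> real) \<Rightarrow> ('a \<Rightarrow> real) \<Rightarrow> 'a \<Rightarrow> real)
    \<Rightarrow> ennreal \<Rightarrow> ('a \<Rightarrow> real) set" where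
  "Vp M V \<Gamma> p = {u \<in> V \<inter> Lp M p. (\<lambda>x. sqrt (\<Gamma> u u x)) \<in> Lp M p}"

definition Vp_norm :: "'a measure \<Rightarrow> (('a \<Rightarrow> real) \<Rightarrow> ('a \<Rightarrow> real) \<Rightarrow> 'a \<Rightarrow> real)
    \<Rightarrow> ennreal \<Rightarrow> ('a \<Rightarrow> real) \<Rightarrow> real" where
  "Vp_norm M \<Gamma> p u = Lp_norm M p u + Lp_norm M p (\<lambda>x. sqrt (\<Gamma> u u x))"

text \<open>\<open>\<Phi> \<in> C^1(\<real>^n)\<close>, where \<open>\<real>^n\<close> is represented by \<open>nat \<Rightarrow> real\<close> and \<open>\<Phi>\<close> only depends
  on the first \<open>n\<close> coordinates: all partial derivatives exist and are continuous.\<close>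
definition C1n :: "nat \<Rightarrow> ((nat \<Rightarrow> real) \<Rightarrow> real) \<Rightarrow> bool" where
  "C1n n \<Phi> \<longleftrightarrow> (\<forall>x y. (\<forall>i<n. x i = y i) \<longrightarrow> \<Phi> x = \<Phi> y) \<and>
     (\<exists>D. (\<forall>x. \<forall>i<n. ((\<lambda>s. \<Phi> (x(i := s))) has_real_derivative D i x) (at (x i))) \<and>
          (\<forall>i<n. \<forall>x. \<forall>e>0. \<exists>d>0. \<forall>y. (\<forall>j<n. \<bar>y j - x j\<bar> < d) \<longrightarrow> \<bar>D i y - D i x\<bar> < e))"

definition dirichlet_setting ::
  "'a::polish_space measure \<Rightarrow> ('a \<Rightarrow> real) set \<Rightarrow> (('a \<Rightarrow> real) \<Rightarrow> ('a \<Rightarrow> real) \<Rightarrow> 'a \<Rightarrow> real)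
     \<Rightarrow> ('a \<Rightarrow> real) set \<Rightarrow> bool" where
  "dirichlet_setting M V \<Gamma> A \<longleftrightarrow>
    \<comment> \<open>the measure space\<close>
    space M = UNIV \<and> sets M = sets borel \<and> sigma_finite_measure M \<and>
    (\<forall>U. open U \<and> U \<noteq> {} \<longrightarrow> emeasure M U > 0) \<and>
    \<comment> \<open>the domain \<open>V\<close>: a linear subspace of \<open>L^2\<close> of a.e.-classes, dense in \<open>L^2\<close>\<close>
    V \<subseteq> Lp M 2 \<and>
    (\<forall>f\<in>V. \<forall>g\<in>V. (\<lambda>x. f x + g x) \<in> V) \<and> (\<forall>f\<in>V. \<forall>c. (\<lambda>x. c * f x) \<in> V) \<and>
    (\<forall>f\<in>V. \<forall>g \<in> borel_measurable M. (AE x in M. f x = g x) \<longrightarrow>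
        g \<in> V \<and> (\<forall>h\<in>V. AE x in M. \<Gamma> f h x = \<Gamma> g h x)) \<and>
    (\<forall>f\<in>Lp M 2. \<forall>e>0. \<exists>g\<in>V. Lp_norm M 2 (\<lambda>x. f x - g x) < e) \<and>
    \<comment> \<open>carre du champ: symmetric bilinear \<open>V \<times> V \<rightarrow> L^1\<close>, \<open>\<Gamma>(f) \<ge> 0\<close>, \<open>\<E>(f) = \<integral> \<Gamma>(f)\<close>\<close>
    (\<forall>f\<in>V. \<forall>g\<in>V. \<Gamma> f g \<in> Lp M 1) \<and>
    (\<forall>f\<in>V. \<forall>g\<in>V. AE x in M. \<Gamma> f g x = \<Gamma> g f x) \<and>
    (\<forall>f\<in>V. \<forall>g\<in>V. \<forall>h\<in>V. AE x in M. \<Gamma> (\<lambda>y. f y + g y) h x = \<Gamma> f h x + \<Gamma> g h x) \<and>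
    (\<forall>f\<in>V. \<forall>h\<in>V. \<forall>c. AE x in M. \<Gamma> (\<lambda>y. c * f y) h x = c * \<Gamma> f h x) \<and>
    (\<forall>f\<in>V. AE x in M. \<Gamma> f f x \<ge> 0) \<and>
    \<comment> \<open>closedness: \<open>V\<close> is complete (Hilbert) for \<open>\<parallel>f\<parallel>_V^2 = \<parallel>f\<parallel>_2^2 + \<E>(f)\<close>\<close>
    (\<forall>F. (\<forall>n. F n \<in> V) \<longrightarrow>
        (\<forall>e>0. \<exists>N. \<forall>n\<ge>N. \<forall>k\<ge>N. V_norm M \<Gamma> (\<lambda>x. F n x - F k x) < e) \<longrightarrow>
        (\<exists>f\<in>V. (\<lambda>n. V_norm M \<Gamma> (\<lambda>x. F n x - f x)) \<longlonglongrightarrow> 0)) \<and>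
    \<comment> \<open>Markov property (unit contraction)\<close>
    (\<forall>f\<in>V. (\<lambda>x. min 1 (max 0 (f x))) \<in> V \<and>
        (\<integral>x. \<Gamma> (\<lambda>y. min 1 (max 0 (f y))) (\<lambda>y. min 1 (max 0 (f y))) x \<partial>M)
          \<le> (\<integral>x. \<Gamma> f f x \<partial>M)) \<and>
    \<comment> \<open>strong locality\<close>
    (\<forall>f\<in>V. \<forall>g\<in>V. \<forall>c::real. (AE x in M. (f x + c) * g x = 0) \<longrightarrow> (\<integral>x. \<Gamma> f g x \<partial>M) = 0) \<and>
    \<comment> \<open>chain rule\<close>
    (\<forall>f\<in>V. \<forall>g\<in>V. \<forall>\<phi> \<phi>'. (\<forall>s. (\<phi> has_real_derivative \<phi>' s) (at s)) \<and> continuous_on UNIV \<phi>' \<and>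
        bounded (range \<phi>') \<and> \<phi> 0 = 0 \<longrightarrow>
        (\<lambda>x. \<phi> (f x)) \<in> V \<and> (AE x in M. \<Gamma> (\<lambda>y. \<phi> (f y)) g x = \<phi>' (f x) * \<Gamma> f g x)) \<and>
    \<comment> \<open>Leibniz rule\<close>
    (\<forall>f\<in>V \<inter> Lp M \<infinity>. \<forall>g\<in>V \<inter> Lp M \<infinity>. \<forall>h\<in>V. (\<lambda>x. f x * g x) \<in> V \<and>
        (AE x in M. \<Gamma> (\<lambda>y. f y * g y) h x = f x * \<Gamma> g h x + g x * \<Gamma> f h x)) \<and>
    \<comment> \<open>the algebra \<open>\<A>\<close>\<close>
    A \<subseteq> V \<and>
    (\<forall>f\<in>A. \<forall>g\<in>A. (\<lambda>x. f x + g x) \<in> A \<and> (\<lambda>x. f x * g x) \<in> A) \<and>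
    (\<forall>f\<in>A. \<forall>c. (\<lambda>x. c * f x) \<in> A) \<and>
    (\<forall>p. 1 \<le> p \<longrightarrow> A \<subseteq> Lp M p) \<and>
    (\<forall>f\<in>V. \<forall>e>0. \<exists>g\<in>A. V_norm M \<Gamma> (\<lambda>x. f x - g x) < e) \<and>
    (\<forall>p. 1 \<le> p \<and> p \<le> 2 \<longrightarrow> A \<subseteq> Vp M V \<Gamma> p \<and>
        (\<forall>f\<in>Vp M V \<Gamma> p. \<forall>e>0. \<exists>g\<in>A. Vp_norm M \<Gamma> p (\<lambda>x. f x - g x) < e)) \<and>
    A \<subseteq> Vp M V \<Gamma> \<infinity> \<and>
    (\<forall>n \<Phi> F. C1n n \<Phi> \<and> \<Phi> (\<lambda>_. 0) = 0 \<and> (\<forall>i<n. F i \<in> A) \<longrightarrow>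
        (\<lambda>x. \<Phi> (\<lambda>i. if i < n then F i x else 0)) \<in> A)"

definition derivation :: "'a measure \<Rightarrow> (('a \<Rightarrow> real) \<Rightarrow> ('a \<Rightarrow> real) \<Rightarrow> 'a \<Rightarrow> real)
    \<Rightarrow> ('a \<Rightarrow> real) set \<Rightarrow> (('a \<Rightarrow> real) \<Rightarrow> ('a \<Rightarrow> real)) \<Rightarrow> bool" where
  "derivation M \<Gamma> A b \<longleftrightarrow>
     (\<forall>f\<in>A. b f \<in> borel_measurable M) \<and>
     (\<forall>f\<in>A. \<forall>g\<in>A. AE x in M. b (\<lambda>y. f y + g y) x = b f x + b g x) \<and>
     (\<forall>f\<in>A. \<forall>c. AE x in M. b (\<lambda>y. c * f y) x = c * b f x) \<and>
     (\<forall>f\<in>A. \<forall>g\<in>A. AE x in M. b (\<lambda>y. f y * g y) x = f x * b g x + g x * b f x) \<and>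
     (\<exists>h \<in> borel_measurable M. \<forall>f\<in>A. AE x in M. \<bar>b f x\<bar> \<le> h x * sqrt (\<Gamma> f f x))"

definition bounds_family :: "'a measure \<Rightarrow> (('a \<Rightarrow> real) \<Rightarrow> ('a \<Rightarrow> real) \<Rightarrow> 'a \<Rightarrow> real)
    \<Rightarrow> ('a \<Rightarrow> real) set \<Rightarrow> real \<Rightarrow> (real \<Rightarrow> ('a \<Rightarrow> real) \<Rightarrow> ('a \<Rightarrow> real))
    \<Rightarrow> (real \<Rightarrow> 'a \<Rightarrow> real) \<Rightarrow> bool" where
  "bounds_family M \<Gamma> A T b g \<longleftrightarrow> jointly_borel M T g \<and>
     (AE t in lborel. t \<in> {0<..<T} \<longrightarrow>
        (\<forall>f\<in>A. AE x in M. \<bar>b t f x\<bar> \<le> g t x * sqrt (\<Gamma> f f x)))"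

definition borel_family :: "'a measure \<Rightarrow> (('a \<Rightarrow> real) \<Rightarrow> ('a \<Rightarrow> real) \<Rightarrow> 'a \<Rightarrow> real)
    \<Rightarrow> ('a \<Rightarrow> real) set \<Rightarrow> real \<Rightarrow> (real \<Rightarrow> ('a \<Rightarrow> real) \<Rightarrow> ('a \<Rightarrow> real)) \<Rightarrow> bool" where
  "borel_family M \<Gamma> A T b \<longleftrightarrow>
     (\<forall>t\<in>{0<..<T}. derivation M \<Gamma> A (b t)) \<and>
     (\<forall>f\<in>A. jointly_borel M T (\<lambda>t. b t f)) \<and>
     (\<exists>g. bounds_family M \<Gamma> A T b g)"

definition weak_solution :: "'a measure \<Rightarrow> ('a \<Rightarrow> real) set \<Rightarrow> real \<Rightarrow> ennreal \<Rightarrow> ennreal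
    \<Rightarrow> (real \<Rightarrow> ('a \<Rightarrow> real) \<Rightarrow> ('a \<Rightarrow> real)) \<Rightarrow> ('a \<Rightarrow> real) \<Rightarrow> (real \<Rightarrow> 'a \<Rightarrow> real) \<Rightarrow> bool" where
  "weak_solution M A T p q b ubar u \<longleftrightarrow>
     \<comment> \<open>\<open>u \<in> L^\<infinity>((0,T); L^p \<inter> L^q)\<close>\<close>
     jointly_borel M T u \<and>
     (\<exists>C. AE t in lborel. t \<in> {0<..<T} \<longrightarrow>
        u t \<in> Lp M p \<inter> Lp M q \<and> Lp_int_norm M p q (u t) \<le> C) \<and>
     \<comment> \<open>the weak formulation, for all \<open>\<phi> \<in> \<A>\<close>, \<open>\<psi> \<in> C^1([0,T])\<close> with \<open>\<psi>(T) = 0\<close>\<close>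
     (\<forall>\<phi>\<in>A. \<forall>\<psi> \<psi>'. (\<forall>t\<in>{0..T}. (\<psi> has_real_derivative \<psi>' t) (at t within {0..T})) \<and>
          continuous_on {0..T} \<psi>' \<and> \<psi> T = 0 \<longrightarrow>
        (LINT t:{0<..<T}|lborel. (\<integral>x. (- \<psi>' t * \<phi> x - \<psi> t * b t \<phi> x) * u t x \<partial>M))
          = \<psi> 0 * (\<integral>x. \<phi> x * ubar x \<partial>M))"

definition weakly_continuous :: "'a measure \<Rightarrow> ('a \<Rightarrow> real) set \<Rightarrow> real set
    \<Rightarrow> (real \<Rightarrow> 'a \<Rightarrow> real) \<Rightarrow> bool" where
  "weakly_continuous M A I u \<longleftrightarrow> (\<forall>f\<in>A. continuous_on I (\<lambda>t. \<integral>x. f x * u t x \<partial>M))"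

definition condition_M :: "'a measure \<Rightarrow> (('a \<Rightarrow> real) \<Rightarrow> ('a \<Rightarrow> real) \<Rightarrow> 'a \<Rightarrow> real)
    \<Rightarrow> ('a \<Rightarrow> real) set \<Rightarrow> bool" where
  "condition_M M \<Gamma> A \<longleftrightarrow> (\<exists>F. (\<forall>n. F n \<in> A) \<and>
     (\<forall>n. AE x in M. 0 \<le> F n x \<and> F n x \<le> 1) \<and>
     (AE x in M. incseq (\<lambda>n. F n x) \<and> (\<lambda>n. F n x) \<longlonglongrightarrow> 1) \<and>
     \<comment> \<open>\<open>sqrt(\<Gamma>(f_n)) \<rightarrow> 0\<close> weakly-* in \<open>L^\<infinity> = (L^1)^*\<close>\<close>
     (\<forall>g\<in>Lp M 1. (\<lambda>n. \<integral>x. sqrt (\<Gamma> (F n) (F n) x) * g x \<partial>M) \<longlonglongrightarrow> 0))"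

end

theory Submission
  imports Defs
begin

text \<open>
  Existence is obtained by duality, without vanishing viscosity. For a test function
  \<open>w = \<Sum>\<^sub>i \<psi>\<^sub>i(t) \<phi>\<^sub>i\<close> with \<open>\<phi>\<^sub>i \<in> \<A>\<close> and \<open>w(T) = 0\<close>, the chain rule for derivations gives an a priori
  bound for the adjoint equation \<open>- \<partial>\<^sub>t w - dw(b) = F\<close>: the integral of \<open>(w(0) - \<lambda>(0))\<^sup>+\<close> is controlled by that
  of \<open>(F - a)\<^sup>+\<close>, where \<open>\<lambda>' = - a\<close>, using only \<open>(div b)\<^sup>- \<in> L\<^sup>1(L\<^sup>\<infinity>)\<close>. A Hahn--Banach type argument for
  functions with values in \<open>[0, C]\<close> turns this bound into a bounded nonnegative solution without increase of mass
  for every bounded nonnegative integrable datum. A general datum is split into its positive and negative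
  parts and then into dyadic levels; summing the corresponding solutions preserves the \<open>L\<^sup>1 \<inter> L\<^sup>r\<close> bounds.
\<close>

text \<open>No solution of the adjoint equation is ever constructed: the estimate holds for
  arbitrary test functions, whose residual is simply computed, and duality turns the inequality into
  existence. On a space of possibly infinite measure a bounded function need not be integrable, so
  the mass bound has to be built into the duality; this is the purpose of \<lambda> and a. Constants
  need not belong to \<open>A\<close>, so the truncation of w - \<lambda> is written as a C^1
  function of w that vanishes at 0; this asks for \<lambda> >= 0 and a smoothed positive part.
  Solutions are not shown to be unique, so there is no linear solution operator to interpolate
  between L^1 and L^infinity. The dyadic levels do this by hand: the piece with values up to 2^k has
  a solution of size 2^k and of no larger mass, and these two facts control the L^r norm of the sum.
  Finally, a space-time solution is determined only up to null sets of times that depend on the test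
  function; a second use of duality, at each fixed time, gives values at every t.\<close>

section \<open>Duality for functions with values in an interval\<close>

definition clip :: "real \<Rightarrow> real \<Rightarrow> real" where
  "clip C s = min C (max 0 s)"

text \<open>The supremum of s * u - u^2 / 2 over u in [0, C], attained at u =
  \<open>clip C s\<close>: the convex conjugate of the quadratic energy on the box. Its integral is
  therefore the dual functional for the element of least L^2 norm under linear constraints.\<close>

definition clip_pot :: "real \<Rightarrow> real \<Rightarrow> real" where
  "clip_pot C s = s * clip C s - (clip C s)\<^sup>2 / 2"

lemma clip_bounds:
  assumes "0 \<le> C"
  shows "0 \<le> clip C s" "clip C s \<le> C"
  using assms by (auto simp: clip_def)

lemma clip_lipschitz: "\<bar>clip C s - clip C t\<bar> \<le> \<bar>s - t\<bar>"
  by (auto simp: clip_def)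

lemma continuous_clip: "continuous_on S (clip C)"
  unfolding clip_def by (intro continuous_intros)

lemma borel_measurable_clip [measurable]: "clip C \<in> borel_measurable borel"
  by (intro borel_measurable_continuous_onI continuous_clip)

lemma borel_measurable_clip_pot [measurable]: "clip_pot C \<in> borel_measurable borel"
  unfolding clip_pot_def by measurable

text \<open>After the square is split off, the remainder is (a - clip C a) * (clip C a - u),
  nonnegative by the variational inequality of the projection onto [0, C].\<close>

lemma clip_pot_ge:
  assumes "0 \<le> u" "u \<le> C"
  shows "clip_pot C a \<ge> a * u - u\<^sup>2 / 2 + (clip C a - u)\<^sup>2 / 2"
proof -
  have *: "clip_pot C a - (a * u - u\<^sup>2 / 2 + (clip C a - u)\<^sup>2 / 2) = (a - clip C a) * (clip C a - u)"
    by (simp add: clip_pot_def power2_eq_square field_simps)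
  have "(a - clip C a) * (clip C a - u) \<ge> 0"
  proof (cases "a \<le> 0")
    case True
    then have "clip C a = 0" using assms by (auto simp: clip_def)
    then show ?thesis using True assms by (simp add: mult_nonpos_nonneg)
  next
    case False
    then show ?thesis using assms by (auto simp: clip_def min_def)
  qed
  with * show ?thesis by linarith
qed

text \<open>The competitors u = C and u = 0 in the supremum. The first turns the hypothesis on
  \<open>max 0 F\<close> into a lower bound for the dual functional.\<close>

lemma clip_pot_bounds:
  assumes "0 \<le> C"
  shows "clip_pot C s \<ge> C * max 0 s - C\<^sup>2 / 2" "0 \<le> clip_pot C s" "clip_pot C s \<le> C * \<bar>s\<bar>"
proof -
  show "0 \<le> clip_pot C s"
    using clip_pot_ge[of 0 C s] assms zero_le_power2[of "clip C s"] by simp (smt (verit) zero_le_power2)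
  show "clip_pot C s \<ge> C * max 0 s - C\<^sup>2 / 2"
  proof (cases "s \<le> 0")
    case True
    with \<open>0 \<le> clip_pot C s\<close> have "0 \<le> C\<^sup>2 / 2" by simp
    moreover have "max 0 s = 0" using True by simp
    ultimately show ?thesis using \<open>0 \<le> clip_pot C s\<close> by (metis diff_0 mult_zero_right neg_le_0_iff_le order_trans)
  next
    case False
    then have "max 0 s = s" by simp
    have "C * s - C\<^sup>2 / 2 \<le> C * s - C\<^sup>2 / 2 + (clip C s - C)\<^sup>2 / 2" by simp
    also have "\<dots> \<le> clip_pot C s" using clip_pot_ge[of C C s] assms by (simp add: mult.commute)
    finally show ?thesis using \<open>max 0 s = s\<close> by simp
  qed
  have "clip_pot C s \<le> s * clip C s" by (simp add: clip_pot_def)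
  also have "\<dots> \<le> \<bar>s\<bar> * C"
    using clip_bounds[OF assms] by (intro mult_mono) auto
  finally show "clip_pot C s \<le> C * \<bar>s\<bar>" by (simp add: mult.commute)
qed

text \<open>Uniform convexity, measured in the values of \<open>clip C\<close> instead of the
  arguments: the clipped midpoint r is a competitor at both a and b, and the two squared defects add
  up to at least the left side. The arguments of a minimizing sequence may run off while their
  clipped values still converge.\<close>

lemma clip_pot_midpoint:
  assumes "0 \<le> C"
  shows "(clip C a - clip C b)\<^sup>2 / 4 \<le> clip_pot C a + clip_pot C b - 2 * clip_pot C ((a + b) / 2)"
proof -
  define r where "r = clip C ((a + b) / 2)"
  have r: "0 \<le> r" "r \<le> C" using clip_bounds[OF assms] by (auto simp: r_def)
  have "2 * clip_pot C ((a + b) / 2) = (a + b) * r - r\<^sup>2"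
    by (simp add: clip_pot_def r_def)
  moreover have "(clip C a - clip C b)\<^sup>2 / 4 \<le> (clip C a - r)\<^sup>2 / 2 + (clip C b - r)\<^sup>2 / 2"
  proof -
    have "0 \<le> ((clip C a - r) + (clip C b - r))\<^sup>2" by simp
    then show ?thesis by (simp add: power2_eq_square field_simps)
  qed
  ultimately show ?thesis
    using clip_pot_ge[OF r, of a] clip_pot_ge[OF r, of b] by (simp add: algebra_simps)
qed

text \<open>By convexity, the slope at the end point a + h of the step bounds the increment from
  above.\<close>

lemma clip_pot_gradient:
  assumes "0 \<le> C"
  shows "clip_pot C (a + h) - clip_pot C a \<le> h * clip C (a + h)"
  using clip_pot_ge[of "clip C (a + h)" C a] clip_bounds[OF assms, of "a + h"] 
  by (simp add: clip_pot_def[of C "a + h"] algebra_simps) (smt (verit) zero_le_power2 field_sum_of_halves)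

text \<open>A pair (F, c) stands for the linear constraint c <= integral of F u on an unknown u. The
  closure conditions lose nothing, since sums and nonnegative multiples of constraints follow from
  them.\<close>

definition convex_cone_of_pairs :: "(('a \<Rightarrow> real) \<times> real) set \<Rightarrow> bool" where
  "convex_cone_of_pairs P \<longleftrightarrow> P \<noteq> {} \<and>
     (\<forall>F c G e. (F, c) \<in> P \<longrightarrow> (G, e) \<in> P \<longrightarrow> ((\<lambda>x. F x + G x), c + e) \<in> P) \<and>
     (\<forall>F c s. (F, c) \<in> P \<longrightarrow> 0 \<le> s \<longrightarrow> ((\<lambda>x. s * F x), s * c) \<in> P)"

text \<open>The bounded solution is the limit of \<open>clip C (F n)\<close> along a minimizing sequence of the
  dual functional \<open>J\<close>; the midpoint inequality makes this sequence Cauchy in \<open>L\<^sup>2\<close>.\<close>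
lemma (in finite_measure) box_duality_finite:
  assumes C: "0 \<le> C" and cone: "convex_cone_of_pairs P"
    and int: "\<And>F c. (F, c) \<in> P \<Longrightarrow> integrable M F"
    and bound: "\<And>F c. (F, c) \<in> P \<Longrightarrow> c \<le> C * (\<integral>x. max 0 (F x) \<partial>M)"
  shows "\<exists>u \<in> borel_measurable M. (\<forall>x. 0 \<le> u x \<and> u x \<le> C) \<and>
           (\<forall>(F, c) \<in> P. c \<le> (\<integral>x. F x * u x \<partial>M))"
proof -
  define J where "J = (\<lambda>(F, c). (\<integral>x. clip_pot C (F x) \<partial>M) - c)"
  have pot_int: "integrable M (\<lambda>x. clip_pot C (F x))" if "integrable M F" for F
  proof (rule Bochner_Integration.integrable_bound)
    show "integrable M (\<lambda>x. C * F x)" using that by simp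
    show "AE x in M. norm (clip_pot C (F x)) \<le> norm (C * F x)"
      using clip_pot_bounds[OF C] C by (auto simp: abs_mult)
    show "(\<lambda>x. clip_pot C (F x)) \<in> borel_measurable M"
      using that by measurable
  qed
  have add: "((\<lambda>x. F x + G x), c + e) \<in> P" if "(F, c) \<in> P" "(G, e) \<in> P" for F c G e
    using cone that unfolding convex_cone_of_pairs_def by blast
  have scale: "((\<lambda>x. s * F x), s * c) \<in> P" if "(F, c) \<in> P" "0 \<le> s" for F c s
    using cone that unfolding convex_cone_of_pairs_def by blast
  \<comment> \<open>Weak duality: the competitor u = C costs the integral of the constant C^2 / 2,
    which is finite because the measure is.\<close>
  have J_lower: "- (C\<^sup>2 / 2 * measure M (space M)) \<le> J p" if "p \<in> P" for p
  proof -
    obtain F c where p: "p = (F, c)" by fastforce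
    with that have Fc: "(F, c) \<in> P" by simp
    have "C * (\<integral>x. max 0 (F x) \<partial>M) - C\<^sup>2 / 2 * measure M (space M)
        = (\<integral>x. C * max 0 (F x) - C\<^sup>2 / 2 \<partial>M)"
      using int[OF Fc] by (subst Bochner_Integration.integral_diff) (auto simp: mult.commute)
    also have "\<dots> \<le> (\<integral>x. clip_pot C (F x) \<partial>M)"
      using int[OF Fc] pot_int[OF int[OF Fc]] clip_pot_bounds[OF C]
      by (intro integral_mono) auto
    finally show ?thesis using bound[OF Fc] by (simp add: J_def p)
  qed
  define I where "I = Inf (J ` P)"
  have bdd: "bdd_below (J ` P)" using J_lower by (auto intro!: bdd_belowI)
  have I_le: "I \<le> J p" if "p \<in> P" for p
    unfolding I_def using bdd that by (intro cInf_lower) auto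
  \<comment> \<open>The rate 16^-n survives two later losses of a factor 2^n: in passing from L^2
    gaps to L^1 gaps, and in dividing by the step 2^-n of the stationarity argument.\<close>
  have "\<exists>p\<in>P. J p < I + (1/16) ^ n" for n
  proof -
    have "Inf (J ` P) < I + (1/16) ^ n" unfolding I_def by simp
    then show ?thesis
      using cInf_less_iff[of "J ` P" "I + (1/16)^n"] bdd cone
      unfolding convex_cone_of_pairs_def by auto
  qed
  then obtain p where p: "\<And>n. p n \<in> P" "\<And>n. J (p n) < I + (1/16) ^ n" by metis
  define F c where "F n = fst (p n)" and "c n = snd (p n)" for n
  have Fc: "(F n, c n) \<in> P" for n using p by (simp add: F_def c_def)
  have JFc: "J (F n, c n) < I + (1/16) ^ n" for n using p by (simp add: F_def c_def)
  have F_int[intro,simp]: "integrable M (F n)" for n using int Fc by blast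
  have [measurable]: "F n \<in> borel_measurable M" for n using F_int[of n] by (rule borel_measurable_integrable)
  define v where "v n x = clip C (F n x)" for n x
  have v_meas[measurable]: "v n \<in> borel_measurable M" for n unfolding v_def by measurable
  have v_bd: "0 \<le> v n x" "v n x \<le> C" for n x using clip_bounds[OF C] by (auto simp: v_def)
  have v_abs: "\<bar>v n x - v k x\<bar> \<le> C" for n k x
    using v_bd[of n x] v_bd[of k x] by (simp add: abs_le_iff)
  have v_sq: "integrable M (\<lambda>x. (v n x - v k x)\<^sup>2)" for n k
  proof (rule integrable_const_bound[where B="C\<^sup>2"])
    show "AE x in M. norm ((v n x - v k x)\<^sup>2) \<le> C\<^sup>2"
      using v_abs C by (auto simp: abs_le_square_iff[symmetric])
  qed measurable
  \<comment> \<open>The midpoint of two almost minimizers stays in the cone, so \<open>J\<close>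
    there is at least the infimum; the midpoint inequality converts the small excess into an L^2
    gap.\<close>
  have gap: "(\<integral>x. (v n x - v (Suc n) x)\<^sup>2 \<partial>M) \<le> 8 * (1/16) ^ n" for n
  proof -
    have mid: "((\<lambda>x. (1/2) * (F n x + F (Suc n) x)), (1/2) * (c n + c (Suc n))) \<in> P"
      by (intro scale add Fc) auto
    have mid_int: "integrable M (\<lambda>x. clip_pot C ((F n x + F (Suc n) x) / 2))"
      using pot_int[OF int[OF mid]] by simp
    have "(\<integral>x. (v n x - v (Suc n) x)\<^sup>2 \<partial>M) / 4 = (\<integral>x. (v n x - v (Suc n) x)\<^sup>2 / 4 \<partial>M)"
      by simp
    also have "\<dots> \<le> (\<integral>x. clip_pot C (F n x) + clip_pot C (F (Suc n) x)
         - 2 * clip_pot C ((F n x + F (Suc n) x) / 2) \<partial>M)"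
      unfolding v_def[symmetric] using v_sq[of n "Suc n"] pot_int[OF F_int] mid_int clip_pot_midpoint[OF C]
      by (intro integral_mono) (auto simp: v_def)
    also have "\<dots> = (\<integral>x. clip_pot C (F n x) \<partial>M) + (\<integral>x. clip_pot C (F (Suc n) x) \<partial>M)
         - 2 * (\<integral>x. clip_pot C ((F n x + F (Suc n) x) / 2) \<partial>M)"
      using pot_int[OF F_int] mid_int by simp
    also have "\<dots> = J (F n, c n) + J (F (Suc n), c (Suc n))
        - 2 * J ((\<lambda>x. (1/2) * (F n x + F (Suc n) x)), (1/2) * (c n + c (Suc n)))"
      by (simp add: J_def algebra_simps add_divide_distrib)
    also have "\<dots> \<le> (1/16) ^ n + (1/16) ^ Suc n"
      using JFc[of n] JFc[of "Suc n"] I_le[OF mid] by linarith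
    also have "\<dots> \<le> 2 * (1/16) ^ n" by simp
    finally show ?thesis by simp
  qed
  have v_diff: "(\<integral>x. \<bar>v n x - v (Suc n) x\<bar> \<partial>M) \<le> (measure M (space M) + 8) * (1/2) ^ n" for n
  proof -
    have abs_int: "integrable M (\<lambda>x. \<bar>v n x - v (Suc n) x\<bar>)"
    proof (rule integrable_const_bound[where B=C])
      show "AE x in M. norm \<bar>v n x - v (Suc n) x\<bar> \<le> C" using v_abs by simp
    qed measurable
    \<comment> \<open>Young's inequality with weight 2^n makes the L^1 gaps geometric, so the whole
      sequence converges almost everywhere.\<close>
    have "(\<integral>x. \<bar>v n x - v (Suc n) x\<bar> \<partial>M) \<le> (\<integral>x. (1/2)^n + 2^n * (v n x - v (Suc n) x)\<^sup>2 \<partial>M)"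
    proof (intro integral_mono abs_int)
      show "integrable M (\<lambda>x. (1/2)^n + 2^n * (v n x - v (Suc n) x)\<^sup>2)" using v_sq by auto
      fix x
      let ?d = "\<bar>v n x - v (Suc n) x\<bar>"
      have "0 \<le> ((1/2)^n - ?d)\<^sup>2" by simp
      then have "2 * (1/2)^n * ?d \<le> ((1/2)^n)\<^sup>2 + ?d\<^sup>2" by (simp add: power2_diff)
      then have "2^n * (2 * (1/2)^n * ?d) \<le> 2^n * (((1/2)^n)\<^sup>2 + ?d\<^sup>2)"
        by (intro mult_left_mono) auto
      moreover have "2^n * (2 * (1/2)^n * ?d) = 2 * ?d" by (simp add: power_one_over field_simps)
      moreover have "2^n * (((1/2)^n)\<^sup>2 + ?d\<^sup>2) = (1/2)^n + 2^n * ?d\<^sup>2"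
        by (simp add: power_one_over field_simps power2_eq_square)
      ultimately have "2 * ?d \<le> (1/2)^n + 2^n * ?d\<^sup>2" by linarith
      then show "?d \<le> (1/2)^n + 2^n * (v n x - v (Suc n) x)\<^sup>2"
        unfolding power2_abs
        by (rule order_trans[rotated]) simp
    qed
    also have "\<dots> = (1/2)^n * measure M (space M) + 2^n * (\<integral>x. (v n x - v (Suc n) x)\<^sup>2 \<partial>M)"
      using v_sq by (subst Bochner_Integration.integral_add) auto
    also have "\<dots> \<le> (1/2)^n * measure M (space M) + 2^n * (8 * (1/16)^n)"
      using gap[of n] by (intro add_left_mono mult_left_mono) auto
    also have "2^n * (8 * (1/16)^n) = (8::real) * (1/8)^n"
      by (simp add: power_mult_distrib[symmetric])
    also have "(8::real) * (1/8)^n \<le> 8 * (1/2)^n" by (intro mult_left_mono power_mono) auto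
    finally show ?thesis by (simp add: algebra_simps)
  qed
  have abs_int: "integrable M (\<lambda>x. \<bar>v n x - v (Suc n) x\<bar>)" for n
  proof (rule integrable_const_bound[where B=C])
    show "AE x in M. norm \<bar>v n x - v (Suc n) x\<bar> \<le> C" using v_abs by simp
  qed measurable
  have "(\<integral>\<^sup>+x. (\<Sum>n. ennreal \<bar>v n x - v (Suc n) x\<bar>) \<partial>M)
      = (\<Sum>n. \<integral>\<^sup>+x. ennreal \<bar>v n x - v (Suc n) x\<bar> \<partial>M)"
    by (intro nn_integral_suminf) measurable
  also have "\<dots> = (\<Sum>n. ennreal (\<integral>x. \<bar>v n x - v (Suc n) x\<bar> \<partial>M))"
    using abs_int by (intro suminf_cong nn_integral_eq_integral) auto
  also have "\<dots> \<le> (\<Sum>n. ennreal ((measure M (space M) + 8) * (1/2) ^ n))"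
    using v_diff by (intro suminf_le ennreal_leI) auto
  also have "\<dots> < \<infinity>"
  proof -
    have "summable (\<lambda>n. (measure M (space M) + 8) * (1/2) ^ n)"
      by (intro summable_mult summable_geometric) auto
    then show ?thesis by (subst suminf_ennreal2) auto
  qed
  finally have "AE x in M. (\<Sum>n. ennreal \<bar>v n x - v (Suc n) x\<bar>) \<noteq> \<infinity>"
    by (intro nn_integral_PInf_AE) auto
  then have conv: "AE x in M. convergent (\<lambda>n. v n x)"
  proof eventually_elim
    case (elim x)
    then have "summable (\<lambda>n. \<bar>v n x - v (Suc n) x\<bar>)"
      using summable_suminf_not_top[of "\<lambda>n. \<bar>v n x - v (Suc n) x\<bar>"] by simp
    then have "summable (\<lambda>n. v n x - v (Suc n) x)" by (rule summable_rabs_cancel)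
    then have "summable (\<lambda>n. v (Suc n) x - v n x)"
      using summable_minus by fastforce
    then have "(\<lambda>n. v n x - v 0 x) \<longlonglongrightarrow> (\<Sum>n. v (Suc n) x - v n x)"
      using summable_LIMSEQ[of "\<lambda>n. v (Suc n) x - v n x"] sum_lessThan_telescope[of "\<lambda>n. v n x"] by simp
    from tendsto_add[OF this tendsto_const[of "v 0 x"]] show ?case by (auto simp: convergent_def)
  qed
  \<comment> \<open>Clipping once more enforces the bounds at every point, also where the sequence
    diverges.\<close>
  define u where "u x = clip C (lim (\<lambda>n. v n x))" for x
  have [measurable]: "u \<in> borel_measurable M" unfolding u_def by measurable
  have lim: "AE x in M. (\<lambda>n. v n x) \<longlonglongrightarrow> u x"
    using conv
  proof eventually_elim
    case (elim x)
    then have l: "(\<lambda>n. v n x) \<longlonglongrightarrow> lim (\<lambda>n. v n x)" by (simp add: convergent_LIMSEQ_iff)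
    then have "0 \<le> lim (\<lambda>n. v n x)" "lim (\<lambda>n. v n x) \<le> C"
      using v_bd by (auto intro: LIMSEQ_le_const LIMSEQ_le_const2)
    then have "u x = lim (\<lambda>n. v n x)" by (simp add: u_def clip_def)
    with l show ?case by simp
  qed
  have "e \<le> (\<integral>x. G x * u x \<partial>M)" if Ge: "(G, e) \<in> P" for G e
  proof -
    have G[simp]: "integrable M G" using int Ge by blast
    then have [measurable]: "G \<in> borel_measurable M" by (rule borel_measurable_integrable)
    \<comment> \<open>Stationarity of almost minimizers: a step s n in the direction (G, e) cannot
      lower \<open>J\<close> by more than 16^-n, so division by s n leaves the error 8^-n. As s n
      tends to 0, the clipped values at the perturbed point share the limit of
      \<open>v n\<close>.\<close>
    define s :: "nat \<Rightarrow> real" where "s n = (1/2)^n" for n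
    define w where "w n x = clip C (F n x + s n * G x)" for n x
    have "e - (1/8)^n \<le> (\<integral>x. G x * w n x \<partial>M)" for n
    proof -
      have dir: "((\<lambda>x. F n x + s n * G x), c n + s n * e) \<in> P"
        by (intro add scale Fc Ge) (auto simp: s_def)
      have Gw: "integrable M (\<lambda>x. G x * w n x)"
      proof (rule Bochner_Integration.integrable_bound[of _ "\<lambda>x. C * G x"])
        show "AE x in M. norm (G x * w n x) \<le> norm (C * G x)"
          using clip_bounds[OF C] C by (auto simp: w_def abs_mult mult.commute[of C] intro!: mult_left_mono AE_I2)
      qed (auto simp: w_def)
      have "I - (I + (1/16)^n) \<le> J ((\<lambda>x. F n x + s n * G x), c n + s n * e) - J (F n, c n)"
        using I_le[OF dir] JFc[of n] by linarith
      also have "\<dots> = (\<integral>x. clip_pot C (F n x + s n * G x) - clip_pot C (F n x) \<partial>M) - s n * e"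
        using pot_int[OF int[OF dir]] pot_int[OF F_int[of n]] by (simp add: J_def)
      also have "\<dots> \<le> (\<integral>x. s n * (G x * w n x) \<partial>M) - s n * e"
      proof (intro diff_right_mono integral_mono)
        show "integrable M (\<lambda>x. clip_pot C (F n x + s n * G x) - clip_pot C (F n x))"
          using pot_int[OF int[OF dir]] pot_int[OF F_int[of n]] by simp
        show "integrable M (\<lambda>x. s n * (G x * w n x))" using Gw by simp
        show "clip_pot C (F n x + s n * G x) - clip_pot C (F n x) \<le> s n * (G x * w n x)" for x
          using clip_pot_gradient[OF C, of "F n x" "s n * G x"] by (simp add: w_def mult.assoc)
      qed
      also have "\<dots> = s n * ((\<integral>x. G x * w n x \<partial>M) - e)" by (simp add: right_diff_distrib)
      finally have "2^n * (- ((1/16)^n)) \<le> 2^n * (s n * ((\<integral>x. G x * w n x \<partial>M) - e))"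
        by (intro mult_left_mono) auto
      moreover have "2^n * (s n * ((\<integral>x. G x * w n x \<partial>M) - e)) = (\<integral>x. G x * w n x \<partial>M) - e"
        by (simp add: s_def power_one_over)
      moreover have "2^n * (- ((1/16)^n)) = - ((1/8::real)^n)"
        by (simp add: power_mult_distrib[symmetric])
      ultimately show ?thesis by linarith
    qed
    moreover have "(\<lambda>n. \<integral>x. G x * w n x \<partial>M) \<longlonglongrightarrow> (\<integral>x. G x * u x \<partial>M)"
    proof (rule integral_dominated_convergence[where w="\<lambda>x. C * \<bar>G x\<bar>"])
      show "AE x in M. (\<lambda>n. G x * w n x) \<longlonglongrightarrow> G x * u x"
        using lim
      proof eventually_elim
        case (elim x)
        have "(\<lambda>n. w n x - v n x) \<longlonglongrightarrow> 0"
        proof (rule Lim_null_comparison)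
          show "\<forall>\<^sub>F n in sequentially. norm (w n x - v n x) \<le> (1/2)^n * \<bar>G x\<bar>"
          proof (intro always_eventually allI)
            fix n show "norm (w n x - v n x) \<le> (1/2)^n * \<bar>G x\<bar>"
              using clip_lipschitz[of C "F n x + s n * G x" "F n x"]
              by (simp add: w_def v_def s_def abs_mult)
          qed
          show "(\<lambda>n. (1/2)^n * \<bar>G x\<bar>) \<longlonglongrightarrow> 0"
            by (intro tendsto_mult_left_zero LIMSEQ_realpow_zero) auto
        qed
        from tendsto_add[OF this elim] have "(\<lambda>n. w n x) \<longlonglongrightarrow> u x" by simp
        then show ?case by (intro tendsto_mult tendsto_const)
      qed
      show "AE x in M. norm (G x * w n x) \<le> C * \<bar>G x\<bar>" for n
        using clip_bounds[OF C] C by (auto simp: w_def abs_mult mult.commute[of C] intro!: mult_left_mono AE_I2)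
    qed (auto simp: w_def)
    moreover have "(\<lambda>n. e - (1/8)^n) \<longlonglongrightarrow> e - 0"
      by (intro tendsto_diff tendsto_const LIMSEQ_realpow_zero) auto
    ultimately show ?thesis by (auto intro: LIMSEQ_le)
  qed
  then show ?thesis
    using clip_bounds[OF C] by (intro bexI[of _ u]) (auto simp: u_def)
qed

text \<open>A strictly positive integrable density k reduces this to a finite measure: F / k against
  k dM pairs with u as F does against M, and division by k > 0 commutes with \<open>max 0\<close>,
  so the cone and its bound survive. The unknown u is not rescaled, so the box stays the
  same.\<close>

lemma (in sigma_finite_measure) box_duality:
  assumes C: "0 \<le> C" and cone: "convex_cone_of_pairs P"
    and int: "\<And>F c. (F, c) \<in> P \<Longrightarrow> integrable M F"
    and bound: "\<And>F c. (F, c) \<in> P \<Longrightarrow> c \<le> C * (\<integral>x. max 0 (F x) \<partial>M)"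
  shows "\<exists>u \<in> borel_measurable M. (\<forall>x. 0 \<le> u x \<and> u x \<le> C) \<and>
           (\<forall>(F, c) \<in> P. c \<le> (\<integral>x. F x * u x \<partial>M))"
proof -
  obtain h where h[measurable]: "h \<in> borel_measurable M" "integral\<^sup>N M h \<noteq> \<infinity>"
    "\<And>x. x \<in> space M \<Longrightarrow> 0 < h x \<and> h x < \<infinity>"
    using Ex_finite_integrable_function by blast
  define k where "k x = enn2real (h x)" for x
  have [measurable]: "k \<in> borel_measurable M" unfolding k_def by measurable
  have k_pos: "0 < k x" if "x \<in> space M" for x
    using h(3)[OF that] by (auto simp: k_def enn2real_positive_iff top.not_eq_extremum)
  have k_nz: "k x \<noteq> 0" if "x \<in> space M" for x
    using k_pos[OF that] by simp
  have hk: "h x = ennreal (k x)" if "x \<in> space M" for x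
    using h(3)[OF that] by (simp add: k_def)
  define N where "N = density M (\<lambda>x. ennreal (k x))"
  have "emeasure N (space N) = integral\<^sup>N M h"
    unfolding N_def by (auto simp: emeasure_density hk cong: nn_integral_cong)
  with h interpret N: finite_measure N by (intro finite_measureI) auto
  have N_int: "integrable N (\<lambda>x. f x / k x) \<longleftrightarrow> integrable M f" 
    if [measurable]: "f \<in> borel_measurable M" for f
  proof -
    have "integrable N (\<lambda>x. f x / k x) \<longleftrightarrow> integrable M (\<lambda>x. k x *\<^sub>R (f x / k x))"
      unfolding N_def using k_pos by (intro integrable_density) (auto intro!: AE_I2 less_imp_le)
    also have "\<dots> \<longleftrightarrow> integrable M f"
      using k_nz by (intro Bochner_Integration.integrable_cong) auto
    finally show ?thesis .
  qed
  have N_eq: "(\<integral>x. f x / k x * g x \<partial>N) = (\<integral>x. f x * g x \<partial>M)" 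
    if [measurable]: "f \<in> borel_measurable M" "g \<in> borel_measurable M" for f g
  proof -
    have "(\<integral>x. f x / k x * g x \<partial>N) = (\<integral>x. k x *\<^sub>R (f x / k x * g x) \<partial>M)"
      unfolding N_def using k_pos by (intro integral_density) (auto intro!: AE_I2 less_imp_le)
    also have "\<dots> = (\<integral>x. f x * g x \<partial>M)"
      using k_nz by (intro Bochner_Integration.integral_cong) auto
    finally show ?thesis .
  qed
  define Q where "Q = (\<lambda>(F, c). (\<lambda>x. F x / k x, c)) ` P"
  have "\<exists>u \<in> borel_measurable N. (\<forall>x. 0 \<le> u x \<and> u x \<le> C) \<and>
           (\<forall>(F, c) \<in> Q. c \<le> (\<integral>x. F x * u x \<partial>N))"
  proof (rule N.box_duality_finite[OF C])
    show "convex_cone_of_pairs Q"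
      unfolding convex_cone_of_pairs_def
    proof (intro conjI allI impI)
      show "Q \<noteq> {}" using cone by (auto simp: Q_def convex_cone_of_pairs_def)
      fix F c G e assume "(F, c) \<in> Q" "(G, e) \<in> Q"
      then obtain F' G' where "(F', c) \<in> P" "F = (\<lambda>x. F' x / k x)" "(G', e) \<in> P" "G = (\<lambda>x. G' x / k x)"
        by (auto simp: Q_def)
      moreover from this have "((\<lambda>x. F' x + G' x), c + e) \<in> P"
        using cone unfolding convex_cone_of_pairs_def by blast
      ultimately show "((\<lambda>x. F x + G x), c + e) \<in> Q"
        unfolding Q_def by (intro rev_image_eqI[where x="(\<lambda>x. F' x + G' x, c + e)"]) (auto simp: add_divide_distrib)
    next
      fix F c and s :: real assume "(F, c) \<in> Q" "0 \<le> s"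
      then obtain F' where "(F', c) \<in> P" "F = (\<lambda>x. F' x / k x)" by (auto simp: Q_def)
      moreover from this have "((\<lambda>x. s * F' x), s * c) \<in> P"
        using cone \<open>0 \<le> s\<close> unfolding convex_cone_of_pairs_def by blast
      ultimately show "((\<lambda>x. s * F x), s * c) \<in> Q"
        unfolding Q_def by (intro rev_image_eqI[where x="(\<lambda>x. s * F' x, s * c)"]) auto
    qed
    fix F c assume "(F, c) \<in> Q"
    then obtain F' where F': "(F', c) \<in> P" "F = (\<lambda>x. F' x / k x)" by (auto simp: Q_def)
    have i: "integrable M F'" using F' int by blast
    then have [measurable]: "F' \<in> borel_measurable M" by auto
    show "integrable N F" using N_int i F' by simp
    have "max 0 (F x) = max 0 (F' x) / k x * 1" if "x \<in> space N" for x
      using k_pos[of x] that F' by (auto simp: N_def max_def zero_le_divide_iff)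
    then have "(\<integral>x. max 0 (F x) \<partial>N) = (\<integral>x. max 0 (F' x) / k x * 1 \<partial>N)"
      by (intro Bochner_Integration.integral_cong) auto
    also have "\<dots> = (\<integral>x. max 0 (F' x) \<partial>M)" by (subst N_eq) auto
    finally show "c \<le> C * (\<integral>x. max 0 (F x) \<partial>N)" using bound[OF F'(1)] by simp
  qed
  then obtain u where u: "u \<in> borel_measurable N" "\<And>x. 0 \<le> u x \<and> u x \<le> C"
    "\<And>F c. (F, c) \<in> Q \<Longrightarrow> c \<le> (\<integral>x. F x * u x \<partial>N)" by blast
  have um: "u \<in> borel_measurable M" using u(1) by (simp add: N_def)
  show ?thesis
  proof (intro bexI[of _ u] conjI ballI allI; (intro um)?)
    fix q assume "q \<in> P"
    then obtain F c where q: "q = (F, c)" "(F, c) \<in> P" by (cases q) auto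
    then have "((\<lambda>x. F x / k x), c) \<in> Q" unfolding Q_def by (intro rev_image_eqI[where x="(F, c)"]) auto
    from u(3)[OF this] show "case q of (F, c) \<Rightarrow> c \<le> (\<integral>x. F x * u x \<partial>M)"
      using N_eq[of F u] um int[OF q(2)] q by auto
  qed (use u in auto)
qed

section \<open>The algebra and its derivations\<close>

locale dirichlet_algebra =
  fixes M :: "'a::polish_space measure" and V A :: "('a \<Rightarrow> real) set"
    and \<Gamma> :: "('a \<Rightarrow> real) \<Rightarrow> ('a \<Rightarrow> real) \<Rightarrow> 'a \<Rightarrow> real"
  assumes setting: "dirichlet_setting M V \<Gamma> A"
begin

lemmas setting_unfolded = setting[unfolded dirichlet_setting_def]

lemma space_M [simp]: "space M = UNIV"
  and sets_M: "sets M = sets borel"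
  and sigma_finite_M: "sigma_finite_measure M"
  and V_subset: "V \<subseteq> Lp M 2"
  and A_subset: "A \<subseteq> V"
  and A_Vinf: "A \<subseteq> Vp M V \<Gamma> \<infinity>"
  by ((insert setting_unfolded)[1], elim conjE, assumption)+

lemma V_add [rule_format]: "\<forall>f\<in>V. \<forall>g\<in>V. (\<lambda>x. f x + g x) \<in> V"
  and V_scale [rule_format]: "\<forall>f\<in>V. \<forall>c. (\<lambda>x. c * f x) \<in> V"
  and V_cong [rule_format]: "\<forall>f\<in>V. \<forall>g \<in> borel_measurable M. (AE x in M. f x = g x) \<longrightarrow>
        g \<in> V \<and> (\<forall>h\<in>V. AE x in M. \<Gamma> f h x = \<Gamma> g h x)"
  and V_dense [rule_format]: "\<forall>f\<in>Lp M 2. \<forall>e>0. \<exists>g\<in>V. Lp_norm M 2 (\<lambda>x. f x - g x) < e"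
  and Gamma_sym [rule_format]: "\<forall>f\<in>V. \<forall>g\<in>V. AE x in M. \<Gamma> f g x = \<Gamma> g f x"
  and Gamma_nonneg [rule_format]: "\<forall>f\<in>V. AE x in M. \<Gamma> f f x \<ge> 0"
  and V_chain' [rule_format]: "\<forall>f\<in>V. \<forall>g\<in>V. \<forall>\<phi> \<phi>'. (\<forall>s. (\<phi> has_real_derivative \<phi>' s) (at s)) \<and> continuous_on UNIV \<phi>' \<and>
        bounded (range \<phi>') \<and> \<phi> 0 = 0 \<longrightarrow>
        (\<lambda>x. \<phi> (f x)) \<in> V \<and> (AE x in M. \<Gamma> (\<lambda>y. \<phi> (f y)) g x = \<phi>' (f x) * \<Gamma> f g x)"
  and A_ring: "\<forall>f\<in>A. \<forall>g\<in>A. (\<lambda>x. f x + g x) \<in> A \<and> (\<lambda>x. f x * g x) \<in> A"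
  and A_scale [rule_format]: "\<forall>f\<in>A. \<forall>c. (\<lambda>x. c * f x) \<in> A"
  and A_Lp [rule_format]: "\<forall>p. 1 \<le> p \<longrightarrow> A \<subseteq> Lp M p"
  and A_dense [rule_format]: "\<forall>f\<in>V. \<forall>e>0. \<exists>g\<in>A. V_norm M \<Gamma> (\<lambda>x. f x - g x) < e"
  and A_Vp' : "\<forall>p. 1 \<le> p \<and> p \<le> 2 \<longrightarrow> A \<subseteq> Vp M V \<Gamma> p \<and>
        (\<forall>f\<in>Vp M V \<Gamma> p. \<forall>e>0. \<exists>g\<in>A. Vp_norm M \<Gamma> p (\<lambda>x. f x - g x) < e)"
  and A_C1n [rule_format]: "\<forall>n \<Phi> F. C1n n \<Phi> \<and> \<Phi> (\<lambda>_. 0) = 0 \<and> (\<forall>i<n. F i \<in> A) \<longrightarrow>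
        (\<lambda>x. \<Phi> (\<lambda>i. if i < n then F i x else 0)) \<in> A"
  by ((insert setting_unfolded)[1], elim conjE, assumption)+

lemma V_chain:
  assumes "f \<in> V" "g \<in> V" "\<And>s. (\<phi> has_real_derivative \<phi>' s) (at s)" "continuous_on UNIV \<phi>'"
    "bounded (range \<phi>')" "\<phi> 0 = 0"
  shows "(\<lambda>x. \<phi> (f x)) \<in> V" "AE x in M. \<Gamma> (\<lambda>y. \<phi> (f y)) g x = \<phi>' (f x) * \<Gamma> f g x"
  using V_chain'[OF assms(1,2), of \<phi> \<phi>'] assms by blast+

lemma A_add: "\<lbrakk>f \<in> A; g \<in> A\<rbrakk> \<Longrightarrow> (\<lambda>x. f x + g x) \<in> A"
  and A_mult: "\<lbrakk>f \<in> A; g \<in> A\<rbrakk> \<Longrightarrow> (\<lambda>x. f x * g x) \<in> A"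
  using A_ring by blast+

lemma A_Vp: "\<lbrakk>1 \<le> p; p \<le> 2\<rbrakk> \<Longrightarrow> A \<subseteq> Vp M V \<Gamma> p"
  using A_Vp' by blast

lemma borel_measurable_A: "f \<in> A \<Longrightarrow> f \<in> borel_measurable M"
  using A_Lp[of 1] by (auto simp: Lp_def)

lemma zero_A: "(\<lambda>x. 0) \<in> A"
  using A_C1n[of 0 "\<lambda>_. 0" "\<lambda>_ _. 0"] by (simp add: C1n_def)

lemma A_diff: "\<lbrakk>f \<in> A; g \<in> A\<rbrakk> \<Longrightarrow> (\<lambda>x. f x - g x) \<in> A"
  using A_add[of f "\<lambda>x. (-1) * g x"] A_scale[of g "-1"] by simp

lemma A_comp:
  assumes f: "f \<in> A" and \<beta>: "\<And>s. (\<beta> has_real_derivative \<beta>' s) (at s)" "continuous_on UNIV \<beta>'" "\<beta> 0 = 0"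
  shows "(\<lambda>x. \<beta> (f x)) \<in> A"
proof -
  have "C1n 1 (\<lambda>x. \<beta> (x 0))"
    unfolding C1n_def
  proof (intro conjI allI impI exI[of _ "\<lambda>i x. \<beta>' (x 0)"])
    fix x :: "nat \<Rightarrow> real" and i :: nat assume "i < 1"
    then show "((\<lambda>s. \<beta> ((x(i := s)) 0)) has_real_derivative \<beta>' (x 0)) (at (x i))"
      using \<beta>(1)[of "x 0"] by simp
  next
    fix i :: nat and x :: "nat \<Rightarrow> real" and e :: real assume "0 < e"
    then obtain d where "0 < d" "\<And>s. dist s (x 0) < d \<Longrightarrow> dist (\<beta>' s) (\<beta>' (x 0)) < e"
      using \<beta>(2) unfolding continuous_on_iff by blast
    then show "\<exists>d>0. \<forall>y. (\<forall>j<1. \<bar>y j - x j\<bar> < d) \<longrightarrow> \<bar>\<beta>' (y 0) - \<beta>' (x 0)\<bar> < e"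
      by (intro exI[of _ d]) (auto simp: dist_real_def)
  qed simp
  from A_C1n[of 1 "\<lambda>x. \<beta> (x 0)" "\<lambda>_. f"] this f \<beta>(3) show ?thesis by simp
qed

lemma A_bounded: assumes "f \<in> A" obtains R where "0 \<le> R" "AE x in M. \<bar>f x\<bar> \<le> R"
proof -
  from A_Lp[of \<infinity>] assms obtain R where "AE x in M. \<bar>f x\<bar> \<le> R" by (auto simp: Lp_def)
  then have "AE x in M. \<bar>f x\<bar> \<le> max 0 R" by eventually_elim auto
  then show ?thesis using that[of "max 0 R"] by simp
qed

lemma A_integrable: assumes "f \<in> A" shows "integrable M f"
proof -
  have "(\<integral>\<^sup>+x. ennreal \<bar>f x\<bar> \<partial>M) < \<infinity>" using A_Lp[of 1] assms by (auto simp: Lp_def)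
  then show ?thesis using borel_measurable_A[OF assms] by (intro integrableI_bounded) auto
qed

lemma sqrt_Gamma_integrable: assumes "f \<in> A" shows "integrable M (\<lambda>x. sqrt (\<Gamma> f f x))"
proof -
  have "(\<lambda>x. sqrt (\<Gamma> f f x)) \<in> Lp M 1" using A_Vp[of 1] assms by (auto simp: Vp_def)
  then have "(\<lambda>x. sqrt (\<Gamma> f f x)) \<in> borel_measurable M" "(\<integral>\<^sup>+x. ennreal \<bar>sqrt (\<Gamma> f f x)\<bar> \<partial>M) < \<infinity>"
    by (auto simp: Lp_def)
  then show ?thesis by (intro integrableI_bounded) auto
qed

lemma sqrt_Gamma_bounded:
  assumes "f \<in> A" obtains R where "0 \<le> R" "AE x in M. \<bar>sqrt (\<Gamma> f f x)\<bar> \<le> R"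
proof -
  have "(\<lambda>x. sqrt (\<Gamma> f f x)) \<in> Lp M \<infinity>" using A_Vinf assms by (auto simp: Vp_def)
  then obtain R where "AE x in M. \<bar>sqrt (\<Gamma> f f x)\<bar> \<le> R" by (auto simp: Lp_def)
  then have "AE x in M. \<bar>sqrt (\<Gamma> f f x)\<bar> \<le> max 0 R" by eventually_elim auto
  then show ?thesis using that[of "max 0 R"] by simp
qed

text \<open>The setting allows a change of representative in the first argument; symmetry carries it
  to the second.\<close>

lemma Gamma_cong:
  assumes f: "f \<in> V" and g: "g \<in> borel_measurable M" and eq: "AE x in M. f x = g x"
  shows "AE x in M. \<Gamma> f f x = \<Gamma> g g x"
proof -
  have gV: "g \<in> V" using V_cong[OF f g eq] by simp
  have "AE x in M. \<Gamma> f f x = \<Gamma> g f x" "AE x in M. \<Gamma> f g x = \<Gamma> g g x"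
    using V_cong[OF f g eq] f gV by blast+
  then show ?thesis using Gamma_sym[OF f gV] by eventually_elim simp
qed

text \<open>The chain rule in both arguments gives \<open>\<Gamma>\<close> of the composition as the
  square of the derivative times \<open>\<Gamma> f f\<close>. The chain rule of the setting asks for
  a derivative bounded on the whole line, which is why e bounds \<open>\<phi>'\<close>
  everywhere.\<close>

lemma Gamma_comp_le:
  assumes f: "f \<in> V" and \<phi>: "\<And>s. (\<phi> has_real_derivative \<phi>' s) (at s)" "continuous_on UNIV \<phi>'" "\<phi> 0 = 0"
    and e: "\<And>s. \<bar>\<phi>' s\<bar> \<le> e"
  shows "(\<lambda>x. \<phi> (f x)) \<in> V" "AE x in M. sqrt (\<Gamma> (\<lambda>y. \<phi> (f y)) (\<lambda>y. \<phi> (f y)) x) \<le> e * sqrt (\<Gamma> f f x)"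
proof -
  have bd: "bounded (range \<phi>')" using e by (intro boundedI[of _ e]) auto
  note chain = V_chain[OF f _ \<phi>(1,2) bd \<phi>(3)]
  show g: "(\<lambda>x. \<phi> (f x)) \<in> V" using chain(1)[OF f] .
  from chain(2)[OF f] chain(2)[OF g] Gamma_sym[OF f g] Gamma_nonneg[OF f]
  show "AE x in M. sqrt (\<Gamma> (\<lambda>y. \<phi> (f y)) (\<lambda>y. \<phi> (f y)) x) \<le> e * sqrt (\<Gamma> f f x)"
  proof eventually_elim
    case (elim x)
    then have "\<Gamma> (\<lambda>y. \<phi> (f y)) (\<lambda>y. \<phi> (f y)) x = (\<phi>' (f x))\<^sup>2 * \<Gamma> f f x"
      by (simp add: power2_eq_square)
    then have "sqrt (\<Gamma> (\<lambda>y. \<phi> (f y)) (\<lambda>y. \<phi> (f y)) x) = \<bar>\<phi>' (f x)\<bar> * sqrt (\<Gamma> f f x)"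
      by (simp only: real_sqrt_mult real_sqrt_abs)
    then show ?case using e[of "f x"] elim by (simp add: mult_right_mono)
  qed
qed

section \<open>Chain rule for derivations\<close>

context
  fixes D assumes D: "derivation M \<Gamma> A D"
begin

lemma derivation_measurable: "f \<in> A \<Longrightarrow> D f \<in> borel_measurable M"
  and derivation_add: "\<lbrakk>f \<in> A; g \<in> A\<rbrakk> \<Longrightarrow> AE x in M. D (\<lambda>y. f y + g y) x = D f x + D g x"
  and derivation_scale: "f \<in> A \<Longrightarrow> AE x in M. D (\<lambda>y. c * f y) x = c * D f x"
  and derivation_mult: "\<lbrakk>f \<in> A; g \<in> A\<rbrakk> \<Longrightarrow> AE x in M. D (\<lambda>y. f y * g y) x = f x * D g x + g x * D f x"
  using D unfolding derivation_def by blast+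

lemma derivation_power:
  assumes f: "f \<in> A"
  shows "(\<lambda>x. f x ^ Suc k) \<in> A \<and> (AE x in M. D (\<lambda>y. f y ^ Suc k) x = real (Suc k) * f x ^ k * D f x)"
proof (induction k)
  case 0
  then show ?case using f by simp
next
  case (Suc k)
  then have 1: "(\<lambda>x. f x * f x ^ Suc k) \<in> A" by (intro A_mult f) auto
  have id: "f x * (real (Suc k) * f x ^ k * D f x) + f x ^ Suc k * D f x
      = real (Suc (Suc k)) * f x ^ Suc k * D f x" for x
    by (simp add: algebra_simps)
  from conjunct2[OF Suc] derivation_mult[OF f conjunct1[OF Suc]]
  have "AE x in M. D (\<lambda>y. f y * f y ^ Suc k) x = real (Suc (Suc k)) * f x ^ Suc k * D f x"
    by eventually_elim (simp only: id)
  with 1 show ?case by simp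
qed

lemma derivation_polynomial:
  assumes f: "f \<in> A"
  shows "(\<lambda>x. \<Sum>k<n. c k * f x ^ Suc k) \<in> A \<and>
    (AE x in M. D (\<lambda>y. \<Sum>k<n. c k * f y ^ Suc k) x = (\<Sum>k<n. c k * real (Suc k) * f x ^ k) * D f x)"
proof (induction n)
  case 0
  from derivation_scale[OF f, of 0] show ?case using zero_A by simp
next
  case (Suc n)
  have p: "(\<lambda>x. c n * f x ^ Suc n) \<in> A" using derivation_power[OF f, of n] by (intro A_scale) auto
  note q = conjunct1[OF Suc]
  have "AE x in M. D (\<lambda>y. f y ^ Suc n) x = real (Suc n) * f x ^ n * D f x"
    using derivation_power[OF f, of n] by blast
  moreover have "AE x in M. D (\<lambda>y. c n * f y ^ Suc n) x = c n * D (\<lambda>y. f y ^ Suc n) x"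
    using derivation_power[OF f, of n] by (intro derivation_scale) auto
  moreover note derivation_add[OF q p] conjunct2[OF Suc]
  ultimately have "AE x in M. D (\<lambda>y. (\<Sum>k<n. c k * f y ^ Suc k) + c n * f y ^ Suc n) x
     = (\<Sum>k<Suc n. c k * real (Suc k) * f x ^ k) * D f x"
    by eventually_elim (simp add: algebra_simps)
  then show ?case using A_add[OF q p] by simp
qed

text \<open>The Leibniz rule gives only polynomials. For general \<open>\<beta>\<close>, its
  derivative is approximated uniformly on the essential range [-R, R] of f by a polynomial p with
  primitive P. The remainder beta(f) - P(f) has a square root of \<open>\<Gamma>\<close> at most e
  times that of f, and the pointwise bound in the definition of a derivation makes \<open>D\<close>
  of it small.\<close>

lemma derivation_comp:
  assumes f: "f \<in> A" and \<beta>: "\<And>s. (\<beta> has_real_derivative \<beta>' s) (at s)" "continuous_on UNIV \<beta>'" "\<beta> 0 = 0"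
  shows "AE x in M. D (\<lambda>y. \<beta> (f y)) x = \<beta>' (f x) * D f x"
proof -
  obtain R where R: "0 \<le> R" "AE x in M. \<bar>f x\<bar> \<le> R" using A_bounded[OF f] by blast
  obtain h where h: "\<And>g. g \<in> A \<Longrightarrow> AE x in M. \<bar>D g x\<bar> \<le> h x * sqrt (\<Gamma> g g x)"
    using D unfolding derivation_def by blast
  have fV: "f \<in> V" using f A_subset by blast
  have approx: "AE x in M. \<bar>D (\<lambda>y. \<beta> (f y)) x - \<beta>' (f x) * D f x\<bar> \<le> e * (\<bar>h x\<bar> * sqrt (\<Gamma> f f x) + \<bar>D f x\<bar>)"
    if "0 < e" for e
  proof -
    have "continuous_on {-R..R} \<beta>'" using \<beta>(2) continuous_on_subset by blast
    then obtain p where p: "real_polynomial_function p" "\<And>s. s \<in> {-R..R} \<Longrightarrow> \<bar>\<beta>' s - p s\<bar> < e"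
      using Stone_Weierstrass_real_polynomial_function[of "{-R..R}" \<beta>' e] \<open>0 < e\<close> by auto
    then obtain a n where pa: "p = (\<lambda>x. \<Sum>i\<le>n. a i * x ^ i)" unfolding real_polynomial_function_iff_sum by blast
    define c where "c k = a k / real (Suc k)" for k
    define P where "P s = (\<Sum>k<Suc n. c k * s ^ Suc k)" for s
    have P': "(P has_real_derivative p s) (at s)" for s
    proof -
      have "(P has_real_derivative (\<Sum>k<Suc n. c k * (real (Suc k) * s ^ k))) (at s)"
        unfolding P_def by (auto intro!: derivative_eq_intros sum.cong simp del: power_Suc)
      moreover have "(\<Sum>k<Suc n. c k * (real (Suc k) * s ^ k)) = p s"
        unfolding pa lessThan_Suc_atMost by (intro sum.cong) (auto simp: c_def simp del: of_nat_Suc)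
      ultimately show ?thesis by simp
    qed
    have p_cont: "continuous_on S p" for S unfolding pa by (intro continuous_intros)
    \<comment> \<open>The derivative of beta - P is small on [-R, R] only. Freezing it outside gives
      a function with globally small derivative that still agrees with beta - P on the essential
      range of f.\<close>
    define cl where "cl s = max (-R) (min R s)" for s
    have cl_cont: "continuous_on S cl" for S unfolding cl_def by (intro continuous_intros)
    have cl_in: "cl s \<in> {-R..R}" for s using R by (auto simp: cl_def)
    have cl_id: "cl s = s" if "s \<in> {-R..R}" for s using that by (auto simp: cl_def)
    define \<phi>' where "\<phi>' s = \<beta>' (cl s) - p (cl s)" for s
    have \<phi>'_cont: "continuous_on UNIV \<phi>'" unfolding \<phi>'_def
      by (intro continuous_intros continuous_on_compose2[OF \<beta>(2) cl_cont] continuous_on_compose2[OF p_cont[of UNIV] cl_cont]) auto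
    have "\<exists>F. \<forall>x::real. - \<infinity> < ereal x \<longrightarrow> ereal x < \<infinity> \<longrightarrow> (F has_vector_derivative \<phi>' x) (at x)"
      by (rule einterval_antiderivative) (use \<phi>'_cont in \<open>auto simp: continuous_on_eq_continuous_at\<close>)
    then obtain F where F: "\<And>s. (F has_real_derivative \<phi>' s) (at s)"
      by (auto simp: has_real_derivative_iff_has_vector_derivative)
    define \<phi> where "\<phi> s = F s - F 0" for s
    have \<phi>: "(\<phi> has_real_derivative \<phi>' s) (at s)" for s
      unfolding \<phi>_def using F by (auto intro!: derivative_eq_intros)
    have \<phi>_eq: "\<phi> s = \<beta> s - P s" if "s \<in> {-R..R}" for s
    proof -
      have "\<exists>c. \<forall>x\<in>{-R..R}. \<phi> x - (\<beta> x - P x) = c"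
      proof (rule has_field_derivative_zero_constant)
        fix x assume x: "x \<in> {-R..R}"
        have "((\<lambda>x. \<phi> x - (\<beta> x - P x)) has_real_derivative (\<phi>' x - (\<beta>' x - p x))) (at x)"
          by (intro derivative_intros \<phi> \<beta> P')
        then have "((\<lambda>x. \<phi> x - (\<beta> x - P x)) has_real_derivative 0) (at x)"
          using x by (simp add: \<phi>'_def cl_id)
        then show "((\<lambda>x. \<phi> x - (\<beta> x - P x)) has_real_derivative 0) (at x within {-R..R})"
          by (rule has_field_derivative_at_within)
      qed auto
      then obtain c where c: "\<And>x. x \<in> {-R..R} \<Longrightarrow> \<phi> x - (\<beta> x - P x) = c" by blast
      from c[of 0] R \<beta>(3) have "c = 0" by (simp add: \<phi>_def P_def)
      then show ?thesis using c[OF that] by simp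
    qed
    have small: "\<bar>\<phi>' s\<bar> \<le> e" for s using p(2)[OF cl_in[of s]] by (simp add: \<phi>'_def)
    have \<phi>0: "\<phi> 0 = 0" by (simp add: \<phi>_def)
    note G = Gamma_comp_le[OF fV \<phi> \<phi>'_cont \<phi>0 small]
    note poly = derivation_polynomial[OF f, of c "Suc n", folded P_def]
    have rest: "(\<lambda>x. \<beta> (f x) - P (f x)) \<in> A"
      using A_diff[OF A_comp[OF f \<beta>] conjunct1[OF poly]] by (simp add: P_def)
    have "AE x in M. \<phi> (f x) = \<beta> (f x) - P (f x)"
      using R(2) by eventually_elim (auto intro!: \<phi>_eq)
    from Gamma_cong[OF G(1) borel_measurable_A[OF rest] this] G(2)
    have small2: "AE x in M. sqrt (\<Gamma> (\<lambda>x. \<beta> (f x) - P (f x)) (\<lambda>x. \<beta> (f x) - P (f x)) x) \<le> e * sqrt (\<Gamma> f f x)"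
      by eventually_elim simp
    have PA: "(\<lambda>x. P (f x)) \<in> A" using poly by (simp add: P_def)
    have DP: "AE x in M. D (\<lambda>y. P (f y)) x = p (f x) * D f x"
    proof -
      have "(\<Sum>k<Suc n. c k * real (Suc k) * s ^ k) = p s" for s
        unfolding pa lessThan_Suc_atMost by (intro sum.cong) (auto simp: c_def simp del: of_nat_Suc)
      then show ?thesis using poly by (simp add: P_def)
    qed
    have "AE x in M. D (\<lambda>y. (\<beta> (f y) - P (f y)) + P (f y)) x = D (\<lambda>x. \<beta> (f x) - P (f x)) x + D (\<lambda>y. P (f y)) x"
      by (rule derivation_add[OF rest PA])
    with h[OF rest] small2 R(2) DP Gamma_nonneg[OF fV] Gamma_nonneg[OF subsetD[OF A_subset rest]] show ?thesis
    proof eventually_elim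
      case (elim x)
      have "D (\<lambda>y. \<beta> (f y)) x - \<beta>' (f x) * D f x = D (\<lambda>x. \<beta> (f x) - P (f x)) x + (p (f x) - \<beta>' (f x)) * D f x"
        using elim by (simp add: algebra_simps)
      also have "\<bar>\<dots>\<bar> \<le> \<bar>D (\<lambda>x. \<beta> (f x) - P (f x)) x\<bar> + \<bar>p (f x) - \<beta>' (f x)\<bar> * \<bar>D f x\<bar>"
        by (metis abs_mult abs_triangle_ineq)
      also have "\<bar>D (\<lambda>x. \<beta> (f x) - P (f x)) x\<bar> \<le> h x * sqrt (\<Gamma> (\<lambda>x. \<beta> (f x) - P (f x)) (\<lambda>x. \<beta> (f x) - P (f x)) x)"
        using elim by simp
      also have "\<dots> \<le> \<bar>h x\<bar> * \<bar>sqrt (\<Gamma> (\<lambda>x. \<beta> (f x) - P (f x)) (\<lambda>x. \<beta> (f x) - P (f x)) x)\<bar>"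
        by (metis abs_ge_self abs_mult)
      also have "\<dots> \<le> \<bar>h x\<bar> * (e * sqrt (\<Gamma> f f x))"
      proof (intro mult_left_mono)
        show "\<bar>sqrt (\<Gamma> (\<lambda>x. \<beta> (f x) - P (f x)) (\<lambda>x. \<beta> (f x) - P (f x)) x)\<bar> \<le> e * sqrt (\<Gamma> f f x)"
          using elim by simp
      qed auto
      also have "\<bar>p (f x) - \<beta>' (f x)\<bar> * \<bar>D f x\<bar> \<le> e * \<bar>D f x\<bar>"
        using p(2)[of "f x"] elim by (intro mult_right_mono) (auto simp: abs_minus_commute abs_le_iff intro!: less_imp_le)
      finally show ?case by (simp add: algebra_simps)
    qed
  qed
  \<comment> \<open>The null set depends on e, so e runs through a sequence before the limit is
    taken pointwise.\<close>
  have "AE x in M. \<forall>n. \<bar>D (\<lambda>y. \<beta> (f y)) x - \<beta>' (f x) * D f x\<bar> \<le> (1 / real (Suc n)) * (\<bar>h x\<bar> * sqrt (\<Gamma> f f x) + \<bar>D f x\<bar>)"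
    unfolding AE_all_countable by (intro allI approx) auto
  then show ?thesis
  proof eventually_elim
    case (elim x)
    have "(\<lambda>n. (1 / real (Suc n)) * (\<bar>h x\<bar> * sqrt (\<Gamma> f f x) + \<bar>D f x\<bar>)) \<longlonglongrightarrow> 0"
      using tendsto_mult_left_zero[OF LIMSEQ_Suc[OF lim_1_over_n]] by simp
    then have "\<bar>D (\<lambda>y. \<beta> (f y)) x - \<beta>' (f x) * D f x\<bar> \<le> 0"
      using elim by (intro LIMSEQ_le_const) auto
    then show ?case by simp
  qed
qed

end

end

section \<open>The time interval\<close>

lemma space_time [simp]: "space (time_space T) = {0<..<T}"
  by (simp add: space_restrict_space)

lemma finite_measure_time: "finite_measure (time_space T)"
proof (rule finite_measureI)
  show "emeasure (time_space T) (space (time_space T)) \<noteq> \<infinity>"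
    by (cases "0 \<le> T") (auto simp: emeasure_restrict_space)
qed

lemma AE_time: "(AE t in time_space T. P t) \<longleftrightarrow> (AE t in lborel. t \<in> {0<..<T} \<longrightarrow> P t)"
  by (simp add: AE_restrict_space_iff)

lemma borel_measurable_time_continuous:
  fixes f :: "real \<Rightarrow> real"
  assumes "continuous_on {0..T} f"
  shows "f \<in> borel_measurable (time_space T)"
proof -
  have "continuous_on {0<..<T} f" using assms by (rule continuous_on_subset) auto
  then have "f \<in> borel_measurable (restrict_space borel {0<..<T})"
    by (rule borel_measurable_continuous_on_restrict)
  then show ?thesis
    by (subst measurable_cong_sets[of _ "restrict_space borel {0<..<T}" borel borel])
      (auto simp: sets_restrict_space)
qed

lemma time_continuous_bounded:
  fixes f :: "real \<Rightarrow> real"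
  assumes "continuous_on {0..T} f"
  obtains B where "0 \<le> B" "\<And>t. t \<in> {0..T} \<Longrightarrow> \<bar>f t\<bar> \<le> B"
proof -
  have "bounded (f ` {0..T})" using assms by (intro compact_imp_bounded compact_continuous_image) auto
  then obtain B where B: "\<forall>x\<in>f ` {0..T}. norm x \<le> B" unfolding bounded_iff by blast
  show ?thesis
  proof (rule that[of "max 0 B"])
    show "\<bar>f t\<bar> \<le> max 0 B" if "t \<in> {0..T}" for t using B that by (simp add: max.coboundedI2)
  qed simp
qed

lemma time_integrable_bounded:
  fixes f :: "real \<Rightarrow> real"
  assumes "f \<in> borel_measurable (time_space T)" "\<And>t. t \<in> {0<..<T} \<Longrightarrow> \<bar>f t\<bar> \<le> B"
  shows "integrable (time_space T) f"
proof -
  interpret finite_measure "time_space T" by (rule finite_measure_time)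
  show ?thesis using assms by (intro integrable_const_bound[where B=B]) auto
qed

lemma integral_time: "integral\<^sup>L (time_space T) f = (LINT t:{0<..<T}|lborel. f t)"
  for f :: "real \<Rightarrow> real"
  by (simp add: integral_restrict_space set_lebesgue_integral_def)

lemma time_FTC:
  fixes f :: "real \<Rightarrow> real"
  assumes ab: "0 \<le> a" "a \<le> b" "b \<le> T"
    and F: "\<And>s. s \<in> {0..T} \<Longrightarrow> (F has_real_derivative f s) (at s within {0..T})"
    and f: "continuous_on {0..T} f"
  shows "(\<integral>s. indicator {a<..<b} s * f s \<partial>time_space T) = F b - F a"
proof -
  have sub: "{a..b} \<subseteq> {0..T}" using ab by auto
  have fab: "continuous_on {a..b} f" using f sub by (rule continuous_on_subset)
  have "(\<integral>s. indicator {a<..<b} s * f s \<partial>time_space T)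
      = (\<integral>s. indicator {0<..<T} s *\<^sub>R (indicator {a<..<b} s * f s) \<partial>lborel)"
    by (simp add: integral_restrict_space)
  also have "\<dots> = (\<integral>s. indicator {a<..<b} s *\<^sub>R f s \<partial>lborel)"
    using ab by (intro Bochner_Integration.integral_cong) (auto simp: indicator_def)
  also have "\<dots> = (\<integral>s. indicator {a..b} s *\<^sub>R f s \<partial>lborel)"
  proof (rule integral_cong_AE)
    show "(\<lambda>s. indicator {a<..<b} s *\<^sub>R f s) \<in> borel_measurable lborel"
      using borel_measurable_continuous_on_indicator[of "{a<..<b}" f] continuous_on_subset[OF fab, of "{a<..<b}"]
      by (simp add: subset_iff)
    show "(\<lambda>s. indicator {a..b} s *\<^sub>R f s) \<in> borel_measurable lborel"
      using borel_measurable_continuous_on_indicator[of "{a..b}" f] fab by auto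
    show "AE s in lborel. indicator {a<..<b} s *\<^sub>R f s = indicator {a..b} s *\<^sub>R f s"
      using AE_lborel_singleton[of a] AE_lborel_singleton[of b]
      by eventually_elim (auto simp: indicator_def)
  qed
  also have "\<dots> = F b - F a"
  proof (rule integral_FTC_atLeastAtMost[OF ab(2) _ fab])
    fix x assume "a \<le> x" "x \<le> b"
    then have "(F has_real_derivative f x) (at x within {a..b})"
      using F[of x] ab sub by (intro DERIV_subset[OF _ sub]) auto
    then show "(F has_vector_derivative f x) (at x within {a..b})"
      by (simp add: has_real_derivative_iff_has_vector_derivative)
  qed
  finally show ?thesis .
qed

text \<open>Supplies the time factors of test functions: any continuous weight is minus the
  derivative of a function that vanishes at the final time.\<close>

lemma time_antiderivative:
  fixes f :: "real \<Rightarrow> real"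
  assumes "continuous_on {0..T} f" "0 \<le> T"
  obtains F where "\<And>s. s \<in> {0..T} \<Longrightarrow> (F has_real_derivative - f s) (at s within {0..T})" "F T = 0"
proof
  let ?F = "\<lambda>s. integral {0..T} f - integral {0..s} f"
  show "(?F has_real_derivative - f s) (at s within {0..T})" if "s \<in> {0..T}" for s
    using integral_has_real_derivative[OF assms(1) that]
    by (auto intro!: derivative_eq_intros)
qed auto

text \<open>Continuous weights suffice because the indicator of {Q > 0} is an almost everywhere
  limit of continuous functions. Clamped to [0, 1], these show in the limit that the positive part
  of Q has integral at most 0.\<close>

lemma time_AE_nonpos:
  fixes Q :: "real \<Rightarrow> real"
  assumes Q: "integrable (time_space T) Q"
    and test: "\<And>\<xi>. continuous_on {0..T} \<xi> \<Longrightarrow> (\<And>s. 0 \<le> \<xi> s) \<Longrightarrow> (\<integral>t. \<xi> t * Q t \<partial>time_space T) \<le> 0"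
  shows "AE t in time_space T. Q t \<le> 0"
proof -
  have Qm[measurable]: "Q \<in> borel_measurable (time_space T)" using Q by auto
  define E where "E = {t \<in> space (time_space T). 0 < Q t}"
  have "E \<in> sets (time_space T)" unfolding E_def by measurable
  then have E: "E \<in> sets borel" by (subst (asm) sets_restrict_space_iff) auto
  have "(indicator E :: real \<Rightarrow> real) \<in> borel_measurable lebesgue"
    using E by (intro measurable_completion) auto
  from lebesgue_measurable_imp_measurable_on_real[OF this, of UNIV]
  obtain N and g :: "nat \<Rightarrow> real \<Rightarrow> real" where N: "negligible N" and g: "\<And>n. continuous_on UNIV (g n)"
    "\<And>t. t \<notin> N \<Longrightarrow> (\<lambda>n. g n t) \<longlonglongrightarrow> indicator E t"
    unfolding measurable_on_def by auto
  have "AE t in lebesgue. t \<notin> N"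
    using N by (intro AE_not_in) (simp add: negligible_iff_null_sets)
  then have "AE t in lborel. t \<notin> N" by (simp add: AE_completion_iff)
  then have AEN: "AE t in time_space T. t \<notin> N" unfolding AE_time by eventually_elim simp
  define \<xi> where "\<xi> n t = min 1 (max 0 (g n t))" for n t
  have \<xi>c: "continuous_on S (\<xi> n)" for n S
    unfolding \<xi>_def by (intro continuous_intros continuous_on_subset[OF g(1)]) auto
  have \<xi>m: "\<xi> n \<in> borel_measurable (time_space T)" for n by (intro borel_measurable_time_continuous \<xi>c)
  have "(\<lambda>n. \<integral>t. \<xi> n t * Q t \<partial>time_space T) \<longlonglongrightarrow> (\<integral>t. max 0 (Q t) \<partial>time_space T)"
  proof (rule integral_dominated_convergence[where w="\<lambda>t. \<bar>Q t\<bar>"])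
    show "AE t in time_space T. (\<lambda>n. \<xi> n t * Q t) \<longlonglongrightarrow> max 0 (Q t)"
      using AEN AE_space
    proof eventually_elim
      case (elim t)
      have "(\<lambda>n. \<xi> n t) \<longlonglongrightarrow> min 1 (max 0 (indicator E t))"
        unfolding \<xi>_def using g(2)[OF elim(1)] by (intro tendsto_intros)
      then have "(\<lambda>n. \<xi> n t) \<longlonglongrightarrow> indicator E t" by (auto simp: indicator_def split: if_splits)
      then have "(\<lambda>n. \<xi> n t * Q t) \<longlonglongrightarrow> indicator E t * Q t" by (intro tendsto_intros)
      moreover have "indicator E t * Q t = max 0 (Q t)" using elim by (auto simp: E_def indicator_def)
      ultimately show ?case by simp
    qed
    show "AE t in time_space T. norm (\<xi> n t * Q t) \<le> \<bar>Q t\<bar>" for n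
      by (rule AE_I2) (auto simp: \<xi>_def abs_mult intro!: mult_left_le_one_le)
  qed (use Q \<xi>m in auto)
  moreover have "(\<integral>t. \<xi> n t * Q t \<partial>time_space T) \<le> 0" for n
    by (intro test \<xi>c) (auto simp: \<xi>_def)
  ultimately have "(\<integral>t. max 0 (Q t) \<partial>time_space T) \<le> 0"
    by (intro LIMSEQ_le_const2) auto
  moreover have "(\<integral>t. max 0 (Q t) \<partial>time_space T) \<ge> 0" by (intro integral_nonneg_AE) auto
  ultimately have "(\<integral>t. max 0 (Q t) \<partial>time_space T) = 0" by simp
  then have "AE t in time_space T. max 0 (Q t) = 0"
    using Q by (subst (asm) integral_nonneg_eq_0_iff_AE) auto
  then show ?thesis by eventually_elim auto
qed

lemma pair_sigma_finite_time: "sigma_finite_measure M \<Longrightarrow> pair_sigma_finite (time_space T) M"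
  using finite_measure.axioms(1)[OF finite_measure_time] by (intro pair_sigma_finite.intro)

lemma time_pair_integrable_fst:
  fixes k :: "real \<Rightarrow> real"
  assumes k: "integrable (time_space T) k"
  shows "integrable (time_space T \<Otimes>\<^sub>M time_space T) (\<lambda>(s, t). k s)"
proof -
  interpret finite_measure "time_space T" by (rule finite_measure_time)
  interpret pair_sigma_finite "time_space T" "time_space T" 
    by (rule pair_sigma_finite_time) (rule finite_measure.axioms(1)[OF finite_measure_time])
  have [measurable]: "k \<in> borel_measurable (time_space T)" using k by auto
  show ?thesis
  proof (rule Fubini_integrable)
    show "integrable (time_space T) (\<lambda>x. \<integral>y. norm (case (x, y) of (s, t) \<Rightarrow> k s) \<partial>time_space T)"
      using k by simp
  qed auto
qed

text \<open>Since k is merely integrable, integration by parts is done as Fubini on the triangle s <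
  t: for fixed s the integral of psi' over (s, T) is psi(T) - psi(s).\<close>

lemma time_by_parts:
  fixes k :: "real \<Rightarrow> real"
  assumes k: "integrable (time_space T) k"
    and \<psi>: "\<And>s. s \<in> {0..T} \<Longrightarrow> (\<psi> has_real_derivative \<psi>' s) (at s within {0..T})" "continuous_on {0..T} \<psi>'"
  shows "(\<integral>t. \<psi>' t * (\<integral>s. indicator {..<t} s * k s \<partial>time_space T) \<partial>time_space T)
    = (\<integral>s. (\<psi> T - \<psi> s) * k s \<partial>time_space T)"
proof -
  interpret pair_sigma_finite "time_space T" "time_space T" 
    by (rule pair_sigma_finite_time) (rule finite_measure.axioms(1)[OF finite_measure_time])
  have [measurable]: "k \<in> borel_measurable (time_space T)" using k by auto
  have [measurable]: "\<psi>' \<in> borel_measurable (time_space T)" by (rule borel_measurable_time_continuous[OF \<psi>(2)])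
  have id[measurable]: "(\<lambda>t. t) \<in> borel_measurable (time_space T)"
    by (rule borel_measurable_time_continuous) (intro continuous_intros)
  have lt[measurable]: "Measurable.pred (time_space T \<Otimes>\<^sub>M time_space T) (\<lambda>p. fst p < snd p)"
    using measurable_compose[OF measurable_fst id] measurable_compose[OF measurable_snd id]
    by (intro borel_measurable_pred_less) auto
  obtain B where B: "\<And>t. t \<in> {0..T} \<Longrightarrow> \<bar>\<psi>' t\<bar> \<le> B" using time_continuous_bounded[OF \<psi>(2)] by blast
  have ind: "(indicator {..<t} s :: real) = (if s < t then 1 else 0)" for s t :: real
    by (simp add: indicator_def)
  have "(\<integral>t. \<psi>' t * (\<integral>s. indicator {..<t} s * k s \<partial>time_space T) \<partial>time_space T)
      = (\<integral>t. (\<integral>s. \<psi>' t * ((if s < t then 1 else 0) * k s) \<partial>time_space T) \<partial>time_space T)"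
    unfolding ind by (simp only: integral_mult_right_zero)
  also have "\<dots> = (\<integral>s. (\<integral>t. \<psi>' t * ((if s < t then 1 else 0) * k s) \<partial>time_space T) \<partial>time_space T)"
  proof (rule Fubini_integral)
    show "integrable (time_space T \<Otimes>\<^sub>M time_space T) (\<lambda>(s, t). \<psi>' t * ((if s < t then 1 else 0) * k s))"
    proof (rule Bochner_Integration.integrable_bound[OF integrable_mult_right[of B, OF time_pair_integrable_fst[OF k]]])
      show "(\<lambda>(s, t). \<psi>' t * ((if s < t then 1 else 0) * k s)) \<in> borel_measurable (time_space T \<Otimes>\<^sub>M time_space T)"
        unfolding split_beta' by measurable
      show "AE x in time_space T \<Otimes>\<^sub>M time_space T. norm (case x of (s, t) \<Rightarrow> \<psi>' t * ((if s < t then 1 else 0) * k s))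
         \<le> norm (B * (case x of (s, t) \<Rightarrow> k s))"
      proof (rule AE_I2)
        fix x assume "x \<in> space (time_space T \<Otimes>\<^sub>M time_space T)"
        then obtain s t where x: "x = (s, t)" "0 < t" "t < T" by (auto simp: space_pair_measure)
        then have "\<bar>\<psi>' t\<bar> \<le> \<bar>B\<bar>" using B[of t] by auto
        then have "\<bar>\<psi>' t\<bar> * \<bar>k s\<bar> \<le> \<bar>B\<bar> * \<bar>k s\<bar>" by (intro mult_right_mono) auto
        then show "norm (case x of (s, t) \<Rightarrow> \<psi>' t * ((if s < t then 1 else 0) * k s)) \<le> norm (B * (case x of (s, t) \<Rightarrow> k s))"
          by (simp add: x abs_mult)
      qed
    qed
  qed
  also have "\<dots> = (\<integral>s. (\<psi> T - \<psi> s) * k s \<partial>time_space T)"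
  proof (rule Bochner_Integration.integral_cong[OF refl])
    fix s assume s: "s \<in> space (time_space T)"
    have "(\<integral>t. \<psi>' t * ((if s < t then 1 else 0) * k s) \<partial>time_space T)
        = (\<integral>t. (indicator {s<..<T} t * \<psi>' t) * k s \<partial>time_space T)"
      by (intro Bochner_Integration.integral_cong) (auto simp: indicator_def)
    also have "\<dots> = (\<psi> T - \<psi> s) * k s"
      using s time_FTC[OF _ _ _ \<psi>, of s T] by simp
    finally show "(\<integral>t. \<psi>' t * ((if s < t then 1 else 0) * k s) \<partial>time_space T) = (\<psi> T - \<psi> s) * k s" .
  qed
  finally show ?thesis .
qed

text \<open>As the end point tends to a, the indicators converge at every s except possibly s = a, a
  null set, and |k| dominates.\<close>

lemma time_indefinite_integral_continuous:
  fixes k :: "real \<Rightarrow> real"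
  assumes k: "integrable (time_space T) k"
  shows "continuous_on S (\<lambda>t. \<integral>s. indicator {..<t} s * k s \<partial>time_space T)"
proof (rule continuous_on_sequentiallyI)
  fix u :: "nat \<Rightarrow> real" and a assume u: "u \<longlonglongrightarrow> a"
  have [measurable]: "k \<in> borel_measurable (time_space T)" using k by auto
  have ind: "(indicator {..<c} :: real \<Rightarrow> real) \<in> borel_measurable (time_space T)" for c
    by (intro measurable_restrict_space1) auto
  have AEa: "AE s in time_space T. s \<noteq> a"
    unfolding AE_time using AE_lborel_singleton[of a] by eventually_elim simp
  show "(\<lambda>n. \<integral>s. indicator {..<u n} s * k s \<partial>time_space T) \<longlonglongrightarrow> (\<integral>s. indicator {..<a} s * k s \<partial>time_space T)"
  proof (rule integral_dominated_convergence[where w="\<lambda>s. \<bar>k s\<bar>"])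
    show "AE s in time_space T. (\<lambda>n. indicator {..<u n} s * k s) \<longlonglongrightarrow> indicator {..<a} s * k s"
      using AEa
    proof eventually_elim
      case (elim s)
      show ?case
      proof (rule tendsto_eventually)
        show "\<forall>\<^sub>F n in sequentially. indicator {..<u n} s * k s = indicator {..<a} s * k s"
        proof (cases "s < a")
          case True
          from order_tendstoD(1)[OF u True] show ?thesis by eventually_elim (use True in auto)
        next
          case False
          with elim have "a < s" by simp
          from order_tendstoD(2)[OF u this] show ?thesis by eventually_elim (use \<open>a < s\<close> in auto)
        qed
      qed
    qed
    show "AE s in time_space T. norm (indicator {..<u n} s * k s) \<le> \<bar>k s\<bar>" for n
      by (rule AE_I2) (auto simp: indicator_def)
  qed (use k ind in auto)
qed

section \<open>A Gronwall inequality with integrable coefficient\<close>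

text \<open>The integrable coefficient is cut at a height n: the part exceeding n has integral below
  1/4, and the rest contributes at most n / kappa, again at most 1/4 for kappa = 4 * (n +
  1).\<close>

lemma exp_kernel_small:
  fixes d :: "real \<Rightarrow> real"
  assumes d: "integrable (time_space T) d" "\<And>s. 0 \<le> d s"
  shows "\<exists>\<kappa>>0. \<forall>t\<in>{0..T}. (\<integral>s. indicator {t<..} s * (d s * exp (- \<kappa> * (s - t))) \<partial>time_space T) \<le> 1 / 2"
proof -
  have [measurable]: "d \<in> borel_measurable (time_space T)" using d by auto
  have "(\<lambda>n. \<integral>s. (if real n < d s then d s else 0) \<partial>time_space T) \<longlonglongrightarrow> (\<integral>s. 0 \<partial>time_space T)"
  proof (rule integral_dominated_convergence[where w=d])
    show "AE s in time_space T. (\<lambda>n. if real n < d s then d s else 0) \<longlonglongrightarrow> 0"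
    proof (rule AE_I2, rule tendsto_eventually)
      fix s
      show "\<forall>\<^sub>F n in sequentially. (if real n < d s then d s else 0) = 0"
        using eventually_ge_at_top[of "nat \<lceil>d s\<rceil>"] by eventually_elim (simp add: nat_le_iff ceiling_le_iff)
    qed
  qed (use d in auto)
  then have "\<forall>\<^sub>F n in sequentially. (\<integral>s. (if real n < d s then d s else 0) \<partial>time_space T) < 1 / 4"
    by (intro order_tendstoD(2)) auto
  then obtain n where n: "(\<integral>s. (if real n < d s then d s else 0) \<partial>time_space T) < 1 / 4"
    by (auto simp: eventually_sequentially)
  define \<kappa> where "\<kappa> = 4 * (real n + 1)"
  have \<kappa>: "0 < \<kappa>" by (simp add: \<kappa>_def)
  have "(\<integral>s. indicator {t<..} s * (d s * exp (- \<kappa> * (s - t))) \<partial>time_space T) \<le> 1 / 2" if t: "t \<in> {0..T}" for t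
  proof -
    have cont: "continuous_on {0..T} (\<lambda>s. exp (- \<kappa> * (s - t)))" by (intro continuous_intros)
    have [measurable]: "(\<lambda>s. exp (- \<kappa> * (s - t))) \<in> borel_measurable (time_space T)"
      by (rule borel_measurable_time_continuous[OF cont])
    have ind[measurable]: "(indicator {t<..} :: real \<Rightarrow> real) \<in> borel_measurable (time_space T)"
      "(indicator {t<..<T} :: real \<Rightarrow> real) \<in> borel_measurable (time_space T)"
      by (intro measurable_restrict_space1, simp)+
    have i1: "integrable (time_space T) (\<lambda>s. indicator {t<..} s * (d s * exp (- \<kappa> * (s - t))))"
    proof (rule Bochner_Integration.integrable_bound[OF d(1)])
      show "AE s in time_space T. norm (indicator {t<..} s * (d s * exp (- \<kappa> * (s - t)))) \<le> norm (d s)"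
        using \<kappa> d(2) by (intro AE_I2) (auto simp: indicator_def abs_mult intro!: mult_right_le_one_le)
    qed measurable
    have i2: "integrable (time_space T) (\<lambda>s. if real n < d s then d s else 0)"
      by (rule Bochner_Integration.integrable_bound[OF d(1)]) auto
    have i3: "integrable (time_space T) (\<lambda>s. indicator {t<..<T} s * exp (- \<kappa> * (s - t)))"
    proof (rule time_integrable_bounded[where B=1])
      show "\<bar>indicator {t<..<T} s * exp (- \<kappa> * (s - t))\<bar> \<le> 1" for s
        using \<kappa> by (auto simp: indicator_def)
    qed measurable
    have "(\<integral>s. indicator {t<..<T} s * exp (- \<kappa> * (s - t)) \<partial>time_space T)
        = (- exp (- \<kappa> * (T - t)) / \<kappa>) - (- exp (- \<kappa> * (t - t)) / \<kappa>)"
      using t \<kappa> by (intro time_FTC[where F="\<lambda>s. - exp (- \<kappa> * (s - t)) / \<kappa>"] cont)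
        (auto intro!: derivative_eq_intros)
    also have "\<dots> \<le> 1 / \<kappa>" using \<kappa> by (simp add: divide_right_mono)
    finally have e: "(\<integral>s. indicator {t<..<T} s * exp (- \<kappa> * (s - t)) \<partial>time_space T) \<le> 1 / \<kappa>" .
    have "(\<integral>s. indicator {t<..} s * (d s * exp (- \<kappa> * (s - t))) \<partial>time_space T)
       \<le> (\<integral>s. (if real n < d s then d s else 0) + real n * (indicator {t<..<T} s * exp (- \<kappa> * (s - t))) \<partial>time_space T)"
    proof (intro integral_mono i1 Bochner_Integration.integrable_add i2 integrable_mult_right i3)
      fix s assume s: "s \<in> space (time_space T)"
      show "indicator {t<..} s * (d s * exp (- \<kappa> * (s - t)))
         \<le> (if real n < d s then d s else 0) + real n * (indicator {t<..<T} s * exp (- \<kappa> * (s - t)))"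
      proof (cases "t < s")
        case True
        then have e1: "exp (- \<kappa> * (s - t)) \<le> 1" using \<kappa> by simp
        show ?thesis
        proof (cases "real n < d s")
          case True
          have "d s * exp (- \<kappa> * (s - t)) \<le> d s" using e1 d(2)[of s] by (intro mult_right_le_one_le) auto
          moreover have "0 \<le> real n * exp (- \<kappa> * (s - t))" by simp
          ultimately have "d s * exp (- \<kappa> * (s - t)) \<le> d s + real n * exp (- \<kappa> * (s - t))" by linarith
          then show ?thesis using True \<open>t < s\<close> s by simp
        next
          case False
          then show ?thesis using \<open>t < s\<close> s by (auto intro!: mult_right_mono)
        qed
      qed (use d(2)[of s] in auto)
    qed
    also have "\<dots> = (\<integral>s. (if real n < d s then d s else 0) \<partial>time_space T)
        + real n * (\<integral>s. indicator {t<..<T} s * exp (- \<kappa> * (s - t)) \<partial>time_space T)"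
      using i2 i3 by (subst Bochner_Integration.integral_add) auto
    also have "\<dots> \<le> 1 / 4 + real n * (1 / \<kappa>)"
      using n e by (intro add_mono mult_left_mono) auto
    also have "\<dots> \<le> 1 / 2" by (simp add: \<kappa>_def field_simps)
    finally show ?thesis .
  qed
  with \<kappa> show ?thesis by blast
qed

text \<open>In the supremum \<open>Y\<close> of y weighted by exp(- kappa (T - t)), the choice of
  kappa makes the integral operator with coefficient d a contraction with factor 1/2, so Y <=
  (integral of H) + Y / 2 can be absorbed. The bound K makes \<open>Y\<close> finite but does not
  enter the constant.\<close>

lemma backward_gronwall:
  fixes d H y :: "real \<Rightarrow> real"
  assumes T: "0 < T" and d: "integrable (time_space T) d" "\<And>s. 0 \<le> d s"
    and \<kappa>: "0 < \<kappa>" "\<And>t. t \<in> {0..T} \<Longrightarrow> (\<integral>s. indicator {t<..} s * (d s * exp (- \<kappa> * (s - t))) \<partial>time_space T) \<le> 1 / 2"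
    and H: "integrable (time_space T) H" "\<And>s. 0 \<le> H s"
    and y: "y \<in> borel_measurable (time_space T)" "\<And>t. t \<in> {0..T} \<Longrightarrow> 0 \<le> y t" "\<And>t. t \<in> {0..T} \<Longrightarrow> y t \<le> K"
    and ineq: "\<And>t. t \<in> {0..T} \<Longrightarrow> y t \<le> (\<integral>s. indicator {t<..} s * (H s + d s * y s) \<partial>time_space T)"
  shows "y 0 \<le> 2 * exp (\<kappa> * T) * (\<integral>s. H s \<partial>time_space T)"
proof -
  define Y where "Y = (SUP t\<in>{0..T}. exp (- \<kappa> * (T - t)) * y t)"
  have bdd: "bdd_above ((\<lambda>t. exp (- \<kappa> * (T - t)) * y t) ` {0..T})"
  proof (rule bdd_aboveI2)
    fix t assume t: "t \<in> {0..T}"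
    have "exp (- \<kappa> * (T - t)) * y t \<le> 1 * y t" using t \<kappa>(1) y(2)[OF t] by (intro mult_right_mono) auto
    then show "exp (- \<kappa> * (T - t)) * y t \<le> K" using y(3)[OF t] by simp
  qed
  have Y: "exp (- \<kappa> * (T - t)) * y t \<le> Y" if "t \<in> {0..T}" for t
    unfolding Y_def using bdd that by (intro cSUP_upper) auto
  have y_le: "y t \<le> exp (\<kappa> * (T - t)) * Y" if "t \<in> {0..T}" for t
  proof -
    have "exp (\<kappa> * (T - t)) * exp (- \<kappa> * (T - t)) = 1" by (simp add: exp_add[symmetric])
    then have "y t = exp (\<kappa> * (T - t)) * (exp (- \<kappa> * (T - t)) * y t)" by (simp only: mult.assoc[symmetric])
    also have "\<dots> \<le> exp (\<kappa> * (T - t)) * Y" using Y[OF that] by (intro mult_left_mono) auto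
    finally show ?thesis .
  qed
  have Y0: "0 \<le> Y" using Y[of 0] y(2)[of 0] T by (smt (verit) atLeastAtMost_iff exp_ge_zero mult_nonneg_nonneg)
  have [measurable]: "d \<in> borel_measurable (time_space T)" "H \<in> borel_measurable (time_space T)" using d H by auto
  have step: "exp (- \<kappa> * (T - t)) * y t \<le> (\<integral>s. H s \<partial>time_space T) + Y / 2" if t: "t \<in> {0..T}" for t
  proof -
    have [measurable]: "(indicator {t<..} :: real \<Rightarrow> real) \<in> borel_measurable (time_space T)"
      by (intro measurable_restrict_space1) simp
    have "continuous_on {0..T} (\<lambda>s. exp (- \<kappa> * (s - t)))" by (intro continuous_intros)
    then have [measurable]: "(\<lambda>s. exp (- \<kappa> * (s - t))) \<in> borel_measurable (time_space T)"
      by (rule borel_measurable_time_continuous)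
    have i1: "integrable (time_space T) (\<lambda>s. indicator {t<..} s * (d s * exp (- \<kappa> * (s - t))))"
    proof (rule Bochner_Integration.integrable_bound[OF d(1)])
      show "AE s in time_space T. norm (indicator {t<..} s * (d s * exp (- \<kappa> * (s - t)))) \<le> norm (d s)"
        using \<kappa> d(2) by (intro AE_I2) (auto simp: indicator_def abs_mult intro!: mult_right_le_one_le)
    qed measurable
    have i2: "integrable (time_space T) (\<lambda>s. indicator {t<..} s * (H s + d s * y s))"
    proof (rule Bochner_Integration.integrable_bound[OF Bochner_Integration.integrable_add[OF H(1) integrable_mult_right[OF d(1), of K]]])
      show "AE s in time_space T. norm (indicator {t<..} s * (H s + d s * y s)) \<le> norm (H s + K * d s)"
      proof (rule AE_I2)
        fix s assume "s \<in> space (time_space T)"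
        then have ys: "0 \<le> y s" "y s \<le> K" using y by auto
        have "0 \<le> d s * y s" "d s * y s \<le> K * d s"
          using ys d(2)[of s] by (auto simp: mult.commute[of K] intro!: mult_left_mono)
        then show "norm (indicator {t<..} s * (H s + d s * y s)) \<le> norm (H s + K * d s)"
          using H(2)[of s] by (auto simp: indicator_def)
      qed
    qed (use y(1) in measurable)
    have "y t \<le> (\<integral>s. indicator {t<..} s * (H s + d s * y s) \<partial>time_space T)" by (rule ineq[OF t])
    also have "\<dots> \<le> (\<integral>s. H s + (exp (\<kappa> * (T - t)) * Y) * (indicator {t<..} s * (d s * exp (- \<kappa> * (s - t)))) \<partial>time_space T)"
    proof (intro integral_mono i2 Bochner_Integration.integrable_add H integrable_mult_right i1)
      fix s assume s: "s \<in> space (time_space T)"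
      show "indicator {t<..} s * (H s + d s * y s)
        \<le> H s + (exp (\<kappa> * (T - t)) * Y) * (indicator {t<..} s * (d s * exp (- \<kappa> * (s - t))))"
      proof (cases "t < s")
        case True
        have "d s * y s \<le> d s * (exp (\<kappa> * (T - s)) * Y)"
          using y_le[of s] s d(2)[of s] by (intro mult_left_mono) auto
        also have "exp (\<kappa> * (T - s)) = exp (\<kappa> * (T - t)) * exp (- \<kappa> * (s - t))"
          by (simp add: exp_add[symmetric] algebra_simps)
        finally show ?thesis using True by (simp add: mult_ac)
      qed (use H(2)[of s] in simp)
    qed
    also have "\<dots> = (\<integral>s. H s \<partial>time_space T) + (exp (\<kappa> * (T - t)) * Y) *
        (\<integral>s. indicator {t<..} s * (d s * exp (- \<kappa> * (s - t))) \<partial>time_space T)"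
      using i1 H by simp
    also have "\<dots> \<le> (\<integral>s. H s \<partial>time_space T) + (exp (\<kappa> * (T - t)) * Y) * (1 / 2)"
      using \<kappa>(2)[OF t] Y0 by (intro add_left_mono mult_left_mono) auto
    finally have "exp (- \<kappa> * (T - t)) * y t
      \<le> exp (- \<kappa> * (T - t)) * ((\<integral>s. H s \<partial>time_space T) + (exp (\<kappa> * (T - t)) * Y) * (1 / 2))"
      by (intro mult_left_mono) auto
    also have "\<dots> = exp (- \<kappa> * (T - t)) * (\<integral>s. H s \<partial>time_space T)
        + (exp (- \<kappa> * (T - t)) * exp (\<kappa> * (T - t))) * Y / 2"
      by (simp add: algebra_simps)
    also have "exp (- \<kappa> * (T - t)) * exp (\<kappa> * (T - t)) = 1" by (simp add: exp_add[symmetric])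
    also have "exp (- \<kappa> * (T - t)) * (\<integral>s. H s \<partial>time_space T) + 1 * Y / 2 \<le> 1 * (\<integral>s. H s \<partial>time_space T) + 1 * Y / 2"
      using t \<kappa>(1) H(2) by (intro add_right_mono mult_right_mono integral_nonneg_AE) auto
    finally show ?thesis by simp
  qed
  have "Y \<le> (\<integral>s. H s \<partial>time_space T) + Y / 2"
    unfolding Y_def using T step by (intro cSUP_least) (auto simp: Y_def)
  then have "Y \<le> 2 * (\<integral>s. H s \<partial>time_space T)" by simp
  then have "exp (\<kappa> * (T - 0)) * Y \<le> exp (\<kappa> * T) * (2 * (\<integral>s. H s \<partial>time_space T))"
    by (intro mult_mono) (use Y0 in auto)
  from order_trans[OF y_le[of 0] this] T show ?thesis by (simp add: mult_ac)
qed

section \<open>Pairing with time-dependent sums of Lebesgue functions\<close>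

text \<open>The infimum defining the norm is attained: the exceptional sets for the bounds enlarged
  by 1 / (n + 1) are countably many.\<close>

lemma Lp_norm_infinity_nonneg: "f \<in> Lp M \<infinity> \<Longrightarrow> 0 \<le> Lp_norm M \<infinity> f"
  and AE_Lp_norm_infinity: "f \<in> Lp M \<infinity> \<Longrightarrow> AE x in M. \<bar>f x\<bar> \<le> Lp_norm M \<infinity> f"
proof -
  assume f: "f \<in> Lp M \<infinity>"
  let ?S = "{C. 0 \<le> C \<and> (AE x in M. \<bar>f x\<bar> \<le> C)}"
  obtain C where "AE x in M. \<bar>f x\<bar> \<le> C" using f by (auto simp: Lp_def)
  then have "AE x in M. \<bar>f x\<bar> \<le> max 0 C" by eventually_elim auto
  then have ne: "?S \<noteq> {}" by (auto intro!: exI[of _ "max 0 C"])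
  have bdd: "bdd_below ?S" by (auto intro!: bdd_belowI[of _ 0])
  have eq: "Lp_norm M \<infinity> f = Inf ?S" by (simp add: Lp_norm_def)
  show "0 \<le> Lp_norm M \<infinity> f" unfolding eq using ne by (intro cInf_greatest) auto
  have "AE x in M. \<forall>n. \<bar>f x\<bar> \<le> Lp_norm M \<infinity> f + 1 / real (Suc n)"
    unfolding AE_all_countable
  proof
    fix n
    have "Inf ?S < Lp_norm M \<infinity> f + 1 / real (Suc n)" unfolding eq by simp
    then obtain c where "c \<in> ?S" "c < Lp_norm M \<infinity> f + 1 / real (Suc n)"
      using cInf_lessD[OF ne] by blast
    then show "AE x in M. \<bar>f x\<bar> \<le> Lp_norm M \<infinity> f + 1 / real (Suc n)"
      by (auto elim: eventually_mono)
  qed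
  then show "AE x in M. \<bar>f x\<bar> \<le> Lp_norm M \<infinity> f"
  proof eventually_elim
    case (elim x)
    have "(\<lambda>n. Lp_norm M \<infinity> f + 1 / real (Suc n)) \<longlonglongrightarrow> Lp_norm M \<infinity> f + 0"
      by (intro tendsto_intros LIMSEQ_Suc[OF lim_1_over_n])
    then show ?case using elim by (intro LIMSEQ_le_const[where X="\<lambda>n. Lp_norm M \<infinity> f + 1 / real (Suc n)"]) auto
  qed
qed

lemma Lp_two_iff: "f \<in> Lp M 2 \<longleftrightarrow> f \<in> borel_measurable M \<and> integrable M (\<lambda>x. (f x)\<^sup>2)"
proof -
  have "ennreal (\<bar>f x\<bar> powr 2) = ennreal (norm ((f x)\<^sup>2))" for x by simp
  then show ?thesis by (auto simp: Lp_def integrable_iff_bounded)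
qed

lemma Lp_norm_two: "Lp_norm M 2 f = sqrt (\<integral>x. (f x)\<^sup>2 \<partial>M)"
  by (simp add: Lp_norm_def powr_half_sqrt)

lemma ennreal_power2_le_imp_le:
  assumes "X\<^sup>2 \<le> ennreal (c\<^sup>2)" "0 \<le> c"
  shows "X \<le> ennreal c"
proof (cases X)
  case (real r)
  with assms have "r\<^sup>2 \<le> c\<^sup>2" by (simp add: ennreal_power)
  then show ?thesis using real assms(2) power2_le_imp_le by (auto intro!: ennreal_leI)
next
  case top
  with assms show ?thesis by (simp add: power2_eq_square ennreal_mult_top top_unique)
qed

text \<open>A splitting f = g + h whose cost is within 1 of the infimum is paired by Cauchy-Schwarz
  in L^2 and by L^infinity against L^1; this is the origin of the summand 1. With 1 <= K one
  constant serves both moments, because K <= K^2.\<close>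

lemma Lp_sum_pairing:
  fixes K :: real
  assumes f: "f \<in> Lp_sum M 2 \<infinity>" and z[measurable]: "z \<in> borel_measurable M" and z0: "\<And>x. 0 \<le> z x"
    and K: "(\<integral>\<^sup>+x. ennreal (z x) \<partial>M) \<le> ennreal K" "(\<integral>\<^sup>+x. ennreal ((z x)\<^sup>2) \<partial>M) \<le> ennreal K" "1 \<le> K"
  shows "(\<integral>\<^sup>+x. ennreal (\<bar>f x\<bar> * z x) \<partial>M) \<le> ennreal (K * (Lp_sum_norm M 2 \<infinity> f + 1))"
proof -
  let ?S = "{Lp_norm M 2 g + Lp_norm M \<infinity> h | g h. g \<in> Lp M 2 \<and> h \<in> Lp M \<infinity> \<and> (AE x in M. f x = g x + h x)}"
  have ne: "?S \<noteq> {}" using f by (auto simp: Lp_sum_def)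
  have "Inf ?S < Lp_sum_norm M 2 \<infinity> f + 1" by (simp add: Lp_sum_norm_def)
  from cInf_lessD[OF ne this] obtain g h where gh: "g \<in> Lp M 2" "h \<in> Lp M \<infinity>" "AE x in M. f x = g x + h x"
    "Lp_norm M 2 g + Lp_norm M \<infinity> h < Lp_sum_norm M 2 \<infinity> f + 1" by auto
  have [measurable]: "g \<in> borel_measurable M" "h \<in> borel_measurable M" using gh by (auto simp: Lp_def)
  have n2: "0 \<le> Lp_norm M 2 g" by (simp add: Lp_norm_two)
  note ninf = Lp_norm_infinity_nonneg[OF gh(2)]
  have "(\<integral>\<^sup>+x. ennreal \<bar>g x\<bar> * ennreal (z x) \<partial>M)\<^sup>2
     \<le> (\<integral>\<^sup>+x. ennreal \<bar>g x\<bar> ^ 2 \<partial>M) * (\<integral>\<^sup>+x. ennreal (z x) ^ 2 \<partial>M)"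
    by (intro Cauchy_Schwarz_nn_integral) auto
  also have "(\<integral>\<^sup>+x. ennreal \<bar>g x\<bar> ^ 2 \<partial>M) = ennreal ((Lp_norm M 2 g)\<^sup>2)"
    using gh(1) by (simp add: ennreal_power Lp_two_iff Lp_norm_two nn_integral_eq_integral)
  also have "(\<integral>\<^sup>+x. ennreal (z x) ^ 2 \<partial>M) = (\<integral>\<^sup>+x. ennreal ((z x)\<^sup>2) \<partial>M)"
    using z0 by (simp add: ennreal_power)
  also have "ennreal ((Lp_norm M 2 g)\<^sup>2) * (\<integral>\<^sup>+x. ennreal ((z x)\<^sup>2) \<partial>M) \<le> ennreal ((Lp_norm M 2 g)\<^sup>2) * ennreal (K\<^sup>2)"
  proof (intro mult_left_mono order_trans[OF K(2)] ennreal_leI)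
    show "K \<le> K\<^sup>2" using K(3) by (simp add: power2_eq_square)
  qed auto
  also have "\<dots> = ennreal ((Lp_norm M 2 g * K)\<^sup>2)" by (simp add: ennreal_mult[symmetric] power_mult_distrib)
  finally have A: "(\<integral>\<^sup>+x. ennreal \<bar>g x\<bar> * ennreal (z x) \<partial>M) \<le> ennreal (Lp_norm M 2 g * K)"
    by (rule ennreal_power2_le_imp_le) (use n2 K in auto)
  have "(\<integral>\<^sup>+x. ennreal \<bar>h x\<bar> * ennreal (z x) \<partial>M) \<le> (\<integral>\<^sup>+x. ennreal (Lp_norm M \<infinity> h) * ennreal (z x) \<partial>M)"
    using AE_Lp_norm_infinity[OF gh(2)]
    by (intro nn_integral_mono_AE) (auto elim!: eventually_mono intro!: mult_right_mono ennreal_leI)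
  also have "\<dots> = ennreal (Lp_norm M \<infinity> h) * (\<integral>\<^sup>+x. ennreal (z x) \<partial>M)"
    by (intro nn_integral_cmult) auto
  also have "\<dots> \<le> ennreal (Lp_norm M \<infinity> h) * ennreal K" by (intro mult_left_mono K) auto
  also have "\<dots> = ennreal (Lp_norm M \<infinity> h * K)" using ninf K by (simp add: ennreal_mult)
  finally have B: "(\<integral>\<^sup>+x. ennreal \<bar>h x\<bar> * ennreal (z x) \<partial>M) \<le> ennreal (Lp_norm M \<infinity> h * K)" .
  have "(\<integral>\<^sup>+x. ennreal (\<bar>f x\<bar> * z x) \<partial>M) \<le> (\<integral>\<^sup>+x. ennreal \<bar>g x\<bar> * ennreal (z x) + ennreal \<bar>h x\<bar> * ennreal (z x) \<partial>M)"
  proof (rule nn_integral_mono_AE)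
    show "AE x in M. ennreal (\<bar>f x\<bar> * z x) \<le> ennreal \<bar>g x\<bar> * ennreal (z x) + ennreal \<bar>h x\<bar> * ennreal (z x)"
      using gh(3)
    proof eventually_elim
      case (elim x)
      have "\<bar>f x\<bar> * z x \<le> (\<bar>g x\<bar> + \<bar>h x\<bar>) * z x" unfolding elim by (intro mult_right_mono z0) auto
      then have "ennreal (\<bar>f x\<bar> * z x) \<le> ennreal (\<bar>g x\<bar> * z x + \<bar>h x\<bar> * z x)"
        by (intro ennreal_leI) (simp add: algebra_simps)
      then show ?case using z0[of x] by (simp add: ennreal_mult)
    qed
  qed
  also have "\<dots> = (\<integral>\<^sup>+x. ennreal \<bar>g x\<bar> * ennreal (z x) \<partial>M) + (\<integral>\<^sup>+x. ennreal \<bar>h x\<bar> * ennreal (z x) \<partial>M)"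
    by (intro nn_integral_add) auto
  also have "\<dots> \<le> ennreal (Lp_norm M 2 g * K) + ennreal (Lp_norm M \<infinity> h * K)" by (intro add_mono A B)
  also have "\<dots> = ennreal ((Lp_norm M 2 g + Lp_norm M \<infinity> h) * K)"
    using n2 ninf K by (simp add: ennreal_plus[symmetric] algebra_simps del: ennreal_plus)
  also have "\<dots> \<le> ennreal (K * (Lp_sum_norm M 2 \<infinity> f + 1))"
    using gh(4) K by (intro ennreal_leI) (simp add: mult.commute[of K] mult_right_mono)
  finally show ?thesis .
qed

text \<open>The slicewise pairing is integrated in time. The obstacle is that t \<mapsto>
  \<open>Lp_sum_norm M 2 \<infinity> (g t)\<close> is not known to be measurable, so its integral
  may be used by monotonicity but not by additivity.\<close>

lemma time_L1_sum_integrable: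
  fixes K :: real
  assumes M: "sigma_finite_measure M"
    and g: "time_L1 T M (Lp_sum M 2 \<infinity>) (Lp_sum_norm M 2 \<infinity>) g"
    and Z[measurable]: "(\<lambda>(t, x). Z t x) \<in> borel_measurable (time_space T \<Otimes>\<^sub>M M)" and Z0: "\<And>t x. 0 \<le> Z t x"
    and K: "AE t in time_space T. (\<integral>\<^sup>+x. ennreal (Z t x) \<partial>M) \<le> ennreal K \<and> (\<integral>\<^sup>+x. ennreal ((Z t x)\<^sup>2) \<partial>M) \<le> ennreal K"
  shows "integrable (time_space T \<Otimes>\<^sub>M M) (\<lambda>(t, x). \<bar>g t x\<bar> * Z t x)"
proof -
  interpret M: sigma_finite_measure M by fact
  interpret \<tau>: finite_measure "time_space T" by (rule finite_measure_time)
  define L where "L = max 1 K"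
  have L: "1 \<le> L" by (simp add: L_def)
  have gm[measurable]: "(\<lambda>(t, x). g t x) \<in> borel_measurable (time_space T \<Otimes>\<^sub>M M)"
    using g by (auto simp: time_L1_def jointly_borel_def)
  define N where "N t = Lp_sum_norm M 2 \<infinity> (g t)" for t
  define I where "I t = (\<integral>\<^sup>+x. ennreal (\<bar>g t x\<bar> * Z t x) \<partial>M)" for t
  have gZm[measurable]: "(\<lambda>(t, x). ennreal (\<bar>g t x\<bar> * Z t x)) \<in> borel_measurable (time_space T \<Otimes>\<^sub>M M)"
    using measurable_compose[OF gm, of abs borel] Z by (simp add: split_beta')
  have Im[measurable]: "I \<in> borel_measurable (time_space T)"
    unfolding I_def using M.borel_measurable_nn_integral[of "\<lambda>t x. ennreal (\<bar>g t x\<bar> * Z t x)" "time_space T"] gZm by simp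
  have "AE t in time_space T. g t \<in> Lp_sum M 2 \<infinity>" using g by (simp add: time_L1_def AE_time)
  with K AE_space have I_le: "AE t in time_space T. I t \<le> ennreal (L * (N t + 1))"
  proof eventually_elim
    case (elim t)
    have zm: "Z t \<in> borel_measurable M" using measurable_compose_Pair1[OF elim(2) Z] by simp
    have "ennreal K \<le> ennreal L" by (auto simp: L_def intro!: ennreal_leI)
    then show ?case unfolding I_def N_def using elim zm Z0 L
      by (intro Lp_sum_pairing) (auto intro: order_trans)
  qed
  have efin: "emeasure (time_space T) {0<..<T} < top"
    using \<tau>.emeasure_finite[of "{0<..<T}"] by (metis infinity_ennreal_def top.not_eq_extremum)
  \<comment> \<open>The pairing bound I <= L * (N + 1) solved for N. Unlike N, this is measurable,
    so the integral of I splits first and J is compared with N afterwards; negative values of J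
    count as 0 in \<open>ennreal\<close>.\<close>
  define J where "J t = enn2real (I t) / L - 1" for t
  have [measurable]: "J \<in> borel_measurable (time_space T)" unfolding J_def by measurable
  have "(\<integral>\<^sup>+t. I t \<partial>time_space T) \<le> (\<integral>\<^sup>+t. ennreal L * ennreal (J t) + ennreal L \<partial>time_space T)"
  proof (rule nn_integral_mono_AE)
    show "AE t in time_space T. I t \<le> ennreal L * ennreal (J t) + ennreal L"
      using I_le
    proof eventually_elim
      case (elim t)
      then have "I t < top" by (meson ennreal_less_top le_less_trans)
      then have "I t = ennreal (enn2real (I t))" by simp
      also have "enn2real (I t) = L * (J t + 1)" using L by (simp add: J_def)
      also have "L * (J t + 1) \<le> L * max 0 (J t) + L" using L by (simp add: algebra_simps max_def mult_le_0_iff)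
      then have "ennreal (L * (J t + 1)) \<le> ennreal (L * max 0 (J t) + L)" by (rule ennreal_leI)
      also have "\<dots> = ennreal L * ennreal (max 0 (J t)) + ennreal L" using L by (simp add: ennreal_mult)
      also have "ennreal (max 0 (J t)) = ennreal (J t)" by (simp add: max_def ennreal_neg)
      finally show ?case .
    qed
  qed
  also have "\<dots> = ennreal L * (\<integral>\<^sup>+t. ennreal (J t) \<partial>time_space T) + ennreal L * emeasure (time_space T) (space (time_space T))"
    by (subst nn_integral_add) (auto simp: nn_integral_cmult)
  also have "(\<integral>\<^sup>+t. ennreal (J t) \<partial>time_space T) \<le> (\<integral>\<^sup>+t. ennreal (N t) \<partial>time_space T)"
  proof (rule nn_integral_mono_AE)
    show "AE t in time_space T. ennreal (J t) \<le> ennreal (N t)"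
      using I_le
    proof eventually_elim
      case (elim t)
      have "J t \<le> max 0 (N t)"
      proof (cases "0 \<le> L * (N t + 1)")
        case True
        from enn2real_mono[OF elim] True have "enn2real (I t) \<le> L * (N t + 1)" by simp
        then have "enn2real (I t) / L \<le> N t + 1" using L by (simp add: field_simps)
        then show ?thesis by (simp add: J_def)
      next
        case False
        then have "I t = 0" using elim by (simp add: ennreal_neg)
        then show ?thesis by (simp add: J_def)
      qed
      then have "ennreal (J t) \<le> ennreal (max 0 (N t))" by (rule ennreal_leI)
      then show ?case by (simp add: max_def ennreal_neg split: if_splits)
    qed
  qed
  also have "(\<integral>\<^sup>+t. ennreal (N t) \<partial>time_space T) = (\<integral>\<^sup>+t\<in>{0<..<T}. ennreal (N t) \<partial>lborel)"
    by (simp add: nn_integral_restrict_space)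
  also have "ennreal L * (\<integral>\<^sup>+t\<in>{0<..<T}. ennreal (N t) \<partial>lborel) + ennreal L * emeasure (time_space T) (space (time_space T)) < \<infinity>"
    using g efin by (auto simp:  time_L1_def N_def ennreal_mult_less_top less_top)
  finally have fin: "(\<integral>\<^sup>+t. I t \<partial>time_space T) < \<infinity>" by (simp add: add_mono mult_left_mono)
  show ?thesis
  proof (rule integrableI_bounded)
    show "(\<lambda>(t, x). \<bar>g t x\<bar> * Z t x) \<in> borel_measurable (time_space T \<Otimes>\<^sub>M M)"
      using measurable_compose[OF gm, of abs borel] Z by (simp add: split_beta')
    have "(\<integral>\<^sup>+p. ennreal (norm (case p of (t, x) \<Rightarrow> \<bar>g t x\<bar> * Z t x)) \<partial>(time_space T \<Otimes>\<^sub>M M))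
        = (\<integral>\<^sup>+p. (case p of (t, x) \<Rightarrow> ennreal (\<bar>g t x\<bar> * Z t x)) \<partial>(time_space T \<Otimes>\<^sub>M M))"
      using Z0 by (intro nn_integral_cong) (auto simp: abs_mult split: prod.split)
    also have "\<dots> = (\<integral>\<^sup>+t. I t \<partial>time_space T)"
      unfolding I_def using M.nn_integral_fst[OF gZm] by simp
    finally show "(\<integral>\<^sup>+p. ennreal (norm (case p of (t, x) \<Rightarrow> \<bar>g t x\<bar> * Z t x)) \<partial>(time_space T \<Otimes>\<^sub>M M)) < \<infinity>"
      using fin by simp
  qed
qed

text \<open>The essential supremum norm of h t is not known to be measurable in t either. The
  infimum of the nonnegative rationals q with h t <= q almost everywhere is, because the measures of
  the slices of {h > q} are. It lies below the norm, and countability of the rationals makes it an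
  almost everywhere bound.\<close>

lemma time_L1_infinity_majorant:
  assumes M: "sigma_finite_measure M" and h: "time_L1 T M (Lp M \<infinity>) (Lp_norm M \<infinity>) h"
  shows "\<exists>d. integrable (time_space T) d \<and> (\<forall>t. 0 \<le> d t) \<and> (AE t in time_space T. AE x in M. h t x \<le> d t)"
proof -
  interpret M: sigma_finite_measure M by fact
  have hm[measurable]: "(\<lambda>(t, x). h t x) \<in> borel_measurable (time_space T \<Otimes>\<^sub>M M)"
    using h by (auto simp: time_L1_def jointly_borel_def)
  define Q where "Q q = {p \<in> space (time_space T \<Otimes>\<^sub>M M). q < (case p of (t, x) \<Rightarrow> h t x)}" for q :: real
  have Q: "Q q \<in> sets (time_space T \<Otimes>\<^sub>M M)" for q unfolding Q_def by measurable
  define I where "I = \<rat> \<inter> {0::real..}"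
  have cI: "countable I" unfolding I_def using countable_rat by blast
  define D where "D t = (INF q\<in>I. if emeasure M (Pair t -` Q q) = 0 then ennreal q else \<infinity>)" for t
  have [measurable]: "(\<lambda>t. emeasure M (Pair t -` Q q)) \<in> borel_measurable (time_space T)" for q
    by (rule M.measurable_emeasure_Pair[OF Q])
  have Dm[measurable]: "D \<in> borel_measurable (time_space T)"
    unfolding D_def by (intro borel_measurable_INF cI) measurable
  have sl: "Pair t -` Q q = {x \<in> space M. q < h t x}" if "t \<in> space (time_space T)" for t q
    using that by (auto simp: Q_def space_pair_measure)
  have hL: "AE t in time_space T. h t \<in> Lp M \<infinity>" using h by (simp add: time_L1_def AE_time)
  from hL AE_space have DL: "AE t in time_space T. D t \<le> ennreal (Lp_norm M \<infinity> (h t))"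
  proof eventually_elim
    case (elim t)
    let ?c = "Lp_norm M \<infinity> (h t)"
    have c: "0 \<le> ?c" "AE x in M. \<bar>h t x\<bar> \<le> ?c"
      using Lp_norm_infinity_nonneg[OF elim(1)] AE_Lp_norm_infinity[OF elim(1)] by auto
    show ?case
    proof (rule ennreal_le_epsilon)
      fix e :: real assume "0 < e"
      then obtain q where q: "q \<in> \<rat>" "?c < q" "q < ?c + e" using Rats_dense_in_real[of ?c "?c + e"] by auto
      have "AE x in M. \<not> q < h t x" using c(2) by eventually_elim (use q in auto)
      then have "emeasure M (Pair t -` Q q) = 0"
        unfolding sl[OF elim(2)] using Q[of q] elim(2) by (intro emeasure_eq_0_AE) (auto simp: sl[symmetric])
      then have "D t \<le> ennreal q"
        unfolding D_def using q c(1) by (intro INF_lower2[of q]) (auto simp: I_def)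
      also have "\<dots> \<le> ennreal ?c + ennreal e" using q c \<open>0 < e\<close> by (subst ennreal_plus[symmetric]) (auto intro!: ennreal_leI simp del: ennreal_plus)
      finally show "D t \<le> ennreal ?c + ennreal e" .
    qed
  qed
  define d where "d t = enn2real (D t)" for t
  have dD: "AE t in time_space T. ennreal (d t) = D t"
    using DL by eventually_elim (auto simp: d_def intro!: ennreal_enn2real le_less_trans[OF _ ennreal_less_top])
  have "integrable (time_space T) d"
  proof (rule integrableI_bounded)
    show "d \<in> borel_measurable (time_space T)" unfolding d_def by measurable
    have "(\<integral>\<^sup>+t. ennreal (norm (d t)) \<partial>time_space T) \<le> (\<integral>\<^sup>+t. ennreal (Lp_norm M \<infinity> (h t)) \<partial>time_space T)"
      using DL dD by (intro nn_integral_mono_AE) (auto simp: d_def elim!: eventually_elim2)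
    also have "\<dots> < \<infinity>" using h by (simp add: nn_integral_restrict_space time_L1_def)
    finally show "(\<integral>\<^sup>+t. ennreal (norm (d t)) \<partial>time_space T) < \<infinity>" .
  qed
  moreover have "AE t in time_space T. AE x in M. h t x \<le> d t"
    using dD AE_space
  proof eventually_elim
    case (elim t)
    have "AE x in M. \<forall>q\<in>I. emeasure M (Pair t -` Q q) = 0 \<longrightarrow> h t x \<le> q"
      unfolding AE_ball_countable[OF cI]
    proof
      fix q assume "q \<in> I"
      show "AE x in M. emeasure M (Pair t -` Q q) = 0 \<longrightarrow> h t x \<le> q"
      proof (cases "emeasure M (Pair t -` Q q) = 0")
        case True
        have "Pair t -` Q q \<in> sets M" using Q by (rule sets_Pair1)
        with True have "Pair t -` Q q \<in> null_sets M" by auto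
        from AE_not_in[OF this, unfolded sl[OF elim(2)]] AE_space show ?thesis
          by eventually_elim auto
      qed auto
    qed
    then show ?case
    proof eventually_elim
      case (elim x)
      show ?case
      proof (rule ccontr)
        assume "\<not> h t x \<le> d t"
        moreover have "0 \<le> d t" by (simp add: d_def)
        ultimately have "D t < ennreal (h t x)" using \<open>ennreal (d t) = D t\<close>[symmetric] by (simp add: ennreal_lessI)
        then obtain q where "q \<in> I" "(if emeasure M (Pair t -` Q q) = 0 then ennreal q else \<infinity>) < ennreal (h t x)"
          unfolding D_def INF_less_iff by blast
        then have "emeasure M (Pair t -` Q q) = 0" "q < h t x" "q \<in> I"
          by (auto split: if_splits simp: I_def ennreal_less_iff)
        with elim show False by force
      qed
    qed
  qed
  ultimately show ?thesis by (intro exI[of _ d]) (auto simp: d_def)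
qed

section \<open>Separability\<close>

text \<open>Outer regularity of the measure restricted to X encloses S in an open U with excess
  below e / 2. Since U is a countable union of basis sets, finitely many of them already exhaust it
  up to e / 2.\<close>

lemma approx_by_finite_union_of_basis:
  fixes M :: "'a::polish_space measure"
  assumes M: "sets M = sets borel" and B: "topological_basis B" "countable B"
    and X: "X \<in> sets M" "emeasure M X \<noteq> \<infinity>" and S: "S \<in> sets M" and e: "0 < e"
  shows "\<exists>F. finite F \<and> F \<subseteq> B \<and> measure M (X \<inter> ((S - \<Union>F) \<union> (\<Union>F - S))) < e"
proof -
  have [simp]: "space M = UNIV" using sets_eq_imp_space_eq[OF M] by simp
  define N where "N = density M (indicator X)"
  have N_emeasure: "emeasure N Y = emeasure M (X \<inter> Y)" if "Y \<in> sets M" for Y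
    using that X by (simp add: N_def emeasure_density indicator_inter_arith[symmetric])
  have N_measure: "measure N Y = measure M (X \<inter> Y)" if "Y \<in> sets M" for Y
    using N_emeasure[OF that] by (simp add: measure_def)
  have sN: "sets N = sets borel" by (simp add: N_def M)
  have opensM: "open U \<Longrightarrow> U \<in> sets M" for U by (simp add: M)
  have finN: "emeasure N (space N) \<noteq> \<infinity>"
    using N_emeasure[of UNIV] X(2) sets.top[of M] by (simp add: N_def)
  interpret N: finite_measure N by (rule finite_measureI[OF finN])
  have "emeasure N S = (INF U \<in> {U. S \<subseteq> U \<and> open U}. emeasure N U)"
    using S by (intro outer_regular sN finN) (simp add: M)
  moreover have "emeasure N S < emeasure N S + ennreal (e / 2)"
    using e N.emeasure_finite[of S] by (auto simp: N.emeasure_eq_measure ennreal_plus[symmetric] ennreal_less_iff simp del: ennreal_plus)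
  ultimately obtain U where U: "S \<subseteq> U" "open U" "emeasure N U < emeasure N S + ennreal (e / 2)"
    by (auto simp: INF_less_iff)
  have US: "measure N (U - S) < e / 2"
  proof -
    have "measure N U < measure N S + e / 2"
      using U(3) e by (simp add: N.emeasure_eq_measure ennreal_plus[symmetric] ennreal_less_iff del: ennreal_plus)
    moreover have "measure N (U - S) = measure N U - measure N S"
      using U S sN M by (intro N.finite_measure_Diff) auto
    ultimately show ?thesis by simp
  qed
  obtain B' where B': "B' \<subseteq> B" "\<Union>B' = U" using B(1) U(2) by (auto simp: topological_basis_def)
  have "\<exists>F. finite F \<and> F \<subseteq> B \<and> \<Union>F \<subseteq> U \<and> measure N (U - \<Union>F) < e / 2"
  proof (cases "B' = {}")
    case True
    then show ?thesis using B' e by (intro exI[of _ "{}"]) auto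
  next
    case False
    have cB': "countable B'" using B' B countable_subset by blast
    define b where "b = from_nat_into B'"
    have b: "range b = B'" unfolding b_def using range_from_nat_into[OF False cB'] .
    define W where "W n = (\<Union>k<n. b k)" for n
    have bo: "open (b k)" for k using b B' B(1) by (metis rangeI subsetD topological_basis_open)
    have W: "W n \<in> sets N" for n unfolding W_def sN using bo by (intro borel_open open_UN) auto
    have "(\<lambda>n. measure N (W n)) \<longlonglongrightarrow> measure N (\<Union>n. W n)"
      using W by (intro N.finite_Lim_measure_incseq) (auto simp: incseq_def W_def, force)
    moreover have "(\<Union>n. W n) = U" unfolding W_def B'(2)[symmetric] b[symmetric] by auto
    ultimately have "\<forall>\<^sub>F n in sequentially. measure N U - e / 2 < measure N (W n)"
      using e by (intro order_tendstoD(1)) auto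
    then obtain n where n: "measure N U - e / 2 < measure N (W n)" by (auto simp: eventually_sequentially)
    have WU: "W n \<subseteq> U" using B' b unfolding W_def by blast
    have "measure N (U - W n) = measure N U - measure N (W n)"
      using U W WU sN by (intro N.finite_measure_Diff) auto
    with n have "measure N (U - W n) < e / 2" by simp
    moreover have "W n = \<Union>(b ` {..<n})" by (simp add: W_def)
    ultimately show ?thesis using WU b B' by (intro exI[of _ "b ` {..<n}"]) auto
  qed
  then obtain F where F: "finite F" "F \<subseteq> B" "\<Union>F \<subseteq> U" "measure N (U - \<Union>F) < e / 2"
    by (elim exE conjE) (rule that)
  have Fo: "\<Union>F \<in> sets N" unfolding sN using F(2) B(1) by (intro borel_open open_Union) (auto simp: topological_basis_open)
  have Us: "U \<in> sets N" "S \<in> sets N" using U S sN M by auto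
  have "measure M (X \<inter> ((S - \<Union>F) \<union> (\<Union>F - S))) = measure N ((S - \<Union>F) \<union> (\<Union>F - S))"
    using Fo S sN M by (subst N_measure) auto
  also have "\<dots> \<le> measure N ((U - \<Union>F) \<union> (U - S))"
    using U(1) F(3) Fo Us by (intro N.finite_measure_mono) auto
  also have "\<dots> \<le> measure N (U - \<Union>F) + measure N (U - S)"
    using Fo Us by (intro measure_Un_le) auto
  also have "\<dots> < e" using US F(4) by simp
  finally show ?thesis using F by blast
qed

text \<open>The dense set consists of rational combinations of indicators of finite unions of basis
  sets, intersected with sets X i of finite measure. Encoding combinations as lists makes addition a
  concatenation, which serves the additive step of the induction on integrable functions.\<close>

lemma countable_dense_L1:
  fixes M :: "'a::polish_space measure"
  assumes M: "sets M = sets borel" "sigma_finite_measure M"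
  shows "\<exists>E :: ('a \<Rightarrow> real) set. countable E \<and> (\<forall>g\<in>E. integrable M g) \<and>
    (\<forall>f. integrable M f \<longrightarrow> (\<forall>e>0. \<exists>g\<in>E. (\<integral>x. \<bar>f x - g x\<bar> \<partial>M) < e))"
proof -
  interpret sigma_finite_measure M by fact
  have [simp]: "space M = UNIV" using sets_eq_imp_space_eq[OF M(1)] by simp
  obtain X :: "nat \<Rightarrow> 'a set" where X: "range X \<subseteq> sets M" "(\<Union>i. X i) = space M" "\<And>i. emeasure M (X i) \<noteq> \<infinity>" "incseq X"
    using sigma_finite_incseq by blast
  obtain B :: "'a set set" where B: "countable B" "topological_basis B" using ex_countable_basis by blast
  define G where "G = (\<lambda>(F, i). \<Union>F \<inter> X i) ` ({F. finite F \<and> F \<subseteq> B} \<times> UNIV)"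
  have cG: "countable G" unfolding G_def
    by (intro countable_image countable_SIGMA countable_Collect_finite_subset B) auto
  define comb where "comb xs x = (\<Sum>(q, S)\<leftarrow>xs. q * indicator S x)" for xs :: "(real \<times> 'a set) list" and x
  define E where "E = {g \<in> comb ` lists (\<rat> \<times> G). integrable M g}"
  have "countable E" unfolding E_def
    using cG countable_rat by (intro countable_subset[OF Collect_subset] countable_image countable_lists countable_SIGMA) auto
  moreover have E_add: "(\<lambda>x. g x + h x) \<in> E" if "g \<in> E" "h \<in> E" for g h
  proof -
    obtain xs ys where "xs \<in> lists (\<rat> \<times> G)" "g = comb xs" "ys \<in> lists (\<rat> \<times> G)" "h = comb ys"
      using \<open>g \<in> E\<close> \<open>h \<in> E\<close> by (auto simp: E_def)
    then have "(\<lambda>x. g x + h x) = comb (xs @ ys)" "xs @ ys \<in> lists (\<rat> \<times> G)"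
      by (auto simp: comb_def)
    moreover have "integrable M (\<lambda>x. g x + h x)" using that by (auto simp: E_def)
    ultimately show ?thesis unfolding E_def by auto
  qed
  moreover have "\<forall>e>0. \<exists>g\<in>E. (\<integral>x. \<bar>f x - g x\<bar> \<partial>M) < e" if "integrable M f" for f
    using that
  proof (induction f rule: integrable_induct)
    case (base A c)
    show ?case
    proof (intro allI impI)
      fix e :: real assume e: "0 < e"
      \<comment> \<open>Three errors of size e / 3: the rational q in place of c, the part of A
        outside X i, and the symmetric difference inside X i. The last two carry the factor |q|, so
        q is fixed before \<open>\<epsilon>\<close>; the added 1 keeps the denominators
        positive.\<close>
      define \<delta> where "\<delta> = e / (3 * (measure M A + 1))"
      have "0 < \<delta>" using e by (simp add: \<delta>_def add_nonneg_pos)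
      then obtain q where q: "q \<in> \<rat>" "c < q" "q < c + \<delta>" using Rats_dense_in_real[of c "c + \<delta>"] by auto
      define \<epsilon> where "\<epsilon> = e / (3 * (\<bar>q\<bar> + 1))"
      have \<epsilon>: "0 < \<epsilon>" using e by (simp add: \<epsilon>_def add_nonneg_pos)
      have q\<epsilon>: "\<bar>q\<bar> * \<epsilon> < e / 3" using e by (simp add: \<epsilon>_def field_simps)
      have "(\<lambda>i. measure M (A - X i)) \<longlonglongrightarrow> measure M (\<Inter>i. A - X i)"
      proof (rule Lim_measure_decseq)
        show "range (\<lambda>i. A - X i) \<subseteq> sets M" using base X by auto
        show "decseq (\<lambda>i. A - X i)" using X(4) by (auto simp: decseq_def incseq_def)
        have "emeasure M (A - X i) \<le> emeasure M A" for i using base X by (intro emeasure_mono) auto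
        then show "emeasure M (A - X i) \<noteq> \<infinity>" for i using base by (metis infinity_ennreal_def leD less_top)
      qed
      moreover have "(\<Inter>i. A - X i) = {}" using X(2) by auto
      ultimately have "(\<lambda>i. measure M (A - X i)) \<longlonglongrightarrow> 0" by (simp only: measure_empty)
      then have "\<forall>\<^sub>F i in sequentially. measure M (A - X i) < \<epsilon>"
        using \<epsilon> by (intro order_tendstoD(2)) auto
      then obtain i where i: "measure M (A - X i) < \<epsilon>" by (auto simp: eventually_sequentially)
      have Xi: "X i \<in> sets M" using X by auto
      obtain F where F: "finite F" "F \<subseteq> B" "measure M (X i \<inter> ((A - \<Union>F) \<union> (\<Union>F - A))) < \<epsilon>"
        using approx_by_finite_union_of_basis[OF M(1) B(2,1) Xi X(3) base(1) \<epsilon>] by blast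
      have Fs: "\<Union>F \<in> sets M" unfolding M using F(2) B(2) by (intro borel_open open_Union) (auto simp: topological_basis_open)
      define S where "S = \<Union>F \<inter> X i"
      define R where "R = X i \<inter> ((A - \<Union>F) \<union> (\<Union>F - A))"
      have sets[measurable]: "S \<in> sets M" "R \<in> sets M" "A - X i \<in> sets M" "A \<in> sets M"
        using Fs Xi base by (auto simp: S_def R_def)
      have fin: "emeasure M S < \<infinity>" "emeasure M R < \<infinity>" "emeasure M (A - X i) < \<infinity>" "emeasure M A < \<infinity>"
      proof -
        have "emeasure M S \<le> emeasure M (X i)" "emeasure M R \<le> emeasure M (X i)" "emeasure M (A - X i) \<le> emeasure M A"
          using sets Xi by (auto simp: S_def R_def intro!: emeasure_mono)
        then show "emeasure M S < \<infinity>" "emeasure M R < \<infinity>" "emeasure M (A - X i) < \<infinity>" "emeasure M A < \<infinity>"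
          using X(3)[of i] base(2) by (auto simp: top.not_eq_extremum intro: le_less_trans)
      qed
      have g: "(\<lambda>x. q * indicator S x) \<in> E"
      proof -
        have "S \<in> G" using F by (auto simp: G_def S_def)
        then have "[(q, S)] \<in> lists (\<rat> \<times> G)" using q by auto
        moreover have "(\<lambda>x. q * indicator S x) = comb [(q, S)]" by (auto simp: comb_def)
        moreover have "integrable M (\<lambda>x. q * indicator S x)" using fin sets by simp
        ultimately show ?thesis unfolding E_def by auto
      qed
      have "(\<integral>x. \<bar>indicator A x *\<^sub>R c - q * indicator S x\<bar> \<partial>M)
         \<le> (\<integral>x. \<delta> * indicator A x + \<bar>q\<bar> * indicator (A - X i) x + \<bar>q\<bar> * indicator R x \<partial>M)"
      proof (rule integral_mono)
        show "integrable M (\<lambda>x. \<bar>indicator A x *\<^sub>R c - q * indicator S x\<bar>)"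
          using fin sets by (intro integrable_abs Bochner_Integration.integrable_diff) auto
        show "integrable M (\<lambda>x. \<delta> * indicator A x + \<bar>q\<bar> * indicator (A - X i) x + \<bar>q\<bar> * indicator R x)"
          using fin sets by (intro Bochner_Integration.integrable_add) auto
        show "\<bar>indicator A x *\<^sub>R c - q * indicator S x\<bar>
           \<le> \<delta> * indicator A x + \<bar>q\<bar> * indicator (A - X i) x + \<bar>q\<bar> * indicator R x" for x
          using q \<open>0 < \<delta>\<close> by (auto simp: indicator_def S_def R_def)
      qed
      also have "\<dots> = \<delta> * measure M A + \<bar>q\<bar> * measure M (A - X i) + \<bar>q\<bar> * measure M R"
        using fin sets by (subst Bochner_Integration.integral_add; (intro Bochner_Integration.integrable_add)?) auto
      also have "\<dots> < e"
      proof -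
        have "\<delta> * measure M A \<le> \<delta> * (measure M A + 1)" using \<open>0 < \<delta>\<close> by (intro mult_left_mono) auto
        also have "\<dots> = e / 3"
        proof -
          have "0 < measure M A + 1" by (simp add: add_nonneg_pos)
          then show ?thesis unfolding \<delta>_def by (simp add: divide_eq_eq eq_divide_eq)
        qed
        finally have "\<delta> * measure M A \<le> e / 3" .
        moreover have "\<bar>q\<bar> * measure M (A - X i) \<le> \<bar>q\<bar> * \<epsilon>" "\<bar>q\<bar> * measure M R \<le> \<bar>q\<bar> * \<epsilon>"
          using i F(3) by (auto simp: R_def intro!: mult_left_mono)
        ultimately show ?thesis using q\<epsilon> by linarith
      qed
      finally show "\<exists>g\<in>E. (\<integral>x. \<bar>indicator A x *\<^sub>R c - g x\<bar> \<partial>M) < e"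
        by (intro bexI[OF _ g])
    qed
  next
    case (add f g)
    show ?case
    proof (intro allI impI)
      fix e :: real assume "0 < e"
      then obtain f' g' where fg: "f' \<in> E" "(\<integral>x. \<bar>f x - f' x\<bar> \<partial>M) < e / 2" "g' \<in> E" "(\<integral>x. \<bar>g x - g' x\<bar> \<partial>M) < e / 2"
        using add by (meson half_gt_zero)
      have "(\<integral>x. \<bar>f x + g x - (f' x + g' x)\<bar> \<partial>M) \<le> (\<integral>x. \<bar>f x - f' x\<bar> + \<bar>g x - g' x\<bar> \<partial>M)"
        using add fg by (intro integral_mono) (auto simp: E_def)
      also have "\<dots> = (\<integral>x. \<bar>f x - f' x\<bar> \<partial>M) + (\<integral>x. \<bar>g x - g' x\<bar> \<partial>M)"
        using add fg by (intro Bochner_Integration.integral_add) (auto simp: E_def)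
      also have "\<dots> < e" using fg by simp
      finally show "\<exists>h\<in>E. (\<integral>x. \<bar>f x + g x - h x\<bar> \<partial>M) < e"
        using E_add[OF fg(1,3)] by (intro bexI[of _ "\<lambda>x. f' x + g' x"])
    qed
  next
    case (lim f s)
    show ?case
    proof (intro allI impI)
      fix e :: real assume e: "0 < e"
      have "(\<lambda>i. \<integral>x. \<bar>f x - s i x\<bar> \<partial>M) \<longlonglongrightarrow> (\<integral>x. 0 \<partial>M)"
      proof (rule integral_dominated_convergence[where w="\<lambda>x. 3 * \<bar>f x\<bar>"])
        show "AE x in M. (\<lambda>i. \<bar>f x - s i x\<bar>) \<longlonglongrightarrow> 0"
        proof (rule AE_I2)
          fix x assume "x \<in> space M"
          from tendsto_rabs[OF tendsto_diff[OF tendsto_const lim(2)[OF this], of "f x"]]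
          show "(\<lambda>i. \<bar>f x - s i x\<bar>) \<longlonglongrightarrow> 0" by simp
        qed
        show "AE x in M. norm \<bar>f x - s i x\<bar> \<le> 3 * \<bar>f x\<bar>" for i
        proof (rule AE_I2)
          fix x assume "x \<in> space M"
          then have "\<bar>s i x\<bar> \<le> 2 * \<bar>f x\<bar>" using lim(3) by simp
          then show "norm \<bar>f x - s i x\<bar> \<le> 3 * \<bar>f x\<bar>" by simp
        qed
      qed (use lim in auto)
      then have "\<forall>\<^sub>F i in sequentially. (\<integral>x. \<bar>f x - s i x\<bar> \<partial>M) < e / 2"
        using e by (intro order_tendstoD(2)) auto
      then obtain i where i: "(\<integral>x. \<bar>f x - s i x\<bar> \<partial>M) < e / 2" by (auto simp: eventually_sequentially)
      obtain g where g: "g \<in> E" "(\<integral>x. \<bar>s i x - g x\<bar> \<partial>M) < e / 2" using lim(5)[of i] e by (meson half_gt_zero)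
      have "(\<integral>x. \<bar>f x - g x\<bar> \<partial>M) \<le> (\<integral>x. \<bar>f x - s i x\<bar> + \<bar>s i x - g x\<bar> \<partial>M)"
        using lim g by (intro integral_mono) (auto simp: E_def)
      also have "\<dots> = (\<integral>x. \<bar>f x - s i x\<bar> \<partial>M) + (\<integral>x. \<bar>s i x - g x\<bar> \<partial>M)"
        using lim g by (intro Bochner_Integration.integral_add) (auto simp: E_def)
      also have "\<dots> < e" using g i by simp
      finally show "\<exists>g\<in>E. (\<integral>x. \<bar>f x - g x\<bar> \<partial>M) < e" using g by blast
    qed
  qed
  ultimately show ?thesis by (intro exI[of _ E]) (auto simp: E_def)
qed

lemma square_diff_integrable:
  fixes f g :: "'a \<Rightarrow> real"
  assumes "f \<in> borel_measurable M" "g \<in> borel_measurable M" "integrable M (\<lambda>x. (f x)\<^sup>2)" "integrable M (\<lambda>x. (g x)\<^sup>2)"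
  shows "integrable M (\<lambda>x. (f x - g x)\<^sup>2)" "integrable M (\<lambda>x. f x * g x)"
proof -
  have i: "integrable M (\<lambda>x. 2 * (f x)\<^sup>2 + 2 * (g x)\<^sup>2)" using assms by simp
  show "integrable M (\<lambda>x. (f x - g x)\<^sup>2)"
  proof (rule Bochner_Integration.integrable_bound[OF i])
    have "(f x - g x)\<^sup>2 \<le> 2 * (f x)\<^sup>2 + 2 * (g x)\<^sup>2" for x
      using zero_le_power2[of "f x + g x"] by (simp add: power2_eq_square algebra_simps)
    then show "AE x in M. norm ((f x - g x)\<^sup>2) \<le> norm (2 * (f x)\<^sup>2 + 2 * (g x)\<^sup>2)" by (intro AE_I2) auto
  qed (use assms in auto)
  show "integrable M (\<lambda>x. f x * g x)"
  proof (rule Bochner_Integration.integrable_bound[OF i])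
    have "\<bar>f x * g x\<bar> \<le> 2 * (f x)\<^sup>2 + 2 * (g x)\<^sup>2" for x
    proof -
      have "2 * \<bar>f x * g x\<bar> \<le> (f x)\<^sup>2 + (g x)\<^sup>2"
        using zero_le_power2[of "\<bar>f x\<bar> - \<bar>g x\<bar>"] by (simp add: power2_diff abs_mult)
      then show ?thesis by (smt (verit) zero_le_power2)
    qed
    then show "AE x in M. norm (f x * g x) \<le> norm (2 * (f x)\<^sup>2 + 2 * (g x)\<^sup>2)" by (intro AE_I2) auto
  qed (use assms in auto)
qed

lemma square_diff_triangle:
  fixes f g h :: "'a \<Rightarrow> real"
  assumes "f \<in> borel_measurable M" "g \<in> borel_measurable M" "h \<in> borel_measurable M"
    "integrable M (\<lambda>x. (f x)\<^sup>2)" "integrable M (\<lambda>x. (g x)\<^sup>2)" "integrable M (\<lambda>x. (h x)\<^sup>2)"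
  shows "(\<integral>x. (f x - h x)\<^sup>2 \<partial>M) \<le> 2 * (\<integral>x. (f x - g x)\<^sup>2 \<partial>M) + 2 * (\<integral>x. (g x - h x)\<^sup>2 \<partial>M)"
proof -
  note i = square_diff_integrable(1)[OF assms(1,2,4,5)] square_diff_integrable(1)[OF assms(2,3,5,6)]
    square_diff_integrable(1)[OF assms(1,3,4,6)]
  have "(\<integral>x. (f x - h x)\<^sup>2 \<partial>M) \<le> (\<integral>x. 2 * (f x - g x)\<^sup>2 + 2 * (g x - h x)\<^sup>2 \<partial>M)"
  proof (rule integral_mono)
    fix x
    show "(f x - h x)\<^sup>2 \<le> 2 * (f x - g x)\<^sup>2 + 2 * (g x - h x)\<^sup>2"
      using zero_le_power2[of "(f x - g x) - (g x - h x)"] by (simp add: power2_eq_square algebra_simps)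
  qed (use i in auto)
  then show ?thesis using i by simp
qed

text \<open>Truncation carries density from L^1 to L^2: for functions bounded by n the squared L^2
  distance is at most 2 n times the L^1 distance. Truncating each member of the L^1 family at each n
  keeps the family countable and puts it into L^2.\<close>

lemma countable_dense_L2:
  fixes M :: "'a::polish_space measure"
  assumes M: "sets M = sets borel" "sigma_finite_measure M"
  shows "\<exists>E :: ('a \<Rightarrow> real) set. countable E \<and> (\<forall>g\<in>E. g \<in> Lp M 2) \<and>
    (\<forall>f\<in>Lp M 2. \<forall>e>0. \<exists>g\<in>E. (\<integral>x. (f x - g x)\<^sup>2 \<partial>M) < e)"
proof -
  interpret sigma_finite_measure M by fact
  obtain X :: "nat \<Rightarrow> 'a set" where X: "range X \<subseteq> sets M" "(\<Union>i. X i) = space M" "\<And>i. emeasure M (X i) \<noteq> \<infinity>" "incseq X"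
    using sigma_finite_incseq by blast
  have [measurable]: "X i \<in> sets M" for i using X by auto
  obtain E :: "('a \<Rightarrow> real) set" where E': "countable E \<and> (\<forall>g\<in>E. integrable M g) \<and>
    (\<forall>f. integrable M f \<longrightarrow> (\<forall>e>0. \<exists>g\<in>E. (\<integral>x. \<bar>f x - g x\<bar> \<partial>M) < e))"
    using countable_dense_L1[OF M] by (elim exE) (rule that)
  have E: "countable E" "\<And>g. g \<in> E \<Longrightarrow> integrable M g"
    "\<And>f e. integrable M f \<Longrightarrow> 0 < e \<Longrightarrow> \<exists>g\<in>E. (\<integral>x. \<bar>f x - g x\<bar> \<partial>M) < e"
    using E' by simp_all
  define cut where "cut n s = max (- real n) (min (real n) s)" for n and s :: real
  have cut_abs: "\<bar>cut n s\<bar> \<le> real n" "\<bar>cut n s\<bar> \<le> \<bar>s\<bar>" "\<bar>s\<bar> \<le> real n \<Longrightarrow> cut n s = s" "\<bar>cut n s - cut n t\<bar> \<le> \<bar>s - t\<bar>" for n :: nat and s t :: real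
    by (auto simp: cut_def)
  have [measurable]: "cut n \<in> borel_measurable borel" for n unfolding cut_def by measurable
  define E2 where "E2 = (\<lambda>(n, g) x. cut n (g x)) ` (UNIV \<times> E)"
  have "countable E2" unfolding E2_def using E(1) by (intro countable_image countable_SIGMA) auto
  moreover have E2L: "g \<in> Lp M 2" if "g \<in> E2" for g
  proof -
    obtain n g' where g: "g = (\<lambda>x. cut n (g' x))" "g' \<in> E" using \<open>g \<in> E2\<close> by (auto simp: E2_def)
    have i: "integrable M g'" using E g by blast
    have [measurable]: "g' \<in> borel_measurable M" using i by (rule borel_measurable_integrable)
    have "integrable M (\<lambda>x. (cut n (g' x))\<^sup>2)"
    proof (rule Bochner_Integration.integrable_bound)
      show "integrable M (\<lambda>x. real n * g' x)" using i by simp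
      have "(cut n s)\<^sup>2 \<le> real n * \<bar>s\<bar>" for s
      proof -
        have "\<bar>cut n s\<bar> * \<bar>cut n s\<bar> \<le> real n * \<bar>s\<bar>" using cut_abs(1,2)[of n s] by (intro mult_mono) auto
        then show ?thesis by (simp add: power2_eq_square abs_mult[symmetric])
      qed
      then show "AE x in M. norm ((cut n (g' x))\<^sup>2) \<le> norm (real n * g' x)" by (auto simp: abs_mult)
    qed measurable
    then show ?thesis unfolding g Lp_two_iff by simp
  qed
  moreover have "\<exists>g\<in>E2. (\<integral>x. (f x - g x)\<^sup>2 \<partial>M) < e" if f: "f \<in> Lp M 2" and e: "0 < e" for f e
  proof -
    have fm[measurable]: "f \<in> borel_measurable M" and fi: "integrable M (\<lambda>x. (f x)\<^sup>2)" using f by (auto simp: Lp_two_iff)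
    define v where "v n x = cut n (f x) * indicator (X n) x" for n x
    have vm[measurable]: "v n \<in> borel_measurable M" for n unfolding v_def by measurable
    have v_abs: "\<bar>v n x\<bar> \<le> \<bar>f x\<bar>" "\<bar>v n x\<bar> \<le> real n" for n x using cut_abs(1,2)[of n "f x"] by (auto simp: v_def indicator_def)
    have v2: "integrable M (\<lambda>x. (v n x)\<^sup>2)" for n
    proof (rule Bochner_Integration.integrable_bound[OF fi])
      show "AE x in M. norm ((v n x)\<^sup>2) \<le> norm ((f x)\<^sup>2)" using v_abs by (auto simp: abs_le_square_iff[symmetric])
    qed measurable
    have v1: "integrable M (v n)" for n
    proof (rule Bochner_Integration.integrable_bound)
      show "integrable M (\<lambda>x. real n * indicator (X n) x)" using X(3)[of n] by (auto simp: less_top)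
      show "AE x in M. norm (v n x) \<le> norm (real n * indicator (X n) x)"
        using cut_abs by (auto simp: v_def indicator_def)
    qed measurable
    have "(\<lambda>n. \<integral>x. (f x - v n x)\<^sup>2 \<partial>M) \<longlonglongrightarrow> (\<integral>x. 0 \<partial>M)"
    proof (rule integral_dominated_convergence[where w="\<lambda>x. 4 * (f x)\<^sup>2"])
      show "AE x in M. (\<lambda>n. (f x - v n x)\<^sup>2) \<longlonglongrightarrow> 0"
      proof (rule AE_I2, rule tendsto_eventually)
        fix x assume "x \<in> space M"
        then obtain i where "x \<in> X i" using X(2) by auto
        then have a: "x \<in> X n" if "i \<le> n" for n using X(4) that by (auto simp: incseq_def)
        have b: "\<bar>f x\<bar> \<le> real n" if "nat \<lceil>\<bar>f x\<bar>\<rceil> \<le> n" for n using that by (simp add: nat_le_iff ceiling_le_iff)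
        show "\<forall>\<^sub>F n in sequentially. (f x - v n x)\<^sup>2 = 0"
          using eventually_ge_at_top[of i] eventually_ge_at_top[of "nat \<lceil>\<bar>f x\<bar>\<rceil>"]
          by eventually_elim (simp add: v_def cut_abs(3) a b)
      qed
      show "AE x in M. norm ((f x - v n x)\<^sup>2) \<le> 4 * (f x)\<^sup>2" for n
      proof (rule AE_I2)
        fix x
        have "\<bar>f x - v n x\<bar> \<le> \<bar>2 * f x\<bar>" using v_abs(1)[of n x] by linarith
        then show "norm ((f x - v n x)\<^sup>2) \<le> 4 * (f x)\<^sup>2" by (simp add: abs_le_square_iff power_mult_distrib)
      qed
    qed (use fi in auto)
    then have "\<forall>\<^sub>F n in sequentially. (\<integral>x. (f x - v n x)\<^sup>2 \<partial>M) < e / 4"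
      using e by (intro order_tendstoD(2)) auto
    then obtain n where n: "(\<integral>x. (f x - v n x)\<^sup>2 \<partial>M) < e / 4" by (auto simp: eventually_sequentially)
    have "0 < e / (4 * (2 * real n + 1))" using e by simp
    then obtain g where g: "g \<in> E" "(\<integral>x. \<bar>v n x - g x\<bar> \<partial>M) < e / (4 * (2 * real n + 1))" using E(3)[OF v1] by blast
    define g' where "g' x = cut n (g x)" for x
    have g'E: "g' \<in> E2" unfolding E2_def using g(1) by (intro image_eqI[where x="(n, g)"]) (auto simp: g'_def)
    have [measurable]: "g \<in> borel_measurable M" using E g by auto
    have g'2: "g' \<in> borel_measurable M" "integrable M (\<lambda>x. (g' x)\<^sup>2)" using E2L[OF g'E] by (auto simp: Lp_two_iff)
    have "(\<integral>x. (v n x - g' x)\<^sup>2 \<partial>M) \<le> (\<integral>x. 2 * real n * \<bar>v n x - g x\<bar> \<partial>M)"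
    proof (rule integral_mono)
      show "integrable M (\<lambda>x. (v n x - g' x)\<^sup>2)" using square_diff_integrable(1)[OF vm g'2(1) v2 g'2(2)] .
      show "integrable M (\<lambda>x. 2 * real n * \<bar>v n x - g x\<bar>)" using v1 E(2)[OF g(1)] by auto
      fix x
      have "v n x = cut n (v n x)" using v_abs(2)[of n x] by (simp add: cut_abs(3))
      then have "\<bar>v n x - g' x\<bar> \<le> \<bar>v n x - g x\<bar>" using cut_abs(4)[of n "v n x" "g x"] by (simp add: g'_def)
      moreover have "\<bar>v n x - g' x\<bar> \<le> 2 * real n" using v_abs(2)[of n x] cut_abs(1)[of n "g x"] unfolding g'_def by linarith
      ultimately have "\<bar>v n x - g' x\<bar> * \<bar>v n x - g' x\<bar> \<le> (2 * real n) * \<bar>v n x - g x\<bar>" by (intro mult_mono) auto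
      then show "(v n x - g' x)\<^sup>2 \<le> 2 * real n * \<bar>v n x - g x\<bar>" by (simp add: power2_eq_square abs_mult[symmetric])
    qed
    also have "\<dots> = 2 * real n * (\<integral>x. \<bar>v n x - g x\<bar> \<partial>M)" by simp
    also have "\<dots> \<le> 2 * real n * (e / (4 * (2 * real n + 1)))" using g(2) by (intro mult_left_mono) auto
    also have "\<dots> < e / 4" using e by (simp add: field_simps)
    finally have "(\<integral>x. (v n x - g' x)\<^sup>2 \<partial>M) < e / 4" .
    with n square_diff_triangle[OF fm vm[of n] g'2(1) fi v2[of n] g'2(2)]
    have "(\<integral>x. (f x - g' x)\<^sup>2 \<partial>M) < e" by linarith
    with g'E show ?thesis by blast
  qed
  ultimately show ?thesis by (intro exI[of _ E2]) auto
qed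

context dirichlet_algebra
begin

text \<open>V is dense in L^2, A is dense in V, and the norm of V dominates that of L^2.\<close>

lemma A_dense_L2:
  assumes f: "f \<in> Lp M 2" and e: "0 < e"
  shows "\<exists>a\<in>A. (\<integral>x. (f x - a x)\<^sup>2 \<partial>M) < e"
proof -
  define \<delta> where "\<delta> = sqrt (e / 4)"
  have \<delta>: "0 < \<delta>" "\<delta>\<^sup>2 = e / 4" using e by (auto simp: \<delta>_def)
  obtain g where g: "g \<in> V" "Lp_norm M 2 (\<lambda>x. f x - g x) < \<delta>" using V_dense[OF f \<delta>(1)] by blast
  obtain a where a: "a \<in> A" "V_norm M \<Gamma> (\<lambda>x. g x - a x) < \<delta>" using A_dense[OF g(1) \<delta>(1)] by blast
  have gaV: "(\<lambda>x. g x - a x) \<in> V"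
    using V_add[OF g(1) V_scale[OF subsetD[OF A_subset a(1)], of "-1"]] by simp
  have sq: "(Lp_norm M 2 h)\<^sup>2 = (\<integral>x. (h x)\<^sup>2 \<partial>M)" for h by (simp add: Lp_norm_two)
  have n0: "0 \<le> Lp_norm M 2 h" for h by (simp add: Lp_norm_two)
  have "0 \<le> (\<integral>x. \<Gamma> (\<lambda>x. g x - a x) (\<lambda>x. g x - a x) x \<partial>M)"
    by (intro integral_nonneg_AE Gamma_nonneg gaV)
  then have "Lp_norm M 2 (\<lambda>x. g x - a x) \<le> V_norm M \<Gamma> (\<lambda>x. g x - a x)"
    unfolding V_norm_def by (intro real_le_rsqrt) simp
  with a have "Lp_norm M 2 (\<lambda>x. g x - a x) < \<delta>" by simp
  then have 1: "(\<integral>x. (g x - a x)\<^sup>2 \<partial>M) < e / 4"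
    unfolding sq[symmetric] \<delta>(2)[symmetric] using n0 by (intro power_strict_mono) auto
  have 2: "(\<integral>x. (f x - g x)\<^sup>2 \<partial>M) < e / 4"
    unfolding sq[symmetric] \<delta>(2)[symmetric] using n0 g by (intro power_strict_mono) auto
  have L: "f \<in> Lp M 2" "g \<in> Lp M 2" "a \<in> Lp M 2" using f g a V_subset A_subset by auto
  have "(\<integral>x. (f x - a x)\<^sup>2 \<partial>M) \<le> 2 * (\<integral>x. (f x - g x)\<^sup>2 \<partial>M) + 2 * (\<integral>x. (g x - a x)\<^sup>2 \<partial>M)"
    using L by (intro square_diff_triangle) (auto simp: Lp_two_iff)
  also have "\<dots> < e" using 1 2 by simp
  finally show ?thesis using a by blast
qed

text \<open>A countable family is needed to select measurably in time and to collect exceptional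
  times into one null set. It has to lie in \<open>A\<close>, because only pairings with
  \<open>A\<close> are controlled; so every member of a countable dense set is replaced by
  approximations from \<open>A\<close>.\<close>

lemma dense_sequence_in_A:
  obtains a :: "nat \<Rightarrow> 'a \<Rightarrow> real" where "\<And>n. a n \<in> A"
    "\<And>f e. f \<in> Lp M 2 \<Longrightarrow> 0 < e \<Longrightarrow> \<exists>n. (\<integral>x. (f x - a n x)\<^sup>2 \<partial>M) < e"
proof -
  obtain E where E': "countable E \<and> (\<forall>g\<in>E. g \<in> Lp M 2) \<and>
    (\<forall>f\<in>Lp M 2. \<forall>e>0. \<exists>g\<in>E. (\<integral>x. (f x - g x)\<^sup>2 \<partial>M) < e)"
    using countable_dense_L2[OF sets_M sigma_finite_M] by (elim exE) (rule that)
  have E: "countable E" "\<And>g. g \<in> E \<Longrightarrow> g \<in> Lp M 2"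
    "\<And>f e. f \<in> Lp M 2 \<Longrightarrow> 0 < e \<Longrightarrow> \<exists>g\<in>E. (\<integral>x. (f x - g x)\<^sup>2 \<partial>M) < e"
    using E' by simp_all
  have "\<forall>g k. \<exists>a. g \<in> E \<longrightarrow> a \<in> A \<and> (\<integral>x. (g x - a x)\<^sup>2 \<partial>M) < 1 / real (Suc k)"
  proof (intro allI)
    fix g k show "\<exists>a. g \<in> E \<longrightarrow> a \<in> A \<and> (\<integral>x. (g x - a x)\<^sup>2 \<partial>M) < 1 / real (Suc k)"
      using A_dense_L2[OF E(2), of g "1 / real (Suc k)"] by auto
  qed
  then obtain c where c: "\<And>g k. g \<in> E \<Longrightarrow> c g k \<in> A \<and> (\<integral>x. (g x - c g k x)\<^sup>2 \<partial>M) < 1 / real (Suc k)" by metis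
  define D where "D = (\<lambda>(g, k). c g k) ` (E \<times> (UNIV :: nat set))"
  have cD: "countable D" unfolding D_def using E(1) by (intro countable_image countable_SIGMA) auto
  have DA: "D \<subseteq> A" using c by (auto simp: D_def)
  have dense: "\<exists>a\<in>D. (\<integral>x. (f x - a x)\<^sup>2 \<partial>M) < e" if f: "f \<in> Lp M 2" and e: "0 < e" for f e
  proof -
    obtain g where g: "g \<in> E" "(\<integral>x. (f x - g x)\<^sup>2 \<partial>M) < e / 4" using E(3)[OF f, of "e / 4"] e by auto
    obtain k where k: "1 / real (Suc k) < e / 4" using e nat_approx_posE[of "e / 4"] by auto
    have L: "f \<in> Lp M 2" "g \<in> Lp M 2" "c g k \<in> Lp M 2" using f E(2)[OF g(1)] c[OF g(1)] V_subset A_subset by auto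
    have "(\<integral>x. (f x - c g k x)\<^sup>2 \<partial>M) \<le> 2 * (\<integral>x. (f x - g x)\<^sup>2 \<partial>M) + 2 * (\<integral>x. (g x - c g k x)\<^sup>2 \<partial>M)"
      using L by (intro square_diff_triangle) (auto simp: Lp_two_iff)
    also have "\<dots> < e" using g(2) k conjunct2[OF c[OF g(1), of k]] by linarith
    finally show ?thesis using g by (auto simp: D_def)
  qed
  have ne: "D \<noteq> {}" using dense[of "\<lambda>_. 0" 1] by (auto simp: Lp_two_iff)
  show ?thesis
  proof (rule that[of "from_nat_into D"])
    show "from_nat_into D n \<in> A" for n using from_nat_into[OF ne] DA by blast
    show "\<exists>n. (\<integral>x. (f x - from_nat_into D n x)\<^sup>2 \<partial>M) < e" if "f \<in> Lp M 2" "0 < e" for f e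
      using dense[OF that] from_nat_into_surj[OF cD] by metis
  qed
qed

end

section \<open>Energy estimate for the adjoint equation\<close>

text \<open>The gradient inequality at both ends of a step traps the increment between h * clip C a
  and h * clip C (a + h), which differ by at most h^2.\<close>

lemma clip_pot_derivative:
  assumes C: "0 \<le> C"
  shows "(clip_pot C has_real_derivative clip C a) (at a)"
proof -
  have bound: "\<bar>clip_pot C (a + h) - clip_pot C a - h * clip C a\<bar> \<le> \<bar>h\<bar> * \<bar>h\<bar>" for h
  proof -
    have 1: "clip_pot C (a + h) - clip_pot C a \<le> h * clip C (a + h)" by (rule clip_pot_gradient[OF C])
    have 2: "h * clip C a \<le> clip_pot C (a + h) - clip_pot C a"
      using clip_pot_gradient[OF C, of "a + h" "- h"] by simp
    have "\<bar>h * clip C (a + h) - h * clip C a\<bar> \<le> \<bar>h\<bar> * \<bar>h\<bar>"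
      unfolding right_diff_distrib[symmetric] abs_mult
      using clip_lipschitz[of C "a + h" a] by (intro mult_left_mono) auto
    with 1 2 show ?thesis by linarith
  qed
  show ?thesis
    unfolding DERIV_def
  proof (rule Lim_null[THEN iffD2], rule Lim_null_comparison)
    show "\<forall>\<^sub>F h in at 0. norm ((clip_pot C (a + h) - clip_pot C a) / h - clip C a) \<le> \<bar>h\<bar>"
      unfolding eventually_at_filter
    proof (intro always_eventually allI impI)
      fix h :: real assume h: "h \<noteq> 0"
      then have "(clip_pot C (a + h) - clip_pot C a) / h - clip C a = (clip_pot C (a + h) - clip_pot C a - h * clip C a) / h"
        by (simp add: field_simps)
      then show "norm ((clip_pot C (a + h) - clip_pot C a) / h - clip C a) \<le> \<bar>h\<bar>"
        using bound[of h] h by (simp add: abs_divide divide_le_eq)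
    qed
    show "((\<lambda>h::real. \<bar>h\<bar>) \<longlongrightarrow> 0) (at 0)" by (intro tendsto_rabs_zero tendsto_ident_at)
  qed
qed

text \<open>\<open>soft_pos e\<close> is a \<open>C\<^sup>1\<close> approximation of the positive part, with derivative \<open>clip 1 (s / e)\<close>.\<close>
definition soft_pos :: "real \<Rightarrow> real \<Rightarrow> real" where
  "soft_pos e s = e * clip_pot 1 (s / e)"

lemma soft_pos_derivative:
  assumes "0 < e"
  shows "(soft_pos e has_real_derivative clip 1 (s / e)) (at s)"
proof -
  have "((\<lambda>s. e * clip_pot 1 (s / e)) has_real_derivative e * (clip 1 (s / e) * (1 / e))) (at s)"
    using assms by (intro DERIV_cmult DERIV_chain2[OF clip_pot_derivative]) (auto intro!: derivative_eq_intros)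
  then show ?thesis using assms by (simp add: soft_pos_def[abs_def])
qed

text \<open>The loss e / 2 disappears when e tends to 0 in the energy estimate. The last bound gives
  the cutoff the decay of s^+, so that it is integrable in space even when the measure is
  infinite.\<close>

lemma soft_pos_bounds:
  assumes e: "0 < e"
  shows "0 \<le> soft_pos e s" "s \<le> soft_pos e s + e / 2" "soft_pos e s \<le> max 0 s"
    "s \<le> 0 \<Longrightarrow> soft_pos e s = 0" "0 \<le> clip 1 (s / e)" "clip 1 (s / e) \<le> 1" "clip 1 (s / e) \<le> max 0 s / e"
proof -
  show "0 \<le> soft_pos e s" using clip_pot_bounds(2)[of 1 "s / e"] e by (simp add: soft_pos_def)
  show z: "s \<le> 0 \<Longrightarrow> soft_pos e s = 0" for s using e by (simp add: soft_pos_def clip_pot_def clip_def divide_nonpos_pos)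
  have "e * (max 0 (s / e) - 1 / 2) \<le> soft_pos e s"
    unfolding soft_pos_def using e clip_pot_bounds(1)[of 1 "s / e"] by (intro mult_left_mono) auto
  moreover have "s \<le> e * max 0 (s / e)" using e by (simp add: max_def field_simps)
  ultimately show "s \<le> soft_pos e s + e / 2" by (simp add: algebra_simps)
  show "soft_pos e s \<le> max 0 s"
  proof (cases "s \<le> 0")
    case False
    have "soft_pos e s \<le> e * (1 * \<bar>s / e\<bar>)"
      unfolding soft_pos_def using e by (intro mult_left_mono clip_pot_bounds) auto
    then show ?thesis using e False by simp
  qed (simp add: z)
  show "0 \<le> clip 1 (s / e)" "clip 1 (s / e) \<le> 1" by (simp_all add: clip_bounds)
  show "clip 1 (s / e) \<le> max 0 s / e" using e by (auto simp: clip_def max_def divide_nonpos_pos)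
qed

lemma continuous_soft_pos': "0 < e \<Longrightarrow> continuous_on S (\<lambda>s. clip 1 (s / e))"
  by (intro continuous_on_compose2[OF continuous_clip[of UNIV]] continuous_intros) auto

lemma borel_measurable_soft_pos [measurable]: "soft_pos e \<in> borel_measurable borel"
  unfolding soft_pos_def by measurable

section \<open>The velocity field and its test functions\<close>

locale transport = dirichlet_algebra M V A \<Gamma>
  for M :: "'a::polish_space measure" and V A \<Gamma> +
  fixes T :: real and b :: "real \<Rightarrow> ('a \<Rightarrow> real) \<Rightarrow> ('a \<Rightarrow> real)" and g h :: "real \<Rightarrow> 'a \<Rightarrow> real"
  assumes T_pos: "0 < T"
    and b_borel: "borel_family M \<Gamma> A T b"
    and g_bound: "bounds_family M \<Gamma> A T b g"
    and g_L1: "time_L1 T M (Lp_sum M 2 \<infinity>) (Lp_sum_norm M 2 \<infinity>) g"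
    and h_L1: "time_L1 T M (Lp M \<infinity>) (Lp_norm M \<infinity>) h"
    and h_nonneg: "\<And>t x. 0 \<le> h t x"
    and h_div: "AE t in time_space T. \<forall>f\<in>A. (AE x in M. 0 \<le> f x) \<longrightarrow> (\<integral>x. b t f x \<partial>M) \<le> (\<integral>x. f x * h t x \<partial>M)"
begin

sublocale M: sigma_finite_measure M by (rule sigma_finite_M)
sublocale \<tau>: finite_measure "time_space T" by (rule finite_measure_time)
sublocale pair: pair_sigma_finite "time_space T" M by (rule pair_sigma_finite_time[OF sigma_finite_M])

abbreviation N :: "(real \<times> 'a) measure" where "N \<equiv> time_space T \<Otimes>\<^sub>M M"

lemma b_measurable: "f \<in> A \<Longrightarrow> (\<lambda>(t, x). b t f x) \<in> borel_measurable N"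
  using b_borel by (auto simp: borel_family_def jointly_borel_def)

lemma g_measurable: "(\<lambda>(t, x). g t x) \<in> borel_measurable N"
  using g_L1 by (auto simp: time_L1_def jointly_borel_def)

lemma b_derivation: "t \<in> {0<..<T} \<Longrightarrow> derivation M \<Gamma> A (b t)"
  using b_borel by (auto simp: borel_family_def)

lemma measurable_static: "f \<in> borel_measurable M \<Longrightarrow> (\<lambda>(t, x). f x) \<in> borel_measurable N"
  by (simp add: split_beta')

lemma integrable_static:
  fixes f :: "'a \<Rightarrow> real"
  assumes f: "integrable M f"
  shows "integrable N (\<lambda>(t, x). f x)"
proof (rule pair.Fubini_integrable)
  show "(\<lambda>(t, x). f x) \<in> borel_measurable N" using f by (intro measurable_static) auto
qed (use f in auto)

text \<open>The bound holds on almost every slice; joint measurability of both sides turns this into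
  a single null set of the product. Taking |g| makes the right side nonnegative whatever the sign of
  g.\<close>

lemma b_bound: 
  assumes f: "f \<in> A"
  shows "AE p in N. case p of (t, x) \<Rightarrow> \<bar>b t f x\<bar> \<le> \<bar>g t x\<bar> * sqrt (\<Gamma> f f x)"
proof (rule pair.AE_pair_measure)
  have [measurable]: "(\<lambda>p. b (fst p) f (snd p)) \<in> borel_measurable N" "(\<lambda>p. g (fst p) (snd p)) \<in> borel_measurable N"
    using b_measurable[OF f] g_measurable by (simp_all add: split_beta')
  have [measurable]: "(\<lambda>x. sqrt (\<Gamma> f f x)) \<in> borel_measurable M" using sqrt_Gamma_integrable[OF f] by auto
  show "{p \<in> space N. case p of (t, x) \<Rightarrow> \<bar>b t f x\<bar> \<le> \<bar>g t x\<bar> * sqrt (\<Gamma> f f x)} \<in> sets N"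
    unfolding split_beta' by measurable
  have "AE t in time_space T. \<forall>f\<in>A. AE x in M. \<bar>b t f x\<bar> \<le> g t x * sqrt (\<Gamma> f f x)"
    using g_bound by (simp add: bounds_family_def AE_time)
  then show "AE t in time_space T. AE x in M. case (t, x) of (t, x) \<Rightarrow> \<bar>b t f x\<bar> \<le> \<bar>g t x\<bar> * sqrt (\<Gamma> f f x)"
  proof eventually_elim
    case (elim t)
    have fV: "f \<in> V" using f A_subset by auto
    from elim f have "AE x in M. \<bar>b t f x\<bar> \<le> g t x * sqrt (\<Gamma> f f x)" by blast
    with Gamma_nonneg[OF fV] show ?case
    proof eventually_elim
      case (elim x)
      have "g t x * sqrt (\<Gamma> f f x) \<le> \<bar>g t x\<bar> * sqrt (\<Gamma> f f x)" using elim by (intro mult_right_mono) auto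
      with elim show ?case by simp
    qed
  qed
qed

text \<open>For f in \<open>A\<close> the square root of \<open>\<Gamma> f f\<close> is integrable
  and bounded, hence has both moments that the pairing with L^2 + L^infinity asks for.\<close>

lemma b_integrable:
  assumes f: "f \<in> A"
  shows "integrable N (\<lambda>(t, x). b t f x)"
proof -
  define S where "S x = \<bar>sqrt (\<Gamma> f f x)\<bar>" for x
  have S: "integrable M S" unfolding S_def using sqrt_Gamma_integrable[OF f] by simp
  then have Sm[measurable]: "S \<in> borel_measurable M" by auto
  obtain R where R: "0 \<le> R" "AE x in M. S x \<le> R" using sqrt_Gamma_bounded[OF f] by (auto simp: S_def)
  define K where "K = (\<integral>x. S x \<partial>M) + (\<integral>x. R * S x \<partial>M)"
  have S0: "0 \<le> S x" for x by (simp add: S_def)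
  have i0: "0 \<le> (\<integral>x. S x \<partial>M)" "0 \<le> (\<integral>x. R * S x \<partial>M)" using S0 R by (auto intro!: integral_nonneg_AE)
  have "integrable N (\<lambda>(t, x). \<bar>g t x\<bar> * S x)"
  proof (rule time_L1_sum_integrable[OF sigma_finite_M g_L1, of "\<lambda>_. S" K])
    show "(\<lambda>(t, x). S x) \<in> borel_measurable N" by (rule measurable_static[OF Sm])
    have "(\<integral>\<^sup>+x. ennreal (S x) \<partial>M) = ennreal (\<integral>x. S x \<partial>M)"
      using S S0 by (intro nn_integral_eq_integral) auto
    then have 1: "(\<integral>\<^sup>+x. ennreal (S x) \<partial>M) \<le> ennreal K"
      using i0 by (auto simp: K_def intro!: ennreal_leI)
    have "(\<integral>\<^sup>+x. ennreal ((S x)\<^sup>2) \<partial>M) \<le> (\<integral>\<^sup>+x. ennreal (R * S x) \<partial>M)"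
      using R(2) by (intro nn_integral_mono_AE) (auto elim!: eventually_mono intro!: ennreal_leI mult_right_mono simp: power2_eq_square S0)
    also have "\<dots> = ennreal (\<integral>x. R * S x \<partial>M)"
      using S S0 R by (intro nn_integral_eq_integral) auto
    also have "\<dots> \<le> ennreal K" using i0 by (auto simp: K_def intro!: ennreal_leI)
    finally show "AE t in time_space T. (\<integral>\<^sup>+x. ennreal (S x) \<partial>M) \<le> ennreal K \<and> (\<integral>\<^sup>+x. ennreal ((S x)\<^sup>2) \<partial>M) \<le> ennreal K"
      using 1 by simp
  qed (rule S0)
  then show ?thesis
  proof (rule Bochner_Integration.integrable_bound[OF _ b_measurable[OF f]])
    show "AE p in N. norm (case p of (t, x) \<Rightarrow> b t f x) \<le> norm (case p of (t, x) \<Rightarrow> \<bar>g t x\<bar> * S x)"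
      using b_bound[OF f]
    proof eventually_elim
      case (elim p)
      obtain t x where p: "p = (t, x)" by fastforce
      have "\<bar>g t x\<bar> * sqrt (\<Gamma> f f x) \<le> \<bar>g t x\<bar> * S x" by (intro mult_left_mono) (auto simp: S_def)
      with elim show ?case by (simp add: p abs_mult S0)
    qed
  qed
qed

text \<open>\<open>test w w' v\<close>: \<open>w\<close> is a finite sum of products \<open>\<psi>(t) \<phi>(x)\<close> vanishing at \<open>T\<close>, with \<open>w' = \<partial>\<^sub>t w\<close> and \<open>v = dw(b)\<close>.\<close>
inductive test :: "(real \<Rightarrow> 'a \<Rightarrow> real) \<Rightarrow> (real \<Rightarrow> 'a \<Rightarrow> real) \<Rightarrow> (real \<Rightarrow> 'a \<Rightarrow> real) \<Rightarrow> bool" where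
  test_base: "\<lbrakk>\<phi> \<in> A; \<And>t. t \<in> {0..T} \<Longrightarrow> (\<psi> has_real_derivative \<psi>' t) (at t within {0..T});
     continuous_on {0..T} \<psi>'; \<psi> T = 0\<rbrakk>
   \<Longrightarrow> test (\<lambda>t x. \<psi> t * \<phi> x) (\<lambda>t x. \<psi>' t * \<phi> x) (\<lambda>t x. \<psi> t * b t \<phi> x)"
| test_add: "\<lbrakk>test w w' v; test z z' y\<rbrakk>
   \<Longrightarrow> test (\<lambda>t x. w t x + z t x) (\<lambda>t x. w' t x + z' t x) (\<lambda>t x. v t x + y t x)"

lemma test_scale: "test w w' v \<Longrightarrow> test (\<lambda>t x. c * w t x) (\<lambda>t x. c * w' t x) (\<lambda>t x. c * v t x)"
proof (induction rule: test.induct)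
  case (test_base \<phi> \<psi> \<psi>')
  have "test (\<lambda>t x. (c * \<psi> t) * \<phi> x) (\<lambda>t x. (c * \<psi>' t) * \<phi> x) (\<lambda>t x. (c * \<psi> t) * b t \<phi> x)"
    using test_base by (intro test.test_base) (auto intro!: DERIV_cmult continuous_intros)
  then show ?case by (simp add: mult.assoc)
next
  case (test_add w w' v z z' y)
  from test.test_add[OF test_add.IH] show ?case by (simp add: distrib_left)
qed

lemma test_A: "test w w' v \<Longrightarrow> w t \<in> A"
  by (induction rule: test.induct) (auto intro: A_scale A_add)

text \<open>The weak formulation sees v, assembled from the spatial factors, while the chain rule
  acts on \<open>b t (w t)\<close>; linearity of the derivation identifies them.\<close>

lemma test_b:
  assumes "test w w' v" and t: "t \<in> {0<..<T}"
  shows "AE x in M. b t (w t) x = v t x"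
  using assms(1)
proof (induction rule: test.induct)
  case (test_base \<phi> \<psi> \<psi>')
  then show ?case using derivation_scale[OF b_derivation[OF t]] by blast
next
  case (test_add w w' v z z' y)
  from test_add.IH derivation_add[OF b_derivation[OF t] test_A[OF test_add(1), of t] test_A[OF test_add(2), of t]]
  show ?case by eventually_elim simp
qed

lemma test_derivative: "test w w' v \<Longrightarrow> t \<in> {0..T} \<Longrightarrow> ((\<lambda>t. w t x) has_real_derivative w' t x) (at t within {0..T})"
  by (induction rule: test.induct) (auto intro!: derivative_eq_intros)

lemma test_continuous: "test w w' v \<Longrightarrow> continuous_on {0..T} (\<lambda>t. w' t x)"
  by (induction rule: test.induct) (auto intro!: continuous_intros)

lemma test_final: "test w w' v \<Longrightarrow> w T x = 0"
  by (induction rule: test.induct) auto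

text \<open>One integrable majorant for all times: it justifies Fubini in the energy estimate and
  bounds the function to which Gronwall is applied.\<close>

lemma test_dominated:
  "test w w' v \<Longrightarrow> \<exists>G. integrable M G \<and> (\<forall>x. 0 \<le> G x) \<and> (\<forall>t\<in>{0..T}. \<forall>x. \<bar>w t x\<bar> \<le> G x \<and> \<bar>w' t x\<bar> \<le> G x)"
proof (induction rule: test.induct)
  case (test_base \<phi> \<psi> \<psi>')
  have "continuous_on {0..T} \<psi>" using test_base(2) by (rule DERIV_continuous_on)
  then obtain B where B: "0 \<le> B" "\<And>t. t \<in> {0..T} \<Longrightarrow> \<bar>\<psi> t\<bar> \<le> B" using time_continuous_bounded by blast
  obtain B' where B': "0 \<le> B'" "\<And>t. t \<in> {0..T} \<Longrightarrow> \<bar>\<psi>' t\<bar> \<le> B'" using time_continuous_bounded[OF test_base(3)] by blast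
  show ?case
  proof (intro exI[of _ "\<lambda>x. (B + B') * \<bar>\<phi> x\<bar>"] conjI ballI allI)
    fix t x assume t: "t \<in> {0..T}"
    show "\<bar>\<psi> t * \<phi> x\<bar> \<le> (B + B') * \<bar>\<phi> x\<bar>" "\<bar>\<psi>' t * \<phi> x\<bar> \<le> (B + B') * \<bar>\<phi> x\<bar>"
      unfolding abs_mult using B B' t by (auto intro!: mult_right_mono simp: add_increasing add_increasing2)
  qed (use A_integrable[OF test_base(1)] B B' in auto)
next
  case (test_add w w' v z z' y)
  then obtain G G' where G: "integrable M G" "\<forall>x. 0 \<le> G x" "\<forall>t\<in>{0..T}. \<forall>x. \<bar>w t x\<bar> \<le> G x \<and> \<bar>w' t x\<bar> \<le> G x"
    "integrable M G'" "\<forall>x. 0 \<le> G' x" "\<forall>t\<in>{0..T}. \<forall>x. \<bar>z t x\<bar> \<le> G' x \<and> \<bar>z' t x\<bar> \<le> G' x" by blast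
  show ?case
  proof (intro exI[of _ "\<lambda>x. G x + G' x"] conjI ballI allI)
    fix t x assume "t \<in> {0..T}"
    then have "\<bar>w t x\<bar> \<le> G x" "\<bar>w' t x\<bar> \<le> G x" "\<bar>z t x\<bar> \<le> G' x" "\<bar>z' t x\<bar> \<le> G' x" using G by auto
    then show "\<bar>w t x + z t x\<bar> \<le> G x + G' x" "\<bar>w' t x + z' t x\<bar> \<le> G x + G' x" by auto
  qed (use G in auto)
qed

lemma test_measurable:
  "test w w' v \<Longrightarrow> (\<lambda>(t, x). w t x) \<in> borel_measurable N \<and> (\<lambda>(t, x). w' t x) \<in> borel_measurable N \<and> integrable N (\<lambda>(t, x). v t x)"
proof (induction rule: test.induct)
  case (test_base \<phi> \<psi> \<psi>')
  have c: "continuous_on {0..T} \<psi>" using test_base(2) by (rule DERIV_continuous_on)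
  then obtain B where B: "0 \<le> B" "\<And>t. t \<in> {0..T} \<Longrightarrow> \<bar>\<psi> t\<bar> \<le> B" using time_continuous_bounded by blast
  have [measurable]: "\<phi> \<in> borel_measurable M" "\<psi> \<in> borel_measurable (time_space T)" "\<psi>' \<in> borel_measurable (time_space T)"
    using borel_measurable_A[OF test_base(1)] borel_measurable_time_continuous c test_base(3) by auto
  have bm[measurable]: "(\<lambda>p. b (fst p) \<phi> (snd p)) \<in> borel_measurable N" using b_measurable[OF test_base(1)] by (simp add: split_beta')
  have "integrable N (\<lambda>(t, x). \<psi> t * b t \<phi> x)"
  proof (rule Bochner_Integration.integrable_bound[OF integrable_mult_right[of B, OF b_integrable[OF test_base(1)]]])
    show "(\<lambda>(t, x). \<psi> t * b t \<phi> x) \<in> borel_measurable N" unfolding split_beta' by measurable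
    show "AE p in N. norm (case p of (t, x) \<Rightarrow> \<psi> t * b t \<phi> x) \<le> norm (B * (case p of (t, x) \<Rightarrow> b t \<phi> x))"
      using B by (intro AE_I2) (auto simp: space_pair_measure abs_mult intro!: mult_right_mono)
  qed
  then show ?case unfolding split_beta' by auto
next
  case (test_add w w' v z z' y)
  then show ?case unfolding split_beta' by auto
qed

lemma test_integrable:
  assumes t: "test w w' v"
  shows "integrable N (\<lambda>(t, x). w' t x)"
proof -
  obtain G where G: "integrable M G" "\<forall>x. 0 \<le> G x" "\<forall>t\<in>{0..T}. \<forall>x. \<bar>w t x\<bar> \<le> G x \<and> \<bar>w' t x\<bar> \<le> G x"
    using test_dominated[OF t] by blast
  show ?thesis
    by (rule Bochner_Integration.integrable_bound[OF integrable_static[OF G(1)]])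
      (use test_measurable[OF t] G in \<open>auto simp: space_pair_measure intro!: AE_I2\<close>)
qed

text \<open>With z = w - l, let y be the space integral of the smoothed positive part of z. Then -
  y' is the integral of clip 1 (z / e) * (- w' - a). Here - w' = F + v + q and q <= a, so at most
  the positive part of F and the term clip * v remain. By the chain rule the latter is the
  derivation of a nonnegative function of w, and the one-sided divergence bound estimates its
  integral by d * y. Gronwall runs backwards from y T = 0. It enters as a hypothesis so that C0 is
  fixed before w.\<close>

lemma energy:
  assumes w: "test w w' v"
    and d: "integrable (time_space T) d" "\<And>t. 0 \<le> d t" "AE t in time_space T. AE x in M. h t x \<le> d t"
    and gronwall: "\<And>H y K. \<lbrakk>integrable (time_space T) H; \<And>s. 0 \<le> H s; y \<in> borel_measurable (time_space T);
        \<And>t. t \<in> {0..T} \<Longrightarrow> 0 \<le> y t; \<And>t. t \<in> {0..T} \<Longrightarrow> y t \<le> K;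
        \<And>t. t \<in> {0..T} \<Longrightarrow> y t \<le> (\<integral>s. indicator {t<..} s * (H s + d s * y s) \<partial>time_space T)\<rbrakk>
        \<Longrightarrow> y 0 \<le> C0 * (\<integral>s. H s \<partial>time_space T)"
    and l: "\<And>t. t \<in> {0..T} \<Longrightarrow> (l has_real_derivative - a t) (at t within {0..T})"
      "continuous_on {0..T} a" "\<And>t. t \<in> {0..T} \<Longrightarrow> 0 \<le> a t" "l T = 0" "\<And>t. t \<in> {0..T} \<Longrightarrow> 0 \<le> l t"
    and q: "integrable N q" "\<And>t x. t \<in> {0<..<T} \<Longrightarrow> 0 \<le> q (t, x) \<and> q (t, x) \<le> a t"
    and u: "integrable M ubar" "\<And>x. 0 \<le> ubar x" "\<And>x. ubar x \<le> m"
  shows "(\<integral>x. w 0 x * ubar x \<partial>M) - l 0 * (\<integral>x. ubar x \<partial>M)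
     \<le> m * C0 * (\<integral>p. max 0 (case p of (t, x) \<Rightarrow> - w' t x - v t x - q (t, x)) \<partial>N)"
proof -
  obtain G where G: "integrable M G" "\<And>x. 0 \<le> G x" "\<And>t x. t \<in> {0..T} \<Longrightarrow> \<bar>w t x\<bar> \<le> G x" "\<And>t x. t \<in> {0..T} \<Longrightarrow> \<bar>w' t x\<bar> \<le> G x"
    using test_dominated[OF w] by blast
  have lc: "continuous_on {0..T} l" using l(1) by (rule DERIV_continuous_on)
  obtain Ba where Ba: "0 \<le> Ba" "\<And>t. t \<in> {0..T} \<Longrightarrow> \<bar>a t\<bar> \<le> Ba" using time_continuous_bounded[OF l(2)] by blast
  have [measurable]: "l \<in> borel_measurable (time_space T)" "a \<in> borel_measurable (time_space T)"
    using borel_measurable_time_continuous lc l(2) by auto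
  have [measurable]: "(\<lambda>p. w (fst p) (snd p)) \<in> borel_measurable N" "(\<lambda>p. w' (fst p) (snd p)) \<in> borel_measurable N"
    using test_measurable[OF w] by (auto simp: split_beta')
  have v_int: "integrable N (\<lambda>(t, x). v t x)" using test_measurable[OF w] by auto
  define F where "F = (\<lambda>(t, x). - w' t x - v t x - q (t, x))"
  have F_int: "integrable N F"
    using test_integrable[OF w] v_int q(1) unfolding F_def split_beta' by auto
  define H where "H s = (\<integral>x. max 0 (F (s, x)) \<partial>M)" for s
  have Fp_int: "integrable N (\<lambda>p. max 0 (F p))" using F_int by auto
  have H_int: "integrable (time_space T) H" unfolding H_def by (rule pair.integrable_fst'[OF Fp_int])
  have H_eq: "(\<integral>s. H s \<partial>time_space T) = (\<integral>p. max 0 (F p) \<partial>N)"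
    unfolding H_def by (rule pair.integral_fst'[OF Fp_int])
  have H0: "0 \<le> H s" for s unfolding H_def by (intro integral_nonneg_AE) auto
  have main: "(\<integral>x. w 0 x * ubar x \<partial>M) - l 0 * (\<integral>x. ubar x \<partial>M) \<le> m * C0 * (\<integral>s. H s \<partial>time_space T) + e * ((\<integral>x. ubar x \<partial>M) / 2)"
    if e: "0 < e" for e
  proof -
    define z where "z t x = w t x - l t" for t x
    define y where "y t = (\<integral>x. soft_pos e (z t x) \<partial>M)" for t
    note sp = soft_pos_bounds[OF e]
    have sp_w: "soft_pos e (z t x) \<le> \<bar>w t x\<bar>" if "t \<in> {0..T}" for t x
      using sp(3)[of "z t x"] l(5)[OF that] by (auto simp: z_def)
    \<comment> \<open>The weight a depends on time alone and does not decay in space; since l >= 0,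
      the cutoff supplies the decay of w instead.\<close>
    have clip_w: "clip 1 (z t x / e) \<le> \<bar>w t x\<bar> / e" if "t \<in> {0..T}" for t x
    proof -
      have "max 0 (z t x) / e \<le> \<bar>w t x\<bar> / e"
        using e l(5)[OF that] by (intro divide_right_mono) (auto simp: z_def)
      then show ?thesis using sp(7)[of "z t x"] by simp
    qed
    have w_meas[measurable]: "w t \<in> borel_measurable M" for t using borel_measurable_A[OF test_A[OF w]] .
    have w_int: "integrable M (w t)" for t by (rule A_integrable[OF test_A[OF w]])
    have sp_int: "integrable M (\<lambda>x. soft_pos e (z t x))" if t: "t \<in> {0..T}" for t
    proof (rule Bochner_Integration.integrable_bound[OF w_int[of t]])
      show "AE x in M. norm (soft_pos e (z t x)) \<le> norm (w t x)" using sp(1) sp_w[OF t] by auto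
    qed (simp add: z_def)
    have y0: "0 \<le> y t" for t unfolding y_def using sp(1) by (intro integral_nonneg_AE) auto
    have yK: "y t \<le> (\<integral>x. G x \<partial>M)" if "t \<in> {0..T}" for t
      unfolding y_def
    proof (rule integral_mono[OF sp_int[OF that] G(1)])
      show "soft_pos e (z t x) \<le> G x" for x using sp_w[OF that, of x] G(3)[OF that, of x] by linarith
    qed
    have zm[measurable]: "(\<lambda>p. z (fst p) (snd p)) \<in> borel_measurable N" unfolding z_def by measurable
    have ym: "y \<in> borel_measurable (time_space T)"
      unfolding y_def using M.borel_measurable_lebesgue_integral[of "\<lambda>t x. soft_pos e (z t x)" "time_space T"]
      by (simp add: split_beta')
    \<comment> \<open>Minus the time derivative of the smoothed positive part of z: integrating it
      from t to T recovers the value at t, because z vanishes at T.\<close>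
    define \<Psi> where "\<Psi> s x = clip 1 (z s x / e) * (- w' s x - a s)" for s x
    have \<Psi>m[measurable]: "(\<lambda>p. \<Psi> (fst p) (snd p)) \<in> borel_measurable N" unfolding \<Psi>_def by measurable
    have \<Psi>_le: "\<bar>\<Psi> s x\<bar> \<le> (1 + Ba / e) * G x" if s: "s \<in> {0..T}" for s x
    proof -
      have "\<bar>- w' s x - a s\<bar> = \<bar>w' s x + a s\<bar>" by linarith
      then have "\<bar>\<Psi> s x\<bar> = clip 1 (z s x / e) * \<bar>w' s x + a s\<bar>"
        using sp(5)[of "z s x"] by (simp only: \<Psi>_def abs_mult abs_of_nonneg)
      also have "\<dots> \<le> clip 1 (z s x / e) * (\<bar>w' s x\<bar> + \<bar>a s\<bar>)" using sp(5)[of "z s x"] by (intro mult_left_mono) auto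
      also have "\<dots> = clip 1 (z s x / e) * \<bar>w' s x\<bar> + clip 1 (z s x / e) * \<bar>a s\<bar>" by (simp add: distrib_left)
      also have "\<dots> \<le> 1 * G x + (G x / e) * Ba"
      proof (intro add_mono mult_mono)
        show "clip 1 (z s x / e) \<le> G x / e"
          using clip_w[OF s, of x] G(3)[OF s, of x] e by (meson divide_right_mono less_imp_le order_trans)
      qed (use sp(6) G(2,4) Ba s e in auto)
      also have "\<dots> = (1 + Ba / e) * G x" by (simp add: algebra_simps)
      finally show ?thesis .
    qed
    have \<Psi>_int: "integrable N (\<lambda>(s, x). indicator {t<..} s * \<Psi> s x)" for t
    proof (rule Bochner_Integration.integrable_bound[OF integrable_static[OF integrable_mult_right[of "1 + Ba / e", OF G(1)]]])
      have [measurable]: "(indicator {t<..} :: real \<Rightarrow> real) \<in> borel_measurable (time_space T)"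
        by (intro measurable_restrict_space1) simp
      show "(\<lambda>(s, x). indicator {t<..} s * \<Psi> s x) \<in> borel_measurable N" unfolding split_beta' by measurable
      show "AE p in N. norm (case p of (s, x) \<Rightarrow> indicator {t<..} s * \<Psi> s x) \<le> norm (case p of (s, x) \<Rightarrow> (1 + Ba / e) * G x)"
      proof (rule AE_I2)
        fix p assume "p \<in> space N"
        then obtain s x where p: "p = (s, x)" "s \<in> {0..T}" by (auto simp: space_pair_measure)
        have "norm (indicator {t<..} s * \<Psi> s x) \<le> \<bar>\<Psi> s x\<bar>" by (auto simp: indicator_def)
        also have "\<dots> \<le> norm ((1 + Ba / e) * G x)" using \<Psi>_le[OF p(2), of x] by simp
        finally show "norm (case p of (s, x) \<Rightarrow> indicator {t<..} s * \<Psi> s x) \<le> norm (case p of (s, x) \<Rightarrow> (1 + Ba / e) * G x)"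
          using p by simp
      qed
    qed
    have FTC: "soft_pos e (z t x) = (\<integral>s. indicator {t<..} s * \<Psi> s x \<partial>time_space T)" if t: "t \<in> {0..T}" for t x
    proof -
      have zc: "continuous_on {0..T} (\<lambda>s. z s x)"
        unfolding z_def using DERIV_continuous_on[OF test_derivative[OF w]] lc by (intro continuous_intros)
      have "(\<integral>s. indicator {t<..<T} s * (clip 1 (z s x / e) * (w' s x + a s)) \<partial>time_space T)
          = soft_pos e (z T x) - soft_pos e (z t x)"
      proof (rule time_FTC)
        show "((\<lambda>s. soft_pos e (z s x)) has_real_derivative clip 1 (z s x / e) * (w' s x + a s)) (at s within {0..T})"
          if "s \<in> {0..T}" for s
        proof (rule DERIV_chain2[OF soft_pos_derivative[OF e]])
          have "((\<lambda>s. w s x - l s) has_real_derivative (w' s x - (- a s))) (at s within {0..T})"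
            by (intro derivative_intros test_derivative[OF w] l that)
          then show "((\<lambda>s. z s x) has_real_derivative w' s x + a s) (at s within {0..T})" by (simp add: z_def)
        qed
        show "continuous_on {0..T} (\<lambda>s. clip 1 (z s x / e) * (w' s x + a s))"
          using e by (intro continuous_intros continuous_on_compose2[OF continuous_soft_pos'[OF e, of UNIV] zc] test_continuous[OF w] l) auto
      qed (use t in auto)
      moreover have "soft_pos e (z T x) = 0" using test_final[OF w] l(4) sp(4) by (simp add: z_def)
      moreover have "(\<integral>s. indicator {t<..} s * \<Psi> s x \<partial>time_space T)
         = (\<integral>s. - (indicator {t<..<T} s * (clip 1 (z s x / e) * (w' s x + a s))) \<partial>time_space T)"
        by (intro Bochner_Integration.integral_cong) (auto simp: \<Psi>_def indicator_def algebra_simps)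
      ultimately show ?thesis by simp
    qed
    have y_eq: "y t = (\<integral>s. indicator {t<..} s * (\<integral>x. \<Psi> s x \<partial>M) \<partial>time_space T)" if t: "t \<in> {0..T}" for t
    proof -
      have "y t = (\<integral>x. (\<integral>s. indicator {t<..} s * \<Psi> s x \<partial>time_space T) \<partial>M)"
        unfolding y_def using FTC[OF t] by simp
      also have "\<dots> = (\<integral>s. (\<integral>x. indicator {t<..} s * \<Psi> s x \<partial>M) \<partial>time_space T)"
        by (rule pair.Fubini_integral[OF \<Psi>_int])
      finally show ?thesis by simp
    qed
    have \<Psi>_est: "AE s in time_space T. (\<integral>x. \<Psi> s x \<partial>M) \<le> H s + d s * y s"
      using pair.AE_integrable_fst'[OF v_int] pair.AE_integrable_fst'[OF Fp_int] pair.AE_integrable_fst'[OF \<Psi>_int[of 0]]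
        h_div d(3) AE_space
    proof eventually_elim
      case (elim s)
      then have s: "s \<in> {0..T}" "s \<in> {0<..<T}" by auto
      have \<Psi>s: "integrable M (\<Psi> s)" using elim(3) s by simp
      define c where "c x = clip 1 (z s x / e)" for x
      have c: "0 \<le> c x" "c x \<le> 1" for x using sp(5,6) by (auto simp: c_def)
      have [measurable]: "c \<in> borel_measurable M" unfolding c_def z_def by measurable
      have vs: "integrable M (v s)" using elim(1) by simp
      then have [measurable]: "v s \<in> borel_measurable M" by auto
      have cv: "integrable M (\<lambda>x. c x * v s x)"
        by (rule Bochner_Integration.integrable_bound[OF vs]) (use c in \<open>auto simp: abs_mult intro!: mult_left_le_one_le\<close>)
      have "(\<integral>x. \<Psi> s x \<partial>M) \<le> (\<integral>x. max 0 (F (s, x)) + c x * v s x \<partial>M)"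
      proof (rule integral_mono[OF \<Psi>s])
        show "integrable M (\<lambda>x. max 0 (F (s, x)) + c x * v s x)" using elim(2) cv by simp
        fix x
        have "\<Psi> s x = c x * (F (s, x) + (q (s, x) - a s)) + c x * v s x"
          by (simp add: \<Psi>_def F_def c_def algebra_simps)
        also have "c x * (F (s, x) + (q (s, x) - a s)) \<le> c x * max 0 (F (s, x))"
          using q(2)[OF s(2), of x] c by (intro mult_left_mono) auto
        also have "\<dots> \<le> max 0 (F (s, x))" using c by (intro mult_left_le_one_le) auto
        finally show "\<Psi> s x \<le> max 0 (F (s, x)) + c x * v s x" by simp
      qed
      also have "\<dots> = H s + (\<integral>x. c x * v s x \<partial>M)" using elim(2) cv by (simp add: H_def)
      also have "(\<integral>x. c x * v s x \<partial>M) \<le> d s * y s"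
      proof -
        \<comment> \<open>At a fixed time l s is a number, so the truncation of w - l is a C^1
          function of w alone. It vanishes at 0 because l s >= 0; hence the composition is in
          \<open>A\<close>, although w - l itself need not be. It is nonnegative, as the one-sided
          divergence bound requires.\<close>
        define \<beta> where "\<beta> r = soft_pos e (r - l s)" for r
        have \<beta>: "(\<beta> has_real_derivative clip 1 ((r - l s) / e)) (at r)" for r
        proof -
          have "((\<lambda>r. soft_pos e (r - l s)) has_real_derivative clip 1 ((r - l s) / e) * (1 - 0)) (at r)"
            by (intro DERIV_chain2[OF soft_pos_derivative[OF e]] derivative_intros)
          then show ?thesis by (simp add: \<beta>_def[abs_def])
        qed
        have \<beta>c: "continuous_on UNIV (\<lambda>r. clip 1 ((r - l s) / e))"
          by (intro continuous_on_compose2[OF continuous_soft_pos'[OF e, of UNIV]] continuous_intros) auto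
        have \<beta>0: "\<beta> 0 = 0" using sp(4)[of "- l s"] l(5)[OF s(1)] by (simp add: \<beta>_def)
        have \<beta>A: "(\<lambda>x. \<beta> (w s x)) \<in> A" by (rule A_comp[OF test_A[OF w] \<beta> \<beta>c \<beta>0])
        have "AE x in M. b s (\<lambda>x. \<beta> (w s x)) x = clip 1 ((w s x - l s) / e) * b s (w s) x"
          by (rule derivation_comp[OF b_derivation[OF s(2)] test_A[OF w] \<beta> \<beta>c \<beta>0])
        with test_b[OF w s(2)] have bs: "AE x in M. c x * v s x = b s (\<lambda>x. \<beta> (w s x)) x"
          by eventually_elim (simp add: c_def z_def)
        have "(\<integral>x. c x * v s x \<partial>M) = (\<integral>x. b s (\<lambda>x. \<beta> (w s x)) x \<partial>M)"
          using bs derivation_measurable[OF b_derivation[OF s(2)] \<beta>A] by (intro integral_cong_AE) auto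
        also have "\<dots> \<le> (\<integral>x. \<beta> (w s x) * h s x \<partial>M)"
          using elim(4) \<beta>A sp(1) by (auto simp: \<beta>_def)
        also have "\<dots> \<le> (\<integral>x. d s * soft_pos e (z s x) \<partial>M)"
        proof (rule integral_mono_AE')
          show "integrable M (\<lambda>x. d s * soft_pos e (z s x))" using sp_int[OF s(1)] by simp
          show "AE x in M. \<beta> (w s x) * h s x \<le> d s * soft_pos e (z s x)"
            using elim(5)
          proof eventually_elim
            case (elim x)
            then show ?case using sp(1)[of "z s x"] by (simp add: \<beta>_def z_def mult.commute[of "d s"] mult_left_mono)
          qed
          show "AE x in M. 0 \<le> d s * soft_pos e (z s x)" using d(2) sp(1) by simp
        qed
        also have "\<dots> = d s * y s" by (simp add: y_def)
        finally show ?thesis .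
      qed
      finally show ?case by simp
    qed
    have "y 0 \<le> C0 * (\<integral>s. H s \<partial>time_space T)"
    proof (rule gronwall[OF H_int H0 ym y0 yK])
      fix t assume t: "t \<in> {0..T}"
      have dm[measurable]: "d \<in> borel_measurable (time_space T)" "H \<in> borel_measurable (time_space T)" using d(1) H_int by auto
      have [measurable]: "(indicator {t<..} :: real \<Rightarrow> real) \<in> borel_measurable (time_space T)"
        by (intro measurable_restrict_space1) simp
      show "y t \<le> (\<integral>s. indicator {t<..} s * (H s + d s * y s) \<partial>time_space T)"
        unfolding y_eq[OF t]
      proof (rule integral_mono_AE)
        show "integrable (time_space T) (\<lambda>s. indicator {t<..} s * (\<integral>x. \<Psi> s x \<partial>M))"
          using pair.integrable_fst'[OF \<Psi>_int[of t]] by simp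
        show "integrable (time_space T) (\<lambda>s. indicator {t<..} s * (H s + d s * y s))"
        proof (rule Bochner_Integration.integrable_bound[OF Bochner_Integration.integrable_add[OF H_int integrable_mult_right[of "\<integral>x. G x \<partial>M", OF d(1)]]])
          show "AE s in time_space T. norm (indicator {t<..} s * (H s + d s * y s)) \<le> norm (H s + (\<integral>x. G x \<partial>M) * d s)"
          proof (rule AE_I2)
            fix s assume "s \<in> space (time_space T)"
            then have ys: "0 \<le> y s" "y s \<le> (\<integral>x. G x \<partial>M)" using y0 yK by auto
            have "0 \<le> d s * y s" "d s * y s \<le> (\<integral>x. G x \<partial>M) * d s"
              using ys d(2)[of s] by (auto simp: mult.commute[of "\<integral>x. G x \<partial>M"] intro!: mult_left_mono)
            then show "norm (indicator {t<..} s * (H s + d s * y s)) \<le> norm (H s + (\<integral>x. G x \<partial>M) * d s)"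
              using H0[of s] by (auto simp: indicator_def)
          qed
        qed (use ym in measurable)
        show "AE s in time_space T. indicator {t<..} s * (\<integral>x. \<Psi> s x \<partial>M) \<le> indicator {t<..} s * (H s + d s * y s)"
          using \<Psi>_est by eventually_elim (auto simp: indicator_def)
      qed
    qed
    \<comment> \<open>The bounds 0 <= ubar <= m, read at any one point, give 0 <= m.\<close>
    then have y0_le: "m * y 0 \<le> m * (C0 * (\<integral>s. H s \<partial>time_space T))"
      using u(2,3)[of undefined] by (intro mult_left_mono) auto
    have [measurable]: "ubar \<in> borel_measurable M" using u(1) by auto
    have ub: "\<bar>ubar x\<bar> \<le> m" for x using u(2,3)[of x] by simp
    have int_u: "integrable M (\<lambda>x. f x * ubar x)" if f: "integrable M f" for f
    proof (rule Bochner_Integration.integrable_bound[OF integrable_mult_right[of m, OF f]])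
      have [measurable]: "f \<in> borel_measurable M" using f by auto
      show "(\<lambda>x. f x * ubar x) \<in> borel_measurable M" by measurable
      show "AE x in M. norm (f x * ubar x) \<le> norm (m * f x)"
      proof (rule AE_I2)
        fix x have "\<bar>ubar x\<bar> \<le> \<bar>m\<bar>" using ub[of x] by simp
        then show "norm (f x * ubar x) \<le> norm (m * f x)"
          by (simp add: abs_mult mult.commute[of "\<bar>m\<bar>"] mult_left_mono)
      qed
    qed
    have s0: "(0::real) \<in> {0..T}" using T_pos by simp
    have "(\<integral>x. w 0 x * ubar x \<partial>M) - l 0 * (\<integral>x. ubar x \<partial>M) = (\<integral>x. w 0 x * ubar x - l 0 * ubar x \<partial>M)"
      using int_u[OF w_int] u(1) by simp
    \<comment> \<open>The smoothing error e / 2 is integrated against ubar, whose integral is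
      finite, and not against the possibly infinite measure.\<close>
    also have "\<dots> \<le> (\<integral>x. m * soft_pos e (z 0 x) + (e / 2) * ubar x \<partial>M)"
    proof (rule integral_mono)
      fix x
      have "w 0 x * ubar x - l 0 * ubar x = z 0 x * ubar x" by (simp add: z_def algebra_simps)
      also have "\<dots> \<le> (soft_pos e (z 0 x) + e / 2) * ubar x" using sp(2) u(2) by (intro mult_right_mono) auto
      also have "\<dots> \<le> m * soft_pos e (z 0 x) + (e / 2) * ubar x"
        using mult_left_mono[OF u(3)[of x] sp(1)[of "z 0 x"]] by (simp add: algebra_simps)
      finally show "w 0 x * ubar x - l 0 * ubar x \<le> m * soft_pos e (z 0 x) + (e / 2) * ubar x" .
    qed (use int_u[OF w_int] u(1) sp_int[OF s0] in auto)
    also have "\<dots> = m * y 0 + (e / 2) * (\<integral>x. ubar x \<partial>M)"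
      using sp_int[OF s0] u(1) by (simp add: y_def)
    finally show ?thesis using y0_le by (simp add: mult_ac)
  qed
  have B0: "0 \<le> (\<integral>x. ubar x \<partial>M)" using u(2) by (intro integral_nonneg_AE) auto
  have "(\<integral>x. w 0 x * ubar x \<partial>M) - l 0 * (\<integral>x. ubar x \<partial>M) \<le> m * C0 * (\<integral>s. H s \<partial>time_space T)"
  proof (rule field_le_epsilon)
    fix e :: real assume e: "0 < e"
    define B where "B = (\<integral>x. ubar x \<partial>M) / 2"
    have "0 < e / (B + 1)" using e B0 by (simp add: B_def)
    from main[OF this] have "(\<integral>x. w 0 x * ubar x \<partial>M) - l 0 * (\<integral>x. ubar x \<partial>M)
       \<le> m * C0 * (\<integral>s. H s \<partial>time_space T) + e / (B + 1) * B" by (simp add: B_def)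
    also have "e / (B + 1) * B \<le> e" using e B0 by (simp add: B_def field_simps)
    finally show "(\<integral>x. w 0 x * ubar x \<partial>M) - l 0 * (\<integral>x. ubar x \<partial>M) \<le> m * C0 * (\<integral>s. H s \<partial>time_space T) + e" by simp
  qed
  then show ?thesis unfolding H_eq F_def .
qed

end

section \<open>Bounded solutions\<close>

text \<open>A strict violation at t persists on a neighbourhood, which meets (0, T) in positive
  length even when t is an end point.\<close>

lemma time_continuous_AE_le:
  fixes f :: "real \<Rightarrow> real"
  assumes T: "0 < T" and f: "continuous_on {0..T} f" and ae: "AE t in time_space T. f t \<le> R" and t: "t \<in> {0..T}"
  shows "f t \<le> R"
proof (rule ccontr)
  assume "\<not> f t \<le> R"
  then have "0 < f t - R" by simp
  with f t obtain \<delta> where \<delta>: "0 < \<delta>" "\<And>s. s \<in> {0..T} \<Longrightarrow> dist s t < \<delta> \<Longrightarrow> dist (f s) (f t) < f t - R"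
    unfolding continuous_on_iff by metis
  define J where "J = {max 0 (t - \<delta>)<..<min T (t + \<delta>)}"
  have "AE s in lborel. s \<notin> J"
    using ae unfolding AE_time
  proof eventually_elim
    case (elim s)
    show ?case
    proof
      assume s: "s \<in> J"
      then have "s \<in> {0..T}" "dist s t < \<delta>" "s \<in> {0<..<T}" by (auto simp: J_def dist_real_def abs_less_iff)
      with \<delta>(2)[of s] elim show False by (auto simp: dist_real_def)
    qed
  qed
  moreover have Js: "J \<in> sets lborel" by (simp add: J_def)
  ultimately have "J \<in> null_sets lborel" using AE_iff_null_sets[OF Js] by blast
  then have "emeasure lborel J = 0" by (rule null_setsD1)
  moreover have "max 0 (t - \<delta>) < min T (t + \<delta>)" using T t \<delta>(1) by auto
  ultimately show False unfolding J_def by (simp only: emeasure_lborel_Ioo[OF less_imp_le] ennreal_eq_0_iff)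
qed

text \<open>Mass bounds can be tested on sets of finite measure, whose indicators are integrable;
  monotone convergence then reaches the whole space.\<close>

lemma nn_integral_le_exhaustion:
  fixes f :: "'a \<Rightarrow> real"
  assumes X: "incseq X" "(\<Union>i. X i) = space M" "\<And>i. X i \<in> sets M" and f[measurable]: "f \<in> borel_measurable M"
    and f0: "\<And>x. 0 \<le> f x" and le: "\<And>i. (\<integral>\<^sup>+x. ennreal (indicator (X i) x * f x) \<partial>M) \<le> B"
  shows "(\<integral>\<^sup>+x. ennreal (f x) \<partial>M) \<le> B"
proof -
  have [measurable]: "X i \<in> sets M" for i by (rule X)
  have "(\<integral>\<^sup>+x. ennreal (f x) \<partial>M) = (\<integral>\<^sup>+x. (SUP i. ennreal (indicator (X i) x * f x)) \<partial>M)"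
  proof (rule nn_integral_cong)
    fix x assume "x \<in> space M"
    then obtain i where "x \<in> X i" using X(2) by auto
    then have "ennreal (f x) \<le> (SUP i. ennreal (indicator (X i) x * f x))" by (intro SUP_upper2[of i]) auto
    moreover have "(SUP i. ennreal (indicator (X i) x * f x)) \<le> ennreal (f x)"
      using f0 by (intro SUP_least ennreal_leI) (auto simp: indicator_def)
    ultimately show "ennreal (f x) = (SUP i. ennreal (indicator (X i) x * f x))" by (rule antisym)
  qed
  also have "\<dots> = (SUP i. \<integral>\<^sup>+x. ennreal (indicator (X i) x * f x) \<partial>M)"
  proof (rule nn_integral_monotone_convergence_SUP)
    show "incseq (\<lambda>i x. ennreal (indicator (X i) x * f x))"
      using X(1) f0 by (auto simp: incseq_def le_fun_def indicator_def intro!: ennreal_leI)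
  qed measurable
  also have "\<dots> \<le> B" by (intro SUP_least le)
  finally show ?thesis .
qed

context transport
begin

definition flux :: "('a \<Rightarrow> real) \<Rightarrow> (real \<Rightarrow> 'a \<Rightarrow> real) \<Rightarrow> real \<Rightarrow> real" where
  "flux \<phi> u s = (\<integral>x. b s \<phi> x * u s x \<partial>M)"

text \<open>The dual variables of the constraint \<open>\<parallel>u(t)\<parallel>\<^sub>1 \<le> \<parallel>ubar\<parallel>\<^sub>1\<close>: \<open>q(t, \<cdot>)\<close> takes values in \<open>[0, a(t)]\<close> and \<open>l(t)\<close> is the
  integral of \<open>a\<close> over \<open>[t, T]\<close>.\<close>
definition adm :: "(real \<Rightarrow> real) \<Rightarrow> (real \<Rightarrow> real) \<Rightarrow> (real \<times> 'a \<Rightarrow> real) \<Rightarrow> bool" where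
  "adm l a q \<longleftrightarrow> (\<forall>t\<in>{0..T}. (l has_real_derivative - a t) (at t within {0..T})) \<and>
     continuous_on {0..T} a \<and> (\<forall>t\<in>{0..T}. 0 \<le> a t) \<and> l T = 0 \<and> (\<forall>t\<in>{0..T}. 0 \<le> l t) \<and>
     integrable N q \<and> (\<forall>t\<in>{0<..<T}. \<forall>x. 0 \<le> q (t, x) \<and> q (t, x) \<le> a t)"

lemma adm_zero: "adm (\<lambda>_. 0) (\<lambda>_. 0) (\<lambda>_. 0)"
  by (auto simp: adm_def)

lemma adm_add: "adm l a q \<Longrightarrow> adm l' a' q' \<Longrightarrow> adm (\<lambda>t. l t + l' t) (\<lambda>t. a t + a' t) (\<lambda>p. q p + q' p)"
  unfolding adm_def
  by (auto intro!: derivative_eq_intros continuous_intros add_mono)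

lemma adm_scale: "adm l a q \<Longrightarrow> 0 \<le> c \<Longrightarrow> adm (\<lambda>t. c * l t) (\<lambda>t. c * a t) (\<lambda>p. c * q p)"
  unfolding adm_def
  by (auto intro!: derivative_eq_intros continuous_intros mult_left_mono)

lemma test_zero: "test (\<lambda>_ _. 0) (\<lambda>_ _. 0) (\<lambda>_ _. 0)"
  using test_base[OF zero_A, of "\<lambda>_. 0" "\<lambda>_. 0"] by auto

text \<open>The compatibility condition that \<open>box_duality\<close> demands of the pair with
  function - w' - v - q and number (integral of w 0 * ubar) - l 0 * (integral of ubar).\<close>

definition energy_bound :: "('a \<Rightarrow> real) \<Rightarrow> real \<Rightarrow> bool" where
  "energy_bound ubar C \<longleftrightarrow> (\<forall>w w' v l a q. test w w' v \<longrightarrow> adm l a q \<longrightarrow>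
    (\<integral>x. w 0 x * ubar x \<partial>M) - l 0 * (\<integral>x. ubar x \<partial>M)
     \<le> C * (\<integral>p. max 0 (case p of (t, x) \<Rightarrow> - w' t x - v t x - q (t, x)) \<partial>N))"

text \<open>The constant 2 * exp(kappa T) comes from T and the majorant d of h alone. The resulting
  bound is linear in the supremum m of the datum, so all dyadic levels can share one C0.\<close>

lemma energy_constant:
  "\<exists>C0\<ge>0. \<forall>ubar m. integrable M ubar \<longrightarrow> (\<forall>x. 0 \<le> ubar x \<and> ubar x \<le> m) \<longrightarrow> energy_bound ubar (m * C0)"
proof -
  obtain d where d: "integrable (time_space T) d" "\<And>t. 0 \<le> d t" "AE t in time_space T. AE x in M. h t x \<le> d t"
    using time_L1_infinity_majorant[OF sigma_finite_M h_L1] by blast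
  obtain \<kappa> where \<kappa>: "0 < \<kappa>" "\<And>t. t \<in> {0..T} \<Longrightarrow> (\<integral>s. indicator {t<..} s * (d s * exp (- \<kappa> * (s - t))) \<partial>time_space T) \<le> 1 / 2"
    using exp_kernel_small[OF d(1,2)] by blast
  show ?thesis
  proof (intro exI[of _ "2 * exp (\<kappa> * T)"] conjI allI impI)
    fix m and ubar :: "'a \<Rightarrow> real"
    assume u: "integrable M ubar" "\<forall>x. 0 \<le> ubar x \<and> ubar x \<le> m"
    show "energy_bound ubar (m * (2 * exp (\<kappa> * T)))"
      unfolding energy_bound_def
    proof (intro allI impI)
      fix w w' v l a q assume w: "test w w' v" and adm: "adm l a q"
      show "(\<integral>x. w 0 x * ubar x \<partial>M) - l 0 * (\<integral>x. ubar x \<partial>M)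
        \<le> m * (2 * exp (\<kappa> * T)) * (\<integral>p. max 0 (case p of (t, x) \<Rightarrow> - w' t x - v t x - q (t, x)) \<partial>N)"
      proof (rule energy[where d=d and a=a, OF w d])
        show "y 0 \<le> 2 * exp (\<kappa> * T) * (\<integral>s. H s \<partial>time_space T)"
          if "integrable (time_space T) H" "\<And>s. 0 \<le> H s" "y \<in> borel_measurable (time_space T)"
            "\<And>t. t \<in> {0..T} \<Longrightarrow> 0 \<le> y t" "\<And>t. t \<in> {0..T} \<Longrightarrow> y t \<le> K"
            "\<And>t. t \<in> {0..T} \<Longrightarrow> y t \<le> (\<integral>s. indicator {t<..} s * (H s + d s * y s) \<partial>time_space T)" for H y K
          by (rule backward_gronwall[OF T_pos d(1,2) \<kappa> that])
      qed (use adm u in \<open>auto simp: adm_def\<close>)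
    qed
  qed simp
qed

text \<open>The constraints \<open>\<integral> q u \<le> l 0 \<integral> ubar\<close> carry the \<open>L\<^sup>1\<close> bound of the solution.\<close>
lemma space_time_solution:
  assumes C0: "0 \<le> C0" and energy: "energy_bound ubar C0"
    and ubar: "integrable M ubar" "\<And>x. \<bar>ubar x\<bar> \<le> m"
  shows "\<exists>u \<in> borel_measurable N. (\<forall>p. 0 \<le> u p \<and> u p \<le> C0) \<and>
    (\<forall>w w' v. test w w' v \<longrightarrow> (\<integral>p. (case p of (t, x) \<Rightarrow> - w' t x - v t x) * u p \<partial>N) = (\<integral>x. w 0 x * ubar x \<partial>M)) \<and>
    (\<forall>l a q. adm l a q \<longrightarrow> (\<integral>p. q p * u p \<partial>N) \<le> l 0 * (\<integral>x. ubar x \<partial>M))"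
proof -
  define F where "F w' v q = (\<lambda>p. case p of (t, x) \<Rightarrow> - w' t x - v t x - q (t, x))"
    for w' v :: "real \<Rightarrow> 'a \<Rightarrow> real" and q :: "real \<times> 'a \<Rightarrow> real"
  define c where "c w l = (\<integral>x. w 0 x * ubar x \<partial>M) - l 0 * (\<integral>x. ubar x \<partial>M)"
    for w :: "real \<Rightarrow> 'a \<Rightarrow> real" and l :: "real \<Rightarrow> real"
  have um[measurable]: "ubar \<in> borel_measurable M" using ubar by auto
  have wu_int: "integrable M (\<lambda>x. w t x * ubar x)" if "test w w' v" for w w' v t
  proof (rule Bochner_Integration.integrable_bound[OF integrable_mult_right[of m, OF A_integrable[OF test_A[OF that, of t]]]])
    have [measurable]: "w t \<in> borel_measurable M" by (rule borel_measurable_A[OF test_A[OF that]])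
    show "(\<lambda>x. w t x * ubar x) \<in> borel_measurable M" by measurable
    show "AE x in M. norm (w t x * ubar x) \<le> norm (m * w t x)"
    proof (rule AE_I2)
      fix x have "\<bar>ubar x\<bar> \<le> \<bar>m\<bar>" using ubar(2)[of x] by simp
      then show "norm (w t x * ubar x) \<le> norm (m * w t x)"
        by (simp add: abs_mult mult.commute[of "\<bar>m\<bar>"] mult_left_mono)
    qed
  qed
  \<comment> \<open>One cone holds two kinds of constraint: the equation, through w, where both
    signs occur, and the mass bounds, through q, where one sign occurs.\<close>
  define P where "P = {(F w' v q, c w l) | w w' v l a q. test w w' v \<and> adm l a q}"
  have PI: "(F w' v q, c w l) \<in> P" if "test w w' v" "adm l a q" for w w' v l a q
    using that unfolding P_def by blast
  have "\<exists>u \<in> borel_measurable N. (\<forall>p. 0 \<le> u p \<and> u p \<le> C0) \<and> (\<forall>(G, e) \<in> P. e \<le> (\<integral>p. G p * u p \<partial>N))"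
  proof (rule sigma_finite_measure.box_duality)
    show "sigma_finite_measure N" by unfold_locales
    show "convex_cone_of_pairs P"
      unfolding convex_cone_of_pairs_def
    proof (intro conjI allI impI)
      show "P \<noteq> {}" using PI[OF test_zero adm_zero] by blast
      fix G e G' e' assume "(G, e) \<in> P" "(G', e') \<in> P"
      then obtain w w' v l a q z z' y k d r where
        1: "test w w' v" "adm l a q" "G = F w' v q" "e = c w l" "test z z' y" "adm k d r" "G' = F z' y r" "e' = c z k"
        unfolding P_def by blast
      have "(\<lambda>x. G x + G' x) = F (\<lambda>t x. w' t x + z' t x) (\<lambda>t x. v t x + y t x) (\<lambda>p. q p + r p)"
        unfolding 1 F_def by (auto simp: fun_eq_iff)
      moreover have "e + e' = c (\<lambda>t x. w t x + z t x) (\<lambda>t. l t + k t)"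
        unfolding 1 c_def using wu_int[OF 1(1)] wu_int[OF 1(5)] by (simp add: algebra_simps)
      ultimately show "(\<lambda>x. G x + G' x, e + e') \<in> P"
        using PI[OF test_add[OF 1(1,5)] adm_add[OF 1(2,6)]] by simp
    next
      fix G e and s :: real assume "(G, e) \<in> P" "0 \<le> s"
      then obtain w w' v l a q where 1: "test w w' v" "adm l a q" "G = F w' v q" "e = c w l"
        unfolding P_def by blast
      have "(\<lambda>x. s * G x) = F (\<lambda>t x. s * w' t x) (\<lambda>t x. s * v t x) (\<lambda>p. s * q p)"
        unfolding 1 F_def by (auto simp: fun_eq_iff algebra_simps)
      moreover have "s * e = c (\<lambda>t x. s * w t x) (\<lambda>t. s * l t)"
        unfolding 1 c_def by (simp add: algebra_simps)
      ultimately show "(\<lambda>x. s * G x, s * e) \<in> P"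
        using PI[OF test_scale[OF 1(1)] adm_scale[OF 1(2) \<open>0 \<le> s\<close>], of s] by simp
    qed
    show "0 \<le> C0" by fact
    fix G e assume "(G, e) \<in> P"
    then obtain w w' v l a q where 1: "test w w' v" "adm l a q" "G = F w' v q" "e = c w l"
      unfolding P_def by blast
    have "integrable N (\<lambda>(t, x). w' t x)" "integrable N (\<lambda>(t, x). v t x)" "integrable N q"
      using test_integrable[OF 1(1)] test_measurable[OF 1(1)] 1(2) by (auto simp: adm_def)
    then show "integrable N G" unfolding 1 F_def by (simp add: split_beta')
    show "e \<le> C0 * (\<integral>p. max 0 (G p) \<partial>N)"
      using energy 1(1,2) unfolding energy_bound_def 1 c_def F_def by blast
  qed
  then obtain u where u: "u \<in> borel_measurable N" "\<And>p. 0 \<le> u p \<and> u p \<le> C0"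
    "\<And>G e. (G, e) \<in> P \<Longrightarrow> e \<le> (\<integral>p. G p * u p \<partial>N)" by blast
  show ?thesis
  proof (intro bexI[OF _ u(1)] conjI allI impI)
    fix w w' v assume w: "test w w' v"
    have 1: "c w (\<lambda>_. 0) \<le> (\<integral>p. F w' v (\<lambda>_. 0) p * u p \<partial>N)" by (rule u(3)[OF PI[OF w adm_zero]])
    \<comment> \<open>Since - w is a test function as well, the inequality for w is an
      equality.\<close>
    have 2: "c (\<lambda>t x. (-1) * w t x) (\<lambda>_. 0) \<le> (\<integral>p. F (\<lambda>t x. (-1) * w' t x) (\<lambda>t x. (-1) * v t x) (\<lambda>_. 0) p * u p \<partial>N)"
      by (rule u(3)[OF PI[OF test_scale[OF w] adm_zero]])
    have 3: "F (\<lambda>t x. (-1) * w' t x) (\<lambda>t x. (-1) * v t x) (\<lambda>_. 0) p * u p = - (F w' v (\<lambda>_. 0) p * u p)" for p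
      by (auto simp: F_def algebra_simps split: prod.split)
    from 2 have "- c w (\<lambda>_. 0) \<le> - (\<integral>p. F w' v (\<lambda>_. 0) p * u p \<partial>N)" unfolding 3 by (simp add: c_def)
    with 1 show "(\<integral>p. (case p of (t, x) \<Rightarrow> - w' t x - v t x) * u p \<partial>N) = (\<integral>x. w 0 x * ubar x \<partial>M)"
      by (simp add: F_def c_def)
  next
    fix l a q assume a: "adm l a q"
    have "F (\<lambda>_ _. 0) (\<lambda>_ _. 0) q = (\<lambda>p. - q p)" by (auto simp: F_def)
    then show "(\<integral>p. q p * u p \<partial>N) \<le> l 0 * (\<integral>x. ubar x \<partial>M)"
      using u(3)[OF PI[OF test_zero a]] by (simp add: c_def)
  qed (use u(2) in auto)
qed

lemma bounded_times_integrable: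
  fixes f u :: "real \<times> 'a \<Rightarrow> real"
  assumes f: "integrable N f" and u: "u \<in> borel_measurable N" "\<And>p. 0 \<le> u p \<and> u p \<le> C"
  shows "integrable N (\<lambda>p. f p * u p)"
proof (rule Bochner_Integration.integrable_bound[OF integrable_mult_right[of C, OF f]])
  show "(\<lambda>p. f p * u p) \<in> borel_measurable N" using f u(1) by auto
  show "AE p in N. norm (f p * u p) \<le> norm (C * f p)"
  proof (rule AE_I2)
    fix p have "\<bar>u p\<bar> \<le> \<bar>C\<bar>" using u(2)[of p] by simp
    then show "norm (f p * u p) \<le> norm (C * f p)"
      by (simp add: abs_mult mult.commute[of "\<bar>C\<bar>"] mult_left_mono)
  qed
qed

text \<open>The time factor is removed: psi is the primitive, vanishing at T, of an arbitrary
  continuous weight - xi with xi >= 0. Integration by parts moves the term with psi onto xi, and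
  varying xi gives the identity at almost every time, outside a null set that still depends on the
  test function.\<close>

lemma space_time_solution_at_time:
  assumes C0: "0 \<le> C0" and energy: "energy_bound ubar C0"
    and ubar: "integrable M ubar" "\<And>x. 0 \<le> ubar x" "\<And>x. ubar x \<le> m"
  shows "\<exists>u. (\<lambda>(t, x). u t x) \<in> borel_measurable N \<and> (\<forall>t x. 0 \<le> u t x \<and> u t x \<le> C0) \<and>
    (\<forall>\<phi>\<in>A. AE t in time_space T. (\<integral>x. \<phi> x * u t x \<partial>M)
        = (\<integral>x. \<phi> x * ubar x \<partial>M) + (\<integral>s. indicator {..<t} s * flux \<phi> u s \<partial>time_space T)) \<and>
    (AE t in time_space T. (\<integral>\<^sup>+x. ennreal (u t x) \<partial>M) \<le> ennreal (\<integral>x. ubar x \<partial>M))"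
proof -
  have "\<bar>ubar x\<bar> \<le> m" for x using ubar(2,3)[of x] by simp
  from space_time_solution[OF C0 energy ubar(1) this] obtain u where um: "u \<in> borel_measurable N"
    and ub: "\<And>p. 0 \<le> u p \<and> u p \<le> C0"
    and u_test: "\<And>w w' v. test w w' v \<Longrightarrow> (\<integral>p. (case p of (t, x) \<Rightarrow> - w' t x - v t x) * u p \<partial>N) = (\<integral>x. w 0 x * ubar x \<partial>M)"
    and u_adm: "\<And>l a q. adm l a q \<Longrightarrow> (\<integral>p. q p * u p \<partial>N) \<le> l 0 * (\<integral>x. ubar x \<partial>M)"
    by blast
  define U where "U t x = u (t, x)" for t x
  note bi = bounded_times_integrable[OF _ um ub]
  have \<psi>0: "\<psi> 0 - \<psi> t = (\<integral>s. indicator {0<..<t} s * \<xi> s \<partial>time_space T)" "0 \<le> (\<psi> t :: real)"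
    if "\<And>t. t \<in> {0..T} \<Longrightarrow> (\<psi> has_real_derivative - \<xi> t) (at t within {0..T})" "\<psi> T = 0"
      "continuous_on {0..T} \<xi>" "\<And>s. 0 \<le> \<xi> s" "t \<in> {0..T}" for \<psi> \<xi> t
  proof -
    have c: "continuous_on {0..T} (\<lambda>s. - \<xi> s)" using that(3) by (intro continuous_intros)
    from time_FTC[OF _ _ _ that(1) c, of 0 t] that(5)
    show "\<psi> 0 - \<psi> t = (\<integral>s. indicator {0<..<t} s * \<xi> s \<partial>time_space T)" by simp
    from time_FTC[OF _ _ _ that(1) c, of t T] that(5) \<open>\<psi> T = 0\<close>
    have "\<psi> t = (\<integral>s. indicator {t<..<T} s * \<xi> s \<partial>time_space T)" by simp
    also have "\<dots> \<ge> 0" using that(4) by (intro integral_nonneg_AE) auto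
    finally show "0 \<le> \<psi> t" .
  qed
  have \<psi>T: "\<psi> 0 = (\<integral>s. \<xi> s \<partial>time_space T)"
    if "\<And>t. t \<in> {0..T} \<Longrightarrow> (\<psi> has_real_derivative - \<xi> t) (at t within {0..T})" "\<psi> T = 0"
      "continuous_on {0..T} \<xi>" "\<And>s. 0 \<le> \<xi> s" for \<psi> \<xi> :: "real \<Rightarrow> real"
  proof -
    have "\<psi> 0 = (\<integral>s. indicator {0<..<T} s * \<xi> s \<partial>time_space T)" using \<psi>0(1)[OF that, of T] T_pos that(2) by simp
    also have "\<dots> = (\<integral>s. \<xi> s \<partial>time_space T)" by (intro Bochner_Integration.integral_cong) auto
    finally show ?thesis .
  qed
  have eq: "AE t in time_space T. (\<integral>x. \<phi> x * U t x \<partial>M)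
        = (\<integral>x. \<phi> x * ubar x \<partial>M) + (\<integral>s. indicator {..<t} s * flux \<phi> U s \<partial>time_space T)" if \<phi>: "\<phi> \<in> A" for \<phi>
  proof -
    define c where "c = (\<integral>x. \<phi> x * ubar x \<partial>M)"
    define K where "K t = (\<integral>s. indicator {..<t} s * flux \<phi> U s \<partial>time_space T)" for t
    define \<mu> where "\<mu> t = (\<integral>x. \<phi> x * U t x \<partial>M)" for t
    have i1: "integrable N (\<lambda>p. (case p of (t, x) \<Rightarrow> \<phi> x) * u p)" by (rule bi[OF integrable_static[OF A_integrable[OF \<phi>]]])
    have i2: "integrable N (\<lambda>p. (case p of (t, x) \<Rightarrow> b t \<phi> x) * u p)" by (rule bi[OF b_integrable[OF \<phi>]])
    have \<mu>i: "integrable (time_space T) \<mu>" using pair.integrable_fst'[OF i1] by (simp add: \<mu>_def[abs_def] U_def)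
    have fi: "integrable (time_space T) (flux \<phi> U)"
      using pair.integrable_fst'[OF i2] by (simp add: flux_def[abs_def] U_def)
    have Kc: "continuous_on {0..T} K" unfolding K_def by (rule time_indefinite_integral_continuous[OF fi])
    obtain BK where BK: "\<And>t. t \<in> {0..T} \<Longrightarrow> \<bar>K t\<bar> \<le> BK" using time_continuous_bounded[OF Kc] by blast
    have Ki: "integrable (time_space T) K"
      using BK by (intro time_integrable_bounded[where B=BK, OF borel_measurable_time_continuous[OF Kc]]) auto
    define Q where "Q t = \<mu> t - c - K t" for t
    have Qi: "integrable (time_space T) Q" unfolding Q_def using \<mu>i Ki by auto
    \<comment> \<open>Nonnegative weights are enough, because the one-sided criterion is applied to
      Q and to - Q.\<close>
    have zero: "(\<integral>t. \<xi> t * Q t \<partial>time_space T) = 0" if \<xi>: "continuous_on {0..T} \<xi>" "\<And>s. 0 \<le> \<xi> s" for \<xi>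
    proof -
      obtain \<psi> where \<psi>: "\<And>t. t \<in> {0..T} \<Longrightarrow> (\<psi> has_real_derivative - \<xi> t) (at t within {0..T})" "\<psi> T = 0"
        using time_antiderivative[OF \<xi>(1)] T_pos by auto
      have \<xi>c: "continuous_on {0..T} (\<lambda>s. - \<xi> s)" using \<xi>(1) by (intro continuous_intros)
      have \<psi>c: "continuous_on {0..T} \<psi>" using \<psi>(1) by (rule DERIV_continuous_on)
      have m: "\<xi> \<in> borel_measurable (time_space T)" "\<psi> \<in> borel_measurable (time_space T)"
        using borel_measurable_time_continuous \<xi>(1) \<psi>c by auto
      obtain B1 where B1: "\<And>t. t \<in> {0..T} \<Longrightarrow> \<bar>\<xi> t\<bar> \<le> B1" using time_continuous_bounded[OF \<xi>(1)] by blast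
      obtain B2 where B2: "\<And>t. t \<in> {0..T} \<Longrightarrow> \<bar>\<psi> t\<bar> \<le> B2" using time_continuous_bounded[OF \<psi>c] by blast
      have mult_int: "integrable (time_space T) (\<lambda>t. \<rho> t * f t)" 
        if "\<rho> \<in> borel_measurable (time_space T)" "\<And>t. t \<in> {0..T} \<Longrightarrow> \<bar>\<rho> t\<bar> \<le> B" "integrable (time_space T) f" for \<rho> f :: "real \<Rightarrow> real" and B
      proof (rule Bochner_Integration.integrable_bound[OF integrable_mult_right[of B, OF that(3)]])
        show "(\<lambda>t. \<rho> t * f t) \<in> borel_measurable (time_space T)" using that(1,3) by auto
        show "AE t in time_space T. norm (\<rho> t * f t) \<le> norm (B * f t)"
        proof (rule AE_I2)
          fix t assume "t \<in> space (time_space T)"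
          then have "\<bar>\<rho> t\<bar> \<le> \<bar>B\<bar>" using that(2)[of t] by auto
          then show "norm (\<rho> t * f t) \<le> norm (B * f t)" by (simp add: abs_mult mult_right_mono)
        qed
      qed
      have tst: "test (\<lambda>t x. \<psi> t * \<phi> x) (\<lambda>t x. - \<xi> t * \<phi> x) (\<lambda>t x. \<psi> t * b t \<phi> x)"
        by (rule test_base[OF \<phi> \<psi>(1) \<xi>c \<psi>(2)])
      have iN: "integrable N (\<lambda>p. (case p of (t, x) \<Rightarrow> - (- \<xi> t * \<phi> x) - \<psi> t * b t \<phi> x) * u p)"
      proof (rule bi)
        show "integrable N (\<lambda>(t, x). - (- \<xi> t * \<phi> x) - \<psi> t * b t \<phi> x)"
          using test_integrable[OF tst] test_measurable[OF tst] by (simp add: split_beta')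
      qed
      have "\<psi> 0 * c = (\<integral>x. \<psi> 0 * \<phi> x * ubar x \<partial>M)" by (simp add: c_def mult.assoc)
      also have "\<dots> = (\<integral>p. (case p of (t, x) \<Rightarrow> - (- \<xi> t * \<phi> x) - \<psi> t * b t \<phi> x) * u p \<partial>N)"
        using u_test[OF tst] by simp
      also have "\<dots> = (\<integral>t. (\<integral>x. (\<xi> t * \<phi> x - \<psi> t * b t \<phi> x) * U t x \<partial>M) \<partial>time_space T)"
        using pair.integral_fst'[OF iN] by (simp add: U_def)
      also have "\<dots> = (\<integral>t. \<xi> t * \<mu> t - \<psi> t * flux \<phi> U t \<partial>time_space T)"
      proof (rule integral_cong_AE)
        show "(\<lambda>t. \<integral>x. (\<xi> t * \<phi> x - \<psi> t * b t \<phi> x) * U t x \<partial>M) \<in> borel_measurable (time_space T)"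
          using borel_measurable_integrable[OF pair.integrable_fst'[OF iN]] by (simp add: U_def)
        show "(\<lambda>t. \<xi> t * \<mu> t - \<psi> t * flux \<phi> U t) \<in> borel_measurable (time_space T)" using m \<mu>i fi by auto
        show "AE t in time_space T. (\<integral>x. (\<xi> t * \<phi> x - \<psi> t * b t \<phi> x) * U t x \<partial>M) = \<xi> t * \<mu> t - \<psi> t * flux \<phi> U t"
          using pair.AE_integrable_fst'[OF i1] pair.AE_integrable_fst'[OF i2]
        proof eventually_elim
          case (elim t)
          then have i: "integrable M (\<lambda>x. \<phi> x * U t x)" "integrable M (\<lambda>x. b t \<phi> x * U t x)" by (auto simp: U_def)
          have "(\<integral>x. (\<xi> t * \<phi> x - \<psi> t * b t \<phi> x) * U t x \<partial>M) = (\<integral>x. \<xi> t * (\<phi> x * U t x) - \<psi> t * (b t \<phi> x * U t x) \<partial>M)"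
            by (intro Bochner_Integration.integral_cong) (auto simp: algebra_simps)
          also have "\<dots> = \<xi> t * \<mu> t - \<psi> t * flux \<phi> U t"
            using i by (simp add: \<mu>_def flux_def)
          finally show ?case .
        qed
      qed
      also have "\<dots> = (\<integral>t. \<xi> t * \<mu> t \<partial>time_space T) - (\<integral>t. \<psi> t * flux \<phi> U t \<partial>time_space T)"
        by (intro Bochner_Integration.integral_diff mult_int[OF m(1) B1 \<mu>i] mult_int[OF m(2) B2 fi])
      also have "(\<integral>t. \<psi> t * flux \<phi> U t \<partial>time_space T) = (\<integral>t. \<xi> t * K t \<partial>time_space T)"
        using time_by_parts[OF fi \<psi>(1) \<xi>c] \<psi>(2) by (simp add: K_def)
      finally have "(\<integral>s. \<xi> s \<partial>time_space T) * c = (\<integral>t. \<xi> t * \<mu> t \<partial>time_space T) - (\<integral>t. \<xi> t * K t \<partial>time_space T)"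
        using \<psi>T[OF \<psi> \<xi>] by simp
      moreover have "(\<integral>t. \<xi> t * Q t \<partial>time_space T) = (\<integral>t. \<xi> t * \<mu> t - \<xi> t * c - \<xi> t * K t \<partial>time_space T)"
        by (simp add: Q_def algebra_simps)
      moreover have "\<dots> = (\<integral>t. \<xi> t * \<mu> t \<partial>time_space T) - (\<integral>t. \<xi> t \<partial>time_space T) * c - (\<integral>t. \<xi> t * K t \<partial>time_space T)"
        using mult_int[OF m(1) B1 \<mu>i] mult_int[OF m(1) B1 Ki] mult_int[OF m(1) B1, of "\<lambda>_. c"] by simp
      ultimately show ?thesis by simp
    qed
    have "AE t in time_space T. Q t \<le> 0" by (rule time_AE_nonpos[OF Qi]) (use zero in simp)
    moreover have "AE t in time_space T. - Q t \<le> 0" by (rule time_AE_nonpos) (use zero Qi in simp_all)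
    ultimately show ?thesis by eventually_elim (simp add: Q_def \<mu>_def K_def c_def)
  qed
  have mass: "AE t in time_space T. (\<integral>\<^sup>+x. ennreal (U t x) \<partial>M) \<le> ennreal (\<integral>x. ubar x \<partial>M)"
  proof -
    define B where "B = (\<integral>x. ubar x \<partial>M)"
    obtain X :: "nat \<Rightarrow> 'a set" where X: "range X \<subseteq> sets M" "(\<Union>i. X i) = space M" "\<And>i. emeasure M (X i) \<noteq> \<infinity>" "incseq X"
      using M.sigma_finite_incseq by blast
    have Xm[measurable]: "X i \<in> sets M" for i using X by auto
    have Xi: "integrable M (indicator (X i) :: 'a \<Rightarrow> real)" for i using X(3)[of i] by (simp add: less_top)
    have "AE t in time_space T. \<forall>i. (\<integral>x. indicator (X i) x * U t x \<partial>M) \<le> B"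
      unfolding AE_all_countable
    proof
      fix i
      have iX: "integrable N (\<lambda>p. (case p of (t, x) \<Rightarrow> indicator (X i) x) * u p)" by (rule bi[OF integrable_static[OF Xi]])
      have \<mu>i: "integrable (time_space T) (\<lambda>t. \<integral>x. indicator (X i) x * U t x \<partial>M)"
        using pair.integrable_fst'[OF iX] by (simp add: U_def)
      have "AE t in time_space T. (\<integral>x. indicator (X i) x * U t x \<partial>M) - B \<le> 0"
      proof (rule time_AE_nonpos)
        show "integrable (time_space T) (\<lambda>t. (\<integral>x. indicator (X i) x * U t x \<partial>M) - B)" using \<mu>i by simp
        fix \<xi> :: "real \<Rightarrow> real" assume \<xi>: "continuous_on {0..T} \<xi>" "\<And>s. 0 \<le> \<xi> s"
        obtain \<psi> where \<psi>: "\<And>t. t \<in> {0..T} \<Longrightarrow> (\<psi> has_real_derivative - \<xi> t) (at t within {0..T})" "\<psi> T = 0"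
          using time_antiderivative[OF \<xi>(1)] T_pos by auto
        have m[measurable]: "\<xi> \<in> borel_measurable (time_space T)" by (rule borel_measurable_time_continuous[OF \<xi>(1)])
        obtain B1 where B1: "\<And>t. t \<in> {0..T} \<Longrightarrow> \<bar>\<xi> t\<bar> \<le> B1" using time_continuous_bounded[OF \<xi>(1)] by blast
        \<comment> \<open>The indicator of a set of finite measure times a weight in time is an
          admissible dual variable with a = xi; the total mass is recovered as X i grows.\<close>
        define q where "q = (\<lambda>p. \<xi> (fst p) * indicator (X i) (snd p) :: real)"
        have qi: "integrable N q"
        proof (rule Bochner_Integration.integrable_bound[OF integrable_mult_right[of B1, OF integrable_static[OF Xi]]])
          show "q \<in> borel_measurable N" unfolding q_def by measurable
          show "AE p in N. norm (q p) \<le> norm (B1 * (case p of (t, x) \<Rightarrow> indicator (X i) x))"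
          proof (rule AE_I2)
            fix p assume "p \<in> space N"
            then obtain t x where p: "p = (t, x)" "t \<in> {0..T}" by (auto simp: space_pair_measure)
            have "\<bar>\<xi> t\<bar> \<le> \<bar>B1\<bar>" using B1[OF p(2)] by simp
            then show "norm (q p) \<le> norm (B1 * (case p of (t, x) \<Rightarrow> indicator (X i) x))"
              by (simp add: p(1) q_def abs_mult mult_right_mono)
          qed
        qed
        have "adm \<psi> \<xi> q"
          unfolding adm_def using \<psi> \<xi> qi \<psi>0(2)[OF \<psi> \<xi>] by (auto simp: q_def indicator_def)
        from u_adm[OF this] have "(\<integral>p. q p * u p \<partial>N) \<le> \<psi> 0 * B" by (simp add: B_def)
        also have "(\<integral>p. q p * u p \<partial>N) = (\<integral>t. (\<integral>x. \<xi> t * (indicator (X i) x * U t x) \<partial>M) \<partial>time_space T)"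
          using pair.integral_fst'[OF bi[OF qi]] by (simp add: U_def q_def mult.assoc)
        also have "\<dots> = (\<integral>t. \<xi> t * (\<integral>x. indicator (X i) x * U t x \<partial>M) \<partial>time_space T)" by simp
        also have "\<psi> 0 = (\<integral>s. \<xi> s \<partial>time_space T)" by (rule \<psi>T[OF \<psi> \<xi>])
        finally have le: "(\<integral>t. \<xi> t * (\<integral>x. indicator (X i) x * U t x \<partial>M) \<partial>time_space T) \<le> (\<integral>s. \<xi> s \<partial>time_space T) * B" .
        have \<xi>i: "integrable (time_space T) \<xi>" using B1 by (intro time_integrable_bounded[where B=B1, OF m]) auto
        have i2: "integrable (time_space T) (\<lambda>t. \<xi> t * (\<integral>x. indicator (X i) x * U t x \<partial>M))"
          using pair.integrable_fst'[OF bi[OF qi]] by (simp add: U_def q_def mult.assoc)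
        have "(\<integral>t. \<xi> t * ((\<integral>x. indicator (X i) x * U t x \<partial>M) - B) \<partial>time_space T)
            = (\<integral>t. \<xi> t * (\<integral>x. indicator (X i) x * U t x \<partial>M) \<partial>time_space T) - (\<integral>s. \<xi> s \<partial>time_space T) * B"
          using i2 \<xi>i by (simp add: right_diff_distrib)
        with le show "(\<integral>t. \<xi> t * ((\<integral>x. indicator (X i) x * U t x \<partial>M) - B) \<partial>time_space T) \<le> 0" by simp
      qed
      then show "AE t in time_space T. (\<integral>x. indicator (X i) x * U t x \<partial>M) \<le> B" by simp
    qed
    with AE_space show ?thesis
    proof eventually_elim
      case (elim t)
      have Um[measurable]: "U t \<in> borel_measurable M" using measurable_compose_Pair1[OF elim(1) um] by (simp add: U_def[abs_def])
      have "(\<integral>\<^sup>+x. ennreal (indicator (X i) x * U t x) \<partial>M) \<le> ennreal B" for i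
      proof -
        have "integrable M (\<lambda>x. indicator (X i) x * U t x)"
        proof (rule Bochner_Integration.integrable_bound[OF integrable_mult_right[of C0, OF Xi[of i]]])
          show "AE x in M. norm (indicator (X i) x * U t x) \<le> norm (C0 * indicator (X i) x)"
            using ub C0 by (auto simp: indicator_def U_def)
        qed measurable
        then have "(\<integral>\<^sup>+x. ennreal (indicator (X i) x * U t x) \<partial>M) = ennreal (\<integral>x. indicator (X i) x * U t x \<partial>M)"
          using ub by (intro nn_integral_eq_integral) (auto simp: U_def)
        also have "\<dots> \<le> ennreal B" using elim(2) by (intro ennreal_leI) auto
        finally show ?thesis .
      qed
      from nn_integral_le_exhaustion[OF X(4,2) Xm Um _ this] show ?case by (simp add: B_def U_def ub)
    qed
  qed
  have Um: "(\<lambda>(t, x). U t x) \<in> borel_measurable N" using um by (simp add: U_def)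
  have Ub: "\<forall>t x. 0 \<le> U t x \<and> U t x \<le> C0" using ub by (simp add: U_def)
  show ?thesis by (intro exI[of _ U] conjI ballI Um Ub eq mass)
qed

end

section \<open>From almost every time to every time\<close>

lemma bounded_integrable_Lp_two:
  fixes f :: "'a \<Rightarrow> real"
  assumes [measurable]: "f \<in> borel_measurable M" and f: "\<And>x. 0 \<le> f x" "\<And>x. f x \<le> C" "(\<integral>\<^sup>+x. ennreal (f x) \<partial>M) < \<infinity>"
  shows "integrable M f" "f \<in> Lp M 2"
proof -
  show i: "integrable M f" using f by (intro integrableI_bounded) auto
  have "integrable M (\<lambda>x. (f x)\<^sup>2)"
  proof (rule Bochner_Integration.integrable_bound[OF integrable_mult_right[of C, OF i]])
    show "AE x in M. norm ((f x)\<^sup>2) \<le> norm (C * f x)"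
    proof (rule AE_I2)
      fix x
      have "f x * f x \<le> C * f x" using f(1,2)[of x] by (intro mult_right_mono) auto
      then show "norm ((f x)\<^sup>2) \<le> norm (C * f x)" by (simp add: power2_eq_square)
    qed
  qed measurable
  then show "f \<in> Lp M 2" by (simp add: Lp_two_iff)
qed

context dirichlet_algebra
begin

lemma square_diff_integral:
  assumes "f \<in> Lp M 2" "g \<in> Lp M 2"
  shows "(\<integral>x. (f x - g x)\<^sup>2 \<partial>M) = (\<integral>x. (f x)\<^sup>2 \<partial>M) - 2 * (\<integral>x. g x * f x \<partial>M) + (\<integral>x. (g x)\<^sup>2 \<partial>M)"
proof -
  have i: "integrable M (\<lambda>x. (f x)\<^sup>2)" "integrable M (\<lambda>x. (g x)\<^sup>2)" "integrable M (\<lambda>x. g x * f x)"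
    using assms square_diff_integrable(2)[of g M f] by (auto simp: Lp_two_iff)
  have "(\<integral>x. (f x - g x)\<^sup>2 \<partial>M) = (\<integral>x. (f x)\<^sup>2 - 2 * (g x * f x) + (g x)\<^sup>2 \<partial>M)"
    by (intro Bochner_Integration.integral_cong) (auto simp: power2_eq_square algebra_simps)
  also have "\<dots> = (\<integral>x. (f x)\<^sup>2 \<partial>M) - 2 * (\<integral>x. g x * f x \<partial>M) + (\<integral>x. (g x)\<^sup>2 \<partial>M)"
    using i by simp
  finally show ?thesis .
qed

lemma A_Lp_two: "f \<in> A \<Longrightarrow> f \<in> Lp M 2"
  using A_subset V_subset by auto

text \<open>If d = f - g is orthogonal to every a n, expanding the square shows that the squared
  norm of d is at most that of d - a n, which density makes arbitrarily small.\<close>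

lemma separating_sequence_in_A:
  obtains a :: "nat \<Rightarrow> 'a \<Rightarrow> real" where "\<And>n. a n \<in> A"
    "\<forall>f\<in>Lp M 2. \<forall>g\<in>Lp M 2. (\<forall>n. (\<integral>x. a n x * f x \<partial>M) = (\<integral>x. a n x * g x \<partial>M)) \<longrightarrow> (AE x in M. f x = g x)"
proof -
  obtain a :: "nat \<Rightarrow> 'a \<Rightarrow> real" where a: "\<And>n. a n \<in> A"
    "\<And>f e. f \<in> Lp M 2 \<Longrightarrow> 0 < e \<Longrightarrow> \<exists>n. (\<integral>x. (f x - a n x)\<^sup>2 \<partial>M) < e" by (rule dense_sequence_in_A, rule that, blast+)
  have "AE x in M. f x = g x" if fg: "f \<in> Lp M 2" "g \<in> Lp M 2" "\<And>n. (\<integral>x. a n x * f x \<partial>M) = (\<integral>x. a n x * g x \<partial>M)" for f g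
  proof -
    define d where "d x = f x - g x" for x
    have d: "d \<in> Lp M 2" using fg(1,2) square_diff_integrable(1)[of f M g] by (auto simp: Lp_two_iff d_def[abs_def])
    have "(\<integral>x. a n x * d x \<partial>M) = 0" for n
    proof -
      have "integrable M (\<lambda>x. a n x * f x)" "integrable M (\<lambda>x. a n x * g x)"
        using fg(1,2) A_Lp_two[OF a(1)[of n]] square_diff_integrable(2) by (auto simp: Lp_two_iff)
      then show ?thesis using fg(3)[of n] by (simp add: d_def right_diff_distrib)
    qed
    then have le: "(\<integral>x. (d x)\<^sup>2 \<partial>M) \<le> (\<integral>x. (d x - a n x)\<^sup>2 \<partial>M)" for n
      using square_diff_integral[OF d A_Lp_two[OF a(1)[of n]]] by simp
    have "(\<integral>x. (d x)\<^sup>2 \<partial>M) \<le> 0"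
    proof (rule field_le_epsilon)
      fix e :: real assume "0 < e"
      then obtain n where "(\<integral>x. (d x - a n x)\<^sup>2 \<partial>M) < e" using a(2)[OF d] by blast
      with le[of n] show "(\<integral>x. (d x)\<^sup>2 \<partial>M) \<le> 0 + e" by simp
    qed
    moreover have "(\<integral>x. (d x)\<^sup>2 \<partial>M) \<ge> 0" by simp
    ultimately have "(\<integral>x. (d x)\<^sup>2 \<partial>M) = 0" by simp
    then have "AE x in M. (d x)\<^sup>2 = 0"
      using d by (subst (asm) integral_nonneg_eq_0_iff_AE) (auto simp: Lp_two_iff)
    then show ?thesis by eventually_elim (simp add: d_def)
  qed
  with a(1) show ?thesis by (intro that[of a]) auto
qed

text \<open>The version is the limit of \<open>a (n k t)\<close>, where \<open>a (n k t)\<close> is the first member of a dense sequence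
  at squared distance less than \<open>4\<^bsup>-k\<^esup>\<close> from \<open>v t\<close>; the distances are measurable in \<open>t\<close> because
  \<open>\<parallel>v\<parallel>\<^sup>2\<close> is the supremum of \<open>2 \<langle>v, a n\<rangle> - \<parallel>a n\<parallel>\<^sup>2\<close>.\<close>
lemma jointly_measurable_version:
  assumes v: "\<And>t. t \<in> space \<Theta> \<Longrightarrow> v t \<in> Lp M 2"
    and meas: "\<And>f. f \<in> A \<Longrightarrow> (\<lambda>t. \<integral>x. f x * v t x \<partial>M) \<in> borel_measurable \<Theta>"
  shows "\<exists>u. (\<lambda>(t, x). u t x) \<in> borel_measurable (\<Theta> \<Otimes>\<^sub>M M) \<and> (\<forall>t\<in>space \<Theta>. AE x in M. u t x = v t x)"
proof -
  obtain a :: "nat \<Rightarrow> 'a \<Rightarrow> real" where a: "\<And>n. a n \<in> A"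
    "\<And>f e. f \<in> Lp M 2 \<Longrightarrow> 0 < e \<Longrightarrow> \<exists>n. (\<integral>x. (f x - a n x)\<^sup>2 \<partial>M) < e" by (rule dense_sequence_in_A, rule that, blast+)
  have [measurable]: "a n \<in> borel_measurable M" for n by (rule borel_measurable_A[OF a(1)])
  define P where "P n t = (\<integral>x. a n x * v t x \<partial>M)" for n t
  define c where "c n = (\<integral>x. (a n x)\<^sup>2 \<partial>M)" for n
  define S where "S t = (SUP n. 2 * P n t - c n)" for t
  have [measurable]: "P n \<in> borel_measurable \<Theta>" for n unfolding P_def using meas[OF a(1)] .
  have dist: "(\<integral>x. (v t x - a n x)\<^sup>2 \<partial>M) = (\<integral>x. (v t x)\<^sup>2 \<partial>M) - 2 * P n t + c n" if "t \<in> space \<Theta>" for t n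
    using square_diff_integral[OF v[OF that] A_Lp_two[OF a(1)]] by (simp add: P_def c_def)
  have upper: "2 * P n t - c n \<le> (\<integral>x. (v t x)\<^sup>2 \<partial>M)" if "t \<in> space \<Theta>" for t n
  proof -
    have "0 \<le> (\<integral>x. (v t x - a n x)\<^sup>2 \<partial>M)" by simp
    then show ?thesis using dist[OF that, of n] by simp
  qed
  have bdd: "bdd_above (range (\<lambda>n. 2 * P n t - c n))" if "t \<in> space \<Theta>" for t
    using upper[OF that] by (auto intro!: bdd_aboveI2)
  have S: "S t = (\<integral>x. (v t x)\<^sup>2 \<partial>M)" if t: "t \<in> space \<Theta>" for t
  proof (rule antisym)
    show "S t \<le> (\<integral>x. (v t x)\<^sup>2 \<partial>M)" unfolding S_def using upper[OF t] by (intro cSUP_least) auto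
    show "(\<integral>x. (v t x)\<^sup>2 \<partial>M) \<le> S t"
    proof (rule field_le_epsilon)
      fix e :: real assume "0 < e"
      then obtain n where n: "(\<integral>x. (v t x - a n x)\<^sup>2 \<partial>M) < e" using a(2)[OF v[OF t]] by blast
      have "2 * P n t - c n \<le> S t" unfolding S_def by (intro cSUP_upper bdd[OF t]) auto
      with n dist[OF t, of n] show "(\<integral>x. (v t x)\<^sup>2 \<partial>M) \<le> S t + e" by simp
    qed
  qed
  have [measurable]: "S \<in> borel_measurable \<Theta>"
    unfolding S_def using bdd by (intro borel_measurable_cSUP) auto
  define \<delta> where "\<delta> n t = S t - 2 * P n t + c n" for n t
  have [measurable]: "\<delta> n \<in> borel_measurable \<Theta>" for n unfolding \<delta>_def by measurable
  have \<delta>: "\<delta> n t = (\<integral>x. (v t x - a n x)\<^sup>2 \<partial>M)" if "t \<in> space \<Theta>" for t n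
    using dist[OF that] S[OF that] by (simp add: \<delta>_def)
  define n where "n k t = (LEAST n. \<delta> n t < (1/4)^k)" for k :: nat and t
  have nm[measurable]: "n k \<in> measurable \<Theta> (count_space UNIV)" for k
    unfolding n_def by (intro measurable_Least) measurable
  have n_le: "(\<integral>x. (v t x - a (n k t) x)\<^sup>2 \<partial>M) < (1/4)^k" if t: "t \<in> space \<Theta>" for t k
  proof -
    have "\<exists>m. \<delta> m t < (1/4)^k" using a(2)[OF v[OF t], of "(1/4)^k"] \<delta>[OF t] by auto
    then have "\<delta> (n k t) t < (1/4)^k" unfolding n_def by (rule LeastI_ex)
    then show ?thesis using \<delta>[OF t] by simp
  qed
  define u where "u t x = lim (\<lambda>k. a (n k t) x)" for t x
  have "(\<lambda>p. a (n k (fst p)) (snd p)) \<in> borel_measurable (\<Theta> \<Otimes>\<^sub>M M)" for k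
  proof (rule measurable_compose_countable[where f="\<lambda>i p. a i (snd p)" and g="\<lambda>p. n k (fst p)"])
    show "(\<lambda>p. n k (fst p)) \<in> measurable (\<Theta> \<Otimes>\<^sub>M M) (count_space UNIV)" by measurable
  qed measurable
  then have um: "(\<lambda>(t, x). u t x) \<in> borel_measurable (\<Theta> \<Otimes>\<^sub>M M)"
    unfolding u_def split_beta' by (intro borel_measurable_lim_metric)
  moreover have "AE x in M. u t x = v t x" if t: "t \<in> space \<Theta>" for t
  proof -
    have [measurable]: "v t \<in> borel_measurable M" using v[OF t] by (simp add: Lp_two_iff)
    have i: "integrable M (\<lambda>x. (v t x - a k x)\<^sup>2)" for k
      using v[OF t] A_Lp_two[OF a(1)[of k]] by (intro square_diff_integrable(1)) (auto simp: Lp_two_iff)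
    \<comment> \<open>The squared distances are summable in k, so the full sequence converges almost
      everywhere and one limit formula serves all t.\<close>
    have "(\<integral>\<^sup>+x. (\<Sum>k. ennreal ((v t x - a (n k t) x)\<^sup>2)) \<partial>M) = (\<Sum>k. \<integral>\<^sup>+x. ennreal ((v t x - a (n k t) x)\<^sup>2) \<partial>M)"
      by (intro nn_integral_suminf) measurable
    also have "\<dots> = (\<Sum>k. ennreal (\<integral>x. (v t x - a (n k t) x)\<^sup>2 \<partial>M))"
      using i by (intro suminf_cong nn_integral_eq_integral) auto
    also have "\<dots> \<le> (\<Sum>k. ennreal ((1/4) ^ k))"
      using n_le[OF t] by (intro suminf_le ennreal_leI less_imp_le) auto
    also have "\<dots> < \<infinity>"
      using summable_geometric[of "1/4::real"] by (subst suminf_ennreal2) auto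
    finally have "AE x in M. (\<Sum>k. ennreal ((v t x - a (n k t) x)\<^sup>2)) \<noteq> \<infinity>"
      by (intro nn_integral_PInf_AE) auto
    then show ?thesis
    proof eventually_elim
      case (elim x)
      then have "summable (\<lambda>k. (v t x - a (n k t) x)\<^sup>2)"
        using summable_suminf_not_top[of "\<lambda>k. (v t x - a (n k t) x)\<^sup>2"] by simp
      then have "(\<lambda>k. (v t x - a (n k t) x)\<^sup>2) \<longlonglongrightarrow> 0" by (rule summable_LIMSEQ_zero)
      then have "(\<lambda>k. sqrt ((v t x - a (n k t) x)\<^sup>2)) \<longlonglongrightarrow> sqrt 0" by (intro tendsto_real_sqrt)
      then have "(\<lambda>k. v t x - a (n k t) x) \<longlonglongrightarrow> 0" by (simp add: tendsto_rabs_zero_iff)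
      from tendsto_diff[OF tendsto_const[of "v t x"] this] have "(\<lambda>k. a (n k t) x) \<longlonglongrightarrow> v t x" by simp
      then show ?case unfolding u_def by (rule limI)
    qed
  qed
  ultimately show ?thesis by blast
qed

end

context transport
begin

lemma flux_integrable:
  assumes f: "f \<in> A" and u: "(\<lambda>(t, x). u t x) \<in> borel_measurable N" "\<And>t x. 0 \<le> u t x \<and> u t x \<le> C"
  shows "integrable (time_space T) (flux f u)"
proof -
  have "integrable N (\<lambda>p. (case p of (t, x) \<Rightarrow> b t f x) * (case p of (t, x) \<Rightarrow> u t x))"
    by (rule bounded_times_integrable[OF b_integrable[OF f] u(1), of C]) (use u(2) in auto)
  from pair.integrable_fst'[OF this] show ?thesis by (simp add: flux_def[abs_def])
qed

text \<open>Continuity selects the values: \<open>L f t\<close>, the continuous representative of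
  the pairing of f with U t, exists for every t, and its linearity in f and its bounds pass from
  almost every t to every t. Duality on M at fixed t represents it by a function v t in the box. A
  jointly measurable version of v agrees almost everywhere with U and may therefore replace it in
  the flux.\<close>

lemma bounded_solution:
  assumes C0: "0 \<le> C" and energy: "energy_bound ubar C"
    and ubar: "integrable M ubar" "\<And>x. 0 \<le> ubar x" "\<And>x. ubar x \<le> m"
  shows "\<exists>u. (\<lambda>(t, x). u t x) \<in> borel_measurable N \<and> (\<forall>t x. 0 \<le> u t x \<and> u t x \<le> C) \<and>
    (\<forall>t\<in>{0..<T}. u t \<in> borel_measurable M \<and> (\<integral>\<^sup>+x. ennreal (u t x) \<partial>M) \<le> ennreal (\<integral>x. ubar x \<partial>M) \<and>
       (\<forall>f\<in>A. (\<integral>x. f x * u t x \<partial>M)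
        = (\<integral>x. f x * ubar x \<partial>M) + (\<integral>s. indicator {..<t} s * flux f u s \<partial>time_space T)))"
proof -
  obtain U where Um: "(\<lambda>(t, x). U t x) \<in> borel_measurable N" and Ub: "\<And>t x. 0 \<le> U t x \<and> U t x \<le> C"
    and U_eq: "\<And>f. f \<in> A \<Longrightarrow> AE t in time_space T. (\<integral>x. f x * U t x \<partial>M)
        = (\<integral>x. f x * ubar x \<partial>M) + (\<integral>s. indicator {..<t} s * flux f U s \<partial>time_space T)"
    and U_mass: "AE t in time_space T. (\<integral>\<^sup>+x. ennreal (U t x) \<partial>M) \<le> ennreal (\<integral>x. ubar x \<partial>M)"
    using space_time_solution_at_time[OF C0 energy ubar] by blast
  define B where "B = (\<integral>x. ubar x \<partial>M)"
  have B0: "0 \<le> B" unfolding B_def using ubar(2) by (intro integral_nonneg_AE) auto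
  define L where "L f t = (\<integral>x. f x * ubar x \<partial>M) + (\<integral>s. indicator {..<t} s * flux f U s \<partial>time_space T)" for f t
  have Lc: "continuous_on {0..T} (L f)" if "f \<in> A" for f
    unfolding L_def by (intro continuous_intros time_indefinite_integral_continuous flux_integrable[OF that Um Ub])
  have AE_meas: "AE t in time_space T. U t \<in> borel_measurable M"
    using AE_space by eventually_elim (use measurable_compose_Pair1[OF _ Um] in auto)
  have fU_int: "integrable M (\<lambda>x. f x * U t x)" if "integrable M f" "U t \<in> borel_measurable M" for f t
  proof (rule Bochner_Integration.integrable_bound[OF integrable_mult_right[of C, OF that(1)]])
    show "(\<lambda>x. f x * U t x) \<in> borel_measurable M" using that by auto
    show "AE x in M. norm (f x * U t x) \<le> norm (C * f x)"
    proof (rule AE_I2)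
      fix x have "\<bar>U t x\<bar> \<le> \<bar>C\<bar>" using Ub[of t x] by simp
      then show "norm (f x * U t x) \<le> norm (C * f x)"
        by (simp add: abs_mult mult.commute[of "\<bar>C\<bar>"] mult_left_mono)
    qed
  qed
  have L_zero: "f t = 0" if "continuous_on {0..T} f" "AE t in time_space T. f t = 0" "t \<in> {0..T}" for f :: "real \<Rightarrow> real" and t
  proof -
    have "f t \<le> 0" by (rule time_continuous_AE_le[OF T_pos that(1) _ that(3)]) (use that(2) in \<open>auto elim: eventually_mono\<close>)
    moreover have "- f t \<le> 0"
      by (rule time_continuous_AE_le[OF T_pos _ _ that(3)]) (use that in \<open>auto elim: eventually_mono intro: continuous_intros\<close>)
    ultimately show ?thesis by simp
  qed
  have L_add: "L (\<lambda>x. f x + f' x) t = L f t + L f' t" if f: "f \<in> A" "f' \<in> A" and t: "t \<in> {0..T}" for f f' t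
  proof -
    have "L (\<lambda>x. f x + f' x) t - (L f t + L f' t) = 0"
    proof (rule L_zero[OF _ _ t])
      show "continuous_on {0..T} (\<lambda>t. L (\<lambda>x. f x + f' x) t - (L f t + L f' t))"
        by (intro continuous_intros Lc A_add f)
      show "AE t in time_space T. L (\<lambda>x. f x + f' x) t - (L f t + L f' t) = 0"
        using U_eq[OF A_add[OF f]] U_eq[OF f(1)] U_eq[OF f(2)] AE_meas
      proof eventually_elim
        case (elim t)
        have "(\<integral>x. (f x + f' x) * U t x \<partial>M) = (\<integral>x. f x * U t x \<partial>M) + (\<integral>x. f' x * U t x \<partial>M)"
          using fU_int[OF A_integrable[OF f(1)] elim(4)] fU_int[OF A_integrable[OF f(2)] elim(4)] by (simp add: distrib_right)
        with elim show ?case by (simp add: L_def)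
      qed
    qed
    then show ?thesis by simp
  qed
  have L_scale: "L (\<lambda>x. c * f x) t = c * L f t" if f: "f \<in> A" and t: "t \<in> {0..T}" for f t c
  proof -
    have "L (\<lambda>x. c * f x) t - c * L f t = 0"
    proof (rule L_zero[OF _ _ t])
      show "continuous_on {0..T} (\<lambda>t. L (\<lambda>x. c * f x) t - c * L f t)"
        by (intro continuous_intros Lc A_scale f)
      show "AE t in time_space T. L (\<lambda>x. c * f x) t - c * L f t = 0"
        using U_eq[OF A_scale[OF f, of c]] U_eq[OF f]
      proof eventually_elim
        case (elim t)
        then show ?case by (simp add: L_def mult.assoc)
      qed
    qed
    then show ?thesis by simp
  qed
  \<comment> \<open>The compatibility condition for duality at time t: the part f - q is paid for by
    the sup bound C, the part q <= c by the mass bound B. The left side is continuous in t, so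
    almost every t suffices.\<close>
  have L_bound: "L f t - c * B \<le> C * (\<integral>x. max 0 (f x - q x) \<partial>M)"
    if f: "f \<in> A" and q: "integrable M q" "\<And>x. 0 \<le> q x \<and> q x \<le> c" and t: "t \<in> {0..T}" for f q c t
  proof (rule time_continuous_AE_le[OF T_pos _ _ t])
    show "continuous_on {0..T} (\<lambda>t. L f t - c * B)" by (intro continuous_intros Lc f)
    show "AE t in time_space T. L f t - c * B \<le> C * (\<integral>x. max 0 (f x - q x) \<partial>M)"
      using U_eq[OF f] U_mass AE_meas
    proof eventually_elim
      case (elim t)
      have c0: "0 \<le> c" using q(2) order_trans by blast
      have Ui: "integrable M (U t)"
        using elim(2,3) Ub by (intro bounded_integrable_Lp_two(1)[of _ _ C]) (auto intro: le_less_trans)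
      have "ennreal (\<integral>x. U t x \<partial>M) \<le> ennreal B"
        using elim(2) Ub nn_integral_eq_integral[OF Ui] by (simp add: B_def)
      then have UB: "(\<integral>x. U t x \<partial>M) \<le> B" using B0 by simp
      have fq: "integrable M (\<lambda>x. f x - q x)" using A_integrable[OF f] q(1) by simp
      have qm: "q \<in> borel_measurable M" using q(1) by auto
      have "L f t = (\<integral>x. f x * U t x \<partial>M)" using elim(1) by (simp add: L_def)
      also have "\<dots> \<le> (\<integral>x. C * max 0 (f x - q x) + c * U t x \<partial>M)"
      proof (rule integral_mono)
        show "integrable M (\<lambda>x. f x * U t x)" by (rule fU_int[OF A_integrable[OF f] elim(3)])
        show "integrable M (\<lambda>x. C * max 0 (f x - q x) + c * U t x)" using fq Ui by simp
        fix x
        have "f x * U t x = (f x - q x) * U t x + q x * U t x" by (simp add: algebra_simps)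
        also have "(f x - q x) * U t x \<le> max 0 (f x - q x) * U t x" using Ub[of t x] by (intro mult_right_mono) auto
        also have "\<dots> \<le> max 0 (f x - q x) * C" using Ub[of t x] by (intro mult_left_mono) auto
        also have "q x * U t x \<le> c * U t x" using Ub[of t x] q(2)[of x] by (intro mult_right_mono) auto
        finally show "f x * U t x \<le> C * max 0 (f x - q x) + c * U t x" by (simp add: mult.commute)
      qed
      also have "\<dots> = C * (\<integral>x. max 0 (f x - q x) \<partial>M) + c * (\<integral>x. U t x \<partial>M)" using fq Ui by simp
      also have "\<dots> \<le> C * (\<integral>x. max 0 (f x - q x) \<partial>M) + c * B" using UB c0 by (intro add_left_mono mult_left_mono)
      finally show ?case by simp
    qed
  qed
  have "\<exists>v. v \<in> borel_measurable M \<and> (\<forall>x. 0 \<le> v x \<and> v x \<le> C) \<and> (\<integral>\<^sup>+x. ennreal (v x) \<partial>M) \<le> ennreal B \<and>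
      (\<forall>f\<in>A. (\<integral>x. f x * v x \<partial>M) = L f t)" if t: "t \<in> {0..T}" for t
  proof -
    \<comment> \<open>The constraints at a fixed time: f prescribes the pairings with
      \<open>A\<close>, and an integrable q between 0 and c keeps the integral of q v below c *
      B.\<close>
    define P where "P = {((\<lambda>x. f x - q x), L f t - c * B) | f q c. f \<in> A \<and> integrable M q \<and> (\<forall>x. 0 \<le> q x \<and> q x \<le> c)}"
    have PI: "((\<lambda>x. f x - q x), L f t - c * B) \<in> P" if "f \<in> A" "integrable M q" "\<And>x. 0 \<le> q x \<and> q x \<le> c" for f q c
      unfolding P_def using that by blast
    have "\<exists>v \<in> borel_measurable M. (\<forall>x. 0 \<le> v x \<and> v x \<le> C) \<and> (\<forall>(G, e) \<in> P. e \<le> (\<integral>x. G x * v x \<partial>M))"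
    proof (rule M.box_duality[OF C0])
      show "convex_cone_of_pairs P"
        unfolding convex_cone_of_pairs_def
      proof (intro conjI allI impI)
        show "P \<noteq> {}" using PI[OF zero_A, of "\<lambda>_. 0" 0] by auto
        fix G e G' e' assume "(G, e) \<in> P" "(G', e') \<in> P"
        then obtain f q c f' q' c' where 1: "f \<in> A" "integrable M q" "\<And>x. 0 \<le> q x \<and> q x \<le> c" "G = (\<lambda>x. f x - q x)" "e = L f t - c * B"
          "f' \<in> A" "integrable M q'" "\<And>x. 0 \<le> q' x \<and> q' x \<le> c'" "G' = (\<lambda>x. f' x - q' x)" "e' = L f' t - c' * B"
          unfolding P_def by blast
        have "((\<lambda>x. (f x + f' x) - (q x + q' x)), L (\<lambda>x. f x + f' x) t - (c + c') * B) \<in> P"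
          using 1 by (intro PI A_add) (auto intro: add_mono)
        moreover have "L (\<lambda>x. f x + f' x) t - (c + c') * B = e + e'"
          using L_add[OF 1(1,6) t] by (simp add: 1 algebra_simps)
        moreover have "(\<lambda>x. (f x + f' x) - (q x + q' x)) = (\<lambda>x. G x + G' x)" by (auto simp: 1)
        ultimately show "(\<lambda>x. G x + G' x, e + e') \<in> P" by simp
      next
        fix G e and s :: real assume "(G, e) \<in> P" "0 \<le> s"
        then obtain f q c where 1: "f \<in> A" "integrable M q" "\<And>x. 0 \<le> q x \<and> q x \<le> c" "G = (\<lambda>x. f x - q x)" "e = L f t - c * B"
          unfolding P_def by blast
        have "((\<lambda>x. s * f x - s * q x), L (\<lambda>x. s * f x) t - (s * c) * B) \<in> P"
          using 1 \<open>0 \<le> s\<close> by (intro PI A_scale) (auto intro: mult_left_mono)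
        moreover have "L (\<lambda>x. s * f x) t - (s * c) * B = s * e"
          using L_scale[OF 1(1) t] by (simp add: 1 algebra_simps)
        moreover have "(\<lambda>x. s * f x - s * q x) = (\<lambda>x. s * G x)" by (auto simp: 1 algebra_simps)
        ultimately show "(\<lambda>x. s * G x, s * e) \<in> P" by simp
      qed
      fix G e assume "(G, e) \<in> P"
      then obtain f q c where 1: "f \<in> A" "integrable M q" "\<And>x. 0 \<le> q x \<and> q x \<le> c" "G = (\<lambda>x. f x - q x)" "e = L f t - c * B"
        unfolding P_def by blast
      show "integrable M G" using A_integrable[OF 1(1)] 1 by simp
      show "e \<le> C * (\<integral>x. max 0 (G x) \<partial>M)" using L_bound[OF 1(1-3) t] by (simp add: 1)
    qed
    then obtain v where v: "v \<in> borel_measurable M" "\<And>x. 0 \<le> v x \<and> v x \<le> C" "\<And>G e. (G, e) \<in> P \<Longrightarrow> e \<le> (\<integral>x. G x * v x \<partial>M)"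
      by blast
    have le: "L f t \<le> (\<integral>x. f x * v x \<partial>M)" if "f \<in> A" for f
      using v(3)[OF PI[OF that, of "\<lambda>_. 0" 0]] by simp
    have "(\<integral>x. f x * v x \<partial>M) = L f t" if f: "f \<in> A" for f
      using le[OF f] le[OF A_scale[OF f, of "-1"]] L_scale[OF f t, of "-1"] by simp
    moreover have "(\<integral>\<^sup>+x. ennreal (v x) \<partial>M) \<le> ennreal B"
    proof -
      obtain X :: "nat \<Rightarrow> 'a set" where X: "range X \<subseteq> sets M" "(\<Union>i. X i) = space M" "\<And>i. emeasure M (X i) \<noteq> \<infinity>" "incseq X"
        using M.sigma_finite_incseq by blast
      have Xm[measurable]: "X i \<in> sets M" for i using X by auto
      have Xi: "integrable M (indicator (X i) :: 'a \<Rightarrow> real)" for i using X(3)[of i] by (simp add: less_top)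
      note [measurable] = v(1)
      have Xle: "(\<integral>\<^sup>+x. ennreal (indicator (X i) x * v x) \<partial>M) \<le> ennreal B" for i
      proof -
        have "integrable M (\<lambda>x. indicator (X i) x * v x)"
        proof (rule Bochner_Integration.integrable_bound[OF integrable_mult_right[of C, OF Xi[of i]]])
          show "AE x in M. norm (indicator (X i) x * v x) \<le> norm (C * indicator (X i) x)"
            using v(2) C0 by (auto simp: indicator_def)
        qed measurable
        then have "(\<integral>\<^sup>+x. ennreal (indicator (X i) x * v x) \<partial>M) = ennreal (\<integral>x. indicator (X i) x * v x \<partial>M)"
          using v(2) by (intro nn_integral_eq_integral) auto
        also have "(\<integral>x. indicator (X i) x * v x \<partial>M) \<le> B"
        proof -
          have "L (\<lambda>x. 0) t = 0" using L_scale[OF zero_A t, of 0] by simp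
          then show ?thesis
            using v(3)[OF PI[OF zero_A Xi[of i], of 1]] by (auto simp: indicator_def)
        qed
        finally show ?thesis by (simp add: ennreal_leI)
      qed
      show ?thesis by (rule nn_integral_le_exhaustion[OF X(4,2) Xm v(1) _ Xle]) (use v(2) in auto)
    qed
    ultimately show ?thesis using v(1,2) by blast
  qed
  then obtain v where v: "\<And>t. t \<in> {0..T} \<Longrightarrow> v t \<in> borel_measurable M"
    "\<And>t x. t \<in> {0..T} \<Longrightarrow> 0 \<le> v t x \<and> v t x \<le> C" "\<And>t. t \<in> {0..T} \<Longrightarrow> (\<integral>\<^sup>+x. ennreal (v t x) \<partial>M) \<le> ennreal B"
    "\<And>t f. t \<in> {0..T} \<Longrightarrow> f \<in> A \<Longrightarrow> (\<integral>x. f x * v t x \<partial>M) = L f t" by metis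
  have vL2: "v t \<in> Lp M 2" if "t \<in> {0..T}" for t
    using v(1-3)[OF that] by (intro bounded_integrable_Lp_two(2)[of _ _ C]) (auto intro: le_less_trans)
  have "\<exists>u. (\<lambda>(t, x). u t x) \<in> borel_measurable N \<and> (\<forall>t\<in>space (time_space T). AE x in M. u t x = v t x)"
  proof (rule jointly_measurable_version)
    show "v t \<in> Lp M 2" if "t \<in> space (time_space T)" for t using vL2 that by simp
    show "(\<lambda>t. \<integral>x. f x * v t x \<partial>M) \<in> borel_measurable (time_space T)" if f: "f \<in> A" for f
      using borel_measurable_time_continuous[OF Lc[OF f]] v(4) f
      by (subst measurable_cong[of _ _ "L f"]) auto
  qed
  then obtain u0 where u0: "(\<lambda>(t, x). u0 t x) \<in> borel_measurable N" "\<And>t. t \<in> {0<..<T} \<Longrightarrow> AE x in M. u0 t x = v t x"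
    by auto
  \<comment> \<open>Time 0 lies outside \<open>time_space T\<close>, on which the measurable version
    lives, so v 0 is used there. Clipping restores the box at every point, and the value 0 at all
    other times keeps the bounds valid for all t.\<close>
  define u where "u t x = (if t \<in> {0<..<T} then clip C (u0 t x) else if t = 0 then v 0 x else 0)" for t x
  have um: "(\<lambda>(t, x). u t x) \<in> borel_measurable N"
  proof -
    have "(\<lambda>p. clip C (case p of (t, x) \<Rightarrow> u0 t x)) \<in> borel_measurable N"
      using measurable_compose[OF u0(1) borel_measurable_clip] .
    then show ?thesis
      by (rule measurable_cong[THEN iffD1, rotated]) (auto simp: u_def space_pair_measure)
  qed
  have ub: "0 \<le> u t x \<and> u t x \<le> C" for t x
    using clip_bounds[OF C0] v(2)[of 0 x] T_pos C0 by (auto simp: u_def)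
  have uv: "AE x in M. u t x = v t x" if t: "t \<in> {0..<T}" for t
  proof (cases "t = 0")
    case False
    with t have t': "t \<in> {0<..<T}" by auto
    from u0(2)[OF this] show ?thesis
      by eventually_elim (use t' v(2)[of t] in \<open>auto simp: u_def clip_def\<close>)
  qed (simp add: u_def)
  have u_meas: "u t \<in> borel_measurable M" if t: "t \<in> {0..<T}" for t
  proof (cases "t = 0")
    case True
    then show ?thesis using v(1)[of 0] T_pos by (simp add: u_def[abs_def])
  next
    case False
    with t show ?thesis using measurable_compose_Pair1[OF _ um, of t] by simp
  qed
  have int_eq: "(\<integral>x. f x * u t x \<partial>M) = (\<integral>x. f x * v t x \<partial>M)" if "t \<in> {0..<T}" "f \<in> borel_measurable M" for f t
    using uv[OF that(1)] u_meas[OF that(1)] v(1)[of t] that by (intro integral_cong_AE) auto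
  obtain a :: "nat \<Rightarrow> 'a \<Rightarrow> real" where a: "\<And>n. a n \<in> A"
    "\<forall>f\<in>Lp M 2. \<forall>g\<in>Lp M 2. (\<forall>n. (\<integral>x. a n x * f x \<partial>M) = (\<integral>x. a n x * g x \<partial>M)) \<longrightarrow> (AE x in M. f x = g x)"
    by (rule separating_sequence_in_A, rule that, blast+)
  \<comment> \<open>Countably many test functions share one null set of times; as they separate
    points of L^2, they identify U t with v t outside it.\<close>
  have "AE t in time_space T. \<forall>n. (\<integral>x. a n x * U t x \<partial>M) = L (a n) t"
    unfolding AE_all_countable L_def using U_eq a(1) by blast
  with U_mass AE_meas AE_space have uU: "AE t in time_space T. AE x in M. U t x = u t x"
  proof eventually_elim
    case (elim t)
    then have t: "t \<in> {0..T}" "t \<in> {0..<T}" by auto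
    have "U t \<in> Lp M 2"
      using elim Ub by (intro bounded_integrable_Lp_two(2)[of _ _ C]) (auto intro: le_less_trans)
    then have "AE x in M. U t x = v t x"
      using elim v(4)[OF t(1) a(1)] vL2[OF t(1)] by (intro a(2)[rule_format]) auto
    with uv[OF t(2)] show ?case by eventually_elim simp
  qed
  \<comment> \<open>\<open>L\<close> was built from the flux of U. Only with the flux of u in its
    place is it an equation for u itself.\<close>
  have L_u: "L f t = (\<integral>x. f x * ubar x \<partial>M) + (\<integral>s. indicator {..<t} s * flux f u s \<partial>time_space T)" if f: "f \<in> A" for f t
  proof -
    have ind: "(indicator {..<t} :: real \<Rightarrow> real) \<in> borel_measurable (time_space T)"
      by (intro measurable_restrict_space1) simp
    have "(\<integral>s. indicator {..<t} s * flux f U s \<partial>time_space T) = (\<integral>s. indicator {..<t} s * flux f u s \<partial>time_space T)"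
    proof (rule integral_cong_AE)
      show "(\<lambda>s. indicator {..<t} s * flux f U s) \<in> borel_measurable (time_space T)"
        "(\<lambda>s. indicator {..<t} s * flux f u s) \<in> borel_measurable (time_space T)"
        using flux_integrable[OF f Um Ub] flux_integrable[OF f um ub] ind by auto
      show "AE s in time_space T. indicator {..<t} s * flux f U s = indicator {..<t} s * flux f u s"
        using uU AE_meas AE_space
      proof eventually_elim
        case (elim s)
        then have s: "s \<in> {0..<T}" "s \<in> {0<..<T}" by auto
        have "flux f U s = flux f u s"
          unfolding flux_def
          using elim(1,2) u_meas[OF s(1)] derivation_measurable[OF b_derivation[OF s(2)] f] by (intro integral_cong_AE) auto
        then show ?case by simp
      qed
    qed
    then show ?thesis by (simp add: L_def)
  qed
  show ?thesis
  proof (intro exI[of _ u] conjI ballI allI)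
    fix t assume t: "t \<in> {0..<T}"
    then have t': "t \<in> {0..T}" by auto
    show "u t \<in> borel_measurable M" by (rule u_meas[OF t])
    have "(\<integral>\<^sup>+x. ennreal (u t x) \<partial>M) = (\<integral>\<^sup>+x. ennreal (v t x) \<partial>M)"
      using uv[OF t] by (intro nn_integral_cong_AE) (auto elim: eventually_mono)
    then show "(\<integral>\<^sup>+x. ennreal (u t x) \<partial>M) \<le> ennreal (\<integral>x. ubar x \<partial>M)" using v(3)[OF t'] by (simp add: B_def)
    fix f assume f: "f \<in> A"
    show "(\<integral>x. f x * u t x \<partial>M) = (\<integral>x. f x * ubar x \<partial>M) + (\<integral>s. indicator {..<t} s * flux f u s \<partial>time_space T)"
      using int_eq[OF t borel_measurable_A[OF f]] v(4)[OF t' f] L_u[OF f] by simp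
  qed (use um ub in auto)
qed

end

section \<open>Dyadic superposition\<close>

text \<open>Level 0 collects all values below 1, and level j + 1 is the range from 2^j up to
  2^(j+1); the pieces \<open>dyadic k\<close> of a function thus live on disjoint sets.\<close>

definition level :: "real \<Rightarrow> nat" where
  "level s = (LEAST k. s < 2 ^ k)"

definition dyadic :: "nat \<Rightarrow> real \<Rightarrow> real" where
  "dyadic k s = (if level s = k then s else 0)"

lemma level_less: "s < 2 ^ level s"
proof -
  obtain n where "s < 2 ^ n" using real_arch_pow[of 2 s] by auto
  then show ?thesis unfolding level_def by (rule LeastI)
qed

lemma level_ge: "level s = Suc k \<Longrightarrow> 2 ^ k \<le> s"
  using not_less_Least[of k "\<lambda>k. s < 2 ^ k"] by (auto simp: level_def)

lemma borel_measurable_dyadic [measurable]: "dyadic k \<in> borel_measurable borel"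
  unfolding dyadic_def level_def by measurable

lemma dyadic_bounds: "0 \<le> s \<Longrightarrow> 0 \<le> dyadic k s" "dyadic k s \<le> 2 ^ k" "0 \<le> s \<Longrightarrow> dyadic k s \<le> s"
  using level_less[of s] by (auto simp: dyadic_def)

lemma sum_dyadic: "(\<Sum>k<n. dyadic k s) = (if level s < n then s else 0)"
  by (induction n) (auto simp: dyadic_def)

lemma suminf_dyadic:
  assumes "0 \<le> s" "\<And>k. 0 \<le> c k"
  shows "(\<Sum>k. ennreal (c k * dyadic k s)) = ennreal (c (level s) * s)"
proof -
  have "(\<Sum>k. ennreal (c k * dyadic k s)) = (\<Sum>k\<in>{level s}. ennreal (c k * dyadic k s))"
    by (rule suminf_finite) (auto simp: dyadic_def)
  then show ?thesis by (simp add: dyadic_def)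
qed

lemma powr_diff_le:
  fixes a b p :: real
  assumes "0 \<le> a" "a \<le> b" "1 \<le> p"
  shows "b powr p - a powr p \<le> p * b powr (p - 1) * (b - a)"
proof (cases "a = b")
  case False
  with assms have ab: "a < b" by simp
  have der: "((\<lambda>x. x powr p) has_real_derivative p * z powr (p - 1)) (at z)" if "a < z" for z
    using that assms by (intro has_real_derivative_powr) auto
  have "continuous_on {a..b} (\<lambda>x. x powr p)"
    using assms by (intro continuous_on_powr') (auto intro: continuous_intros)
  then obtain l z where z: "a < z" "z < b" "((\<lambda>x. x powr p) has_real_derivative l) (at z)" "b powr p - a powr p = (b - a) * l"
    using MVT[OF ab, of "\<lambda>x. x powr p"] der by (metis real_differentiable_def)
  have "l = p * z powr (p - 1)" using DERIV_unique[OF z(3) der[OF z(1)]] .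
  also have "\<dots> \<le> p * b powr (p - 1)" using z assms by (intro mult_left_mono powr_mono2) auto
  finally show ?thesis unfolding z(4) using ab by (simp add: mult.commute)
qed simp

text \<open>This is the interpolation step. Adding a n to a partial sum S raises its p-th power by
  at most p (S + a n)^(p-1) * a n, and S + a n <= 2^(n+1) C by the geometric bounds. The resulting
  bound is linear in the a k, so afterwards only their L^1 norms matter.\<close>

lemma powr_sum_dyadic_le:
  fixes a :: "nat \<Rightarrow> real"
  assumes a: "\<And>k. 0 \<le> a k" "\<And>k. a k \<le> 2 ^ k * C" and C: "0 \<le> C" and p: "1 \<le> p"
  shows "(\<Sum>k<n. a k) powr p \<le> p * (2 * C) powr (p - 1) * (\<Sum>k<n. (2 ^ k) powr (p - 1) * a k)"
proof (induction n)
  case (Suc n)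
  define S where "S n = (\<Sum>k<n. a k)" for n
  have S0: "0 \<le> S n" for n unfolding S_def by (intro sum_nonneg a)
  have "S n \<le> (2 ^ n - 1) * C" for n
  proof (induction n)
    case (Suc n)
    then show ?case using a(2)[of n] by (simp add: S_def algebra_simps)
  qed (simp add: S_def)
  from this[of "Suc n"] have "S (Suc n) \<le> 2 ^ Suc n * C" using C by (simp add: algebra_simps)
  then have "S (Suc n) \<le> 2 * C * 2 ^ n" by (simp add: mult_ac)
  then have "S (Suc n) powr (p - 1) \<le> (2 * C * 2 ^ n) powr (p - 1)" using S0 p by (intro powr_mono2) auto
  also have "\<dots> = (2 * C) powr (p - 1) * (2 ^ n) powr (p - 1)" using C by (simp add: powr_mult)
  finally have le: "S (Suc n) powr (p - 1) \<le> (2 * C) powr (p - 1) * (2 ^ n) powr (p - 1)" .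
  have "S (Suc n) powr p \<le> S n powr p + p * S (Suc n) powr (p - 1) * (S (Suc n) - S n)"
    using powr_diff_le[of "S n" "S (Suc n)" p] S0 a(1)[of n] p by (simp add: S_def)
  also have "S (Suc n) - S n = a n" by (simp add: S_def)
  also have "p * S (Suc n) powr (p - 1) * a n \<le> p * ((2 * C) powr (p - 1) * (2 ^ n) powr (p - 1)) * a n"
    using le a(1)[of n] p by (intro mult_right_mono mult_left_mono) auto
  also have "S n powr p \<le> p * (2 * C) powr (p - 1) * (\<Sum>k<n. (2 ^ k) powr (p - 1) * a k)"
    using Suc by (simp add: S_def)
  finally show ?case by (simp add: S_def algebra_simps)
qed (use p in simp)

text \<open>The sum is formed in [0, infinity] and then converted to a real, which keeps it
  measurable and defined everywhere. On the null set where it is infinite the conversion gives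
  0.\<close>

lemma AE_superposition_limit:
  fixes a :: "nat \<Rightarrow> 'a \<Rightarrow> real"
  assumes [measurable]: "\<And>k. a k \<in> borel_measurable M" and a: "\<And>k x. 0 \<le> a k x"
    and fin: "(\<integral>\<^sup>+x. (\<Sum>k. ennreal (a k x)) \<partial>M) < \<infinity>"
  shows "AE x in M. ennreal (enn2real (\<Sum>k. ennreal (a k x))) = (\<Sum>k. ennreal (a k x)) \<and>
    (\<lambda>n. \<Sum>k<n. a k x) \<longlonglongrightarrow> enn2real (\<Sum>k. ennreal (a k x)) \<and>
    (\<forall>n. (\<Sum>k<n. a k x) \<le> enn2real (\<Sum>k. ennreal (a k x)))"
proof -
  have "AE x in M. (\<Sum>k. ennreal (a k x)) \<noteq> \<infinity>"
    using fin by (intro nn_integral_PInf_AE) auto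
  then show ?thesis
  proof eventually_elim
    case (elim x)
    then have s: "summable (\<lambda>k. a k x)" using summable_suminf_not_top[of "\<lambda>k. a k x"] a by simp
    then have eq: "enn2real (\<Sum>k. ennreal (a k x)) = (\<Sum>k. a k x)"
      using a by (simp add: suminf_ennreal2 suminf_nonneg)
    have "(\<lambda>n. \<Sum>k<n. a k x) \<longlonglongrightarrow> (\<Sum>k. a k x)" using s by (rule summable_LIMSEQ)
    moreover have "(\<Sum>k<n. a k x) \<le> (\<Sum>k. a k x)" for n using s a by (intro sum_le_suminf) auto
    moreover have "ennreal (\<Sum>k. a k x) = (\<Sum>k. ennreal (a k x))" using s a by (simp add: suminf_ennreal2)
    ultimately show ?case unfolding eq by simp
  qed
qed

text \<open>K is found before the family a, since it has to serve all times. Each a k is known only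
  through its sup bound and its mass; the masses of the dyadic pieces, weighted by (2^k)^(p-1), add
  up to a multiple of the integrals of v and v^p. The second moment is recorded because the pairing
  with the velocity needs it.\<close>

lemma dyadic_superposition_Lp:
  fixes v :: "'a \<Rightarrow> real"
  assumes r: "2 \<le> r" and C: "0 \<le> C" and v: "v \<in> Lp M 1" "v \<in> Lp M r" "\<And>x. 0 \<le> v x"
  obtains K where "0 \<le> K"
    "\<And>a :: nat \<Rightarrow> 'a \<Rightarrow> real. \<lbrakk>\<And>k. a k \<in> borel_measurable M; \<And>k x. 0 \<le> a k x; \<And>k x. a k x \<le> 2 ^ k * C;
      \<And>k. (\<integral>\<^sup>+x. ennreal (a k x) \<partial>M) \<le> (\<integral>\<^sup>+x. ennreal (dyadic k (v x)) \<partial>M)\<rbrakk> \<Longrightarrow>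
      (\<integral>\<^sup>+x. (\<Sum>k. ennreal (a k x)) \<partial>M) \<le> (\<integral>\<^sup>+x. ennreal (v x) \<partial>M) \<and>
      (\<lambda>x. enn2real (\<Sum>k. ennreal (a k x))) \<in> Lp M r \<and>
      Lp_norm M r (\<lambda>x. enn2real (\<Sum>k. ennreal (a k x))) \<le> K \<and>
      (\<integral>\<^sup>+x. ennreal ((enn2real (\<Sum>k. ennreal (a k x)))\<^sup>2) \<partial>M) \<le> ennreal K"
proof -
  have vm[measurable]: "v \<in> borel_measurable M" using v by (auto simp: Lp_def)
  define J where "J = enn2real (\<integral>\<^sup>+x. ennreal (v x) \<partial>M)"
  have J: "0 \<le> J" "(\<integral>\<^sup>+x. ennreal (v x) \<partial>M) = ennreal J" using v(1,3) by (auto simp: J_def Lp_def)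
  have L1: "(\<integral>\<^sup>+x. (\<Sum>k. ennreal (a k x)) \<partial>M) \<le> ennreal J"
    if [measurable]: "\<And>k. a k \<in> borel_measurable M" and a: "\<And>k. (\<integral>\<^sup>+x. ennreal (a k x) \<partial>M) \<le> (\<integral>\<^sup>+x. ennreal (dyadic k (v x)) \<partial>M)"
    for a :: "nat \<Rightarrow> 'a \<Rightarrow> real"
  proof -
    have "(\<integral>\<^sup>+x. (\<Sum>k. ennreal (a k x)) \<partial>M) = (\<Sum>k. \<integral>\<^sup>+x. ennreal (a k x) \<partial>M)"
      by (intro nn_integral_suminf) measurable
    also have "\<dots> \<le> (\<Sum>k. \<integral>\<^sup>+x. ennreal (dyadic k (v x)) \<partial>M)" by (intro suminf_le a) auto
    also have "\<dots> = (\<integral>\<^sup>+x. (\<Sum>k. ennreal (1 * dyadic k (v x))) \<partial>M)"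
      by (subst nn_integral_suminf) auto
    also have "\<dots> = (\<integral>\<^sup>+x. ennreal (v x) \<partial>M)"
      by (intro nn_integral_cong) (subst suminf_dyadic, auto simp: v)
    finally show ?thesis by (simp add: J)
  qed
  show ?thesis
  proof (cases "r = \<infinity>")
    case True
    obtain R where R: "AE x in M. \<bar>v x\<bar> \<le> R" using v(2) True by (auto simp: Lp_def)
    obtain n where n: "R < 2 ^ n" using real_arch_pow[of 2 R] by auto
    define K1 where "K1 = (\<Sum>k<Suc n. 2 ^ k * C)"
    have K1: "0 \<le> K1" unfolding K1_def using C by (intro sum_nonneg) auto
    show ?thesis
    proof (rule that[of "K1 + K1 * J"])
      show "0 \<le> K1 + K1 * J" using K1 J by simp
      fix a :: "nat \<Rightarrow> 'a \<Rightarrow> real"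
      assume am[measurable]: "\<And>k. a k \<in> borel_measurable M" and a: "\<And>k x. 0 \<le> a k x" "\<And>k x. a k x \<le> 2 ^ k * C"
        and a1: "\<And>k. (\<integral>\<^sup>+x. ennreal (a k x) \<partial>M) \<le> (\<integral>\<^sup>+x. ennreal (dyadic k (v x)) \<partial>M)"
      define U where "U x = enn2real (\<Sum>k. ennreal (a k x))" for x
      have [measurable]: "U \<in> borel_measurable M" unfolding U_def by measurable
      note L = L1[of a, OF am a1]
      have lim: "AE x in M. ennreal (U x) = (\<Sum>k. ennreal (a k x)) \<and> (\<lambda>n. \<Sum>k<n. a k x) \<longlonglongrightarrow> U x \<and> (\<forall>n. (\<Sum>k<n. a k x) \<le> U x)"
        unfolding U_def by (rule AE_superposition_limit[OF am a(1)]) (use L in \<open>auto intro: le_less_trans\<close>)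
      \<comment> \<open>A bounded v has no levels above n, so the corresponding a k have zero mass
        and only finitely many sup bounds add up.\<close>
      have zero: "AE x in M. a k x = 0" if k: "n < k" for k
      proof -
        have "AE x in M. dyadic k (v x) = 0"
          using R
        proof eventually_elim
          case (elim x)
          show ?case
          proof (rule ccontr)
            assume "dyadic k (v x) \<noteq> 0"
            then have "level (v x) = k" by (auto simp: dyadic_def split: if_splits)
            then obtain j where j: "k = Suc j" "2 ^ j \<le> v x" using k level_ge by (cases k) auto
            have "(2::real) ^ n \<le> 2 ^ j" using k j by (intro power_increasing) auto
            with j n elim show False by linarith
          qed
        qed
        then have "(\<integral>\<^sup>+x. ennreal (dyadic k (v x)) \<partial>M) = (\<integral>\<^sup>+x. 0 \<partial>M)"
          by (intro nn_integral_cong_AE) (auto elim: eventually_mono)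
        then have "(\<integral>\<^sup>+x. ennreal (a k x) \<partial>M) = 0" using a1[of k] by simp
        then have "AE x in M. ennreal (a k x) = 0" by (subst (asm) nn_integral_0_iff_AE) auto
        then show ?thesis by eventually_elim (use a(1) in \<open>simp add: antisym\<close>)
      qed
      have "AE x in M. \<forall>k. n < k \<longrightarrow> a k x = 0" unfolding AE_all_countable using zero by auto
      with lim have U: "AE x in M. \<bar>U x\<bar> \<le> K1"
      proof eventually_elim
        case (elim x)
        have "(\<Sum>k<m. a k x) \<le> K1" for m
        proof -
          have "(\<Sum>k<m. a k x) \<le> (\<Sum>k<m. if k < Suc n then 2 ^ k * C else 0)"
            using elim(2) a(2)[of _ x] by (intro sum_mono) (auto simp: not_less)
          also have "\<dots> \<le> (\<Sum>k<max m (Suc n). if k < Suc n then 2 ^ k * C else 0)"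
            using C by (intro sum_mono2) auto
          also have "\<dots> = K1" unfolding K1_def by (intro sum.mono_neutral_cong_right) auto
          finally show ?thesis .
        qed
        then have "U x \<le> K1" using elim(1) by (intro LIMSEQ_le_const2[of "\<lambda>n. \<Sum>k<n. a k x"]) auto
        then show ?case by (simp add: U_def)
      qed
      have "Lp_norm M r U \<le> K1"
        unfolding Lp_norm_def using True U K1 by (auto intro!: cInf_lower bdd_belowI[of _ 0])
      then have 1: "Lp_norm M r U \<le> K1 + K1 * J" using K1 J by (meson add_increasing2 mult_nonneg_nonneg order_trans order_refl)
      have "(\<integral>\<^sup>+x. ennreal ((U x)\<^sup>2) \<partial>M) \<le> (\<integral>\<^sup>+x. ennreal K1 * (\<Sum>k. ennreal (a k x)) \<partial>M)"
      proof (rule nn_integral_mono_AE)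
        show "AE x in M. ennreal ((U x)\<^sup>2) \<le> ennreal K1 * (\<Sum>k. ennreal (a k x))"
          using lim U
        proof eventually_elim
          case (elim x)
          have U0: "0 \<le> U x" by (simp add: U_def)
          have "(U x)\<^sup>2 \<le> K1 * U x" using elim(2) U0 by (simp add: power2_eq_square mult_right_mono)
          then have "ennreal ((U x)\<^sup>2) \<le> ennreal (K1 * U x)" by (rule ennreal_leI)
          also have "\<dots> = ennreal K1 * ennreal (U x)" using K1 U0 by (simp add: ennreal_mult)
          finally show ?case using elim(1) by simp
        qed
      qed
      also have "\<dots> = ennreal K1 * (\<integral>\<^sup>+x. (\<Sum>k. ennreal (a k x)) \<partial>M)" by (intro nn_integral_cmult) measurable
      also have "\<dots> \<le> ennreal K1 * ennreal J" by (intro mult_left_mono L) auto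
      also have "\<dots> = ennreal (K1 * J)" using K1 J by (simp add: ennreal_mult)
      also have "\<dots> \<le> ennreal (K1 + K1 * J)" using K1 by (intro ennreal_leI) simp
      finally have 2: "(\<integral>\<^sup>+x. ennreal ((U x)\<^sup>2) \<partial>M) \<le> ennreal (K1 + K1 * J)" .
      have "U \<in> Lp M r" using True U by (auto simp: Lp_def)
      with L J 1 2 show "(\<integral>\<^sup>+x. (\<Sum>k. ennreal (a k x)) \<partial>M) \<le> (\<integral>\<^sup>+x. ennreal (v x) \<partial>M) \<and>
        (\<lambda>x. enn2real (\<Sum>k. ennreal (a k x))) \<in> Lp M r \<and>
        Lp_norm M r (\<lambda>x. enn2real (\<Sum>k. ennreal (a k x))) \<le> K1 + K1 * J \<and>
        (\<integral>\<^sup>+x. ennreal ((enn2real (\<Sum>k. ennreal (a k x)))\<^sup>2) \<partial>M) \<le> ennreal (K1 + K1 * J)"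
        by (simp add: U_def[abs_def])
    qed
  next
    case False
    define p where "p = enn2real r"
    have p: "2 \<le> p" unfolding p_def using enn2real_mono[OF r] False by (simp add: top.not_eq_extremum)
    have "(\<integral>\<^sup>+x. ennreal (v x powr p) \<partial>M) < \<infinity>" using v(2,3) False by (simp add: Lp_def p_def)
    then obtain Jp where Jp: "0 \<le> Jp" "(\<integral>\<^sup>+x. ennreal (v x powr p) \<partial>M) = ennreal Jp"
      by (metis ennreal_enn2real enn2real_nonneg infinity_ennreal_def)
    define c where "c = p * (2 * C) powr (p - 1)"
    have c: "0 \<le> c" using p by (simp add: c_def)
    define X where "X = c * (J + 2 powr (p - 1) * Jp)"
    have X: "0 \<le> X" using c J Jp by (simp add: X_def)
    show ?thesis
    proof (rule that[of "X powr (1 / p) + (J + X)"])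
      show "0 \<le> X powr (1 / p) + (J + X)" using X J by simp
      fix a :: "nat \<Rightarrow> 'a \<Rightarrow> real"
      assume am[measurable]: "\<And>k. a k \<in> borel_measurable M" and a: "\<And>k x. 0 \<le> a k x" "\<And>k x. a k x \<le> 2 ^ k * C"
        and a1: "\<And>k. (\<integral>\<^sup>+x. ennreal (a k x) \<partial>M) \<le> (\<integral>\<^sup>+x. ennreal (dyadic k (v x)) \<partial>M)"
      define U where "U x = enn2real (\<Sum>k. ennreal (a k x))" for x
      have U0: "0 \<le> U x" for x by (simp add: U_def)
      have [measurable]: "U \<in> borel_measurable M" unfolding U_def by measurable
      note L = L1[of a, OF am a1]
      have lim: "AE x in M. ennreal (U x) = (\<Sum>k. ennreal (a k x)) \<and> (\<lambda>n. \<Sum>k<n. a k x) \<longlonglongrightarrow> U x \<and> (\<forall>n. (\<Sum>k<n. a k x) \<le> U x)"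
        unfolding U_def by (rule AE_superposition_limit[OF am a(1)]) (use L in \<open>auto intro: le_less_trans\<close>)
      define q where "q k = (2 ^ k) powr (p - 1)" for k :: nat
      have q0: "0 \<le> q k" for k by (simp add: q_def)
      have "(\<integral>\<^sup>+x. ennreal (U x powr p) \<partial>M) \<le> (\<integral>\<^sup>+x. ennreal c * (\<Sum>k. ennreal (q k * a k x)) \<partial>M)"
      proof (rule nn_integral_mono_AE)
        show "AE x in M. ennreal (U x powr p) \<le> ennreal c * (\<Sum>k. ennreal (q k * a k x))"
          using lim
        proof eventually_elim
          case (elim x)
          have "(\<lambda>n. (\<Sum>k<n. a k x) powr p) \<longlonglongrightarrow> U x powr p"
          proof (rule tendsto_powr')
            show "(\<lambda>n. \<Sum>k<n. a k x) \<longlonglongrightarrow> U x" using elim by blast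
            have "\<forall>\<^sub>F n in sequentially. 0 \<le> (\<Sum>k<n. a k x)" using a by (intro always_eventually allI sum_nonneg) simp
            then show "U x \<noteq> 0 \<or> 0 < p \<and> (\<forall>\<^sub>F n in sequentially. 0 \<le> (\<Sum>k<n. a k x))" using p by simp
          qed simp
          then have to: "(\<lambda>n. ennreal ((\<Sum>k<n. a k x) powr p)) \<longlonglongrightarrow> ennreal (U x powr p)"
            by (rule tendsto_ennrealI)
          have le: "ennreal ((\<Sum>k<n. a k x) powr p) \<le> ennreal c * (\<Sum>k. ennreal (q k * a k x))" for n
          proof -
            have "ennreal ((\<Sum>k<n. a k x) powr p) \<le> ennreal (c * (\<Sum>k<n. q k * a k x))"
              unfolding c_def q_def using a C p by (intro ennreal_leI powr_sum_dyadic_le) auto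
            also have "\<dots> = ennreal c * (\<Sum>k<n. ennreal (q k * a k x))"
              using c a q0 by (subst sum_ennreal) (auto simp: ennreal_mult sum_nonneg)
            also have "\<dots> \<le> ennreal c * (\<Sum>k. ennreal (q k * a k x))"
              by (intro mult_left_mono sum_le_suminf) auto
            finally show ?thesis .
          qed
          show ?case by (rule LIMSEQ_le_const2[OF to]) (blast intro: le)
        qed
      qed
      also have "\<dots> = ennreal c * (\<Sum>k. ennreal (q k) * (\<integral>\<^sup>+x. ennreal (a k x) \<partial>M))"
        using q0 a by (simp add: nn_integral_cmult nn_integral_suminf ennreal_mult)
      also have "\<dots> \<le> ennreal c * (\<Sum>k. ennreal (q k) * (\<integral>\<^sup>+x. ennreal (dyadic k (v x)) \<partial>M))"
        by (intro mult_left_mono suminf_le a1) auto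
      also have "\<dots> = ennreal c * (\<integral>\<^sup>+x. (\<Sum>k. ennreal (q k * dyadic k (v x))) \<partial>M)"
        using q0 v(3) by (simp add: nn_integral_cmult nn_integral_suminf ennreal_mult dyadic_bounds)
      also have "\<dots> \<le> ennreal c * (\<integral>\<^sup>+x. ennreal (v x) + ennreal (2 powr (p - 1)) * ennreal (v x powr p) \<partial>M)"
      proof (intro mult_left_mono nn_integral_mono)
        fix x
        \<comment> \<open>Level 0 has weight 1 and gives the term v. At level j + 1 the value is at
          least 2^j, so 2^(j+1) <= 2 v and the weight is at most (2 v)^(p-1).\<close>
        have "q (level (v x)) * v x \<le> v x + 2 powr (p - 1) * v x powr p"
        proof (cases "level (v x)")
          case 0
          then show ?thesis by (simp add: q_def)
        next
          case (Suc j)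
          then have vj: "2 ^ j \<le> v x" by (rule level_ge)
          then have vp: "0 < v x" by (rule less_le_trans[rotated]) simp
          have "q (level (v x)) \<le> (2 * v x) powr (p - 1)"
            unfolding q_def Suc using vj p by (intro powr_mono2) auto
          also have "\<dots> = 2 powr (p - 1) * v x powr (p - 1)" using vp by (simp add: powr_mult)
          finally have "q (level (v x)) * v x \<le> 2 powr (p - 1) * v x powr (p - 1) * v x"
            using vp by (intro mult_right_mono) auto
          also have "\<dots> = 2 powr (p - 1) * v x powr p" using vp by (simp add: powr_diff)
          finally show ?thesis using vp by simp
        qed
        then have "ennreal (q (level (v x)) * v x) \<le> ennreal (v x + 2 powr (p - 1) * v x powr p)" by (rule ennreal_leI)
        then show "(\<Sum>k. ennreal (q k * dyadic k (v x))) \<le> ennreal (v x) + ennreal (2 powr (p - 1)) * ennreal (v x powr p)"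
          using v(3)[of x] q0 by (simp add: suminf_dyadic ennreal_mult)
      qed simp
      also have "\<dots> = ennreal c * (ennreal J + ennreal (2 powr (p - 1)) * ennreal Jp)"
        by (simp add: nn_integral_add nn_integral_cmult J Jp)
      also have "\<dots> = ennreal X" using c J Jp by (simp add: X_def ennreal_mult)
      finally have Up: "(\<integral>\<^sup>+x. ennreal (U x powr p) \<partial>M) \<le> ennreal X" .
      have ULr: "U \<in> Lp M r"
        using False Up U0 by (auto simp: Lp_def p_def[symmetric] intro: le_less_trans)
      have "(\<integral>x. U x powr p \<partial>M) \<le> X"
      proof -
        have "(\<integral>x. U x powr p \<partial>M) = enn2real (\<integral>\<^sup>+x. ennreal (U x powr p) \<partial>M)"
          by (intro integral_eq_nn_integral) auto
        also have "\<dots> \<le> X" using enn2real_mono[OF Up] X by simp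
        finally show ?thesis .
      qed
      then have "(\<integral>x. U x powr p \<partial>M) powr (1 / p) \<le> X powr (1 / p)"
        using p by (intro powr_mono2 integral_nonneg_AE) auto
      then have 1: "Lp_norm M r U \<le> X powr (1 / p) + (J + X)"
        using False U0 J X by (simp add: Lp_norm_def p_def[symmetric])
      have "(\<integral>\<^sup>+x. ennreal ((U x)\<^sup>2) \<partial>M) \<le> (\<integral>\<^sup>+x. (\<Sum>k. ennreal (a k x)) + ennreal (U x powr p) \<partial>M)"
      proof (rule nn_integral_mono_AE)
        show "AE x in M. ennreal ((U x)\<^sup>2) \<le> (\<Sum>k. ennreal (a k x)) + ennreal (U x powr p)"
          using lim
        proof eventually_elim
          case (elim x)
          \<comment> \<open>The exponent 2 lies between 1 and p, which is what r >= 2 provides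
            here.\<close>
          have "(U x)\<^sup>2 \<le> U x + U x powr p"
          proof (cases "U x \<le> 1")
            case True
            have "(U x)\<^sup>2 \<le> U x" using True U0[of x] by (simp add: power2_eq_square mult_left_le)
            then show ?thesis by (simp add: add_increasing2)
          next
            case False
            then have "(U x)\<^sup>2 = U x powr 2" by simp
            also have "\<dots> \<le> U x powr p" using False p by (intro powr_mono) auto
            finally show ?thesis using U0[of x] by simp
          qed
          then have "ennreal ((U x)\<^sup>2) \<le> ennreal (U x + U x powr p)" by (rule ennreal_leI)
          then show ?case using elim U0[of x] by simp
        qed
      qed
      also have "\<dots> = (\<integral>\<^sup>+x. (\<Sum>k. ennreal (a k x)) \<partial>M) + (\<integral>\<^sup>+x. ennreal (U x powr p) \<partial>M)"
        by (intro nn_integral_add) measurable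
      also have "\<dots> \<le> ennreal J + ennreal X" by (intro add_mono L Up)
      also have "\<dots> = ennreal (J + X)" using J X by simp
      also have "\<dots> \<le> ennreal (X powr (1 / p) + (J + X))" by (intro ennreal_leI) simp
      finally have 2: "(\<integral>\<^sup>+x. ennreal ((U x)\<^sup>2) \<partial>M) \<le> ennreal (X powr (1 / p) + (J + X))" .
      from L J 1 2 ULr show "(\<integral>\<^sup>+x. (\<Sum>k. ennreal (a k x)) \<partial>M) \<le> (\<integral>\<^sup>+x. ennreal (v x) \<partial>M) \<and>
        (\<lambda>x. enn2real (\<Sum>k. ennreal (a k x))) \<in> Lp M r \<and>
        Lp_norm M r (\<lambda>x. enn2real (\<Sum>k. ennreal (a k x))) \<le> X powr (1 / p) + (J + X) \<and>
        (\<integral>\<^sup>+x. ennreal ((enn2real (\<Sum>k. ennreal (a k x)))\<^sup>2) \<partial>M) \<le> ennreal (X powr (1 / p) + (J + X))"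
        by (simp add: U_def[abs_def])
    qed
  qed
qed

section \<open>Solutions in integrated form and their superposition\<close>

context transport
begin

text \<open>Membership in \<open>L\<^sup>\<infinity>((0,T); L\<^sup>1 \<inter> L\<^sup>2)\<close>, the class in which \<open>|g| |u|\<close> is integrable over space-time.\<close>
definition regular :: "(real \<Rightarrow> 'a \<Rightarrow> real) \<Rightarrow> bool" where
  "regular u \<longleftrightarrow> (\<lambda>(t, x). u t x) \<in> borel_measurable N \<and>
     (\<exists>K. AE t in time_space T. (\<integral>\<^sup>+x. ennreal \<bar>u t x\<bar> \<partial>M) \<le> ennreal K \<and> (\<integral>\<^sup>+x. ennreal ((u t x)\<^sup>2) \<partial>M) \<le> ennreal K)"

lemma regular_g_integrable:
  assumes u: "regular u"
  shows "integrable N (\<lambda>(t, x). \<bar>g t x\<bar> * \<bar>u t x\<bar>)"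
proof -
  from u obtain K where um: "(\<lambda>(t, x). u t x) \<in> borel_measurable N"
    and K: "AE t in time_space T. (\<integral>\<^sup>+x. ennreal \<bar>u t x\<bar> \<partial>M) \<le> ennreal K \<and> (\<integral>\<^sup>+x. ennreal ((u t x)\<^sup>2) \<partial>M) \<le> ennreal K"
    by (auto simp: regular_def)
  have "(\<lambda>(t, x). \<bar>u t x\<bar>) \<in> borel_measurable N"
    using measurable_compose[OF um, of abs borel] by (simp add: split_beta')
  then show ?thesis
    by (rule time_L1_sum_integrable[OF sigma_finite_M g_L1, where K=K]) (use K in auto)
qed

text \<open>Here u may be unbounded: the bounded square root of \<open>\<Gamma> f f\<close> is taken
  out, and |g| |u| is integrable by the moments of u.\<close>

lemma regular_b_integrable:
  assumes f: "f \<in> A" and u: "regular u"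
  shows "integrable N (\<lambda>(t, x). b t f x * u t x)"
proof -
  obtain R where R: "0 \<le> R" "AE x in M. \<bar>sqrt (\<Gamma> f f x)\<bar> \<le> R" using sqrt_Gamma_bounded[OF f] by blast
  have um: "(\<lambda>(t, x). u t x) \<in> borel_measurable N" using u by (auto simp: regular_def)
  have [measurable]: "(\<lambda>x. sqrt (\<Gamma> f f x)) \<in> borel_measurable M" using sqrt_Gamma_integrable[OF f] by auto
  have RN: "AE p in N. \<bar>sqrt (\<Gamma> f f (snd p))\<bar> \<le> R"
    using R(2) by (intro pair.AE_pair_measure) auto
  show ?thesis
  proof (rule Bochner_Integration.integrable_bound[OF integrable_mult_right[of R, OF regular_g_integrable[OF u]]])
    show "(\<lambda>(t, x). b t f x * u t x) \<in> borel_measurable N"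
      using b_measurable[OF f] um by (simp add: split_beta')
    show "AE p in N. norm (case p of (t, x) \<Rightarrow> b t f x * u t x) \<le> norm (R * (case p of (t, x) \<Rightarrow> \<bar>g t x\<bar> * \<bar>u t x\<bar>))"
      using b_bound[OF f] RN
    proof eventually_elim
      case (elim p)
      obtain t x where p: "p = (t, x)" by fastforce
      have "\<bar>b t f x\<bar> \<le> \<bar>g t x\<bar> * sqrt (\<Gamma> f f x)" using elim(1) by (simp add: p)
      also have "\<dots> \<le> \<bar>g t x\<bar> * R" using elim(2) by (intro mult_left_mono) (auto simp: p)
      finally have "\<bar>b t f x\<bar> * \<bar>u t x\<bar> \<le> (\<bar>g t x\<bar> * R) * \<bar>u t x\<bar>" by (intro mult_right_mono) auto
      then show ?case using R by (simp add: p abs_mult mult_ac)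
    qed
  qed
qed

lemma regular_flux_integrable: "f \<in> A \<Longrightarrow> regular u \<Longrightarrow> integrable (time_space T) (flux f u)"
  using pair.integrable_fst'[OF regular_b_integrable, of f u] by (simp add: flux_def[abs_def])

lemma indicator_time_integrable:
  assumes "integrable N (\<lambda>(s, x). F s x)"
  shows "integrable N (\<lambda>(s, x). indicator {..<t} s * F s x :: real)"
proof (rule Bochner_Integration.integrable_bound[OF assms])
  have [measurable]: "(indicator {..<t} :: real \<Rightarrow> real) \<in> borel_measurable (time_space T)"
    by (intro measurable_restrict_space1) simp
  have [measurable]: "(\<lambda>p. F (fst p) (snd p)) \<in> borel_measurable N"
    using borel_measurable_integrable[OF assms] by (simp add: split_beta')
  show "(\<lambda>(s, x). indicator {..<t} s * F s x :: real) \<in> borel_measurable N"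
    unfolding split_beta' by measurable
qed (auto simp: indicator_def)

text \<open>Slice integrals are well behaved only at almost every s. In space-time form the flux
  term is additive in u and passes to the limit by dominated convergence.\<close>

lemma flux_integral_eq:
  assumes "f \<in> A" "regular u"
  shows "(\<integral>s. indicator {..<t} s * flux f u s \<partial>time_space T) = (\<integral>(s, x). indicator {..<t} s * (b s f x * u s x) \<partial>N)"
  using pair.integral_fst'[OF indicator_time_integrable[OF regular_b_integrable[OF assms], of t]]
  by (simp add: flux_def)

text \<open>The equation integrated from 0 to t, imposed at every t in [0, T). Weak continuity, the
  weak formulation and the conservation of mass are all read off from it.\<close>

definition solves :: "('a \<Rightarrow> real) \<Rightarrow> (real \<Rightarrow> 'a \<Rightarrow> real) \<Rightarrow> bool" where
  "solves v u \<longleftrightarrow> regular u \<and> (\<forall>t\<in>{0..<T}. integrable M (u t)) \<and>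
     (\<forall>t\<in>{0..<T}. \<forall>f\<in>A. (\<integral>x. f x * u t x \<partial>M)
        = (\<integral>x. f x * v x \<partial>M) + (\<integral>s. indicator {..<t} s * flux f u s \<partial>time_space T))"

lemma A_times_integrable:
  assumes f: "f \<in> A" and v: "integrable M v"
  shows "integrable M (\<lambda>x. f x * v x)"
proof -
  obtain R where R: "0 \<le> R" "AE x in M. \<bar>f x\<bar> \<le> R" using A_bounded[OF f] by blast
  have [measurable]: "f \<in> borel_measurable M" "v \<in> borel_measurable M" using borel_measurable_A[OF f] v by auto
  show ?thesis
    by (rule Bochner_Integration.integrable_bound[OF integrable_mult_right[of R, OF v]])
      (use R in \<open>auto simp: abs_mult elim!: eventually_mono intro!: mult_right_mono\<close>)
qed

text \<open>The k-th dyadic piece of the datum is at most 2^k, so it has a solution of size at most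
  2^k C0 whose mass does not exceed that of the piece; these are the inputs of
  \<open>dyadic_superposition_Lp\<close> at each t. The equation for the sum follows by dominated
  convergence, with the sum itself providing the majorant.\<close>

lemma nonneg_solution:
  assumes C0: "0 \<le> C0" and energy: "\<forall>v m. integrable M v \<longrightarrow> (\<forall>x. 0 \<le> v x \<and> v x \<le> m) \<longrightarrow> energy_bound v (m * C0)"
    and r: "2 \<le> r" and v: "v \<in> Lp M 1" "v \<in> Lp M r" "\<And>x. 0 \<le> v x"
  shows "\<exists>u K. solves v u \<and> (\<forall>t x. 0 \<le> u t x) \<and>
    (\<forall>t\<in>{0..<T}. u t \<in> Lp M r \<and> Lp_norm M r (u t) \<le> K \<and> (\<integral>\<^sup>+x. ennreal (u t x) \<partial>M) \<le> (\<integral>\<^sup>+x. ennreal (v x) \<partial>M))"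
proof -
  have vm[measurable]: "v \<in> borel_measurable M" using v by (auto simp: Lp_def)
  have vfin: "(\<integral>\<^sup>+x. ennreal (v x) \<partial>M) < \<infinity>" using v by (simp add: Lp_def)
  have vi: "integrable M v" using vfin v(3) by (intro integrableI_bounded) auto
  have dyi: "integrable M (\<lambda>x. dyadic k (v x))" for k
    by (rule Bochner_Integration.integrable_bound[OF vi]) (use dyadic_bounds v(3) in auto)
  have "\<exists>u. (\<lambda>(t, x). u t x) \<in> borel_measurable N \<and> (\<forall>t x. 0 \<le> u t x \<and> u t x \<le> 2 ^ k * C0) \<and>
    (\<forall>t\<in>{0..<T}. u t \<in> borel_measurable M \<and> (\<integral>\<^sup>+x. ennreal (u t x) \<partial>M) \<le> ennreal (\<integral>x. dyadic k (v x) \<partial>M) \<and>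
       (\<forall>f\<in>A. (\<integral>x. f x * u t x \<partial>M)
        = (\<integral>x. f x * dyadic k (v x) \<partial>M) + (\<integral>s. indicator {..<t} s * flux f u s \<partial>time_space T)))" for k
    by (rule bounded_solution[where m="2 ^ k"])
      (use C0 dyi dyadic_bounds v(3) in \<open>auto intro!: energy[rule_format]\<close>)
  then have "\<exists>u. \<forall>k. (\<lambda>(t, x). u k t x) \<in> borel_measurable N \<and> (\<forall>t x. 0 \<le> u k t x \<and> u k t x \<le> 2 ^ k * C0) \<and>
    (\<forall>t\<in>{0..<T}. u k t \<in> borel_measurable M \<and> (\<integral>\<^sup>+x. ennreal (u k t x) \<partial>M) \<le> ennreal (\<integral>x. dyadic k (v x) \<partial>M) \<and>
       (\<forall>f\<in>A. (\<integral>x. f x * u k t x \<partial>M)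
        = (\<integral>x. f x * dyadic k (v x) \<partial>M) + (\<integral>s. indicator {..<t} s * flux f (u k) s \<partial>time_space T)))"
    by (intro choice allI)
  then obtain u where um: "\<And>k. (\<lambda>(t, x). u k t x) \<in> borel_measurable N"
    and ub: "\<And>k t x. 0 \<le> u k t x" "\<And>k t x. u k t x \<le> 2 ^ k * C0"
    and utm: "\<And>k t. t \<in> {0..<T} \<Longrightarrow> u k t \<in> borel_measurable M"
    and u_mass: "\<And>k t. t \<in> {0..<T} \<Longrightarrow> (\<integral>\<^sup>+x. ennreal (u k t x) \<partial>M) \<le> ennreal (\<integral>x. dyadic k (v x) \<partial>M)"
    and u_eq: "\<And>k t f. t \<in> {0..<T} \<Longrightarrow> f \<in> A \<Longrightarrow> (\<integral>x. f x * u k t x \<partial>M)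
        = (\<integral>x. f x * dyadic k (v x) \<partial>M) + (\<integral>s. indicator {..<t} s * flux f (u k) s \<partial>time_space T)"
    by blast
  have u_mass': "(\<integral>\<^sup>+x. ennreal (u k t x) \<partial>M) \<le> (\<integral>\<^sup>+x. ennreal (dyadic k (v x)) \<partial>M)" if "t \<in> {0..<T}" for k t
    using u_mass[OF that, of k] nn_integral_eq_integral[OF dyi[of k]] dyadic_bounds(1) v(3) by simp
  obtain K where K: "0 \<le> K"
    "\<And>a :: nat \<Rightarrow> 'a \<Rightarrow> real. \<lbrakk>\<And>k. a k \<in> borel_measurable M; \<And>k x. 0 \<le> a k x; \<And>k x. a k x \<le> 2 ^ k * C0;
      \<And>k. (\<integral>\<^sup>+x. ennreal (a k x) \<partial>M) \<le> (\<integral>\<^sup>+x. ennreal (dyadic k (v x)) \<partial>M)\<rbrakk> \<Longrightarrow>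
      (\<integral>\<^sup>+x. (\<Sum>k. ennreal (a k x)) \<partial>M) \<le> (\<integral>\<^sup>+x. ennreal (v x) \<partial>M) \<and>
      (\<lambda>x. enn2real (\<Sum>k. ennreal (a k x))) \<in> Lp M r \<and>
      Lp_norm M r (\<lambda>x. enn2real (\<Sum>k. ennreal (a k x))) \<le> K \<and>
      (\<integral>\<^sup>+x. ennreal ((enn2real (\<Sum>k. ennreal (a k x)))\<^sup>2) \<partial>M) \<le> ennreal K"
  proof (rule dyadic_superposition_Lp[OF r C0 v], goal_cases)
    case (1 K)
    show ?case by (rule 1(1)[OF 1(2)], rule 1(3); blast)
  qed
  define U where "U t x = enn2real (\<Sum>k. ennreal (u k t x))" for t x
  have U0: "0 \<le> U t x" for t x by (simp add: U_def)
  have UK: "(\<integral>\<^sup>+x. (\<Sum>k. ennreal (u k t x)) \<partial>M) \<le> (\<integral>\<^sup>+x. ennreal (v x) \<partial>M)" "U t \<in> Lp M r" "Lp_norm M r (U t) \<le> K"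
    "(\<integral>\<^sup>+x. ennreal ((U t x)\<^sup>2) \<partial>M) \<le> ennreal K" if t: "t \<in> {0..<T}" for t
    using K(2)[of "\<lambda>k. u k t", OF utm[OF t] ub u_mass'[OF t]] by (simp_all add: U_def[abs_def])
  have lim: "AE x in M. ennreal (U t x) = (\<Sum>k. ennreal (u k t x)) \<and> (\<lambda>n. \<Sum>k<n. u k t x) \<longlonglongrightarrow> U t x \<and> (\<forall>n. (\<Sum>k<n. u k t x) \<le> U t x)"
    if t: "t \<in> {0..<T}" for t
    unfolding U_def by (rule AE_superposition_limit[OF utm[OF t] ub(1)]) (use UK(1)[OF t] vfin in \<open>auto intro: le_less_trans\<close>)
  have Utm: "U t \<in> borel_measurable M" if t: "t \<in> {0..<T}" for t
    using UK(2)[OF t] by (auto simp: Lp_def)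
  have U_mass: "(\<integral>\<^sup>+x. ennreal (U t x) \<partial>M) \<le> (\<integral>\<^sup>+x. ennreal (v x) \<partial>M)" if t: "t \<in> {0..<T}" for t
  proof -
    have "(\<integral>\<^sup>+x. ennreal (U t x) \<partial>M) = (\<integral>\<^sup>+x. (\<Sum>k. ennreal (u k t x)) \<partial>M)"
      using lim[OF t] by (intro nn_integral_cong_AE) (auto elim: eventually_mono)
    then show ?thesis using UK(1)[OF t] by simp
  qed
  have Ui: "integrable M (U t)" if t: "t \<in> {0..<T}" for t
    using Utm[OF t] U_mass[OF t] vfin U0 by (intro integrableI_bounded) (auto intro: le_less_trans)
  define uN where "uN k p = u k (fst p) (snd p)" for k p
  have uNm[measurable]: "uN k \<in> borel_measurable N" for k using um[of k] by (simp add: uN_def[abs_def] split_beta')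
  have Um: "(\<lambda>(t, x). U t x) \<in> borel_measurable N"
  proof -
    have "(\<lambda>p. enn2real (\<Sum>k. ennreal (uN k p))) \<in> borel_measurable N" by measurable
    then show ?thesis by (simp add: U_def uN_def split_beta')
  qed
  define J where "J = enn2real (\<integral>\<^sup>+x. ennreal (v x) \<partial>M)"
  have J: "(\<integral>\<^sup>+x. ennreal (v x) \<partial>M) = ennreal J" "0 \<le> J" using vfin by (auto simp: J_def)
  have reg: "regular U"
    unfolding regular_def
  proof (intro conjI exI[of _ "J + K"])
    show "AE t in time_space T. (\<integral>\<^sup>+x. ennreal \<bar>U t x\<bar> \<partial>M) \<le> ennreal (J + K) \<and> (\<integral>\<^sup>+x. ennreal ((U t x)\<^sup>2) \<partial>M) \<le> ennreal (J + K)"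
    proof (rule AE_I2)
      fix t assume "t \<in> space (time_space T)"
      then have t: "t \<in> {0..<T}" by auto
      have "ennreal J \<le> ennreal (J + K)" "ennreal K \<le> ennreal (J + K)" using J K by (auto intro!: ennreal_leI)
      with U_mass[OF t] UK(4)[OF t] show "(\<integral>\<^sup>+x. ennreal \<bar>U t x\<bar> \<partial>M) \<le> ennreal (J + K) \<and> (\<integral>\<^sup>+x. ennreal ((U t x)\<^sup>2) \<partial>M) \<le> ennreal (J + K)"
        using U0 by (auto simp: J(1) intro: order_trans)
    qed
  qed (rule Um)
  \<comment> \<open>The flux term is an integral over space-time, so convergence is needed almost
    everywhere in the product too; the mass bound, uniform on the bounded interval, makes the sum
    finite there.\<close>
  have limN: "AE p in N. (\<lambda>n. \<Sum>k<n. uN k p) \<longlonglongrightarrow> U (fst p) (snd p) \<and> (\<forall>n. (\<Sum>k<n. uN k p) \<le> U (fst p) (snd p))"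
  proof -
    have "(\<integral>\<^sup>+p. (\<Sum>k. ennreal (uN k p)) \<partial>N) = (\<integral>\<^sup>+t. (\<integral>\<^sup>+x. (\<Sum>k. ennreal (uN k (t, x))) \<partial>M) \<partial>time_space T)"
      by (rule M.nn_integral_fst[symmetric]) measurable
    also have "\<dots> \<le> (\<integral>\<^sup>+t. ennreal J \<partial>time_space T)"
      using UK(1) J by (intro nn_integral_mono) (auto simp: uN_def)
    also have "\<dots> = ennreal J * emeasure (time_space T) (space (time_space T))" by simp
    also have "\<dots> < \<infinity>"
    proof -
      have "emeasure (time_space T) {0<..<T} < top"
        using \<tau>.emeasure_finite[of "{0<..<T}"] by (metis infinity_ennreal_def top.not_eq_extremum)
      then show ?thesis by (simp add: ennreal_mult_less_top)
    qed
    finally have "AE p in N. ennreal (enn2real (\<Sum>k. ennreal (uN k p))) = (\<Sum>k. ennreal (uN k p)) \<and>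
       (\<lambda>n. \<Sum>k<n. uN k p) \<longlonglongrightarrow> enn2real (\<Sum>k. ennreal (uN k p)) \<and> (\<forall>n. (\<Sum>k<n. uN k p) \<le> enn2real (\<Sum>k. ennreal (uN k p)))"
      by (intro AE_superposition_limit uNm) (auto simp: uN_def ub)
    then show ?thesis by eventually_elim (auto simp: U_def uN_def)
  qed
  have reg_k: "regular (u k)" for k
    unfolding regular_def
  proof (intro conjI exI[of _ "J + 2 ^ k * C0 * J"])
    show "AE t in time_space T. (\<integral>\<^sup>+x. ennreal \<bar>u k t x\<bar> \<partial>M) \<le> ennreal (J + 2 ^ k * C0 * J) \<and> (\<integral>\<^sup>+x. ennreal ((u k t x)\<^sup>2) \<partial>M) \<le> ennreal (J + 2 ^ k * C0 * J)"
    proof (rule AE_I2)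
      fix t assume "t \<in> space (time_space T)"
      then have t: "t \<in> {0..<T}" by auto
      note [measurable] = utm[OF t, of k]
      have "(\<integral>\<^sup>+x. ennreal (u k t x) \<partial>M) \<le> (\<integral>\<^sup>+x. ennreal (dyadic k (v x)) \<partial>M)" by (rule u_mass'[OF t])
      also have "\<dots> \<le> ennreal J" unfolding J(1)[symmetric] using dyadic_bounds(3) v(3) by (intro nn_integral_mono ennreal_leI) auto
      finally have 1: "(\<integral>\<^sup>+x. ennreal (u k t x) \<partial>M) \<le> ennreal J" .
      have "(\<integral>\<^sup>+x. ennreal ((u k t x)\<^sup>2) \<partial>M) \<le> (\<integral>\<^sup>+x. ennreal (2 ^ k * C0) * ennreal (u k t x) \<partial>M)"
        using ub C0 by (intro nn_integral_mono) (auto simp: power2_eq_square ennreal_mult[symmetric] intro!: ennreal_leI mult_right_mono)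
      also have "\<dots> = ennreal (2 ^ k * C0) * (\<integral>\<^sup>+x. ennreal (u k t x) \<partial>M)" by (intro nn_integral_cmult) measurable
      also have "\<dots> \<le> ennreal (2 ^ k * C0) * ennreal J" by (intro mult_left_mono 1) auto
      also have "\<dots> = ennreal (2 ^ k * C0 * J)" using C0 J by (simp add: ennreal_mult)
      finally have 2: "(\<integral>\<^sup>+x. ennreal ((u k t x)\<^sup>2) \<partial>M) \<le> ennreal (2 ^ k * C0 * J)" .
      have "ennreal J \<le> ennreal (J + 2 ^ k * C0 * J)" "ennreal (2 ^ k * C0 * J) \<le> ennreal (J + 2 ^ k * C0 * J)"
        using J C0 by (auto intro!: ennreal_leI)
      with 1 2 show "(\<integral>\<^sup>+x. ennreal \<bar>u k t x\<bar> \<partial>M) \<le> ennreal (J + 2 ^ k * C0 * J) \<and> (\<integral>\<^sup>+x. ennreal ((u k t x)\<^sup>2) \<partial>M) \<le> ennreal (J + 2 ^ k * C0 * J)"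
        using ub by (auto intro: order_trans)
    qed
  qed (rule um)
  have "(\<integral>x. f x * U t x \<partial>M) = (\<integral>x. f x * v x \<partial>M) + (\<integral>s. indicator {..<t} s * flux f U s \<partial>time_space T)"
    if t: "t \<in> {0..<T}" and f: "f \<in> A" for t f
  proof -
    have [measurable]: "f \<in> borel_measurable M" by (rule borel_measurable_A[OF f])
    note [measurable] = utm[OF t] Utm[OF t]
    have ui: "integrable M (u k t)" for k
      by (rule bounded_integrable_Lp_two(1)[OF utm[OF t] ub le_less_trans[OF u_mass[OF t]]]) simp
    have 1: "(\<lambda>n. \<integral>x. f x * (\<Sum>k<n. u k t x) \<partial>M) \<longlonglongrightarrow> (\<integral>x. f x * U t x \<partial>M)"
    proof (rule integral_dominated_convergence[where w="\<lambda>x. \<bar>f x * U t x\<bar>"])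
      show "integrable M (\<lambda>x. \<bar>f x * U t x\<bar>)" using A_times_integrable[OF f Ui[OF t]] by simp
      show "AE x in M. (\<lambda>n. f x * (\<Sum>k<n. u k t x)) \<longlonglongrightarrow> f x * U t x"
        using lim[OF t] by eventually_elim (auto intro: tendsto_mult)
      show "AE x in M. norm (f x * (\<Sum>k<n. u k t x)) \<le> \<bar>f x * U t x\<bar>" for n
        using lim[OF t] by eventually_elim (use ub U0 in \<open>auto simp: abs_mult sum_nonneg intro!: mult_left_mono\<close>)
    qed measurable
    have 2: "(\<lambda>n. \<integral>x. f x * (\<Sum>k<n. dyadic k (v x)) \<partial>M) \<longlonglongrightarrow> (\<integral>x. f x * v x \<partial>M)"
    proof (rule integral_dominated_convergence[where w="\<lambda>x. \<bar>f x * v x\<bar>"])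
      show "integrable M (\<lambda>x. \<bar>f x * v x\<bar>)" using A_times_integrable[OF f vi] by simp
      show "AE x in M. (\<lambda>n. f x * (\<Sum>k<n. dyadic k (v x))) \<longlonglongrightarrow> f x * v x"
      proof (rule AE_I2, rule tendsto_eventually)
        fix x show "\<forall>\<^sub>F n in sequentially. f x * (\<Sum>k<n. dyadic k (v x)) = f x * v x"
          using eventually_gt_at_top[of "level (v x)"] by eventually_elim (simp add: sum_dyadic)
      qed
      show "AE x in M. norm (f x * (\<Sum>k<n. dyadic k (v x))) \<le> \<bar>f x * v x\<bar>" for n
        by (rule AE_I2) (auto simp: sum_dyadic abs_mult)
    qed measurable
    \<comment> \<open>Additivity of this functional on partial sums rests on the regularity of each
      u k, and its limit on the integrable majorant |b f U|.\<close>
    define \<Phi> where "\<Phi> w = (\<integral>(s, x). indicator {..<t} s * (b s f x * w s x) \<partial>N)" for w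
    have bm[measurable]: "(\<lambda>p. b (fst p) f (snd p)) \<in> borel_measurable N" using b_measurable[OF f] by (simp add: split_beta')
    have ind[measurable]: "(indicator {..<t} :: real \<Rightarrow> real) \<in> borel_measurable (time_space T)"
      by (intro measurable_restrict_space1) simp
    have U2[measurable]: "(\<lambda>p. U (fst p) (snd p)) \<in> borel_measurable N" using Um by (simp add: split_beta')
    have 3: "(\<lambda>n. \<Phi> (\<lambda>s x. \<Sum>k<n. u k s x)) \<longlonglongrightarrow> \<Phi> U"
      unfolding \<Phi>_def
    proof (rule integral_dominated_convergence[where w="\<lambda>(s, x). \<bar>b s f x * U s x\<bar>"])
      show "integrable N (\<lambda>(s, x). \<bar>b s f x * U s x\<bar>)"
        using integrable_abs[OF regular_b_integrable[OF f reg]] by (simp add: split_beta')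
      show "AE p in N. (\<lambda>n. case p of (s, x) \<Rightarrow> indicator {..<t} s * (b s f x * (\<Sum>k<n. u k s x)))
          \<longlonglongrightarrow> (case p of (s, x) \<Rightarrow> indicator {..<t} s * (b s f x * U s x))"
        using limN by eventually_elim (auto simp: split_beta' uN_def intro!: tendsto_mult)
      show "AE p in N. norm (case p of (s, x) \<Rightarrow> indicator {..<t} s * (b s f x * (\<Sum>k<n. u k s x))) \<le> (case p of (s, x) \<Rightarrow> \<bar>b s f x * U s x\<bar>)" for n
        using limN by eventually_elim
          (use ub U0 in \<open>auto simp: split_beta' uN_def abs_mult indicator_def sum_nonneg intro!: mult_left_mono\<close>)
      show "(\<lambda>(s, x). indicator {..<t} s * (b s f x * U s x)) \<in> borel_measurable N"
        unfolding split_beta' by measurable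
      show "(\<lambda>(s, x). indicator {..<t} s * (b s f x * (\<Sum>k<n. u k s x))) \<in> borel_measurable N" for n
        using uNm unfolding split_beta' uN_def by measurable
    qed
    have "(\<integral>x. f x * (\<Sum>k<n. u k t x) \<partial>M) = (\<integral>x. f x * (\<Sum>k<n. dyadic k (v x)) \<partial>M) + \<Phi> (\<lambda>s x. \<Sum>k<n. u k s x)" for n
    proof -
      have "(\<integral>x. f x * (\<Sum>k<n. u k t x) \<partial>M) = (\<Sum>k<n. \<integral>x. f x * u k t x \<partial>M)"
        unfolding sum_distrib_left using A_times_integrable[OF f ui] by (intro Bochner_Integration.integral_sum) auto
      also have "\<dots> = (\<Sum>k<n. (\<integral>x. f x * dyadic k (v x) \<partial>M) + \<Phi> (u k))"
        unfolding \<Phi>_def using u_eq[OF t f] flux_integral_eq[OF f reg_k] by simp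
      also have "\<dots> = (\<Sum>k<n. \<integral>x. f x * dyadic k (v x) \<partial>M) + (\<Sum>k<n. \<Phi> (u k))" by (rule sum.distrib)
      also have "(\<Sum>k<n. \<integral>x. f x * dyadic k (v x) \<partial>M) = (\<integral>x. f x * (\<Sum>k<n. dyadic k (v x)) \<partial>M)"
        unfolding sum_distrib_left using A_times_integrable[OF f dyi] by (intro Bochner_Integration.integral_sum[symmetric]) auto
      also have "(\<Sum>k<n. \<Phi> (u k)) = \<Phi> (\<lambda>s x. \<Sum>k<n. u k s x)"
      proof -
        have "(\<Sum>k<n. \<Phi> (u k)) = (\<integral>p. (\<Sum>k<n. case p of (s, x) \<Rightarrow> indicator {..<t} s * (b s f x * u k s x)) \<partial>N)"
          unfolding \<Phi>_def
          by (intro Bochner_Integration.integral_sum[symmetric] indicator_time_integrable regular_b_integrable f reg_k)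
        also have "\<dots> = \<Phi> (\<lambda>s x. \<Sum>k<n. u k s x)"
          unfolding \<Phi>_def by (intro Bochner_Integration.integral_cong) (auto simp: sum_distrib_left)
        finally show ?thesis .
      qed
      finally show ?thesis .
    qed
    then have "(\<lambda>n. \<integral>x. f x * (\<Sum>k<n. u k t x) \<partial>M) \<longlonglongrightarrow> (\<integral>x. f x * v x \<partial>M) + \<Phi> U"
      using tendsto_add[OF 2 3] by simp
    with 1 have "(\<integral>x. f x * U t x \<partial>M) = (\<integral>x. f x * v x \<partial>M) + \<Phi> U" by (rule LIMSEQ_unique)
    then show ?thesis using flux_integral_eq[OF f reg, of t] by (simp add: \<Phi>_def)
  qed
  then have "solves v U" unfolding solves_def using reg Ui by blast
  then show ?thesis using U0 UK U_mass by blast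
qed

lemma solves_diff:
  assumes 1: "solves v u" "integrable M v" and 2: "solves w z" "integrable M w"
  shows "solves (\<lambda>x. v x - w x) (\<lambda>t x. u t x - z t x)"
proof -
  have ru: "regular u" and rz: "regular z" using 1 2 by (auto simp: solves_def)
  then obtain K L where um: "(\<lambda>(t, x). u t x) \<in> borel_measurable N" and zm: "(\<lambda>(t, x). z t x) \<in> borel_measurable N"
    and K: "AE t in time_space T. (\<integral>\<^sup>+x. ennreal \<bar>u t x\<bar> \<partial>M) \<le> ennreal K \<and> (\<integral>\<^sup>+x. ennreal ((u t x)\<^sup>2) \<partial>M) \<le> ennreal K"
    and L: "AE t in time_space T. (\<integral>\<^sup>+x. ennreal \<bar>z t x\<bar> \<partial>M) \<le> ennreal L \<and> (\<integral>\<^sup>+x. ennreal ((z t x)\<^sup>2) \<partial>M) \<le> ennreal L"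
    unfolding regular_def by blast
  have reg: "regular (\<lambda>t x. u t x - z t x)"
    unfolding regular_def
  proof (intro conjI exI[of _ "2 * (max 0 K + max 0 L)"])
    show "(\<lambda>(t, x). u t x - z t x) \<in> borel_measurable N" using um zm by (simp add: split_beta')
    show "AE t in time_space T. (\<integral>\<^sup>+x. ennreal \<bar>u t x - z t x\<bar> \<partial>M) \<le> ennreal (2 * (max 0 K + max 0 L)) \<and>
       (\<integral>\<^sup>+x. ennreal ((u t x - z t x)\<^sup>2) \<partial>M) \<le> ennreal (2 * (max 0 K + max 0 L))"
      using K L AE_space
    proof eventually_elim
      case (elim t)
      have [measurable]: "u t \<in> borel_measurable M" "z t \<in> borel_measurable M"
        using measurable_compose_Pair1[OF elim(3) um] measurable_compose_Pair1[OF elim(3) zm] by simp_all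
      \<comment> \<open>The factor 2 comes from (a - b)^2 <= 2 a^2 + 2 b^2; using it for the first
        moment as well lets one bound serve both.\<close>
      have le: "2 * (\<integral>\<^sup>+x. ennreal (f x) \<partial>M) + 2 * (\<integral>\<^sup>+x. ennreal (f' x) \<partial>M) \<le> ennreal (2 * (max 0 K + max 0 L))"
        if "(\<integral>\<^sup>+x. ennreal (f x) \<partial>M) \<le> ennreal K" "(\<integral>\<^sup>+x. ennreal (f' x) \<partial>M) \<le> ennreal L" for f f'
      proof -
        have "ennreal K \<le> ennreal (max 0 K)" "ennreal L \<le> ennreal (max 0 L)" by (auto intro!: ennreal_leI)
        with that have "2 * (\<integral>\<^sup>+x. ennreal (f x) \<partial>M) + 2 * (\<integral>\<^sup>+x. ennreal (f' x) \<partial>M) \<le> 2 * ennreal (max 0 K) + 2 * ennreal (max 0 L)"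
          by (intro add_mono mult_left_mono) (auto intro: order_trans)
        also have "\<dots> = ennreal (2 * (max 0 K + max 0 L))"
          by (simp add: ennreal_mult distrib_left)
        finally show ?thesis .
      qed
      have "(\<integral>\<^sup>+x. ennreal \<bar>u t x - z t x\<bar> \<partial>M) \<le> (\<integral>\<^sup>+x. 2 * ennreal \<bar>u t x\<bar> + 2 * ennreal \<bar>z t x\<bar> \<partial>M)"
      proof (rule nn_integral_mono)
        fix x
        have "ennreal \<bar>u t x - z t x\<bar> \<le> ennreal (2 * \<bar>u t x\<bar> + 2 * \<bar>z t x\<bar>)" by (intro ennreal_leI) auto
        then show "ennreal \<bar>u t x - z t x\<bar> \<le> 2 * ennreal \<bar>u t x\<bar> + 2 * ennreal \<bar>z t x\<bar>" by (simp add: ennreal_mult)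
      qed
      also have "\<dots> = 2 * (\<integral>\<^sup>+x. ennreal \<bar>u t x\<bar> \<partial>M) + 2 * (\<integral>\<^sup>+x. ennreal \<bar>z t x\<bar> \<partial>M)"
        by (simp add: nn_integral_add nn_integral_cmult)
      also have "\<dots> \<le> ennreal (2 * (max 0 K + max 0 L))" using elim by (intro le) auto
      finally have A: "(\<integral>\<^sup>+x. ennreal \<bar>u t x - z t x\<bar> \<partial>M) \<le> ennreal (2 * (max 0 K + max 0 L))" .
      have "(\<integral>\<^sup>+x. ennreal ((u t x - z t x)\<^sup>2) \<partial>M) \<le> (\<integral>\<^sup>+x. 2 * ennreal ((u t x)\<^sup>2) + 2 * ennreal ((z t x)\<^sup>2) \<partial>M)"
      proof (rule nn_integral_mono)
        fix x
        have "(u t x - z t x)\<^sup>2 \<le> 2 * (u t x)\<^sup>2 + 2 * (z t x)\<^sup>2"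
          using zero_le_power2[of "u t x + z t x"] by (simp add: power2_eq_square algebra_simps)
        then have "ennreal ((u t x - z t x)\<^sup>2) \<le> ennreal (2 * (u t x)\<^sup>2 + 2 * (z t x)\<^sup>2)" by (rule ennreal_leI)
        then show "ennreal ((u t x - z t x)\<^sup>2) \<le> 2 * ennreal ((u t x)\<^sup>2) + 2 * ennreal ((z t x)\<^sup>2)" by (simp add: ennreal_mult)
      qed
      also have "\<dots> = 2 * (\<integral>\<^sup>+x. ennreal ((u t x)\<^sup>2) \<partial>M) + 2 * (\<integral>\<^sup>+x. ennreal ((z t x)\<^sup>2) \<partial>M)"
        by (simp add: nn_integral_add nn_integral_cmult)
      also have "\<dots> \<le> ennreal (2 * (max 0 K + max 0 L))" using elim by (intro le) auto
      finally show ?case using A by blast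
    qed
  qed
  have "(\<integral>x. f x * (u t x - z t x) \<partial>M) = (\<integral>x. f x * (v x - w x) \<partial>M)
      + (\<integral>s. indicator {..<t} s * flux f (\<lambda>t x. u t x - z t x) s \<partial>time_space T)"
    if t: "t \<in> {0..<T}" and f: "f \<in> A" for t f
  proof -
    have "integrable M (u t)" "integrable M (z t)" using 1 2 t by (auto simp: solves_def)
    then have "(\<integral>x. f x * (u t x - z t x) \<partial>M) = (\<integral>x. f x * u t x \<partial>M) - (\<integral>x. f x * z t x \<partial>M)"
      using A_times_integrable[OF f] by (simp add: right_diff_distrib)
    moreover have "(\<integral>x. f x * (v x - w x) \<partial>M) = (\<integral>x. f x * v x \<partial>M) - (\<integral>x. f x * w x \<partial>M)"
      using A_times_integrable[OF f] 1(2) 2(2) by (simp add: right_diff_distrib)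
    moreover have "(\<integral>s. indicator {..<t} s * flux f (\<lambda>t x. u t x - z t x) s \<partial>time_space T)
        = (\<integral>s. indicator {..<t} s * flux f u s \<partial>time_space T) - (\<integral>s. indicator {..<t} s * flux f z s \<partial>time_space T)"
    proof -
      have "(\<integral>(s, x). indicator {..<t} s * (b s f x * (u s x - z s x)) \<partial>N)
          = (\<integral>p. (case p of (s, x) \<Rightarrow> indicator {..<t} s * (b s f x * u s x))
              - (case p of (s, x) \<Rightarrow> indicator {..<t} s * (b s f x * z s x)) \<partial>N)"
        by (intro Bochner_Integration.integral_cong) (auto simp: algebra_simps)
      also have "\<dots> = (\<integral>(s, x). indicator {..<t} s * (b s f x * u s x) \<partial>N) - (\<integral>(s, x). indicator {..<t} s * (b s f x * z s x) \<partial>N)"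
        by (intro Bochner_Integration.integral_diff indicator_time_integrable regular_b_integrable f ru rz)
      finally show ?thesis
        unfolding flux_integral_eq[OF f ru] flux_integral_eq[OF f rz] flux_integral_eq[OF f reg] .
    qed
    ultimately show ?thesis using 1 2 t f by (simp add: solves_def)
  qed
  then show ?thesis unfolding solves_def using reg 1 2 by (auto simp: solves_def)
qed

lemma solves_continuous:
  assumes u: "solves v u"
  shows "weakly_continuous M A {0..<T} u"
  unfolding weakly_continuous_def
proof
  fix f assume f: "f \<in> A"
  have "continuous_on {0..<T} (\<lambda>t. (\<integral>x. f x * v x \<partial>M) + (\<integral>s. indicator {..<t} s * flux f u s \<partial>time_space T))"
    using u by (intro continuous_intros time_indefinite_integral_continuous regular_flux_integrable f) (simp add: solves_def)
  then show "continuous_on {0..<T} (\<lambda>t. \<integral>x. f x * u t x \<partial>M)"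
    by (rule continuous_on_cong[THEN iffD1, rotated 2]) (use u f in \<open>auto simp: solves_def\<close>)
qed

text \<open>Once the integrated equation is inserted, the term with psi' splits into psi(0) times
  the pairing with the datum and a term with the primitive of the flux. Because psi vanishes at T,
  integration by parts makes the latter cancel the drift term.\<close>

lemma solves_weak_form:
  assumes u: "solves v u" and f: "f \<in> A"
    and \<psi>: "\<And>t. t \<in> {0..T} \<Longrightarrow> (\<psi> has_real_derivative \<psi>' t) (at t within {0..T})" "continuous_on {0..T} \<psi>'" "\<psi> T = 0"
  shows "(\<integral>t. (\<integral>x. (- \<psi>' t * f x - \<psi> t * b t f x) * u t x \<partial>M) \<partial>time_space T) = \<psi> 0 * (\<integral>x. f x * v x \<partial>M)"
proof -
  have ru: "regular u" using u by (simp add: solves_def)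
  define c where "c = (\<integral>x. f x * v x \<partial>M)"
  define K where "K t = (\<integral>s. indicator {..<t} s * flux f u s \<partial>time_space T)" for t
  note fi = regular_flux_integrable[OF f ru]
  have \<psi>c: "continuous_on {0..T} \<psi>" using \<psi>(1) by (rule DERIV_continuous_on)
  have m: "\<psi>' \<in> borel_measurable (time_space T)" "\<psi> \<in> borel_measurable (time_space T)"
    using borel_measurable_time_continuous \<psi>(2) \<psi>c by auto
  have Kc: "continuous_on {0..T} K" unfolding K_def by (rule time_indefinite_integral_continuous[OF fi])
  obtain B1 where B1: "\<And>t. t \<in> {0..T} \<Longrightarrow> \<bar>\<psi>' t\<bar> \<le> B1" using time_continuous_bounded[OF \<psi>(2)] by blast
  obtain B2 where B2: "\<And>t. t \<in> {0..T} \<Longrightarrow> \<bar>\<psi> t\<bar> \<le> B2" using time_continuous_bounded[OF \<psi>c] by blast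
  have c3: "continuous_on {0..T} (\<lambda>t. \<psi>' t * K t)" using \<psi>(2) Kc by (intro continuous_intros)
  obtain B3 where B3: "\<And>t. t \<in> {0..T} \<Longrightarrow> \<bar>\<psi>' t * K t\<bar> \<le> B3" using time_continuous_bounded[OF c3] by blast
  note m3 = borel_measurable_time_continuous[OF c3]
  have i1: "integrable (time_space T) \<psi>'" using B1 by (intro time_integrable_bounded[where B=B1, OF m(1)]) auto
  have i3: "integrable (time_space T) (\<lambda>t. \<psi>' t * K t)" using B3 by (intro time_integrable_bounded[where B=B3, OF m3]) auto
  have i2: "integrable (time_space T) (\<lambda>t. \<psi> t * flux f u t)"
  proof (rule Bochner_Integration.integrable_bound[OF integrable_mult_right[of B2, OF fi]])
    show "(\<lambda>t. \<psi> t * flux f u t) \<in> borel_measurable (time_space T)" using m fi by auto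
    show "AE t in time_space T. norm (\<psi> t * flux f u t) \<le> norm (B2 * flux f u t)"
    proof (rule AE_I2)
      fix t assume "t \<in> space (time_space T)"
      then have "\<bar>\<psi> t\<bar> \<le> \<bar>B2\<bar>" using B2[of t] by auto
      then show "norm (\<psi> t * flux f u t) \<le> norm (B2 * flux f u t)" by (simp add: abs_mult mult_right_mono)
    qed
  qed
  have um: "(\<lambda>p. u (fst p) (snd p)) \<in> borel_measurable N" using ru by (simp add: regular_def split_beta')
  have "(\<integral>t. (\<integral>x. (- \<psi>' t * f x - \<psi> t * b t f x) * u t x \<partial>M) \<partial>time_space T)
      = (\<integral>t. - (\<psi>' t * c) - \<psi>' t * K t - \<psi> t * flux f u t \<partial>time_space T)"
  proof (rule integral_cong_AE)
    have [measurable]: "(\<lambda>p. u (fst p) (snd p)) \<in> borel_measurable N" "(\<lambda>p. b (fst p) f (snd p)) \<in> borel_measurable N"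
      "f \<in> borel_measurable M" "\<psi>' \<in> borel_measurable (time_space T)" "\<psi> \<in> borel_measurable (time_space T)"
      using um b_measurable[OF f] borel_measurable_A[OF f] m by (simp_all add: split_beta')
    have "(\<lambda>(t, x). (- \<psi>' t * f x - \<psi> t * b t f x) * u t x) \<in> borel_measurable N"
      unfolding split_beta' by measurable
    then show "(\<lambda>t. \<integral>x. (- \<psi>' t * f x - \<psi> t * b t f x) * u t x \<partial>M) \<in> borel_measurable (time_space T)"
      by (rule M.borel_measurable_lebesgue_integral)
    show "(\<lambda>t. - (\<psi>' t * c) - \<psi>' t * K t - \<psi> t * flux f u t) \<in> borel_measurable (time_space T)"
      using i1 i2 i3 by auto
    show "AE t in time_space T. (\<integral>x. (- \<psi>' t * f x - \<psi> t * b t f x) * u t x \<partial>M) = - (\<psi>' t * c) - \<psi>' t * K t - \<psi> t * flux f u t"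
      using pair.AE_integrable_fst'[OF regular_b_integrable[OF f ru]] AE_space
    proof eventually_elim
      case (elim t)
      then have t: "t \<in> {0..<T}" by auto
      have i: "integrable M (\<lambda>x. f x * u t x)" "integrable M (\<lambda>x. b t f x * u t x)"
        using A_times_integrable[OF f, of "u t"] u t elim by (auto simp: solves_def)
      have "(\<integral>x. (- \<psi>' t * f x - \<psi> t * b t f x) * u t x \<partial>M) = (\<integral>x. - \<psi>' t * (f x * u t x) - \<psi> t * (b t f x * u t x) \<partial>M)"
        by (intro Bochner_Integration.integral_cong) (auto simp: algebra_simps)
      also have "\<dots> = - \<psi>' t * (\<integral>x. f x * u t x \<partial>M) - \<psi> t * flux f u t" using i by (simp add: flux_def)
      also have "(\<integral>x. f x * u t x \<partial>M) = c + K t" using u t f by (simp add: solves_def c_def K_def)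
      finally show ?case by (simp add: algebra_simps)
    qed
  qed
  also have "\<dots> = - ((\<integral>t. \<psi>' t \<partial>time_space T) * c) - (\<integral>t. \<psi>' t * K t \<partial>time_space T) - (\<integral>t. \<psi> t * flux f u t \<partial>time_space T)"
    using i1 i2 i3 by simp
  also have "(\<integral>t. \<psi>' t \<partial>time_space T) = (\<integral>t. indicator {0<..<T} t * \<psi>' t \<partial>time_space T)"
    by (intro Bochner_Integration.integral_cong) auto
  also have "\<dots> = \<psi> T - \<psi> 0" using T_pos by (intro time_FTC \<psi>) auto
  also have "(\<integral>t. \<psi>' t * K t \<partial>time_space T) = - (\<integral>t. \<psi> t * flux f u t \<partial>time_space T)"
    unfolding K_def using time_by_parts[OF fi \<psi>(1,2)] \<psi>(3) by simp
  finally show ?thesis using \<psi>(3) by (simp add: c_def)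
qed

text \<open>The functions from condition (M) are test functions increasing to 1. Their flux is
  bounded by the pairing of the square root of \<open>\<Gamma> (F n) (F n)\<close> with one fixed
  integrable function of x, so weak-* convergence removes it in the limit.\<close>

lemma solves_mass:
  assumes u: "solves v u" and v: "integrable M v" and cond: "condition_M M \<Gamma> A" and t: "t \<in> {0..<T}"
  shows "(\<integral>x. u t x \<partial>M) = (\<integral>x. v x \<partial>M)"
proof -
  have ru: "regular u" and ut: "integrable M (u t)" using u t by (auto simp: solves_def)
  obtain F where F: "\<And>n. F n \<in> A" "\<And>n. AE x in M. 0 \<le> F n x \<and> F n x \<le> 1"
    "AE x in M. incseq (\<lambda>n. F n x) \<and> (\<lambda>n. F n x) \<longlonglongrightarrow> 1"
    "\<And>G. G \<in> Lp M 1 \<Longrightarrow> (\<lambda>n. \<integral>x. sqrt (\<Gamma> (F n) (F n) x) * G x \<partial>M) \<longlonglongrightarrow> 0"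
    using cond unfolding condition_M_def by blast
  have lim: "(\<lambda>n. \<integral>x. F n x * w x \<partial>M) \<longlonglongrightarrow> (\<integral>x. w x \<partial>M)" if w: "integrable M w" for w
  proof (rule integral_dominated_convergence[where w="\<lambda>x. \<bar>w x\<bar>"])
    show "AE x in M. (\<lambda>n. F n x * w x) \<longlonglongrightarrow> w x"
      using F(3)
    proof eventually_elim
      case (elim x)
      then show ?case using tendsto_mult[of "\<lambda>n. F n x" 1 sequentially "\<lambda>_. w x" "w x"] by simp
    qed
    show "AE x in M. norm (F n x * w x) \<le> \<bar>w x\<bar>" for n
      using F(2)[of n] by eventually_elim (auto simp: abs_mult intro!: mult_left_le_one_le)
    show "(\<lambda>x. F n x * w x) \<in> borel_measurable M" for n using borel_measurable_A[OF F(1)[of n]] w by auto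
  qed (use w in auto)
  \<comment> \<open>Condition (M) speaks of functions of x only. Integrating out the time gives a
    majorant independent of n that lies in L^1 by Fubini.\<close>
  define G where "G x = (\<integral>s. \<bar>g s x\<bar> * \<bar>u s x\<bar> \<partial>time_space T)" for x
  note gu = regular_g_integrable[OF ru]
  have Gi: "integrable M G" unfolding G_def using pair.integrable_snd[OF gu] by simp
  have "G \<in> Lp M 1"
  proof -
    have "(\<integral>\<^sup>+x. ennreal \<bar>G x\<bar> \<partial>M) < \<infinity>" using Gi by (simp add: integrable_iff_bounded)
    then show ?thesis using Gi by (auto simp: Lp_def)
  qed
  note FG = F(4)[OF this]
  have flux_le: "\<bar>\<integral>s. indicator {..<t} s * flux (F n) u s \<partial>time_space T\<bar> \<le> (\<integral>x. sqrt (\<Gamma> (F n) (F n) x) * G x \<partial>M)" for n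
  proof -
    note f = F(1)[of n]
    obtain R where R: "0 \<le> R" "AE x in M. \<bar>sqrt (\<Gamma> (F n) (F n) x)\<bar> \<le> R" using sqrt_Gamma_bounded[OF f] by blast
    have sm[measurable]: "(\<lambda>x. sqrt (\<Gamma> (F n) (F n) x)) \<in> borel_measurable M" using sqrt_Gamma_integrable[OF f] by auto
    have RN: "AE p in N. \<bar>sqrt (\<Gamma> (F n) (F n) (snd p))\<bar> \<le> R"
      using R(2) by (intro pair.AE_pair_measure) auto
    have [measurable]: "(\<lambda>p. \<bar>g (fst p) (snd p)\<bar> * \<bar>u (fst p) (snd p)\<bar>) \<in> borel_measurable N"
      using borel_measurable_integrable[OF gu] by (simp add: split_beta')
    have i: "integrable N (\<lambda>(s, x). sqrt (\<Gamma> (F n) (F n) x) * (\<bar>g s x\<bar> * \<bar>u s x\<bar>))"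
    proof (rule Bochner_Integration.integrable_bound[OF integrable_mult_right[of R, OF gu]])
      show "(\<lambda>(s, x). sqrt (\<Gamma> (F n) (F n) x) * (\<bar>g s x\<bar> * \<bar>u s x\<bar>)) \<in> borel_measurable N"
        unfolding split_beta' by measurable
      show "AE p in N. norm (case p of (s, x) \<Rightarrow> sqrt (\<Gamma> (F n) (F n) x) * (\<bar>g s x\<bar> * \<bar>u s x\<bar>)) \<le> norm (R * (case p of (s, x) \<Rightarrow> \<bar>g s x\<bar> * \<bar>u s x\<bar>))"
        using RN by eventually_elim (use R in \<open>auto simp: split_beta' abs_mult intro!: mult_right_mono\<close>)
    qed
    note bi = regular_b_integrable[OF f ru]
    have "\<bar>\<integral>s. indicator {..<t} s * flux (F n) u s \<partial>time_space T\<bar> \<le> (\<integral>p. norm (case p of (s, x) \<Rightarrow> indicator {..<t} s * (b s (F n) x * u s x)) \<partial>N)"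
      unfolding flux_integral_eq[OF f ru] using integral_norm_bound[of N "\<lambda>(s, x). indicator {..<t} s * (b s (F n) x * u s x)"] by simp
    also have "\<dots> \<le> (\<integral>(s, x). sqrt (\<Gamma> (F n) (F n) x) * (\<bar>g s x\<bar> * \<bar>u s x\<bar>) \<partial>N)"
    proof (rule integral_mono_AE[OF integrable_norm[OF indicator_time_integrable[OF bi]] i])
      show "AE p in N. norm (case p of (s, x) \<Rightarrow> indicator {..<t} s * (b s (F n) x * u s x)) \<le> (case p of (s, x) \<Rightarrow> sqrt (\<Gamma> (F n) (F n) x) * (\<bar>g s x\<bar> * \<bar>u s x\<bar>))"
        using b_bound[OF f]
      proof eventually_elim
        case (elim p)
        obtain s x where p: "p = (s, x)" by fastforce
        have "\<bar>b s (F n) x * u s x\<bar> \<le> (\<bar>g s x\<bar> * sqrt (\<Gamma> (F n) (F n) x)) * \<bar>u s x\<bar>"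
          unfolding abs_mult using elim by (intro mult_right_mono) (auto simp: p)
        then show ?case by (auto simp: p indicator_def mult_ac intro: order_trans[OF abs_ge_zero])
      qed
    qed
    also have "\<dots> = (\<integral>x. (\<integral>s. sqrt (\<Gamma> (F n) (F n) x) * (\<bar>g s x\<bar> * \<bar>u s x\<bar>) \<partial>time_space T) \<partial>M)"
      using pair.integral_snd[OF i] by simp
    also have "\<dots> = (\<integral>x. sqrt (\<Gamma> (F n) (F n) x) * G x \<partial>M)" by (simp add: G_def)
    finally show ?thesis .
  qed
  have "(\<lambda>n. \<integral>s. indicator {..<t} s * flux (F n) u s \<partial>time_space T) \<longlonglongrightarrow> 0"
    by (rule Lim_null_comparison[OF _ FG]) (use flux_le in auto)
  from tendsto_add[OF lim[OF v] this]
  have "(\<lambda>n. \<integral>x. F n x * u t x \<partial>M) \<longlonglongrightarrow> (\<integral>x. v x \<partial>M)" using u t F(1) by (simp add: solves_def)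
  with lim[OF ut] show ?thesis by (rule LIMSEQ_unique)
qed

end

section \<open>Signed data\<close>

lemma Lp_mono:
  assumes "g \<in> Lp M r" "f \<in> borel_measurable M" "\<And>x. \<bar>f x\<bar> \<le> \<bar>g x\<bar>"
  shows "f \<in> Lp M r"
proof (cases "r = \<infinity>")
  case True
  with assms(1) obtain C where "AE x in M. \<bar>g x\<bar> \<le> C" by (auto simp: Lp_def)
  then have "AE x in M. \<bar>f x\<bar> \<le> C" by eventually_elim (use assms(3) order_trans in blast)
  then show ?thesis using True assms(2) by (auto simp: Lp_def)
next
  case False
  have "(\<integral>\<^sup>+x. ennreal (\<bar>f x\<bar> powr enn2real r) \<partial>M) \<le> (\<integral>\<^sup>+x. ennreal (\<bar>g x\<bar> powr enn2real r) \<partial>M)"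
    using assms(3) by (intro nn_integral_mono ennreal_leI powr_mono2) auto
  also have "\<dots> < \<infinity>" using assms(1) False by (simp add: Lp_def)
  finally show ?thesis using assms(2) False by (simp add: Lp_def)
qed

text \<open>For nonnegative f and g the difference is at most max(f, g) in absolute value, and the
  p-th power of the maximum is at most f^p + g^p. Minkowski's inequality is thereby avoided, at the
  price of the constant (2 K^p)^(1/p).\<close>

lemma Lp_diff_nonneg:
  assumes r: "1 \<le> r" and f: "f \<in> Lp M r" "\<And>x. 0 \<le> f x" "Lp_norm M r f \<le> K"
    and g: "g \<in> Lp M r" "\<And>x. 0 \<le> g x" "Lp_norm M r g \<le> K"
  shows "(\<lambda>x. f x - g x) \<in> Lp M r"
    "Lp_norm M r (\<lambda>x. f x - g x) \<le> (if r = \<infinity> then K else (2 * K powr enn2real r) powr (1 / enn2real r))"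
proof -
  have [measurable]: "f \<in> borel_measurable M" "g \<in> borel_measurable M" using f g by (auto simp: Lp_def)
  have "(\<lambda>x. f x - g x) \<in> Lp M r \<and>
    Lp_norm M r (\<lambda>x. f x - g x) \<le> (if r = \<infinity> then K else (2 * K powr enn2real r) powr (1 / enn2real r))"
  proof (cases "r = \<infinity>")
    case True
    have bound: "AE x in M. \<bar>w x\<bar> \<le> K" if "w \<in> Lp M r" "Lp_norm M r w \<le> K" for w
    proof -
      have "AE x in M. \<bar>w x\<bar> \<le> Lp_norm M \<infinity> w" using that True by (intro AE_Lp_norm_infinity) simp
      then show ?thesis by eventually_elim (use that(2) True in simp)
    qed
    have ae: "AE x in M. \<bar>f x\<bar> \<le> K" "AE x in M. \<bar>g x\<bar> \<le> K" "0 \<le> K"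
      using bound[OF f(1,3)] bound[OF g(1,3)] Lp_norm_infinity_nonneg[of f M] f(1,3) True by auto
    from ae(1,2) have ae': "AE x in M. \<bar>f x - g x\<bar> \<le> K"
    proof eventually_elim
      case (elim x)
      then show ?case using f(2)[of x] g(2)[of x] by (auto simp: abs_le_iff)
    qed
    then have "Lp_norm M r (\<lambda>x. f x - g x) \<le> K"
      unfolding Lp_norm_def using True ae(3) by (auto intro!: cInf_lower bdd_belowI[of _ 0])
    then show ?thesis using True ae' by (auto simp: Lp_def)
  next
    case False
    define p where "p = enn2real r"
    have p: "1 \<le> p" unfolding p_def using enn2real_mono[OF r] False by (simp add: top.not_eq_extremum)
    have fin: "(\<integral>\<^sup>+x. ennreal (h x powr p) \<partial>M) \<le> ennreal (K powr p)" "integrable M (\<lambda>x. h x powr p)"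
      if h: "h \<in> Lp M r" "\<And>x. 0 \<le> h x" "Lp_norm M r h \<le> K" for h
    proof -
      have [measurable]: "h \<in> borel_measurable M" using h by (auto simp: Lp_def)
      show i: "integrable M (\<lambda>x. h x powr p)"
        using h(1,2) False by (intro integrableI_bounded) (auto simp: Lp_def p_def)
      define I where "I = (\<integral>x. h x powr p \<partial>M)"
      have I0: "0 \<le> I" unfolding I_def by (intro integral_nonneg_AE) auto
      have "I powr (1 / p) \<le> K" using h(2,3) False by (simp add: Lp_norm_def p_def I_def)
      then have "(I powr (1 / p)) powr p \<le> K powr p" using p by (intro powr_mono2) auto
      moreover have "(I powr (1 / p)) powr p = I" using p I0 by (simp add: powr_powr)
      ultimately have "I \<le> K powr p" by simp
      then show "(\<integral>\<^sup>+x. ennreal (h x powr p) \<partial>M) \<le> ennreal (K powr p)"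
        using nn_integral_eq_integral[OF i] by (simp add: I_def ennreal_leI)
    qed
    have "(\<integral>\<^sup>+x. ennreal (\<bar>f x - g x\<bar> powr p) \<partial>M) \<le> (\<integral>\<^sup>+x. ennreal (f x powr p) + ennreal (g x powr p) \<partial>M)"
    proof (rule nn_integral_mono)
      fix x
      have "\<bar>f x - g x\<bar> powr p \<le> (max (f x) (g x)) powr p"
        using f(2)[of x] g(2)[of x] p by (intro powr_mono2) auto
      also have "\<dots> \<le> f x powr p + g x powr p" by (auto simp: max_def)
      finally have "ennreal (\<bar>f x - g x\<bar> powr p) \<le> ennreal (f x powr p + g x powr p)" by (rule ennreal_leI)
      then show "ennreal (\<bar>f x - g x\<bar> powr p) \<le> ennreal (f x powr p) + ennreal (g x powr p)" by simp
    qed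
    also have "\<dots> = (\<integral>\<^sup>+x. ennreal (f x powr p) \<partial>M) + (\<integral>\<^sup>+x. ennreal (g x powr p) \<partial>M)"
      by (intro nn_integral_add) measurable
    also have "\<dots> \<le> ennreal (K powr p) + ennreal (K powr p)" using fin(1)[OF f] fin(1)[OF g] by (rule add_mono)
    also have "\<dots> = ennreal (2 * K powr p)" by (subst ennreal_plus[symmetric]) auto
    finally have le: "(\<integral>\<^sup>+x. ennreal (\<bar>f x - g x\<bar> powr p) \<partial>M) \<le> ennreal (2 * K powr p)" .
    have "(\<integral>x. \<bar>f x - g x\<bar> powr p \<partial>M) = enn2real (\<integral>\<^sup>+x. ennreal (\<bar>f x - g x\<bar> powr p) \<partial>M)"
      by (intro integral_eq_nn_integral) auto
    also have "\<dots> \<le> 2 * K powr p" using enn2real_mono[OF le] by simp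
    finally have "(\<integral>x. \<bar>f x - g x\<bar> powr p \<partial>M) powr (1 / p) \<le> (2 * K powr p) powr (1 / p)"
      using p by (intro powr_mono2 integral_nonneg_AE) auto
    then show ?thesis using False le by (auto simp: Lp_norm_def Lp_def p_def intro: le_less_trans)
  qed
  then show "(\<lambda>x. f x - g x) \<in> Lp M r"
    "Lp_norm M r (\<lambda>x. f x - g x) \<le> (if r = \<infinity> then K else (2 * K powr enn2real r) powr (1 / enn2real r))" by auto
qed

theorem theorem4p2:
  fixes M :: "'a::polish_space measure"
    and V A :: "('a \<Rightarrow> real) set"
    and \<Gamma> :: "('a \<Rightarrow> real) \<Rightarrow> ('a \<Rightarrow> real) \<Rightarrow> 'a \<Rightarrow> real"
    and T :: real and r :: ennreal
    and ubar :: "'a \<Rightarrow> real"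
    and b :: "real \<Rightarrow> ('a \<Rightarrow> real) \<Rightarrow> ('a \<Rightarrow> real)"
  assumes setting: "dirichlet_setting M V \<Gamma> A"
    and T_pos: "T > 0"
    and r_ge: "2 \<le> r"
    and ubar: "ubar \<in> Lp M 1 \<inter> Lp M r"
    and b_borel: "borel_family M \<Gamma> A T b"
    and b_abs: "\<exists>g. bounds_family M \<Gamma> A T b g \<and> time_L1 T M (Lp_sum M 2 \<infinity>) (Lp_sum_norm M 2 \<infinity>) g"
    and b_div: "\<exists>g. time_L1 T M (Lp_sum M 2 \<infinity>) (Lp_sum_norm M 2 \<infinity>) g \<and>
        (AE t in lborel. t \<in> {0<..<T} \<longrightarrow>
           (\<forall>f\<in>A. (\<integral>x. b t f x \<partial>M) = - (\<integral>x. f x * g t x \<partial>M)))"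
    and b_div_neg: "\<exists>h. time_L1 T M (Lp M \<infinity>) (Lp_norm M \<infinity>) h \<and>
        (\<forall>t x. 0 \<le> h t x) \<and>
        (AE t in lborel. t \<in> {0<..<T} \<longrightarrow>
           (\<forall>f\<in>A. (AE x in M. 0 \<le> f x) \<longrightarrow> (\<integral>x. b t f x \<partial>M) \<le> (\<integral>x. f x * h t x \<partial>M)))"
  shows "\<exists>u. weak_solution M A T 1 r b ubar u \<and>
           (\<forall>t\<in>{0..<T}. u t \<in> Lp M 1 \<inter> Lp M r) \<and>
           weakly_continuous M A {0..<T} u \<and>
           ((AE x in M. 0 \<le> ubar x) \<longrightarrow> (\<forall>t\<in>{0..<T}. AE x in M. 0 \<le> u t x)) \<and>
           (condition_M M \<Gamma> A \<longrightarrow>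
              (\<forall>t\<in>{0..<T}. (\<integral>x. u t x \<partial>M) = (\<integral>x. ubar x \<partial>M)))"
proof -
  obtain g where g: "bounds_family M \<Gamma> A T b g" "time_L1 T M (Lp_sum M 2 \<infinity>) (Lp_sum_norm M 2 \<infinity>) g"
    using b_abs by (elim exE conjE) (rule that)
  obtain h where h: "time_L1 T M (Lp M \<infinity>) (Lp_norm M \<infinity>) h" "\<forall>t x. 0 \<le> h t x"
    "AE t in lborel. t \<in> {0<..<T} \<longrightarrow>
           (\<forall>f\<in>A. (AE x in M. 0 \<le> f x) \<longrightarrow> (\<integral>x. b t f x \<partial>M) \<le> (\<integral>x. f x * h t x \<partial>M))"
    using b_div_neg by (elim exE conjE) (rule that)
  interpret transport M V A \<Gamma> T b g h
  proof
    show "dirichlet_setting M V \<Gamma> A" "0 < T" "borel_family M \<Gamma> A T b" by fact+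
    show "bounds_family M \<Gamma> A T b g" "time_L1 T M (Lp_sum M 2 \<infinity>) (Lp_sum_norm M 2 \<infinity>) g"
      "time_L1 T M (Lp M \<infinity>) (Lp_norm M \<infinity>) h" by fact+
    show "0 \<le> h t x" for t x using h(2) by simp
    show "AE t in time_space T. \<forall>f\<in>A. (AE x in M. 0 \<le> f x) \<longrightarrow> (\<integral>x. b t f x \<partial>M) \<le> (\<integral>x. f x * h t x \<partial>M)"
      unfolding AE_time by (rule h(3))
  qed
  obtain C0 where C0: "0 \<le> C0" and energy: "\<forall>v m. integrable M v \<longrightarrow> (\<forall>x. 0 \<le> v x \<and> v x \<le> m) \<longrightarrow> energy_bound v (m * C0)"
    using energy_constant by (elim exE conjE) (rule that)
  have ubm[measurable]: "ubar \<in> borel_measurable M" using ubar by (auto simp: Lp_def)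
  define vp where "vp x = max 0 (ubar x)" for x
  define vn where "vn x = max 0 (- ubar x)" for x
  have vm[measurable]: "vp \<in> borel_measurable M" "vn \<in> borel_measurable M" unfolding vp_def vn_def by measurable
  have vp0: "0 \<le> vp x" and vn0: "0 \<le> vn x" for x by (auto simp: vp_def vn_def)
  have vL: "vp \<in> Lp M s" "vn \<in> Lp M s" if "ubar \<in> Lp M s" for s
    by (rule Lp_mono[OF that vm(1)], simp add: vp_def max_def, rule Lp_mono[OF that vm(2)], simp add: vn_def max_def)
  have L1_int: "integrable M f" if "f \<in> Lp M 1" for f
    using that by (intro integrableI_bounded) (auto simp: Lp_def)
  have vpL: "vp \<in> Lp M 1" "vp \<in> Lp M r" and vnL: "vn \<in> Lp M 1" "vn \<in> Lp M r" using ubar vL by auto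
  obtain up Kp where up: "solves vp up" "\<forall>t x. 0 \<le> up t x"
    "\<forall>t\<in>{0..<T}. up t \<in> Lp M r \<and> Lp_norm M r (up t) \<le> Kp \<and> (\<integral>\<^sup>+x. ennreal (up t x) \<partial>M) \<le> (\<integral>\<^sup>+x. ennreal (vp x) \<partial>M)"
    using nonneg_solution[OF C0 energy r_ge vpL vp0] by (elim exE conjE) (rule that)
  obtain un Kn where un: "solves vn un" "\<forall>t x. 0 \<le> un t x"
    "\<forall>t\<in>{0..<T}. un t \<in> Lp M r \<and> Lp_norm M r (un t) \<le> Kn \<and> (\<integral>\<^sup>+x. ennreal (un t x) \<partial>M) \<le> (\<integral>\<^sup>+x. ennreal (vn x) \<partial>M)"
    using nonneg_solution[OF C0 energy r_ge vnL vn0] by (elim exE conjE) (rule that)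
  define u where "u t x = up t x - un t x" for t x
  have "(\<lambda>x. vp x - vn x) = ubar" by (auto simp: vp_def vn_def max_def)
  then have sol: "solves ubar u"
    using solves_diff[OF up(1) L1_int[OF vpL(1)] un(1) L1_int[OF vnL(1)]] by (simp add: u_def[abs_def])
  define J where "J = (\<integral>x. vp x \<partial>M) + (\<integral>x. vn x \<partial>M)"
  have J0: "0 \<le> (\<integral>x. vp x \<partial>M)" "0 \<le> (\<integral>x. vn x \<partial>M)" using vp0 vn0 by (auto intro!: integral_nonneg_AE)
  \<comment> \<open>The mass bounds are stated with extended integrals; here they become membership
    in L^1 and a norm bound by the total mass J of both parts.\<close>
  have one: "w \<in> Lp M 1 \<and> Lp_norm M 1 w \<le> J"
    if w: "w \<in> borel_measurable M" "\<And>x. 0 \<le> w x" and v: "v = vp \<or> v = vn" 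
      "(\<integral>\<^sup>+x. ennreal (w x) \<partial>M) \<le> (\<integral>\<^sup>+x. ennreal (v x) \<partial>M)" for w v
  proof -
    have v': "integrable M v" "\<And>x. 0 \<le> v x" "(\<integral>x. v x \<partial>M) \<le> J"
      using v(1) L1_int[OF vpL(1)] L1_int[OF vnL(1)] vp0 vn0 J0 by (auto simp: J_def)
    have le: "(\<integral>\<^sup>+x. ennreal (w x) \<partial>M) \<le> ennreal (\<integral>x. v x \<partial>M)"
      using v(2) nn_integral_eq_integral[OF v'(1)] v'(2) by simp
    have "(\<integral>x. w x \<partial>M) = enn2real (\<integral>\<^sup>+x. ennreal (w x) \<partial>M)"
      using w by (intro integral_eq_nn_integral) auto
    also have "\<dots> \<le> (\<integral>x. v x \<partial>M)" using enn2real_mono[OF le] v'(2) by (simp add: integral_nonneg_AE)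
    finally have "(\<integral>x. w x \<partial>M) \<le> J" using v'(3) by simp
    moreover have "0 \<le> (\<integral>x. w x \<partial>M)" using w by (intro integral_nonneg_AE) auto
    ultimately show ?thesis using w le by (auto simp: Lp_def Lp_norm_def intro: le_less_trans)
  qed
  have um: "up t \<in> borel_measurable M" "un t \<in> borel_measurable M" if "t \<in> {0..<T}" for t
    using up(3) un(3) that by (auto simp: Lp_def)
  define K where "K = max Kp Kn"
  \<comment> \<open>\<open>C1\<close> and \<open>Cr\<close> have the form of the constant in
    \<open>Lp_diff_nonneg\<close>, for the exponents 1 and r.\<close>
  define C1 where "C1 = (2 * J powr enn2real 1) powr (1 / enn2real 1)"
  define Cr where "Cr = (if r = \<infinity> then K else (2 * K powr enn2real r) powr (1 / enn2real r))"
  have r1: "1 \<le> r" using r_ge by (rule order_trans[rotated]) simp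
  have uL1: "u t \<in> Lp M 1" "Lp_norm M 1 (u t) \<le> C1" if t: "t \<in> {0..<T}" for t
  proof -
    have p: "up t \<in> Lp M 1 \<and> Lp_norm M 1 (up t) \<le> J"
      using up(2,3) um[OF t] t by (intro one[of "up t" vp]) auto
    have n: "un t \<in> Lp M 1 \<and> Lp_norm M 1 (un t) \<le> J"
      using un(2,3) um[OF t] t by (intro one[of "un t" vn]) auto
    have "u t = (\<lambda>x. up t x - un t x)" by (simp add: u_def[abs_def])
    then show "u t \<in> Lp M 1" "Lp_norm M 1 (u t) \<le> C1"
      using Lp_diff_nonneg[of 1 "up t" M J "un t"] p n up(2) un(2) by (auto simp: C1_def)
  qed
  have uLr: "u t \<in> Lp M r" "Lp_norm M r (u t) \<le> Cr" if t: "t \<in> {0..<T}" for t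
  proof -
    have p: "up t \<in> Lp M r" "Lp_norm M r (up t) \<le> K" and n: "un t \<in> Lp M r" "Lp_norm M r (un t) \<le> K"
    proof -
      have "up t \<in> Lp M r" "Lp_norm M r (up t) \<le> Kp" "un t \<in> Lp M r" "Lp_norm M r (un t) \<le> Kn"
        using up(3) un(3) t by blast+
      then show "up t \<in> Lp M r" "Lp_norm M r (up t) \<le> K" "un t \<in> Lp M r" "Lp_norm M r (un t) \<le> K"
        by (simp_all add: K_def le_max_iff_disj)
    qed
    have "u t = (\<lambda>x. up t x - un t x)" by (simp add: u_def[abs_def])
    then show "u t \<in> Lp M r" "Lp_norm M r (u t) \<le> Cr"
      unfolding Cr_def using Lp_diff_nonneg[OF r1 p(1) _ p(2) n(1) _ n(2)] up(2) un(2) by simp_all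
  qed
  show ?thesis
  proof (intro exI[of _ u] conjI impI ballI)
    show "weak_solution M A T 1 r b ubar u"
      unfolding weak_solution_def
    proof (intro conjI ballI allI impI)
      show "jointly_borel M T u" using sol by (simp add: solves_def regular_def jointly_borel_def)
      show "\<exists>C. AE t in lborel. t \<in> {0<..<T} \<longrightarrow> u t \<in> Lp M 1 \<inter> Lp M r \<and> Lp_int_norm M 1 r (u t) \<le> C"
        using uL1 uLr by (intro exI[of _ "C1 + Cr"] AE_I2) (auto simp: Lp_int_norm_def intro: add_mono)
      fix \<phi> \<psi> \<psi>'
      assume "\<phi> \<in> A" and \<psi>: "(\<forall>t\<in>{0..T}. (\<psi> has_real_derivative \<psi>' t) (at t within {0..T})) \<and> continuous_on {0..T} \<psi>' \<and> \<psi> T = 0"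
      then show "(LINT t:{0<..<T}|lborel. (\<integral>x. (- \<psi>' t * \<phi> x - \<psi> t * b t \<phi> x) * u t x \<partial>M)) = \<psi> 0 * (\<integral>x. \<phi> x * ubar x \<partial>M)"
        unfolding integral_time[symmetric] by (intro solves_weak_form[OF sol]) auto
    qed
    fix t assume t: "t \<in> {0..<T}"
    show "u t \<in> Lp M 1 \<inter> Lp M r" using uL1(1)[OF t] uLr(1)[OF t] by simp
  next
    show "weakly_continuous M A {0..<T} u" by (rule solves_continuous[OF sol])
  next
    fix t assume pos: "AE x in M. 0 \<le> ubar x" and t: "t \<in> {0..<T}"
    \<comment> \<open>Mass does not increase, so the solution started from a null negative part
      vanishes almost everywhere at each t, and u t agrees with up t almost everywhere.\<close>
    have "AE x in M. ennreal (vn x) = 0" using pos by eventually_elim (simp add: vn_def)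
    then have "(\<integral>\<^sup>+x. ennreal (vn x) \<partial>M) = (\<integral>\<^sup>+x. 0 \<partial>M)" by (rule nn_integral_cong_AE)
    then have "(\<integral>\<^sup>+x. ennreal (un t x) \<partial>M) = 0" using un(3) t by auto
    then have "AE x in M. ennreal (un t x) = 0" using um[OF t] by (subst (asm) nn_integral_0_iff_AE) auto
    then show "AE x in M. 0 \<le> u t x"
      by eventually_elim (use up(2) un(2) in \<open>auto simp: u_def ennreal_eq_0_iff intro: order_trans\<close>)
  next
    fix t assume "condition_M M \<Gamma> A" "t \<in> {0..<T}"
    then show "(\<integral>x. u t x \<partial>M) = (\<integral>x. ubar x \<partial>M)"
      using ubar by (intro solves_mass[OF sol L1_int]) auto
  qed
qed

end
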